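(* Let the contour $H_1$, the functions $f(\alpha,w)$, $S(\alpha,w)$, $g(\alpha,r)$, $g_{\mathrm{reg}}(\alpha,r)$, the change of variables $r=r(w)$ (with inverse $w=w(r)$), and the integrals $L(\alpha,\lambda)$ and $K(\alpha,\lambda)$ be as defined in the context. Then, for each integer $N\ge 1$, $L$ satisfies the following two asymptotic formulas: (i) $$L(\alpha,\lambda)= e^{\frac{\pi i}{4}} e^{-\lambda i(1+\ln\alpha)}\sum_{j=0}^{\lfloor N/2\rfloor}\frac{\partial_r^{2j}g_{\mathrm{reg}}(\alpha,0)}{(2j)!}\,\Gamma\!\left(j+\tfrac12\right)\left(\frac{2}{\lambda}\right)^{j+\frac12}+K(\alpha,\lambda)+O\!\left(\lambda^{-\frac{N+2}{2}}\right),\qquad \lambda\to\infty,\ \alpha>0,$$ and (ii) $$L(\alpha,\lambda)= e^{\frac{\pi i}{4}} e^{-\lambda i(1+\ln\alpha)}\sum_{j=0}^{\lfloor N/2\rfloor}\frac{\partial_r^{2j}g(\alpha,0)}{(2j)!}\,\Gamma\!\left(j+\tfrac12\right)\left(\frac{2}{\lambda}\right)^{j+\frac12}+O\!\left(\left(\frac{1}{|\alpha-1|^{N+2}}+1\right)\lambda^{-\frac{N+2}{2}}\right),\qquad \lambda\to\infty,\ \alpha\in(0,\infty)\setminus\{1\},$$ where the error terms are uniform with respect to $\alpha$ in the given ranges, and $\lfloor N/2\rfloor$ denotes the integer part of $N/2$. In the special case $N=3$, the formulas (i) and (ii) reduce to $$L(\alpha,\lambda)= e^{\frac{\pi i}{4}}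 e^{-\lambda i(1+\ln\alpha)}\left\{\frac{\alpha-1-\ln\alpha}{\sqrt{\pi}\,(\alpha-1)\ln\alpha}\left(\frac{2}{\lambda}\right)^{\frac12}+ i\,\frac{\frac{1+10\alpha+\alpha^2}{(\alpha-1)^3}-\frac{12-6\ln\alpha+(\ln\alpha)^2}{(\ln\alpha)^3}}{24\sqrt{\pi}}\left(\frac{2}{\lambda}\right)^{\frac32}\right\}+K(\alpha,\lambda)+O\!\left(\lambda^{-\frac52}\right),\qquad \lambda\to\infty,\ \alpha>0,$$ and $$L(\alpha,\lambda)= e^{\frac{\pi i}{4}} e^{-\lambda i(1+\ln\alpha)}\left\{\frac{1}{\sqrt{\pi}\,\ln\alpha}\left(\frac{2}{\lambda}\right)^{\frac12}- i\,\frac{12-6\ln\alpha+(\ln\alpha)^2}{24\sqrt{\pi}\,(\ln\alpha)^3}\left(\frac{2}{\lambda}\right)^{\frac32}\right\}+O\!\left(\left(\frac{1}{|\alpha-1|^{5}}+1\right)\lambda^{-\frac52}\right),\qquad \lambda\to\infty,\ \alpha\in(0,\infty)\setminus\{1\},$$ as $\lambda\to\infty$, uniformly for $\alpha$ in the given ranges.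
   Context: Unless stated otherwise, the principal branch is used for the logarithm $\ln z$. The Hankel contour is $$H_1=\{re^{-i\pi}:1<r<\infty\}\cup\{e^{i\theta}:-\pi<\theta<\pi\}\cup\{re^{i\pi}:1<r<\infty\};$$ it surrounds the negative real axis in the counterclockwise direction (it comes in from $\infty e^{-i\pi}$ below the cut $(-\infty,0]$, runs counterclockwise along the unit circle, and goes out to $\infty e^{i\pi}$ above the cut). For $\alpha>0$ and $\lambda>0$ define $$L(\alpha,\lambda)=\int_{H_1} f(\alpha,w)\,e^{\lambda S(\alpha,w)}\,dw,\qquad f(\alpha,w)=\frac{1}{\pi w\left(\frac{\pi}{2}-i\ln(w/\alpha)\right)},\qquad S(\alpha,w)=w-\frac{\pi}{2}+i\ln(w/\alpha).$$ The variable $r=r(w)$ is defined by $$S(\alpha,w)-S(\alpha,-i)=-\tfrac12 r^2,\qquad\text{i.e.}\qquad r=e^{-\frac{\pi i}{4}}\sqrt{2\left(1-iw+\ln(iw)\right)},$$ where the branches are such that $r=0$ and $\frac{dr}{dw}=e^{-\frac{i\pi}{4}}$ at $w=-i$, and such that $w$ depends continuously on $r\in\mathbb{R}$. In the formulas below $w=w(r)$ denotes the corresponding value of $w$. Define $$g(\alpha,r)=\frac{e^{\frac{\pi i}{4}}\,r}{\pi\left(\frac{\pi}{2}-i\ln\frac{w}{\alpha}\right)(1-iw)},\qquad g_{\mathrm{reg}}(\alpha,r)=\frac{w\,e^{\frac{\pi i}{4}}\,r}{\pi(1-iw)}\left(\frac{1}{w\left(\frac{\pi}{2}-i\ln\frac{w}{\alpha}\right)}-\frac{i}{w+i\alpha}\right),$$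 and $$K(\alpha,\lambda)=-\frac{i\,e^{-\lambda i(1+\ln\alpha)}}{\pi}\int_{-\infty}^{\infty}\frac{e^{-\frac{\lambda}{2}r^2}}{w+i\alpha}\,\frac{wr}{w+i}\,dr.$$ The removable singularities of $g$ and $g_{\mathrm{reg}}$ at $r=0$ (where $w=-i$), of $g_{\mathrm{reg}}$ at $w=-i\alpha$, and of the explicit $g_{\mathrm{reg}}$-coefficients at $\alpha=1$ are understood to be removed by analytic continuation; $\partial_r^{2j}g(\alpha,0)$ and $\partial_r^{2j}g_{\mathrm{reg}}(\alpha,0)$ denote $2j$-th derivatives in $r$ at $r=0$ of the resulting functions. *)

theory Defs
  imports "HOL-Complex_Analysis.Complex_Analysis"
begin

(* In hankel_f and hankel_S the argument l is the value of ln w in use, so that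
   ln (w/a) = l - ln a for a > 0.  It is a separate argument because both the lower edge of the
   cut (where arg w = -pi, not covered by Ln) and the curve w(r), which crosses the cut, need
   other determinations than the principal one. *)

definition hankel_f :: "real \<Rightarrow> complex \<Rightarrow> complex \<Rightarrow> complex" where
  "hankel_f a w l = 1 / (of_real pi * w * (of_real pi / 2 - \<i> * (l - of_real (ln a))))"

definition hankel_S :: "real \<Rightarrow> complex \<Rightarrow> complex \<Rightarrow> complex" where
  "hankel_S a w l = w - of_real pi / 2 + \<i> * (l - of_real (ln a))"

(* Integral of G w (ln w) over the Hankel contour: in along r e^{-i pi} (r from infinity to 1,
   dw = -dr), along the unit circle, out along r e^{i pi} (r from 1 to infinity, dw = -dr). *)
definition hankel_integral :: "(complex \<Rightarrow> complex \<Rightarrow> complex) \<Rightarrow> complex" where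
  "hankel_integral G =
     (LINT r:{1<..}|lborel. G (- of_real r) (of_real (ln r) - \<i> * of_real pi))
     + contour_integral (part_circlepath 0 1 (- pi) pi) (\<lambda>w. G w (Ln w))
     - (LINT r:{1<..}|lborel. G (- of_real r) (of_real (ln r) + \<i> * of_real pi))"

(* The pole w = -i a of f is on the contour exactly when a = 1; there both L and K are
   Cauchy principal values, i.e. limits of the integrals over the part |w + i a| > d.
   For d = 0 and a other than 1 nothing is cut out. *)

definition hankel_L_cut :: "real \<Rightarrow> real \<Rightarrow> real \<Rightarrow> complex" where
  "hankel_L_cut d a lam = hankel_integral (\<lambda>w l.
     if cmod (w + \<i> * of_real a) > d
     then hankel_f a w l * exp (of_real lam * hankel_S a w l) else 0)"

definition hankel_L :: "real \<Rightarrow> real \<Rightarrow> complex" where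
  "hankel_L a lam =
     (if a = 1 then Lim (at_right 0) (\<lambda>d. hankel_L_cut d a lam) else hankel_L_cut 0 a lam)"

(* w = w(r): the logarithm l r of w r is continued along the curve, starting from its principal
   value at w 0 = -i; the condition dr/dw = e^{-i pi/4} is stated for the inverse function.
   Past r = 2 sqrt pi, where w returns to -i with another value of the logarithm (again a saddle
   point), continuity leaves a choice of branch; every such choice satisfies the predicate. *)
definition saddle_curve :: "(real \<Rightarrow> complex) \<Rightarrow> bool" where
  "saddle_curve w \<longleftrightarrow>
     continuous_on UNIV w \<and> w 0 = - \<i> \<and>
     (w has_vector_derivative exp (\<i> * of_real pi / 4)) (at 0) \<and>
     (\<exists>l. continuous_on UNIV l \<and> l 0 = Ln (- \<i>) \<and> (\<forall>r. exp (l r) = w r) \<and>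
          (\<forall>a>0. \<forall>r. hankel_S a (w r) (l r) - hankel_S a (- \<i>) (Ln (- \<i>))
                        = - (of_real r)\<^sup>2 / 2))"

definition hankel_K_cut :: "(real \<Rightarrow> complex) \<Rightarrow> real \<Rightarrow> real \<Rightarrow> real \<Rightarrow> complex" where
  "hankel_K_cut w d a lam =
     - (\<i> * exp (- (of_real lam * \<i> * (1 + of_real (ln a)))) / of_real pi) *
     (LINT r|lborel. (if cmod (w r + \<i> * of_real a) > d
        then exp (- (of_real lam / 2) * (of_real r)\<^sup>2) / (w r + \<i> * of_real a)
               * (w r * of_real r / (w r + \<i>))
        else 0))"

definition hankel_K :: "(real \<Rightarrow> complex) \<Rightarrow> real \<Rightarrow> real \<Rightarrow> complex" where
  "hankel_K w a lam =
     (if a = 1 then Lim (at_right 0) (\<lambda>d. hankel_K_cut w d a lam) else hankel_K_cut w 0 a lam)"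

definition remove_sing_at :: "real \<Rightarrow> (real \<Rightarrow> complex) \<Rightarrow> real \<Rightarrow> complex" where
  "remove_sing_at x0 h x = (if x = x0 then Lim (at x0) h else h x)"

(* Only the germs of g and g_reg at r = 0 are used, where ln (w/a) is principal; near 0 the real
   curve w(r) meets -i a only for a = 1 and r = 0, so r = 0 is the only point to fill in. *)

definition g_fun :: "(real \<Rightarrow> complex) \<Rightarrow> real \<Rightarrow> real \<Rightarrow> complex" where
  "g_fun w a = remove_sing_at 0 (\<lambda>r.
     exp (of_real pi * \<i> / 4) * of_real r
     / (of_real pi * (of_real pi / 2 - \<i> * Ln (w r / of_real a)) * (1 - \<i> * w r)))"

definition g_reg :: "(real \<Rightarrow> complex) \<Rightarrow> real \<Rightarrow> real \<Rightarrow> complex" where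
  "g_reg w a = remove_sing_at 0 (\<lambda>r.
     w r * exp (of_real pi * \<i> / 4) * of_real r / (of_real pi * (1 - \<i> * w r))
     * (1 / (w r * (of_real pi / 2 - \<i> * Ln (w r / of_real a)))
        - \<i> / (w r + \<i> * of_real a)))"

definition nth_deriv :: "nat \<Rightarrow> (real \<Rightarrow> complex) \<Rightarrow> real \<Rightarrow> complex" where
  "nth_deriv n = (\<lambda>h x. vector_derivative h (at x)) ^^ n"

definition hankel_prefactor :: "real \<Rightarrow> real \<Rightarrow> complex" where
  "hankel_prefactor a lam =
     exp (of_real pi * \<i> / 4) * exp (- (of_real lam * \<i> * (1 + of_real (ln a))))"

definition hankel_sum :: "(real \<Rightarrow> complex) \<Rightarrow> nat \<Rightarrow> real \<Rightarrow> complex" where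
  "hankel_sum h N lam =
     (\<Sum>j=0..N div 2. nth_deriv (2 * j) h 0 / fact (2 * j)
        * of_real (Gamma (real j + 1/2) * (2 / lam) powr (real j + 1/2)))"

definition reg_coeff0 :: "real \<Rightarrow> complex" where
  "reg_coeff0 = remove_sing_at 1 (\<lambda>a.
     of_real ((a - 1 - ln a) / (sqrt pi * (a - 1) * ln a)))"

definition reg_coeff1 :: "real \<Rightarrow> complex" where
  "reg_coeff1 = remove_sing_at 1 (\<lambda>a.
     \<i> * of_real (((1 + 10 * a + a\<^sup>2) / (a - 1) ^ 3
                    - (12 - 6 * ln a + (ln a)\<^sup>2) / (ln a) ^ 3) / (24 * sqrt pi)))"

end

(* Substitute w = -i e^v.  With b = ln a the integrand of L becomes a constant multiple of
   e^(-i lam (e^v - 1 - v)) / (v - b), so the pole sits at the real point v = b, and the curve w(r)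
   becomes a curve v(r) with e^v - 1 - v = -i r^2 / 2, which is analytic near r = 0 and leaves 0 in
   the direction e^(3 pi i / 4).  The Hankel contour can be deformed to the arc |r| <= rho of this
   curve at the cost of an exponentially small error, uniformly in a.

   The integrand of K in the variable r is v' times e^v / (e^v - a), and
   1/u - e^u / (e^u - 1) with u = v - b is holomorphic and bounded in the strip |Im u| <= 1.  Hence
   on the arc L - K is a Gaussian integral of a holomorphic function that is bounded uniformly in a,
   and Watson's lemma gives (i).  For (ii) the kernel v' / (v - b) is replaced by its Taylor part in
   v / b; the remainder costs |b|^-(N+2).

   The rest of K is exponentially small, but the curve w(r) may come back to the saddle point -i
   whenever r^2 / 2 is a multiple of 2 pi, where the pole -i a can be arbitrarily close.  The distance of
   e^v from the ray of positive reals is bounded below by a multiple of the distance of e^v from 1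
   there, and an integration by parts against Ln (1 - e^v / a) leaves the integrable singularities
   |sin (r^2 / 4)|^(-1/2).  For a = 1 the principal values of L and K both produce the jump i pi of
   the logarithm at v = 0, and the two jumps cancel. *)

theory Submission
  imports Defs "HOL-Probability.Distributions"
begin

section \<open>Gaussian integrals and Watson's lemma\<close>

text \<open>The contour moves without homotopies: the integrand has a primitive on both open half
  planes, which for b \<noteq> 0 are joined through 0, so an integral is a difference of values and
  a deformation is an estimate of increments. These are exponentially small uniformly in b because
  the connecting segments keep a fixed distance from the real axis, where the pole lies.

  The tail estimates are shaped by the fact that only continuity of the curve is known. Near a
  return to the saddle point both factors of (e^v - 1) (e^v - a) can be of the order of |sin (r^2 /
  4)|^(1/2), and the reciprocal of the product is not integrable uniformly in a; a logarithm loses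
  one factor only. That the second factor is not much smaller than the first rests on one fact: for
  u = v - 2 pi i k the number e^u - 1 - u is imaginary and (e^u - 1)^2 is its double up to O(u^3),
  so e^v - 1 points nearly along a diagonal, whichever branch was taken. For a = 1 the logarithm
  would meet its branch point; there the real part of the integrand is a derivative of -ln |e^v -
  1|, and the imaginary part has a weaker singularity.\<close>

lemma gauss_moment_even:
  assumes "0 < lam"
  shows "has_bochner_integral lborel (\<lambda>r::real. exp (- (lam / 2) * r\<^sup>2) * r ^ (2 * j))
           (Gamma (real j + 1/2) * (2 / lam) powr (real j + 1/2))"
proof -
  \<comment> \<open>Moments of the normal density with standard deviation
    \<open>1 / sqrt lam\<close> come with factorials; the Gamma form agrees with them by induction,
    each step contributing the factor (j + 1/2) (2 / lam).\<close>
  have eq: "Gamma (real j + 1/2) * (2 / lam) powr (real j + 1/2)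
      = fact (2 * j) / ((2 * lam) ^ j * fact j) * sqrt (2 * pi / lam)"
  proof (induction j)
    case 0
    show ?case using assms
      by (simp add: Gamma_one_half_real powr_half_sqrt real_sqrt_mult real_sqrt_divide)
  next
    case (Suc j)
    have "real j + 1/2 \<notin> \<int>\<^sub>\<le>\<^sub>0"
      using nonpos_Ints_nonpos[of "real j + 1/2"] by auto
    then have "Gamma (real (Suc j) + 1/2) = (real j + 1/2) * Gamma (real j + 1/2)"
      using Gamma_plus1[of "real j + 1/2"] by (simp add: add_ac)
    moreover have "(2 / lam) powr (real (Suc j) + 1/2) = (2 / lam) * (2 / lam) powr (real j + 1/2)"
      using assms powr_add[of "2/lam" 1 "real j + 1/2"] by (simp add: add_ac)
    ultimately have "Gamma (real (Suc j) + 1/2) * (2 / lam) powr (real (Suc j) + 1/2)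
      = (real j + 1/2) * (2 / lam) * (Gamma (real j + 1/2) * (2 / lam) powr (real j + 1/2))"
      by simp
    also have "\<dots> = (real j + 1/2) * (2 / lam) *
        (fact (2 * j) / ((2 * lam) ^ j * fact j) * sqrt (2 * pi / lam))"
      by (simp only: Suc.IH)
    also have "\<dots> = ((real j + 1/2) * (2 / lam) *
        (fact (2 * j) / ((2 * lam) ^ j * fact j))) * sqrt (2 * pi / lam)"
      by (simp only: mult.assoc)
    also have "(real j + 1/2) * (2 / lam) * (fact (2 * j) / ((2 * lam) ^ j * fact j))
        = (real (2 * Suc j) * real (2 * j + 1) * fact (2 * j)) / ((2 * lam) ^ Suc j * (real (Suc j) * fact j))"
      using assms by (simp add: divide_simps) (simp add: algebra_simps)
    also have "real (2 * Suc j) * real (2 * j + 1) * fact (2 * j) = fact (2 * Suc j)"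
      by (simp add: algebra_simps)
    also have "real (Suc j) * fact j = fact (Suc j)" by simp
    finally show ?case .
  qed
  have "has_bochner_integral lborel (\<lambda>x. normal_density 0 (1 / sqrt lam) x * (x - 0) ^ (2 * j) * sqrt (2 * pi / lam))
     (fact (2 * j) / ((2 / (1 / sqrt lam)\<^sup>2)^j * fact j) * sqrt (2 * pi / lam))"
    using assms by (intro has_bochner_integral_mult_left normal_moment_even) auto
  moreover have "(\<lambda>x. normal_density 0 (1 / sqrt lam) x * (x - 0) ^ (2 * j) * sqrt (2 * pi / lam))
      = (\<lambda>r. exp (- (lam / 2) * r\<^sup>2) * r ^ (2 * j))"
    using assms by (auto simp: normal_density_def fun_eq_iff power_divide real_sqrt_divide real_sqrt_mult field_simps)
  ultimately show ?thesis
    using assms eq by (simp add: power_divide)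
qed

text \<open>Rescaling r by \<open>sqrt lam\<close> reduces every \<open>lam\<close> to 1, so a
  single constant \<open>m\<close> serves all of them; its value is irrelevant, only that it is
  finite and independent of \<open>lam\<close>.\<close>

lemma gauss_moment_abs:
  obtains m :: real where "m \<ge> 0" "\<And>lam. lam > 0 \<Longrightarrow>
     has_bochner_integral lborel (\<lambda>r::real. exp (- (lam / 2) * r\<^sup>2) * \<bar>r\<bar> ^ n)
       (m * lam powr (- (real n + 1) / 2))"
proof -
  let ?f = "\<lambda>x::real. exp (- (1/2) * x\<^sup>2) * \<bar>x\<bar> ^ n"
  have int: "integrable lborel ?f"
  proof (rule Bochner_Integration.integrable_bound)
    show "integrable lborel (\<lambda>x::real. exp (- (1/2) * x\<^sup>2) * x ^ (2*0) + exp (- (1/2) * x\<^sup>2) * x ^ (2*n))"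
      using gauss_moment_even[of 1 0] gauss_moment_even[of 1 n]
      by (intro Bochner_Integration.integrable_add) (auto simp: has_bochner_integral_iff)
    have "\<bar>x\<bar> ^ n \<le> 1 + x ^ (2 * n)" for x :: real
    proof (cases "\<bar>x\<bar> \<le> 1")
      case True
      then show ?thesis by (simp add: power_le_one add_increasing2 power_mult)
    next
      case False
      then have "\<bar>x\<bar> ^ n \<le> \<bar>x\<bar> ^ (2 * n)" by (intro power_increasing) auto
      then show ?thesis by (simp add: power_mult)
    qed
    then have "norm (?f x) \<le> norm (exp (- (1/2) * x\<^sup>2) * (1 + x ^ (2*n)))" for x
      by (simp add: abs_mult)
    then show "AE x in lborel. norm (?f x) \<le> norm (exp (- (1/2) * x\<^sup>2) * x ^ (2*0) + exp (- (1/2) * x\<^sup>2) * x ^ (2*n))"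
      by (intro AE_I2) (simp only: distrib_left power_0 mult_0_right)
  qed simp
  define m where "m = integral\<^sup>L lborel ?f"
  show thesis
  proof
    show "m \<ge> 0" unfolding m_def by (intro Bochner_Integration.integral_nonneg) auto
    fix lam :: real assume lam: "lam > 0"
    have "has_bochner_integral lborel ?f m"
      using int by (simp add: has_bochner_integral_iff m_def)
    then have "has_bochner_integral lborel (\<lambda>x. ?f (0 + sqrt lam * x)) (m /\<^sub>R \<bar>sqrt lam\<bar>)"
      using lam by (subst (asm) lborel_has_bochner_integral_real_affine_iff[where c = "sqrt lam" and t = 0]) auto
    then have "has_bochner_integral lborel (\<lambda>x. ?f (0 + sqrt lam * x) * lam powr (- real n / 2)) (m /\<^sub>R \<bar>sqrt lam\<bar> * lam powr (- real n / 2))"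
      by (rule has_bochner_integral_mult_left)
    moreover have "sqrt lam ^ n * lam powr (- real n / 2) = 1"
      using lam by (simp add: powr_half_sqrt[symmetric] powr_realpow[symmetric] powr_powr flip: powr_add)
    then have "?f (0 + sqrt lam * x) * lam powr (- real n / 2) = exp (- (lam / 2) * x\<^sup>2) * \<bar>x\<bar> ^ n" for x
      using lam by (simp add: power_mult_distrib abs_mult mult_ac)
    moreover have "m /\<^sub>R \<bar>sqrt lam\<bar> * lam powr (- real n / 2) = m * lam powr (- (real n + 1) / 2)"
    proof -
      have "inverse (sqrt lam) = lam powr (- (1/2))"
        using lam by (simp add: powr_minus powr_half_sqrt)
      moreover have "lam powr (- (1/2)) * lam powr (- real n / 2) = lam powr (- (real n + 1) / 2)"
        by (subst powr_add[symmetric]) (simp add: field_simps)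
      ultimately show ?thesis using lam by simp
    qed
    ultimately show "has_bochner_integral lborel (\<lambda>r::real. exp (- (lam / 2) * r\<^sup>2) * \<bar>r\<bar> ^ n)
       (m * lam powr (- (real n + 1) / 2))" by (simp only:)
  qed
qed

lemma gauss_moment_odd:
  assumes "0 < lam" "odd n"
  shows "has_bochner_integral lborel (\<lambda>r::real. exp (- (lam / 2) * r\<^sup>2) * r ^ n) 0"
proof -
  let ?f = "\<lambda>r::real. exp (- (lam / 2) * r\<^sup>2) * r ^ n"
  obtain m where m: "m \<ge> 0" "\<And>lam. lam > 0 \<Longrightarrow>
     has_bochner_integral lborel (\<lambda>r::real. exp (- (lam / 2) * r\<^sup>2) * \<bar>r\<bar> ^ n)
       (m * lam powr (- (real n + 1) / 2))"
    by (fact gauss_moment_abs)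
  have "integrable lborel (\<lambda>r::real. exp (- (lam / 2) * r\<^sup>2) * \<bar>r\<bar> ^ n)"
    using m(2)[OF assms(1)] by (simp only: has_bochner_integral_iff)
  then have "integrable lborel ?f"
    by (rule Bochner_Integration.integrable_bound) (auto simp: abs_mult power_abs)
  moreover have "integral\<^sup>L lborel ?f = - integral\<^sup>L lborel ?f"
    using lborel_integral_real_affine[of "-1" ?f 0] assms(2) by simp
  ultimately show ?thesis by (simp add: has_bochner_integral_iff)
qed

text \<open>The constant depends on \<rho>, R and N but not on \<open>G\<close>; all uniformity in a
  comes from here. The indicator makes the estimate hold on the whole line: inside the interval it
  bounds the tail of the power series, outside it bounds the Taylor polynomial itself, which is
  O(|r|^(N+1)) because |r| > \<rho>. So the missing Gaussian tails need no separate
  treatment.\<close>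

lemma taylor_remainder_bound:
  assumes "0 < \<rho>" "\<rho> < R"
  obtains B where "B \<ge> 0" "\<And>G M r. G holomorphic_on ball (0::complex) R \<Longrightarrow>
     (\<And>z. z \<in> ball 0 R \<Longrightarrow> norm (G z) \<le> M) \<Longrightarrow>
     norm (indicator {-\<rho>..\<rho>} r *\<^sub>R G (of_real r) - (\<Sum>k\<le>N. (deriv ^^ k) G 0 / fact k * of_real r ^ k))
        \<le> B * M * \<bar>r\<bar> ^ (N + 1)"
proof -
  \<comment> \<open>A radius strictly between: Cauchy's inequality is applied on the closed disc of
    radius \<open>R1\<close> < R, and the geometric series has ratio at most \<rho> /
    \<open>R1\<close> < 1.\<close>
  define R1 where "R1 = (\<rho> + R) / 2"
  have R1: "0 < R1" "\<rho> < R1" "R1 < R" using assms by (auto simp: R1_def)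
  define B1 where "B1 = 1 / R1 ^ (N + 1) / (1 - \<rho> / R1)"
  define B2 where "B2 = (\<Sum>k\<le>N. 1 / R1 ^ k / \<rho> ^ (N + 1 - k))"
  have B1: "B1 \<ge> 0" using R1 by (simp add: B1_def)
  have B2: "B2 \<ge> 0" using R1 assms by (simp add: B2_def sum_nonneg)
  show thesis
  proof (rule that)
    show "B1 + B2 \<ge> 0" using B1 B2 by simp
    fix G M and r :: real
    assume hol: "G holomorphic_on ball (0::complex) R" and M: "\<And>z. z \<in> ball 0 R \<Longrightarrow> norm (G z) \<le> M"
    define c where "c k = (deriv ^^ k) G 0 / fact k" for k
    have "norm (G 0) \<le> M" using M[of 0] R1 by simp
    then have M0: "M \<ge> 0" by (smt (verit) norm_ge_zero)
    have cb: "norm (c k) \<le> M / R1 ^ k" for k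
    proof -
      have "norm ((deriv ^^ k) G 0) \<le> fact k * M / R1 ^ k"
      proof (rule Cauchy_inequality)
        show "G holomorphic_on ball 0 R1" by (rule holomorphic_on_subset[OF hol]) (use R1 in auto)
        show "continuous_on (cball 0 R1) G"
          by (rule holomorphic_on_imp_continuous_on, rule holomorphic_on_subset[OF hol]) (use R1 in auto)
      qed (use R1 M in auto)
      then show ?thesis by (simp add: c_def norm_divide field_simps)
    qed
    show "norm (indicator {-\<rho>..\<rho>} r *\<^sub>R G (of_real r) - (\<Sum>k\<le>N. (deriv ^^ k) G 0 / fact k * of_real r ^ k))
        \<le> (B1 + B2) * M * \<bar>r\<bar> ^ (N + 1)"
    proof (cases "\<bar>r\<bar> \<le> \<rho>")
      case True
      have sm: "(\<lambda>k. c k * of_real r ^ k) sums G (of_real r)"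
        using holomorphic_power_series[OF hol, of "of_real r"] True R1 by (simp add: c_def)
      then have sm2: "(\<lambda>k. c (k + (N+1)) * of_real r ^ (k + (N+1))) sums (G (of_real r) - (\<Sum>k<N+1. c k * of_real r ^ k))"
        by (rule sums_split_initial_segment)
      have q: "norm (\<bar>r\<bar> / R1) < 1" using True R1 by simp
      have gs: "(\<lambda>k. M * (\<bar>r\<bar> / R1) ^ (N+1) * (\<bar>r\<bar> / R1) ^ k) sums (M * (\<bar>r\<bar> / R1) ^ (N+1) * (1 / (1 - \<bar>r\<bar> / R1)))"
        by (intro sums_mult geometric_sums q)
      have bd: "norm (c (k + (N+1)) * of_real r ^ (k + (N+1))) \<le> M * (\<bar>r\<bar> / R1) ^ (N+1) * (\<bar>r\<bar> / R1) ^ k" for k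
      proof -
        have "norm (c (k + (N+1)) * of_real r ^ (k + (N+1))) = norm (c (k + (N+1))) * \<bar>r\<bar> ^ (k + (N+1))"
          by (simp add: norm_mult norm_power)
        also have "\<dots> \<le> M / R1 ^ (k + (N+1)) * \<bar>r\<bar> ^ (k + (N+1))"
          by (intro mult_right_mono cb) auto
        also have "\<dots> = M * (\<bar>r\<bar> / R1) ^ (N+1) * (\<bar>r\<bar> / R1) ^ k"
          by (simp add: power_divide power_add mult_ac)
        finally show ?thesis .
      qed
      have "norm (G (of_real r) - (\<Sum>k<N+1. c k * of_real r ^ k)) \<le> M * (\<bar>r\<bar> / R1) ^ (N+1) * (1 / (1 - \<bar>r\<bar> / R1))"
        using norm_suminf_le[of "\<lambda>k. c (k + (N+1)) * of_real r ^ (k + (N+1))", OF bd] sums_unique[OF sm2] sums_unique[OF gs] sums_summable[OF gs]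
        by presburger
      also have "\<dots> \<le> M * (\<bar>r\<bar> / R1) ^ (N+1) * (1 / (1 - \<rho> / R1))"
        using True R1 M0 by (intro mult_left_mono divide_left_mono mult_pos_pos diff_left_mono divide_right_mono) auto
      also have "\<dots> = B1 * M * \<bar>r\<bar> ^ (N+1)" by (simp add: B1_def power_divide)
      also have "\<dots> \<le> (B1 + B2) * M * \<bar>r\<bar> ^ (N+1)"
        using B2 M0 by (intro mult_right_mono) auto
      finally show ?thesis using True by (simp add: c_def lessThan_Suc_atMost indicator_def abs_le_iff)
    next
      case False
      have "norm (\<Sum>k\<le>N. c k * of_real r ^ k) \<le> (\<Sum>k\<le>N. M * (1 / R1 ^ k / \<rho> ^ (N + 1 - k)) * \<bar>r\<bar> ^ (N+1))"
      proof (rule sum_norm_le)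
        fix k assume k: "k \<in> {..N}"
        have "norm (c k * of_real r ^ k) = norm (c k) * \<bar>r\<bar> ^ k" by (simp add: norm_mult norm_power)
        also have "\<dots> \<le> M / R1 ^ k * \<bar>r\<bar> ^ k" by (intro mult_right_mono cb) auto
        also have "\<dots> \<le> M / R1 ^ k * (\<bar>r\<bar> ^ (N+1) / \<rho> ^ (N+1-k))"
        proof (intro mult_left_mono)
          have "\<rho> ^ (N+1-k) * \<bar>r\<bar> ^ k \<le> \<bar>r\<bar> ^ (N+1-k) * \<bar>r\<bar> ^ k"
            using False assms by (intro mult_right_mono power_mono) auto
          also have "\<dots> = \<bar>r\<bar> ^ (N+1)" using k by (simp flip: power_add)
          finally show "\<bar>r\<bar> ^ k \<le> \<bar>r\<bar> ^ (N+1) / \<rho> ^ (N+1-k)" using assms by (simp add: field_simps)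
        qed (use M0 R1 in auto)
        finally show "norm (c k * of_real r ^ k) \<le> M * (1 / R1 ^ k / \<rho> ^ (N + 1 - k)) * \<bar>r\<bar> ^ (N+1)"
          by (simp add: mult_ac)
      qed
      also have "\<dots> = B2 * M * \<bar>r\<bar> ^ (N+1)" by (simp add: B2_def sum_distrib_left sum_distrib_right mult_ac)
      also have "\<dots> \<le> (B1 + B2) * M * \<bar>r\<bar> ^ (N+1)"
        using B1 M0 by (intro mult_right_mono) auto
      finally have "norm (\<Sum>k\<le>N. c k * of_real r ^ k) \<le> (B1 + B2) * M * \<bar>r\<bar> ^ (N+1)" .
      moreover have "r \<notin> {-\<rho>..\<rho>}" using False by auto
      ultimately show ?thesis unfolding c_def by simp
    qed
  qed
qed

text \<open>Watson's lemma with a constant independent of \<open>G\<close>: the Taylor polynomial is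
  integrated over the whole line, where odd powers vanish, and the remainder O(|r|^(N+1))
  contributes the moment of order N + 1, hence the exponent -(N+2)/2. It holds for every positive
  \<open>lam\<close>, not only for large ones.\<close>

lemma watson_holomorphic:
  assumes "0 < \<rho>" "\<rho> < R"
  obtains C where "C \<ge> 0" "\<And>G M lam. G holomorphic_on ball (0::complex) R \<Longrightarrow>
     (\<And>z. z \<in> ball 0 R \<Longrightarrow> norm (G z) \<le> M) \<Longrightarrow> lam > 0 \<Longrightarrow>
     norm ((LINT r:{-\<rho>..\<rho>}|lborel. exp (- (lam / 2) * r\<^sup>2) *\<^sub>R G (of_real r))
        - (\<Sum>j=0..N div 2. (deriv ^^ (2 * j)) G 0 / fact (2 * j)
             * of_real (Gamma (real j + 1/2) * (2 / lam) powr (real j + 1/2))))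
       \<le> C * M * lam powr (- (real N + 2) / 2)"
proof -
  obtain B where B0: "B \<ge> 0" and B: "\<And>G M r. G holomorphic_on ball (0::complex) R \<Longrightarrow>
     (\<And>z. z \<in> ball 0 R \<Longrightarrow> norm (G z) \<le> M) \<Longrightarrow>
     norm (indicator {-\<rho>..\<rho>} r *\<^sub>R G (of_real r) - (\<Sum>k\<le>N. (deriv ^^ k) G 0 / fact k * of_real r ^ k))
        \<le> B * M * \<bar>r\<bar> ^ (N + 1)"
    by (fact taylor_remainder_bound[OF assms])
  obtain m where m0: "m \<ge> 0" and m: "\<And>lam. lam > 0 \<Longrightarrow>
     has_bochner_integral lborel (\<lambda>r::real. exp (- (lam / 2) * r\<^sup>2) * \<bar>r\<bar> ^ (N + 1))
       (m * lam powr (- (real (N + 1) + 1) / 2))"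
    by (fact gauss_moment_abs)
  show thesis
  proof (rule that)
    show "B * m \<ge> 0" using B0 m0 by simp
    fix G M and lam :: real
    assume hol: "G holomorphic_on ball (0::complex) R" and M: "\<And>z. z \<in> ball 0 R \<Longrightarrow> norm (G z) \<le> M"
      and lam: "lam > 0"
    define c where "c k = (deriv ^^ k) G 0 / fact k" for k
    define mom where "mom k = (if even k then Gamma (real (k div 2) + 1/2) * (2 / lam) powr (real (k div 2) + 1/2) else 0)" for k
    let ?e = "\<lambda>r::real. exp (- (lam / 2) * r\<^sup>2)"
    have mom: "has_bochner_integral lborel (\<lambda>r. ?e r * r ^ k) (mom k)" for k
    proof (cases "even k")
      case True
      then obtain j where k: "k = 2 * j" by (rule evenE)
      have "mom k = Gamma (real j + 1/2) * (2 / lam) powr (real j + 1/2)" by (simp add: mom_def k)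
      then show ?thesis using gauss_moment_even[OF lam, of j] by (simp only: k)
    next
      case False
      then have "mom k = 0" by (simp add: mom_def)
      then show ?thesis using gauss_moment_odd[OF lam False] by (simp only:)
    qed
    have mom1: "has_bochner_integral lborel (\<lambda>r. ?e r *\<^sub>R (c k * of_real r ^ k)) (c k * of_real (mom k))" for k
    proof -
      have "has_bochner_integral lborel (\<lambda>r. c k * complex_of_real (?e r * r ^ k)) (c k * of_real (mom k))"
        by (rule has_bochner_integral_mult_right[OF has_bochner_integral_of_real[OF mom]])
      moreover have "(\<lambda>r. c k * complex_of_real (?e r * r ^ k)) = (\<lambda>r. ?e r *\<^sub>R (c k * of_real r ^ k))"
        by (rule ext) (simp only: scaleR_conv_of_real of_real_mult of_real_power mult.left_commute)
      ultimately show ?thesis by (simp only:)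
    qed
    have mom2: "has_bochner_integral lborel (\<lambda>r. \<Sum>k\<le>N. ?e r *\<^sub>R (c k * of_real r ^ k)) (\<Sum>k\<le>N. c k * of_real (mom k))"
      by (intro has_bochner_integral_sum mom1)
    have sumeq: "(\<Sum>k\<le>N. c k * of_real (mom k)) = (\<Sum>j=0..N div 2. c (2*j) * of_real (mom (2*j)))"
    proof -
      have "(\<Sum>k\<le>N. c k * of_real (mom k)) = (\<Sum>k\<in>(\<lambda>j. 2*j) ` {0..N div 2}. c k * of_real (mom k))"
      proof (rule sum.mono_neutral_right)
        show "\<forall>k\<in>{..N} - (\<lambda>j. 2 * j) ` {0..N div 2}. c k * of_real (mom k) = 0"
        proof
          fix k assume "k \<in> {..N} - (\<lambda>j. 2 * j) ` {0..N div 2}"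
          then have "odd k" by (auto elim!: evenE)
          then show "c k * of_real (mom k) = 0" by (simp add: mom_def)
        qed
      qed auto
      also have "\<dots> = (\<Sum>j=0..N div 2. c (2*j) * of_real (mom (2*j)))"
        by (subst sum.reindex) (auto simp: inj_on_def)
      finally show ?thesis .
    qed
    have si: "set_integrable lborel {-\<rho>..\<rho>} (\<lambda>r. ?e r *\<^sub>R G (of_real r))"
    proof (rule borel_integrable_atLeastAtMost')
      have "continuous_on (complex_of_real ` {-\<rho>..\<rho>}) G"
        by (rule continuous_on_subset[OF holomorphic_on_imp_continuous_on[OF hol]]) (use assms in auto)
      then have "continuous_on {-\<rho>..\<rho>} (\<lambda>r. G (of_real r))"
        by (rule continuous_on_compose2) (auto intro: continuous_intros)
      then show "continuous_on {-\<rho>..\<rho>} (\<lambda>r. ?e r *\<^sub>R G (of_real r))"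
        by (intro continuous_intros)
    qed
    let ?h = "\<lambda>r. ?e r *\<^sub>R (indicator {-\<rho>..\<rho>} r *\<^sub>R G (of_real r) - (\<Sum>k\<le>N. c k * of_real r ^ k))"
    have heq: "?h = (\<lambda>r. indicator {-\<rho>..\<rho>} r *\<^sub>R (?e r *\<^sub>R G (of_real r)) - (\<Sum>k\<le>N. ?e r *\<^sub>R (c k * of_real r ^ k)))"
      by (rule ext) (simp only: scaleR_diff_right scaleR_sum_right scaleR_left_commute[of "indicator _ _"])
    have hb: "has_bochner_integral lborel ?h ((LINT r:{-\<rho>..\<rho>}|lborel. ?e r *\<^sub>R G (of_real r)) - (\<Sum>k\<le>N. c k * of_real (mom k)))"
      unfolding heq using si mom2
      by (intro has_bochner_integral_diff) (auto simp: has_bochner_integral_iff set_integrable_def set_lebesgue_integral_def)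
    have "norm (integral\<^sup>L lborel ?h) \<le> (LINT r|lborel. B * M * (?e r * \<bar>r\<bar> ^ (N + 1)))"
    proof (rule Bochner_Integration.integral_norm_bound_integral)
      show "integrable lborel ?h" using hb by (simp add: has_bochner_integral_iff)
      show "integrable lborel (\<lambda>r. B * M * (?e r * \<bar>r\<bar> ^ (N + 1)))"
        using m[OF lam] by (intro integrable_mult_right) (simp add: has_bochner_integral_iff)
      fix r :: real
      show "norm (?h r) \<le> B * M * (?e r * \<bar>r\<bar> ^ (N + 1))"
      proof -
        have "norm (?h r) = ?e r * norm (indicator {-\<rho>..\<rho>} r *\<^sub>R G (of_real r) - (\<Sum>k\<le>N. c k * of_real r ^ k))"
          by simp
        also have "\<dots> \<le> ?e r * (B * M * \<bar>r\<bar> ^ (N + 1))"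
          unfolding c_def by (intro mult_left_mono B hol M) auto
        finally show ?thesis by (simp only: mult.left_commute)
      qed
    qed
    also have "\<dots> = B * M * (m * lam powr (- (real (N + 1) + 1) / 2))"
      using m[OF lam] by (simp add: has_bochner_integral_iff)
    finally have bd: "norm ((LINT r:{-\<rho>..\<rho>}|lborel. ?e r *\<^sub>R G (of_real r)) - (\<Sum>k\<le>N. c k * of_real (mom k))) \<le> \<dots>"
      using hb by (simp add: has_bochner_integral_iff)
    show "norm ((LINT r:{-\<rho>..\<rho>}|lborel. exp (- (lam / 2) * r\<^sup>2) *\<^sub>R G (of_real r))
        - (\<Sum>j=0..N div 2. (deriv ^^ (2 * j)) G 0 / fact (2 * j)
             * of_real (Gamma (real j + 1/2) * (2 / lam) powr (real j + 1/2))))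
       \<le> B * m * M * lam powr (- (real N + 2) / 2)"
    proof -
      have "(real (N + 1) + 1) = real N + 2" "\<And>j. mom (2 * j) = Gamma (real j + 1/2) * (2 / lam) powr (real j + 1/2)"
        by (auto simp: mom_def)
      moreover have "B * M * (m * y) = B * m * M * y" for y by simp
      ultimately show ?thesis using bd[unfolded sumeq] unfolding c_def by (simp only:)
    qed
  qed
qed

text \<open>Only the values of \<open>h\<close> at the real points of \<open>S\<close> enter, so
  \<open>h\<close> may be arbitrary elsewhere; this turns the iterated real derivatives of
  \<open>g_fun\<close> and \<open>g_reg\<close> at 0 into complex ones.\<close>

lemma nth_deriv_of_real:
  assumes "open S" "G holomorphic_on S" "of_real x \<in> S" "\<And>r. of_real r \<in> S \<Longrightarrow> h r = G (of_real r)"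
  shows "nth_deriv n h x = (deriv ^^ n) G (of_real x)"
  using assms
proof (induction n arbitrary: x)
  case (Suc n)
  have hol: "(deriv ^^ n) G holomorphic_on S"
    using Suc.prems(1,2) by (rule holomorphic_higher_deriv[rotated])
  have "((deriv ^^ n) G has_field_derivative deriv ((deriv ^^ n) G) (of_real x)) (at (of_real x))"
    by (rule holomorphic_derivI[OF hol Suc.prems(1,3)])
  then have "((\<lambda>r. (deriv ^^ n) G (of_real r)) has_vector_derivative deriv ((deriv ^^ n) G) (of_real x)) (at x)"
    by (rule has_vector_derivative_real_field)
  moreover have "open (complex_of_real -` S)"
    using Suc.prems(1) by (rule open_vimage) (intro continuous_intros)
  moreover have "(deriv ^^ n) G (of_real r) = nth_deriv n h r" if "r \<in> complex_of_real -` S" for r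
    by (rule Suc.IH[OF Suc.prems(1,2) _ Suc.prems(4), symmetric]) (use that in auto)
  ultimately have "x \<in> complex_of_real -` S \<Longrightarrow> (nth_deriv n h has_vector_derivative deriv ((deriv ^^ n) G) (of_real x)) (at x)"
    by (blast intro: has_vector_derivative_transform_within_open)
  then show ?case
    using Suc.prems(3) by (simp add: nth_deriv_def vector_derivative_at)
qed (simp add: nth_deriv_def)

section \<open>The saddle point\<close>

definition divdiff :: "(complex \<Rightarrow> complex) \<Rightarrow> complex \<Rightarrow> complex" where
  "divdiff f z = (if z = 0 then deriv f 0 else (f z - f 0) / z)"

lemma divdiff_holomorphic:
  assumes "f holomorphic_on S" "open S"
  shows "divdiff f holomorphic_on S"
proof -
  have "(\<lambda>z. if z = 0 then deriv f 0 else (f z - f 0) / (z - 0)) holomorphic_on S"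
    by (rule pole_lemma_open[OF assms])
  then show ?thesis by (simp add: divdiff_def[abs_def] cong: if_cong)
qed

lemma divdiff_eq: "f z = f 0 + z * divdiff f z"
  by (simp add: divdiff_def)

text \<open>\<open>expq\<close> z is (e^z - 1) / z and \<open>expq2\<close> z is (e^z - 1 - z) /
  z^2, both made entire by filling in z = 0.\<close>

definition expq :: "complex \<Rightarrow> complex" where "expq = divdiff exp"

definition expq2 :: "complex \<Rightarrow> complex" where "expq2 = divdiff expq"

lemma expq_holomorphic: "expq holomorphic_on S" and expq2_holomorphic: "expq2 holomorphic_on S"
proof -
  have "expq holomorphic_on UNIV"
    unfolding expq_def by (intro divdiff_holomorphic holomorphic_intros) auto
  then show "expq holomorphic_on S" by (rule holomorphic_on_subset) auto
  have "expq2 holomorphic_on UNIV"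
    unfolding expq2_def by (intro divdiff_holomorphic \<open>expq holomorphic_on UNIV\<close>) auto
  then show "expq2 holomorphic_on S" by (rule holomorphic_on_subset) auto
qed

lemma expq_0: "expq 0 = 1"
  by (simp add: expq_def divdiff_def DERIV_imp_deriv[OF DERIV_exp])

lemma exp_expq: "exp z = 1 + z * expq z"
  using divdiff_eq[of exp z] by (simp add: expq_def)

lemma expq_expq2: "expq z = 1 + z * expq2 z"
  using divdiff_eq[of expq z] by (simp add: expq2_def expq_0)

lemma exp_expq2: "exp z - 1 - z = z\<^sup>2 * expq2 z"
  using exp_expq[of z] expq_expq2[of z] by (simp add: power2_eq_square algebra_simps)

text \<open>Differentiating e^z = 1 + z \<open>expq\<close> z twice gives 2 \<open>expq\<close>'(0)
  = 1 at z = 0.\<close>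

lemma expq2_0: "expq2 0 = 1/2"
proof -
  have d: "(expq has_field_derivative deriv expq z) (at z)" for z
    by (rule holomorphic_derivI[OF expq_holomorphic[of UNIV]]) auto
  have e: "exp z = expq z + z * deriv expq z" for z
  proof -
    have "((\<lambda>z. 1 + z * expq z) has_field_derivative (expq z + z * deriv expq z)) (at z)"
      by (rule derivative_eq_intros d refl)+ simp
    then have "(exp has_field_derivative (expq z + z * deriv expq z)) (at z)"
      by (simp add: exp_expq[abs_def])
    then show ?thesis using DERIV_exp DERIV_unique by blast
  qed
  have d2: "(deriv expq has_field_derivative deriv (deriv expq) 0) (at 0)"
    by (rule holomorphic_derivI[of _ UNIV]) (auto intro: holomorphic_deriv expq_holomorphic)
  have "((\<lambda>z. expq z + z * deriv expq z) has_field_derivative (deriv expq 0 + (1 * deriv expq 0 + 0 * deriv (deriv expq) 0))) (at 0)"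
    by (rule derivative_eq_intros d d2 refl)+ simp
  then have "(exp has_field_derivative (deriv expq 0 + (1 * deriv expq 0 + 0 * deriv (deriv expq) 0))) (at 0)"
    by (simp add: e[abs_def])
  then have "deriv expq 0 + (1 * deriv expq 0 + 0 * deriv (deriv expq) 0) = exp 0"
    using DERIV_exp DERIV_unique by blast
  then show ?thesis by (simp add: expq2_def divdiff_def field_simps)
qed

text \<open>A square root of -i, since v^2 is -i r^2 to leading order. Of the two roots it is the
  one with dv/dr = i dw/dr at 0, where dw/dr = e^(i pi / 4).\<close>

definition sdir :: complex where "sdir = cis (3 * pi / 4)"

lemma sdir_sq: "sdir\<^sup>2 = - \<i>"
proof -
  have "sdir\<^sup>2 = cis (3 * pi / 4 + 3 * pi / 4)" by (simp add: sdir_def power2_eq_square cis_mult)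
  also have "3 * pi / 4 + 3 * pi / 4 = pi + pi / 2" by simp
  also have "cis \<dots> = - \<i>" by (simp only: cis_mult[symmetric] cis_pi cis_pi_half) simp
  finally show ?thesis .
qed

lemma norm_sdir [simp]: "norm sdir = 1"
  by (simp add: sdir_def)

lemma sdir_nz [simp]: "sdir \<noteq> 0"
  using norm_sdir by force

lemma sdir_Re_Im: "Re sdir = - sqrt 2 / 2" "Im sdir = sqrt 2 / 2"
proof -
  have "3 * pi / 4 = pi - pi / 4" by simp
  then show "Re sdir = - sqrt 2 / 2" "Im sdir = sqrt 2 / 2"
    by (simp_all only: sdir_def cis.sel cos_pi_minus sin_pi_minus cos_45 sin_45)
qed

text \<open>z sqrt(2 \<open>expq2\<close> z) is a holomorphic square root of 2 (e^z - 1 - z) with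
  derivative 1 at 0. The phase equation then reads \<open>psi\<close> (v) = \<plusminus>
  \<open>sdir\<close> * r, and V is the local inverse of \<open>psi\<close> at \<open>sdir\<close> *
  z. The last clause says that every curve with the right tangent is V near 0: the tangent fixes the
  sign, and injectivity of \<open>psi\<close> does the rest.\<close>

lemma saddle_inverse:
  obtains V R where "0 < R" "R \<le> 1/2" "V holomorphic_on ball 0 R" "deriv V 0 = sdir"
    "\<And>z. z \<in> ball 0 R \<Longrightarrow> exp (V z) - 1 - V z = - \<i> * z\<^sup>2 / 2"
    "\<And>z. z \<in> ball 0 R \<Longrightarrow> norm (V z - sdir * z) \<le> norm z / 10"
    "\<And>v :: real \<Rightarrow> complex. \<lbrakk>v 0 = 0; (v has_vector_derivative sdir) (at 0);
        \<And>r. exp (v r) - 1 - v r = - \<i> * (of_real r)\<^sup>2 / 2\<rbrakk>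
        \<Longrightarrow> \<exists>\<delta>>0. \<forall>r. \<bar>r\<bar> < \<delta> \<longrightarrow> v r = V (of_real r)"
proof -
  define psi where "psi z = z * csqrt (2 * expq2 z)" for z
  have psi2: "(psi z)\<^sup>2 = 2 * (exp z - 1 - z)" for z
    by (simp add: psi_def power_mult_distrib exp_expq2)
  \<comment> \<open>\<open>2 * expq2 0\<close> = 1, so near 0 the radicand stays in the right half
    plane, off the cut of \<open>csqrt\<close>.\<close>
  have "isCont (\<lambda>z. Re (2 * expq2 z)) 0"
    using continuous_on_interior[OF holomorphic_on_imp_continuous_on[OF expq2_holomorphic[of UNIV]], of 0]
    by (intro isCont_Re continuous_intros) auto
  then have "eventually (\<lambda>z. Re (2 * expq2 z) > 0) (at 0)"
    by (intro order_tendstoD(1)) (auto simp: isCont_def expq2_0)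
  then obtain e where e: "e > 0" "\<And>z. z \<noteq> 0 \<Longrightarrow> dist z 0 < e \<Longrightarrow> Re (2 * expq2 z) > 0"
    by (auto simp: eventually_at)
  have Repos: "Re (2 * expq2 z) > 0" if "z \<in> ball 0 e" for z
    using e(2)[of z] that by (cases "z = 0") (auto simp: expq2_0 dist_commute)
  have csq: "(\<lambda>z. csqrt (2 * expq2 z)) holomorphic_on ball 0 e"
    by (intro holomorphic_intros expq2_holomorphic) (use Repos complex_nonpos_Reals_iff in force)
  have psihol: "psi holomorphic_on ball 0 e"
    unfolding psi_def[abs_def] by (intro holomorphic_intros csq)
  have dpsi: "deriv psi 0 = 1"
  proof -
    have "((\<lambda>z. csqrt (2 * expq2 z)) has_field_derivative deriv (\<lambda>z. csqrt (2 * expq2 z)) 0) (at 0)"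
      by (rule holomorphic_derivI[OF csq]) (use e in auto)
    then have "(psi has_field_derivative 1 * csqrt (2 * expq2 0) + deriv (\<lambda>z. csqrt (2 * expq2 z)) 0 * 0) (at 0)"
      unfolding psi_def[abs_def] by (intro DERIV_mult DERIV_ident)
    then show ?thesis by (simp add: expq2_0 DERIV_imp_deriv)
  qed
  obtain r where r: "r > 0" "ball 0 r \<subseteq> ball (0::complex) e" "open (psi ` ball 0 r)" "inj_on psi (ball 0 r)"
    using has_complex_derivative_locally_invertible[OF psihol, of 0] e(1) dpsi by auto
  have psihr: "psi holomorphic_on ball 0 r" using psihol r(2) by (rule holomorphic_on_subset)
  obtain g where g: "g holomorphic_on psi ` ball 0 r"
      "\<And>z. z \<in> ball 0 r \<Longrightarrow> deriv psi z * deriv g (psi z) = 1"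
      "\<And>z. z \<in> ball 0 r \<Longrightarrow> g (psi z) = z"
    using holomorphic_has_inverse[OF psihr _ r(4)] by auto
  have psi0: "psi 0 = 0" by (simp add: psi_def)
  then have "0 \<in> psi ` ball 0 r" using r(1) by force
  then obtain s where s: "s > 0" "ball 0 s \<subseteq> psi ` ball 0 r"
    using r(3) open_contains_ball by blast
  have inv: "g z \<in> ball 0 r" "psi (g z) = z" if "z \<in> ball 0 s" for z
  proof -
    from that s obtain u where "u \<in> ball 0 r" "z = psi u" by auto
    then show "g z \<in> ball 0 r" "psi (g z) = z" using g(3) by auto
  qed
  define V where "V z = g (sdir * z)" for z
  have inball: "sdir * z \<in> ball 0 s" if "z \<in> ball 0 s" for z
    using that by (simp add: norm_mult)
  have Vhol: "V holomorphic_on ball 0 s"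
  proof -
    have "(g \<circ> (\<lambda>z. sdir * z)) holomorphic_on ball 0 s"
      by (rule holomorphic_on_compose_gen[OF _ holomorphic_on_subset[OF g(1) s(2)]])
         (auto intro: holomorphic_intros simp: norm_mult)
    then show ?thesis by (simp add: V_def[abs_def] comp_def)
  qed
  have V0: "V 0 = 0" using g(3)[of 0] psi0 r(1) by (simp add: V_def)
  have dV: "deriv V 0 = sdir"
  proof -
    have "deriv g 0 = 1" using g(2)[of 0] dpsi psi0 r(1) by simp
    moreover have "(g has_field_derivative deriv g 0) (at 0)"
      by (rule holomorphic_derivI[OF holomorphic_on_subset[OF g(1) s(2)]]) (use s in auto)
    ultimately have "(g has_field_derivative 1) (at (sdir * 0))" by simp
    then have "(V has_field_derivative 1 * sdir) (at 0)"
      unfolding V_def[abs_def] by (rule DERIV_chain2) (auto intro!: derivative_eq_intros)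
    then show ?thesis by (simp add: DERIV_imp_deriv)
  qed
  have VD: "(V has_field_derivative sdir) (at 0)"
    using holomorphic_derivI[OF Vhol, of 0] s dV by simp
  have "((\<lambda>z. (V z - V 0) / (z - 0)) \<longlongrightarrow> sdir) (at 0)"
    using VD by (simp add: has_field_derivative_iff)
  then have "eventually (\<lambda>z. dist ((V z - V 0) / (z - 0)) sdir < 1/10) (at 0)"
    by (rule tendstoD) simp
  then obtain t where t: "t > 0" "\<And>z. z \<noteq> 0 \<Longrightarrow> dist z 0 < t \<Longrightarrow> dist (V z / z) sdir < 1/10"
    by (auto simp: eventually_at V0)
  \<comment> \<open>The bound 1/2, together with the deviation 1/10 from the tangent, gives |V z| <=
    11/20 < 1 on the disc, so that strips around the real axis are never left.\<close>
  define R where "R = min (1/2) (min s t)"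
  have R: "0 < R" "R \<le> 1/2" "R \<le> s" "R \<le> t" using s t by (auto simp: R_def)
  show thesis
  proof (rule that)
    show "0 < R" "R \<le> 1/2" "deriv V 0 = sdir" by fact+
    show "V holomorphic_on ball 0 R" by (rule holomorphic_on_subset[OF Vhol]) (use R in auto)
    show "exp (V z) - 1 - V z = - \<i> * z\<^sup>2 / 2" if "z \<in> ball 0 R" for z
    proof -
      have "psi (V z) = sdir * z" unfolding V_def by (intro inv inball) (use that R in auto)
      then have "(sdir * z)\<^sup>2 = 2 * (exp (V z) - 1 - V z)" using psi2[of "V z"] by simp
      then show ?thesis by (simp add: power_mult_distrib sdir_sq)
    qed
    show "norm (V z - sdir * z) \<le> norm z / 10" if "z \<in> ball 0 R" for z
    proof (cases "z = 0")
      case False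
      have "norm (V z / z - sdir) \<le> 1/10" using t(2)[OF False] that R by (auto simp: dist_norm)
      then have "norm (V z / z - sdir) * norm z \<le> 1/10 * norm z" by (rule mult_right_mono) simp
      moreover have "(V z / z - sdir) * z = V z - sdir * z" using False by (simp add: field_simps)
      ultimately show ?thesis by (simp flip: norm_mult)
    qed (simp add: V0)
    fix v :: "real \<Rightarrow> complex"
    assume v: "v 0 = 0" "(v has_vector_derivative sdir) (at 0)" "\<And>r. exp (v r) - 1 - v r = - \<i> * (of_real r)\<^sup>2 / 2"
    have "(psi has_field_derivative 1) (at (v 0))"
      using holomorphic_derivI[OF psihol, of 0] e dpsi v(1) by simp
    then have pd: "((psi \<circ> v) has_vector_derivative sdir * 1) (at 0)"
      by (rule field_vector_diff_chain_at[OF v(2)])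
    \<comment> \<open>This excludes the minus sign: -\<open>sdir\<close> * x is at distance 2 |x|
      from \<open>sdir\<close> * x, but differentiability at 0 allows only |x| / 2.\<close>
    then obtain d1 where d1: "d1 > 0" "\<And>r. \<bar>r\<bar> < d1 \<Longrightarrow> norm (psi (v r) - sdir * r) \<le> 1/2 * \<bar>r\<bar>"
    proof -
      have "\<exists>d>0. \<forall>y. norm (y - 0) < d \<longrightarrow>
          norm ((psi \<circ> v) y - (psi \<circ> v) 0 - (y - 0) *\<^sub>R (sdir * 1)) \<le> 1/2 * norm (y - 0)"
        using pd[unfolded has_vector_derivative_def has_derivative_at_alt]
        by (elim conjE allE[of _ "1/2"]) auto
      then show ?thesis using that by (auto simp: v(1) psi0 scaleR_conv_of_real mult_ac)
    qed
    have "isCont v 0" using v(2) by (rule has_vector_derivative_continuous)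
    then obtain d2 where d2: "d2 > 0" "\<And>x. \<bar>x\<bar> < d2 \<Longrightarrow> norm (v x) < r"
      using r(1) v(1) unfolding continuous_at_eps_delta by (auto simp: dist_norm)
    show "\<exists>\<delta>>0. \<forall>r. \<bar>r\<bar> < \<delta> \<longrightarrow> v r = V (of_real r)"
    proof (intro exI conjI allI impI)
      show "min R (min d1 d2) > 0" using R d1 d2 by simp
      fix x :: real assume x: "\<bar>x\<bar> < min R (min d1 d2)"
      have "(psi (v x))\<^sup>2 = (sdir * x)\<^sup>2"
        by (simp add: psi2 v(3) power_mult_distrib sdir_sq)
      then have "psi (v x) = sdir * x \<or> psi (v x) = - (sdir * x)" by (simp only: power2_eq_iff)
      moreover have "psi (v x) \<noteq> - (sdir * x)" if "x \<noteq> 0"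
      proof
        assume eq: "psi (v x) = - (sdir * x)"
        have "psi (v x) - sdir * x = (-2) * (sdir * x)" unfolding eq by simp
        then have "norm (psi (v x) - sdir * x) = 2 * \<bar>x\<bar>" by (simp only: norm_mult) simp
        then show False using d1(2)[of x] x that by simp
      qed
      ultimately have 1: "psi (v x) = sdir * x" by (cases "x = 0") auto
      have xs: "of_real x \<in> ball (0::complex) s" using x R by simp
      have "psi (V x) = sdir * x" "V x \<in> ball 0 r"
        unfolding V_def using inv[OF inball[OF xs]] by auto
      moreover have "v x \<in> ball 0 r" using d2(2)[of x] x by simp
      ultimately show "v x = V x" using inj_onD[OF r(4), of "v x" "V x"] 1 by simp
    qed
  qed
qed

text \<open>The function 1/u - e^u / (e^u - 1), written so that it has its right value at u = 0. The
  zeros of \<open>expq\<close> are the nonzero multiples of 2 pi i, whence the strip |Im u| < 2 pi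
  below.\<close>

definition reg_kernel :: "complex \<Rightarrow> complex" where
  "reg_kernel u = expq2 u / expq u - 1"

lemma exp_eq_1_strip:
  assumes "\<bar>Im u\<bar> < 2 * pi" "exp u = 1"
  shows "u = 0"
proof -
  obtain n :: int where n: "Re u = 0" "Im u = of_int (2 * n) * pi"
    using assms(2) by (auto simp: exp_eq_1)
  have "\<bar>of_int n\<bar> * (2 * pi) < 1 * (2 * pi)" using assms(1) unfolding n by (simp add: abs_mult mult_ac)
  then have "\<bar>real_of_int n\<bar> < 1" by (simp only: mult_less_cancel_right) auto
  then have "n = 0" by simp
  then show ?thesis using n by (simp add: complex_eq_iff)
qed

lemma expq_nz: "\<bar>Im u\<bar> < 2 * pi \<Longrightarrow> expq u \<noteq> 0"
  using exp_eq_1_strip[of u] exp_expq[of u] expq_0 by (cases "u = 0") auto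

lemma reg_kernel_eq:
  assumes "\<bar>Im u\<bar> < 2 * pi" "u \<noteq> 0"
  shows "reg_kernel u = 1 / u - exp u / (exp u - 1)"
proof -
  have e: "exp u - 1 \<noteq> 0" using exp_eq_1_strip assms by auto
  have "expq u = (exp u - 1) / u" using exp_expq[of u] assms by (simp add: field_simps)
  moreover have "expq2 u = (exp u - 1 - u) / u\<^sup>2" using exp_expq2[of u] assms by simp
  moreover have "((e - 1 - u) / u\<^sup>2) / ((e - 1) / u) - 1 = 1 / u - e / (e - 1)" if "e - 1 \<noteq> 0" for e
    using that assms(2) by (simp add: divide_simps power2_eq_square) (simp add: algebra_simps)
  ultimately show ?thesis using e by (simp only: reg_kernel_def)
qed

lemma open_strip: "open {u. \<bar>Im u\<bar> < c}"
  by (intro open_Collect_less continuous_intros)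

lemma reg_kernel_holomorphic: "reg_kernel holomorphic_on {u. \<bar>Im u\<bar> < 2 * pi}"
  unfolding reg_kernel_def[abs_def]
  by (intro holomorphic_intros expq_holomorphic expq2_holomorphic) (use expq_nz in auto)

text \<open>A compact rectangle handles |Re u| <= 2; beyond it 1/u is small and e^u / (e^u - 1) is
  close to 1 on the right and to 0 on the left. Since the strip is unbounded to both sides, a shift
  of u by any real ln a costs nothing.\<close>

lemma reg_kernel_bounded: "\<exists>B>0. \<forall>u. \<bar>Im u\<bar> \<le> 1 \<longrightarrow> norm (reg_kernel u) \<le> B"
proof -
  have "compact (cbox (Complex (-2) (-1)) (Complex 2 1))" by (rule compact_cbox)
  moreover have "continuous_on (cbox (Complex (-2) (-1)) (Complex 2 1)) reg_kernel"
    using holomorphic_on_imp_continuous_on[OF reg_kernel_holomorphic]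
    by (rule continuous_on_subset) (use pi_gt3 in \<open>auto simp: in_cbox_complex_iff\<close>)
  ultimately have "bounded (reg_kernel ` cbox (Complex (-2) (-1)) (Complex 2 1))"
    by (intro compact_imp_bounded compact_continuous_image) auto
  then obtain B where B: "B > 0" "\<And>u. u \<in> cbox (Complex (-2) (-1)) (Complex 2 1) \<Longrightarrow> norm (reg_kernel u) \<le> B"
    by (auto simp: bounded_pos)
  have "norm (reg_kernel u) \<le> B + 3" if u: "\<bar>Im u\<bar> \<le> 1" for u
  proof (cases "\<bar>Re u\<bar> \<le> 2")
    case True
    then have "norm (reg_kernel u) \<le> B" using u by (intro B(2)) (auto simp: in_cbox_complex_iff)
    then show ?thesis by simp
  next
    case False
    have e2: "exp (2::real) \<ge> 3" using exp_ge_add_one_self[of 2] by simp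
    have n2: "norm u \<ge> 2" using False abs_Re_le_cmod[of u] by linarith
    then have "u \<noteq> 0" by auto
    then have eq: "reg_kernel u = 1 / u - exp u / (exp u - 1)" using u pi_gt3 by (intro reg_kernel_eq) auto
    have "norm (exp u / (exp u - 1)) \<le> 2"
    proof (cases "Re u > 2")
      case True
      have "exp (2::real) \<le> exp (Re u)" using True by simp
      then have "exp (Re u) \<ge> 3" using e2 by linarith
      moreover have "norm (exp u - 1) \<ge> exp (Re u) - 1"
        using norm_triangle_ineq2[of "exp u" 1] by simp
      ultimately show ?thesis by (simp add: norm_divide divide_le_eq)
    next
      case nf: False
      then have "Re u < -2" using False by linarith
      then have "exp 2 * exp (Re u) \<le> 1" by (simp flip: exp_add)
      moreover have "3 * exp (Re u) \<le> exp 2 * exp (Re u)" using e2 by (intro mult_right_mono) auto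
      ultimately have "3 * exp (Re u) \<le> 1" by linarith
      moreover have "norm (exp u - 1) \<ge> 1 - exp (Re u)"
        using norm_triangle_ineq2[of 1 "exp u"] by (simp add: norm_minus_commute)
      ultimately show ?thesis by (simp add: norm_divide divide_le_eq)
    qed
    moreover have "norm (1 / u) \<le> 1" using n2 by (simp add: norm_divide divide_le_eq)
    ultimately have "norm (reg_kernel u) \<le> 1 + 2"
      unfolding eq by (intro order_trans[OF norm_triangle_ineq4] add_mono)
    then show ?thesis using B(1) by simp
  qed
  then show ?thesis using B(1) by (intro exI[of _ "B + 3"]) auto
qed

text \<open>What \<open>saddle_inverse\<close> provides, detached from its construction. All
  conditions survive a smaller \<open>R\<close>; this is used to keep V z away from a nearby ln
  a.\<close>

locale local_saddle =
  fixes V :: "complex \<Rightarrow> complex" and R :: real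
  assumes R_pos: "0 < R" and R_le: "R \<le> 1/2" and V_hol: "V holomorphic_on ball 0 R"
    and V_deriv_0: "deriv V 0 = sdir"
    and V_phase: "z \<in> ball 0 R \<Longrightarrow> exp (V z) - 1 - V z = - \<i> * z\<^sup>2 / 2"
    and V_near: "z \<in> ball 0 R \<Longrightarrow> norm (V z - sdir * z) \<le> norm z / 10"
begin

lemma V_0 [simp]: "V 0 = 0"
  using V_near[of 0] R_pos by simp

lemma V_upper: "z \<in> ball 0 R \<Longrightarrow> norm (V z) \<le> 11/10 * norm z"
  using V_near[of z] norm_triangle_ineq2[of "V z" "sdir * z"] by (simp add: norm_mult)

lemma V_lower: "z \<in> ball 0 R \<Longrightarrow> 9/10 * norm z \<le> norm (V z)"
  using V_near[of z] norm_triangle_ineq3[of "V z" "sdir * z"] by (simp add: norm_mult)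

lemma V_less_1: "z \<in> ball 0 R \<Longrightarrow> norm (V z) < 1"
  using V_upper[of z] R_le by simp

lemma V_has_deriv: "z \<in> ball 0 R \<Longrightarrow> (V has_field_derivative deriv V z) (at z)"
  by (rule holomorphic_derivI[OF V_hol]) auto

lemma deriv_V_hol: "deriv V holomorphic_on ball 0 R"
  by (rule holomorphic_deriv[OF V_hol]) auto

text \<open>The phase equation differentiated. It is the change of variables between r and v: it
  turns r / (e^v - 1) into a multiple of dv/dr.\<close>

lemma V_ode:
  assumes "z \<in> ball 0 R"
  shows "deriv V z * (exp (V z) - 1) = - \<i> * z"
proof -
  have "((\<lambda>z. exp (V z) - 1 - V z) has_field_derivative (exp (V z) * deriv V z - 0 - deriv V z)) (at z)"
    by (rule derivative_eq_intros V_has_deriv assms refl)+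
  moreover have "((\<lambda>z. - \<i> * z\<^sup>2 / 2) has_field_derivative (- \<i> * z)) (at z)"
    by (auto intro!: derivative_eq_intros)
  then have "((\<lambda>z. exp (V z) - 1 - V z) has_field_derivative (- \<i> * z)) (at z)"
    by (rule has_field_derivative_transform_within_open[OF _ open_ball assms]) (simp add: V_phase)
  ultimately have "exp (V z) * deriv V z - 0 - deriv V z = - \<i> * z" by (rule DERIV_unique)
  then show ?thesis by (simp add: algebra_simps)
qed

lemma V_real:
  assumes "\<bar>r\<bar> < R"
  shows "\<bar>Im (V (of_real r))\<bar> \<ge> \<bar>r\<bar> / 2"
    "r > 0 \<Longrightarrow> Im (V (of_real r)) \<ge> r / 2" "r > 0 \<Longrightarrow> Re (V (of_real r)) \<le> - r / 2"
    "r < 0 \<Longrightarrow> Im (V (of_real r)) \<le> r / 2" "r < 0 \<Longrightarrow> Re (V (of_real r)) \<ge> - r / 2"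
proof -
  have n: "norm (V r - sdir * r) \<le> \<bar>r\<bar> / 10" using V_near[of r] assms by simp
  have I: "\<bar>Im (V r) - sqrt 2 / 2 * r\<bar> \<le> \<bar>r\<bar> / 10"
    using n abs_Im_le_cmod[of "V r - sdir * r"] by (simp add: sdir_Re_Im)
  have R: "\<bar>Re (V r) + sqrt 2 / 2 * r\<bar> \<le> \<bar>r\<bar> / 10"
    using n abs_Re_le_cmod[of "V r - sdir * r"] by (simp add: sdir_Re_Im)
  \<comment> \<open>The tangent contributes at least 7/10 |r| to each coordinate and the deviation
    takes away at most |r| / 10, which leaves more than |r| / 2.\<close>
  have s: "sqrt 2 / 2 \<ge> (7/10 :: real)" using real_le_rsqrt[of "7/5" 2] by (simp add: power2_eq_square)
  have p: "sqrt 2 / 2 * r \<ge> 7/10 * r" if "r > 0" using that by (intro mult_right_mono s) auto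
  have m: "sqrt 2 / 2 * r \<le> 7/10 * r" if "r < 0" using that by (intro mult_right_mono_neg s) auto
  show "r > 0 \<Longrightarrow> Im (V (of_real r)) \<ge> r / 2" "r > 0 \<Longrightarrow> Re (V (of_real r)) \<le> - r / 2"
    "r < 0 \<Longrightarrow> Im (V (of_real r)) \<le> r / 2" "r < 0 \<Longrightarrow> Re (V (of_real r)) \<ge> - r / 2"
    using I R p m by linarith+
  then show "\<bar>Im (V (of_real r))\<bar> \<ge> \<bar>r\<bar> / 2" by (cases r "0::real" rule: linorder_cases) simp_all
qed

text \<open>The curve leaves the real axis at a definite angle, so the distance D from a real b
  controls both |r| and |b|: the imaginary part gives |r| <= 2 D, and then |b| <= |V| + D <= (22/10
  + 1) D. This holds on the whole arc, however small b is.\<close>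

lemma V_minus_real:
  assumes "\<bar>r\<bar> < R"
  shows "\<bar>r\<bar> / 2 \<le> norm (V (of_real r) - of_real b)" "\<bar>b\<bar> / 5 \<le> norm (V (of_real r) - of_real b)"
proof -
  show 1: "\<bar>r\<bar> / 2 \<le> norm (V (of_real r) - of_real b)"
    using V_real(1)[OF assms] abs_Im_le_cmod[of "V r - b"] by simp
  have 2: "norm (V r) \<le> 11/10 * \<bar>r\<bar>" using V_upper[of r] assms by simp
  have 3: "\<bar>b\<bar> - norm (V r) \<le> norm (V (of_real r) - of_real b)"
    using norm_triangle_ineq3[of "V r" "of_real b"] by simp
  show "\<bar>b\<bar> / 5 \<le> norm (V (of_real r) - of_real b)" using 1 2 3 by linarith
qed

lemma deriv_V_bounded:
  assumes "r < R"
  shows "\<exists>B>0. \<forall>z\<in>cball 0 r. norm (deriv V z) \<le> B"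
proof -
  have "continuous_on (cball 0 r) (deriv V)"
    by (rule continuous_on_subset[OF holomorphic_on_imp_continuous_on[OF deriv_V_hol]]) (use assms in auto)
  then have "bounded (deriv V ` cball 0 r)"
    by (intro compact_imp_bounded compact_continuous_image) auto
  then show ?thesis by (auto simp: bounded_pos)
qed

text \<open>Repeated differentiation of \<open>V_ode\<close>. At 0 the highest derivative is
  multiplied by e^V - 1 = 0, so one differentiation more than the order sought is required:
  \<open>e2\<close> determines the second derivative and \<open>e3\<close> the third.\<close>

lemma V_derivs_0: "deriv (deriv V) 0 = - sdir\<^sup>2 / 3" "deriv (deriv (deriv V)) 0 = sdir ^ 3 / 6"
proof -
  define W0 W1 W2 W3 where W: "W0 = deriv V" "W1 = deriv W0" "W2 = deriv W1" "W3 = deriv W2"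
  have h: "W0 holomorphic_on ball 0 R" "W1 holomorphic_on ball 0 R" "W2 holomorphic_on ball 0 R"
    unfolding W by (intro holomorphic_deriv V_hol open_ball)+
  have d: "(W0 has_field_derivative W1 z) (at z)" "(W1 has_field_derivative W2 z) (at z)"
    "(W2 has_field_derivative W3 z) (at z)" "(V has_field_derivative W0 z) (at z)" if "z \<in> ball 0 R" for z
    unfolding W(2,3,4) using that holomorphic_derivI[OF h(1) open_ball that]
      holomorphic_derivI[OF h(2) open_ball that] holomorphic_derivI[OF h(3) open_ball that] V_has_deriv[OF that]
    by (simp_all only: W(1) W(2,3,4))
  have step: "g' z = h' z" if "\<And>z. z \<in> ball 0 R \<Longrightarrow> g z = h z" "\<And>z. z \<in> ball 0 R \<Longrightarrow> (g has_field_derivative g' z) (at z)"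
    "\<And>z. z \<in> ball 0 R \<Longrightarrow> (h has_field_derivative h' z) (at z)" "z \<in> ball 0 R" for g h g' h' :: "complex \<Rightarrow> complex" and z
    using DERIV_unique[OF has_field_derivative_transform_within_open[OF that(2)[OF that(4)] open_ball that(4) that(1)] that(3)[OF that(4)]] .
  have e0: "W0 z * (exp (V z) - 1) = - \<i> * z" if "z \<in> ball 0 R" for z
    using V_ode[OF that] by (simp only: W(1))
  have e1: "W1 z * (exp (V z) - 1) + W0 z ^ 2 * exp (V z) = - \<i>" if "z \<in> ball 0 R" for z
  proof -
    have "((\<lambda>z. W0 z * (exp (V z) - 1)) has_field_derivative (W1 z * (exp (V z) - 1) + W0 z ^ 2 * exp (V z))) (at z)"
      if "z \<in> ball 0 R" for z
      by (rule derivative_eq_intros d that refl)+ (simp add: power2_eq_square algebra_simps)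
    moreover have "((\<lambda>z. - \<i> * z) has_field_derivative - \<i>) (at z)" for z
      by (rule derivative_eq_intros refl)+ simp
    ultimately show ?thesis using that by - (rule step, erule e0, assumption+)
  qed
  have e2: "W2 z * (exp (V z) - 1) + 3 * W0 z * W1 z * exp (V z) + W0 z ^ 3 * exp (V z) = 0" if "z \<in> ball 0 R" for z
  proof -
    have "((\<lambda>z. W1 z * (exp (V z) - 1) + W0 z ^ 2 * exp (V z)) has_field_derivative
        (W2 z * (exp (V z) - 1) + 3 * W0 z * W1 z * exp (V z) + W0 z ^ 3 * exp (V z))) (at z)"
      if "z \<in> ball 0 R" for z
      by (rule derivative_eq_intros d that refl)+ (simp add: power2_eq_square power3_eq_cube algebra_simps)
    moreover have "((\<lambda>z. - \<i>) has_field_derivative 0) (at z)" for z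
      by (rule DERIV_const)
    ultimately show ?thesis using that by - (rule step, erule e1, assumption+)
  qed
  have e3: "W3 z * (exp (V z) - 1) + (4 * W0 z * W2 z + 3 * W1 z ^ 2 + 6 * W0 z ^ 2 * W1 z + W0 z ^ 4) * exp (V z) = 0"
    if "z \<in> ball 0 R" for z
  proof -
    have "((\<lambda>z. W2 z * (exp (V z) - 1) + 3 * W0 z * W1 z * exp (V z) + W0 z ^ 3 * exp (V z)) has_field_derivative
        (W3 z * (exp (V z) - 1) + (4 * W0 z * W2 z + 3 * W1 z ^ 2 + 6 * W0 z ^ 2 * W1 z + W0 z ^ 4) * exp (V z))) (at z)"
      if "z \<in> ball 0 R" for z
      by (rule derivative_eq_intros d that refl)+ (simp add: power2_eq_square power3_eq_cube power4_eq_xxxx algebra_simps)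
    moreover have "((\<lambda>z. 0) has_field_derivative 0) (at z)" for z
      by (rule DERIV_const)
    ultimately show ?thesis using that by - (rule step, erule e2, assumption+)
  qed
  have 0: "(0::complex) \<in> ball 0 R" using R_pos by simp
  have W0: "W0 0 = sdir" by (simp add: W V_deriv_0)
  have "sdir * (3 * W1 0 + sdir\<^sup>2) = 0"
    using e2[OF 0] by (simp add: W0 power2_eq_square power3_eq_cube algebra_simps)
  then have "3 * W1 0 + sdir\<^sup>2 = 0" by (simp only: mult_eq_0_iff sdir_nz simp_thms)
  then have W1: "W1 0 = - sdir\<^sup>2 / 3" by (simp add: eq_neg_iff_add_eq_0 field_simps)
  have "4 * sdir * W2 0 + 3 * (- sdir\<^sup>2 / 3) ^ 2 + 6 * sdir ^ 2 * (- sdir\<^sup>2 / 3) + sdir ^ 4 = 0"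
    using e3[OF 0] by (simp add: W0 W1)
  then have "sdir * (6 * W2 0 - sdir ^ 3) = 0"
    by (simp add: power2_eq_square power3_eq_cube power4_eq_xxxx field_simps)
  then have W2: "W2 0 = sdir ^ 3 / 6" by (simp add: field_simps)
  show "deriv (deriv V) 0 = - sdir\<^sup>2 / 3" "deriv (deriv (deriv V)) 0 = sdir ^ 3 / 6"
    using W1 W2 by (simp_all add: W)
qed

text \<open>Stated for a general \<open>h\<close> since it is applied both to 1/u and to
  \<open>reg_kernel\<close>. The three weights are V''' = \<open>sdir\<close>^3 / 6, 3 V' V'' = -
  \<open>sdir\<close>^3 and V'^3 = \<open>sdir\<close>^3 at 0.\<close>

lemma kernel_deriv2:
  assumes "h holomorphic_on S" "open S" "\<And>z. z \<in> ball 0 R \<Longrightarrow> V z - b \<in> S"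
  shows "(\<lambda>z. deriv V z * h (V z - b)) holomorphic_on ball 0 R"
    and "(deriv ^^ 2) (\<lambda>z. deriv V z * h (V z - b)) 0
       = sdir ^ 3 * (h (- b) / 6 - deriv h (- b) + deriv (deriv h) (- b))"
proof -
  define W0 W1 W2 where W: "W0 = deriv V" "W1 = deriv W0" "W2 = deriv W1"
  define h1 h2 where hh: "h1 = deriv h" "h2 = deriv h1"
  have hol: "W0 holomorphic_on ball 0 R" "W1 holomorphic_on ball 0 R"
    unfolding W by (intro holomorphic_deriv V_hol open_ball)+
  have d: "(W0 has_field_derivative W1 z) (at z)" "(W1 has_field_derivative W2 z) (at z)"
    "(V has_field_derivative W0 z) (at z)" if "z \<in> ball 0 R" for z
    using holomorphic_derivI[OF hol(1) open_ball that]
      holomorphic_derivI[OF hol(2) open_ball that] V_has_deriv[OF that]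
    by (simp_all only: W)
  have hd: "(h has_field_derivative h1 u) (at u)" "(h1 has_field_derivative h2 u) (at u)" if "u \<in> S" for u
    unfolding hh using that assms
    by (auto intro!: holomorphic_derivI[OF _ assms(2)] holomorphic_deriv)
  have dh: "((\<lambda>z. h (V z - b)) has_field_derivative h1 (V z - b) * W0 z) (at z)"
      "((\<lambda>z. h1 (V z - b)) has_field_derivative h2 (V z - b) * W0 z) (at z)" if "z \<in> ball 0 R" for z
    by (rule DERIV_chain2[of _ _ "\<lambda>z. V z - b"], rule hd, use that assms(3) in blast,
        use d(3)[OF that] in \<open>auto intro!: derivative_eq_intros\<close>)+
  have g1: "((\<lambda>z. W0 z * h (V z - b)) has_field_derivative W1 z * h (V z - b) + h1 (V z - b) * W0 z * W0 z) (at z)" if "z \<in> ball 0 R" for z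
    by (rule DERIV_mult[OF d(1) dh(1)]) (use that in auto)
  show "(\<lambda>z. deriv V z * h (V z - b)) holomorphic_on ball 0 R"
    unfolding W(1)[symmetric] holomorphic_on_open[OF open_ball] using g1 by blast
  have 0: "(0::complex) \<in> ball 0 R" using R_pos by simp
  have "((\<lambda>z. W1 z * h (V z - b) + h1 (V z - b) * W0 z * W0 z) has_field_derivative
      (W2 0 * h (V 0 - b) + h1 (V 0 - b) * W0 0 * W1 0 + (((h2 (V 0 - b) * W0 0) * W0 0 + W1 0 * h1 (V 0 - b)) * W0 0 + W1 0 * (h1 (V 0 - b) * W0 0)))) (at 0)"
    by (intro DERIV_add DERIV_mult d dh 0)
  then have "(deriv (\<lambda>z. W0 z * h (V z - b)) has_field_derivative
      (W2 0 * h (V 0 - b) + h1 (V 0 - b) * W0 0 * W1 0 + (((h2 (V 0 - b) * W0 0) * W0 0 + W1 0 * h1 (V 0 - b)) * W0 0 + W1 0 * (h1 (V 0 - b) * W0 0)))) (at 0)"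
    by (rule has_field_derivative_transform_within_open[OF _ open_ball 0])
       (rule DERIV_imp_deriv[OF g1, symmetric])
  then have "(deriv ^^ 2) (\<lambda>z. W0 z * h (V z - b)) 0 = 
      (W2 0 * h (V 0 - b) + h1 (V 0 - b) * W0 0 * W1 0 + (((h2 (V 0 - b) * W0 0) * W0 0 + W1 0 * h1 (V 0 - b)) * W0 0 + W1 0 * (h1 (V 0 - b) * W0 0)))"
    by (simp add: numeral_2_eq_2 DERIV_imp_deriv)
  also have "\<dots> = sdir ^ 3 * (h (- b) / 6 - h1 (- b) + h2 (- b))"
    using V_derivs_0 by (simp add: W V_deriv_0 power2_eq_square power3_eq_cube algebra_simps)
  finally show "(deriv ^^ 2) (\<lambda>z. deriv V z * h (V z - b)) 0
       = sdir ^ 3 * (h (- b) / 6 - deriv h (- b) + deriv (deriv h) (- b))"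
    by (simp add: W(1) hh)
qed

end

section \<open>Deformation of the Hankel contour\<close>

definition osc :: "real \<Rightarrow> complex \<Rightarrow> complex" where
  "osc lam v = exp (- \<i> * of_real lam * (exp v - 1 - v))"

lemma norm_osc: "norm (osc lam v) = exp (lam * (exp (Re v) * sin (Im v) - Im v))"
  by (simp add: osc_def Re_exp Im_exp)

lemma osc_0 [simp]: "osc lam 0 = 1"
  by (simp add: osc_def)

lemma osc_holomorphic: "osc lam holomorphic_on S"
  unfolding osc_def[abs_def] by (intro holomorphic_intros)

text \<open>After subtraction of the residue the quotient is entire and has a primitive on the whole
  plane; what remains of the kernel is a constant over v - b, whose primitive is a
  logarithm.\<close>

lemma osc_regular_primitive:
  "\<exists>E. \<forall>v. (E has_field_derivative (if v = b then deriv (osc lam) b else (osc lam v - osc lam b) / (v - b))) (at v)"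
proof -
  have "(\<lambda>v. if v = b then deriv (osc lam) b else (osc lam v - osc lam b) / (v - b)) holomorphic_on UNIV"
    by (rule pole_lemma_open[OF osc_holomorphic]) auto
  then obtain E where "\<And>v. v \<in> UNIV \<Longrightarrow> (E has_field_derivative (if v = b then deriv (osc lam) b else (osc lam v - osc lam b) / (v - b))) (at v within UNIV)"
    by (rule holomorphic_convex_primitive'[OF convex_UNIV open_UNIV]) blast
  then show ?thesis by (intro exI[of _ E] allI) simp
qed

text \<open>The cut of the logarithm is laid along the real axis from b away from 0, to the right
  for b > 0 and to the left for b < 0. The half planes are thus joined through v = 0, which is where
  both the Hankel contour and the saddle curve cross, so one primitive serves for both.\<close>

lemma osc_primitive:
  fixes b :: real
  assumes "b \<noteq> 0"
  shows "\<exists>F. \<forall>v. Im v \<noteq> 0 \<or> v = 0 \<longrightarrow> (F has_field_derivative osc lam v / (v - of_real b)) (at v)"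
proof -
  obtain E where E: "\<And>v. (E has_field_derivative (if v = of_real b then deriv (osc lam) (of_real b)
      else (osc lam v - osc lam (of_real b)) / (v - of_real b))) (at v)"
    using osc_regular_primitive[of "of_real b" lam] by auto
  define G where "G v = (if b > 0 then Ln (of_real b - v) else Ln (v - of_real b))" for v
  have G: "(G has_field_derivative 1 / (v - of_real b)) (at v)" if "Im v \<noteq> 0 \<or> v = 0" for v
  proof (cases "b > 0")
    case True
    have "of_real b - v \<notin> \<real>\<^sub>\<le>\<^sub>0" using that True by (auto simp: complex_nonpos_Reals_iff)
    then have "((\<lambda>v. Ln (of_real b - v)) has_field_derivative (0 - 1) / (of_real b - v)) (at v)"
      by (auto intro!: derivative_eq_intros simp: divide_simps)
    moreover have "(0 - 1) / (of_real b - v) = 1 / (v - of_real b)"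
      by (metis minus_diff_eq minus_divide_divide diff_0)
    ultimately show ?thesis using True by (simp add: G_def[abs_def])
  next
    case False
    then have "v - of_real b \<notin> \<real>\<^sub>\<le>\<^sub>0" using that assms by (auto simp: complex_nonpos_Reals_iff)
    then have "((\<lambda>v. Ln (v - of_real b)) has_field_derivative 1 / (v - of_real b)) (at v)"
      by (auto intro!: derivative_eq_intros simp: divide_simps)
    then show ?thesis using False by (simp add: G_def[abs_def])
  qed
  have "((\<lambda>v. E v + osc lam (of_real b) * G v) has_field_derivative osc lam v / (v - of_real b)) (at v)"
    if v: "Im v \<noteq> 0 \<or> v = 0" for v
  proof -
    have "v \<noteq> of_real b" using v assms by auto
    then have "(osc lam v - osc lam (of_real b)) / (v - of_real b) + osc lam (of_real b) * (1 / (v - of_real b)) = osc lam v / (v - of_real b)"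
      by (simp add: diff_divide_distrib)
    moreover have "((\<lambda>v. E v + osc lam (of_real b) * G v) has_field_derivative
       (osc lam v - osc lam (of_real b)) / (v - of_real b) + osc lam (of_real b) * (1 / (v - of_real b))) (at v)"
      using E[of v] \<open>v \<noteq> of_real b\<close> by (intro DERIV_add DERIV_cmult G v) simp
    ultimately show ?thesis by simp
  qed
  then show ?thesis by blast
qed

text \<open>For b = 0 the pole sits at the crossing point and the half planes are separated. The
  residue is \<open>osc lam 0\<close> = 1 and \<open>E\<close> is continuous, so the jump of
  \<open>F\<close> at 0 is exactly that of \<open>Ln\<close>.\<close>

lemma osc_primitive_0:
  "\<exists>F E. (\<forall>v. isCont E v) \<and> (\<forall>v. F v = E v + Ln v) \<and>
      (\<forall>v. Im v \<noteq> 0 \<longrightarrow> (F has_field_derivative osc lam v / v) (at v))"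
proof -
  obtain E where E: "\<And>v. (E has_field_derivative (if v = 0 then deriv (osc lam) 0
      else (osc lam v - osc lam 0) / (v - 0))) (at v)"
    using osc_regular_primitive[of 0 lam] by auto
  have "((\<lambda>v. E v + Ln v) has_field_derivative osc lam v / v) (at v)"
    if v: "Im v \<noteq> 0" for v
  proof -
    have "v \<noteq> 0" using v by auto
    then have "(osc lam v - osc lam 0) / v + 1 / v = osc lam v / v"
      by (simp add: diff_divide_distrib)
    moreover have "(Ln has_field_derivative 1 / v) (at v)"
      using v by (auto intro!: derivative_eq_intros simp: complex_nonpos_Reals_iff divide_simps)
    then have "((\<lambda>v. E v + Ln v) has_field_derivative (osc lam v - osc lam 0) / v + 1 / v) (at v)"
      using E[of v] \<open>v \<noteq> 0\<close> by (intro DERIV_add) simp_all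
    ultimately show ?thesis by simp
  qed
  moreover have "isCont E v" for v by (rule DERIV_isCont[OF E])
  ultimately show ?thesis by (intro exI[of _ "\<lambda>v. E v + Ln v"] exI[of _ E]) simp
qed

lemma set_integrable_exp_bound:
  fixes f :: "real \<Rightarrow> complex"
  assumes "c > 0" "continuous_on {a..} f" "\<And>r. r \<ge> a \<Longrightarrow> norm (f r) \<le> C * exp (- c * r)"
  shows "set_integrable lborel {a..} f"
proof -
  have "(\<lambda>r. C * exp (- c * r)) absolutely_integrable_on {a..}"
  proof (rule nonnegative_absolutely_integrable_1)
    show "(\<lambda>r. C * exp (- c * r)) integrable_on {a..}"
      by (rule has_integral_integrable[OF has_integral_mult_right[OF has_integral_exp_minus_to_infinity[OF assms(1)]]])
    show "\<And>r. r \<in> {a..} \<Longrightarrow> 0 \<le> C * exp (- c * r)"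
      using assms(3) by (metis atLeast_iff norm_ge_zero order_trans)
  qed
  then have "set_integrable lborel {a..} (\<lambda>r. C * exp (- c * r))"
    unfolding set_integrable_def by (subst (asm) integrable_completion) auto
  moreover have "set_borel_measurable lborel {a..} f"
    unfolding set_borel_measurable_def
    using borel_measurable_continuous_on_indicator[OF _ assms(2)] by simp
  ultimately show ?thesis
    unfolding set_integrable_def set_borel_measurable_def
    by (rule Bochner_Integration.integrable_bound)
       (use assms(3) in \<open>auto simp: indicator_def intro!: AE_I2 order_trans[OF _ abs_ge_self]\<close>)
qed

lemma ray_limit:
  fixes f H :: "real \<Rightarrow> complex"
  assumes "c > 0" "continuous_on {a..} f" "\<And>r. r \<ge> a \<Longrightarrow> norm (f r) \<le> C * exp (- c * r)"
    and "\<And>r. r \<ge> a \<Longrightarrow> (H has_vector_derivative f r) (at r)"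
  shows "((\<lambda>R. H R - H a) \<longlongrightarrow> (LINT r:{a<..}|lborel. f r)) at_top"
proof -
  have si: "set_integrable lborel {a..} f" by (rule set_integrable_exp_bound[OF assms(1-3)])
  have "((\<lambda>R. LINT r:{a..R}|lborel. f r) \<longlongrightarrow> (LINT r:{a..}|lborel. f r)) at_top"
    by (rule tendsto_set_lebesgue_integral_at_top[OF _ si]) simp
  moreover have "eventually (\<lambda>R. (LINT r:{a..R}|lborel. f r) = H R - H a) at_top"
    using eventually_ge_at_top[of a]
  proof eventually_elim
    case (elim R)
    show ?case unfolding set_lebesgue_integral_def
    proof (rule integral_FTC_Icc[OF elim])
      show "continuous_on {a..R} f" by (rule continuous_on_subset[OF assms(2)]) auto
    qed (rule has_vector_derivative_at_within[OF assms(4)])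
  qed
  moreover have "(LINT r:{a..}|lborel. f r) = (LINT r:{a<..}|lborel. f r)"
    unfolding set_lebesgue_integral_def
    by (rule integral_discrete_difference[of "{a}"]) (auto simp: indicator_def)
  ultimately show ?thesis by (simp add: tendsto_cong)
qed

text \<open>Replaces the estimation of a path integral: the increment of a primitive along a segment
  is bounded by the increment of an explicit antiderivative of a majorant.\<close>

lemma line_bound:
  fixes F :: "complex \<Rightarrow> complex" and p :: "real \<Rightarrow> complex"
  assumes "a \<le> b"
    and "\<And>t. t \<in> {a..b} \<Longrightarrow> (F has_field_derivative f (p t)) (at (p t))"
    and "\<And>t. t \<in> {a..b} \<Longrightarrow> (p has_vector_derivative d) (at t)"
    and "\<And>t. t \<in> {a..b} \<Longrightarrow> (\<phi> has_real_derivative \<phi>' t) (at t)"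
    and "\<And>t. t \<in> {a..b} \<Longrightarrow> norm (d * f (p t)) \<le> \<phi>' t"
  shows "norm (F (p b) - F (p a)) \<le> \<phi> b - \<phi> a"
proof (cases "a = b")
  case False
  have D: "((\<lambda>t. F (p t)) has_vector_derivative d * f (p t)) (at t)" if "t \<in> {a..b}" for t
    using field_vector_diff_chain_at[OF assms(3)[OF that] assms(2)[OF that]] by (simp add: comp_def)
  show ?thesis
  proof (rule differentiable_bound_general[where f = "\<lambda>t. F (p t)" and f' = "\<lambda>t. d * f (p t)" and \<phi>' = \<phi>'])
    show "a < b" using assms(1) False by simp
    show "continuous_on {a..b} (\<lambda>t. F (p t))"
      using D by (intro continuous_at_imp_continuous_on ballI has_vector_derivative_continuous)
    show "continuous_on {a..b} \<phi>"
      using assms(4) by (intro continuous_at_imp_continuous_on ballI DERIV_isCont)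
  qed (use D assms(4,5) in \<open>auto simp: has_real_derivative_iff_has_vector_derivative\<close>)
qed (use assms in simp)

lemma vertical_line: "((\<lambda>t. Complex x t) has_vector_derivative \<i>) (at t)"
  and horizontal_line: "((\<lambda>t. Complex t y) has_vector_derivative 1) (at t)"
proof -
  have "((\<lambda>t. of_real x + of_real t * \<i>) has_vector_derivative \<i>) (at t)"
    "((\<lambda>t. of_real t + of_real y * \<i>) has_vector_derivative 1) (at t)"
    by (auto intro!: derivative_eq_intros has_vector_derivative_real_field)
  moreover have "(\<lambda>t. of_real x + of_real t * \<i>) = (\<lambda>t. Complex x t)"
    "(\<lambda>t. of_real t + of_real y * \<i>) = (\<lambda>t. Complex t y)"
    by (simp_all add: fun_eq_iff complex_eq_iff)
  ultimately show "((\<lambda>t. Complex x t) has_vector_derivative \<i>) (at t)"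
    "((\<lambda>t. Complex t y) has_vector_derivative 1) (at t)" by simp_all
qed

lemma Im_le_norm_diff: "\<bar>Im v\<bar> \<le> norm (v - of_real b)"
  using abs_Im_le_cmod[of "v - of_real b"] by simp

text \<open>The pole is real, so its distance from v is at least |Im v| whatever b is. This is the
  source of uniformity in a for the deformation.\<close>

lemma norm_kernel_le:
  assumes "lam * (exp (Re v) * sin (Im v) - Im v) \<le> m" "0 < k" "k \<le> \<bar>Im v\<bar>"
  shows "norm (osc lam v / (v - of_real b)) \<le> exp m / k"
  unfolding norm_divide norm_osc
  using assms Im_le_norm_diff[of v b] by (intro frac_le) auto

text \<open>The path goes up from \<open>x0 + i y0\<close> to height 3 pi / 2 and then to the right.
  On the vertical segment \<open>x0\<close> < 0 and sin t <= t keep e^x sin t - t below -(1 - e^x)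
  y0; at height 3 pi / 2 the sine is -1, so the integrand even decays doubly exponentially to the
  right. Hence the bound does not depend on \<open>X\<close>.\<close>

lemma upper_path_bound:
  assumes "x0 < 0" "0 < y0" "y0 \<le> 3 * pi / 2"
  shows "\<exists>C\<ge>0. \<exists>c>0. \<forall>lam\<ge>1. \<forall>b F. \<forall>X\<ge>x0.
    (\<forall>v. Im v \<noteq> 0 \<longrightarrow> (F has_field_derivative osc lam v / (v - of_real b)) (at v)) \<longrightarrow>
    norm (F (Complex X (3 * pi / 2)) - F (Complex x0 y0)) \<le> C * exp (- c * lam)"
proof -
  define c0 where "c0 = (1 - exp x0) * y0"
  have c0: "c0 > 0" using assms by (simp add: c0_def)
  define C where "C = (3 * pi / 2 - y0) / y0 + exp (- x0)"
  \<comment> \<open>\<open>c0\<close> is the decay rate on the vertical segment; 4 < 3 pi / 2 is one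
    for the horizontal segment.\<close>
  define c where "c = min c0 4"
  have main: "norm (F (Complex X (3 * pi / 2)) - F (Complex x0 y0)) \<le> C * exp (- c * lam)"
    if lam: "lam \<ge> 1" and X: "X \<ge> x0"
      and F: "\<forall>v. Im v \<noteq> 0 \<longrightarrow> (F has_field_derivative osc lam v / (v - of_real b)) (at v)" for lam b F X
  proof -
    have "norm (F (Complex x0 (3 * pi / 2)) - F (Complex x0 y0)) \<le>
        exp (- c0 * lam) / y0 * (3 * pi / 2) - exp (- c0 * lam) / y0 * y0"
    proof (rule line_bound[where d = \<i> and f = "\<lambda>v. osc lam v / (v - of_real b)" and p = "Complex x0" and a = y0 and b = "3 * pi / 2"
        and \<phi> = "\<lambda>t. exp (- c0 * lam) / y0 * t" and \<phi>' = "\<lambda>t. exp (- c0 * lam) / y0"])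
      fix t assume t: "t \<in> {y0..3 * pi / 2}"
      have t0: "t > 0" using t assms by auto
      show "(F has_field_derivative osc lam (Complex x0 t) / (Complex x0 t - of_real b)) (at (Complex x0 t))"
        using F t0 by auto
      have "exp x0 * sin t \<le> exp x0 * t" using sin_x_le_x[of t] t0 by simp
      moreover have "(1 - exp x0) * y0 \<le> (1 - exp x0) * t" using t assms by (intro mult_left_mono) auto
      ultimately have "exp x0 * sin t - t \<le> - c0" unfolding c0_def left_diff_distrib by linarith
      then have "lam * (exp x0 * sin t - t) \<le> lam * (- c0)" using lam by (intro mult_left_mono) auto
      then show "norm (\<i> * (osc lam (Complex x0 t) / (Complex x0 t - of_real b))) \<le> exp (- c0 * lam) / y0"
        unfolding norm_mult norm_ii mult_1 using t assms by (intro norm_kernel_le) (auto simp: mult_ac)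
    qed (use assms vertical_line in \<open>auto intro!: derivative_eq_intros\<close>)
    also have "\<dots> = (3 * pi / 2 - y0) / y0 * exp (- c0 * lam)" by (simp add: field_simps)
    also have "\<dots> \<le> (3 * pi / 2 - y0) / y0 * exp (- c * lam)"
      using assms lam by (intro mult_left_mono) (auto simp: c_def)
    finally have 1: "norm (F (Complex x0 (3 * pi / 2)) - F (Complex x0 y0)) \<le> (3 * pi / 2 - y0) / y0 * exp (- c * lam)" .
    have sin3: "sin (3 * pi / 2) = -1"
      using sin_3over2_pi by simp
    have "norm (F (Complex X (3 * pi / 2)) - F (Complex x0 (3 * pi / 2))) \<le>
        - exp (- 4 * lam) * exp (- X) - (- exp (- 4 * lam) * exp (- x0))"
    proof (rule line_bound[where d = 1 and f = "\<lambda>v. osc lam v / (v - of_real b)" and p = "\<lambda>t. Complex t (3 * pi / 2)" and a = x0 and b = X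
        and \<phi> = "\<lambda>t. - exp (- 4 * lam) * exp (- t)" and \<phi>' = "\<lambda>t. exp (- 4 * lam) * exp (- t)"])
      fix t assume t: "t \<in> {x0..X}"
      show "(F has_field_derivative osc lam (Complex t (3 * pi / 2)) / (Complex t (3 * pi / 2) - of_real b)) (at (Complex t (3 * pi / 2)))"
        using F by simp
      have "1 * exp t \<le> lam * exp t" using lam by (intro mult_right_mono) auto
      then have "t \<le> lam * exp t" using exp_ge_add_one_self[of t] by linarith
      moreover have "4 * lam \<le> (3 * pi / 2) * lam" using pi_gt3 lam by (intro mult_right_mono) auto
      ultimately have "lam * (exp t * (-1) - 3 * pi / 2) \<le> - 4 * lam + - t" by (simp add: algebra_simps)
      then have "norm (osc lam (Complex t (3 * pi / 2)) / (Complex t (3 * pi / 2) - of_real b)) \<le> exp (- 4 * lam + - t) / 1"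
        using pi_gt3 by (intro norm_kernel_le) (auto simp: sin3)
      then show "norm (1 * (osc lam (Complex t (3 * pi / 2)) / (Complex t (3 * pi / 2) - of_real b))) \<le> exp (- 4 * lam) * exp (- t)"
        by (simp add: exp_add[symmetric] del: exp_add)
    qed (use X horizontal_line in \<open>auto intro!: derivative_eq_intros\<close>)
    also have "\<dots> \<le> exp (- 4 * lam) * exp (- x0)" by simp
    also have "\<dots> \<le> exp (- c * lam) * exp (- x0)" using lam by (intro mult_right_mono) (auto simp: c_def)
    finally have "norm (F (Complex X (3 * pi / 2)) - F (Complex x0 (3 * pi / 2))) \<le> exp (- c * lam) * exp (- x0)" .
    with 1 have "norm (F (Complex X (3 * pi / 2)) - F (Complex x0 y0)) \<le>
      (3 * pi / 2 - y0) / y0 * exp (- c * lam) + exp (- c * lam) * exp (- x0)"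
      by (metis add_mono add.commute norm_diff_triangle_le)
    then show ?thesis by (simp add: C_def algebra_simps)
  qed
  have C: "C \<ge> 0" "c > 0" using assms c0 by (auto simp: C_def c_def)
  show ?thesis
    by (rule exI[of _ C], intro conjI exI[of _ c] allI impI C, rule main, assumption+)
qed

text \<open>The end point lies in a valley of the exponent by the last assumption. To the right of
  it, at the same height, e^x sin y falls because sin y < 0, by at least |y1| per unit, which makes
  the horizontal segment integrable; the final descent to height -pi / 2 is taken far to the right,
  where e^x outweighs everything else.\<close>

lemma lower_path_bound:
  assumes "0 < x1" "y1 < 0" "- pi / 2 < y1" "exp x1 * sin y1 - y1 < 0"
  shows "\<exists>C\<ge>0. \<exists>c>0. \<exists>X0. \<forall>lam\<ge>1. \<forall>b F. \<forall>X\<ge>X0.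
    (\<forall>v. Im v \<noteq> 0 \<longrightarrow> (F has_field_derivative osc lam v / (v - of_real b)) (at v)) \<longrightarrow>
    norm (F (Complex X (- pi / 2)) - F (Complex x1 y1)) \<le> C * exp (- c * lam)"
proof -
  define k where "k = - (exp x1 * sin y1 - y1)"
  have k: "k > 0" using assms by (simp add: k_def)
  define s where "s = - sin y1"
  have s: "s > 0" using assms sin_gt_zero[of "- y1"] by (simp add: s_def)
  have ks: "exp x1 * s = k + - y1" by (simp add: k_def s_def)
  \<comment> \<open>From e^X >= X >= (pi / 2 + k) / s follows e^X sin t - t <= -e^X s + pi / 2 <= -k
    on the vertical segment.\<close>
  define X0 where "X0 = max x1 ((pi / 2 + k) / s)"
  define C where "C = 1 / y1\<^sup>2 + pi / 2 / - y1"
  have main: "norm (F (Complex X (- pi / 2)) - F (Complex x1 y1)) \<le> C * exp (- k * lam)"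
    if lam: "lam \<ge> 1" and X: "X \<ge> X0"
      and F: "\<forall>v. Im v \<noteq> 0 \<longrightarrow> (F has_field_derivative osc lam v / (v - of_real b)) (at v)" for lam b F X
  proof -
    have X1: "x1 \<le> X" using X by (simp add: X0_def)
    let ?K = "exp (- k * lam)"
    have "norm (F (Complex X y1) - F (Complex x1 y1)) \<le>
        - (1 / y1\<^sup>2) * ?K * exp (y1 * (X - x1)) - (- (1 / y1\<^sup>2) * ?K * exp (y1 * (x1 - x1)))"
    proof (rule line_bound[where d = 1 and f = "\<lambda>v. osc lam v / (v - of_real b)" and p = "\<lambda>t. Complex t y1" and a = x1 and b = X
        and \<phi> = "\<lambda>t. - (1 / y1\<^sup>2) * ?K * exp (y1 * (t - x1))" and \<phi>' = "\<lambda>t. ?K * exp (y1 * (t - x1)) / - y1"])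
      fix t assume t: "t \<in> {x1..X}"
      show "(F has_field_derivative osc lam (Complex t y1) / (Complex t y1 - of_real b)) (at (Complex t y1))"
        using F assms by simp
      have "exp x1 * s * (1 + (t - x1)) \<le> exp x1 * s * exp (t - x1)"
        using s by (intro mult_left_mono exp_ge_add_one_self) auto
      also have "\<dots> = exp t * s" by (simp add: exp_diff)
      finally have "exp x1 * s + exp x1 * s * (t - x1) \<le> exp t * s" by (simp add: algebra_simps)
      moreover have "- y1 * (t - x1) \<le> exp x1 * s * (t - x1)"
        using t k ks by (intro mult_right_mono) auto
      ultimately have "exp t * sin y1 - y1 \<le> - k + y1 * (t - x1)" using ks by (simp add: s_def)
      then have "lam * (exp t * sin y1 - y1) \<le> lam * (- k + y1 * (t - x1))" using lam by (intro mult_left_mono) auto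
      also have "lam * (y1 * (t - x1)) \<le> 1 * (y1 * (t - x1))"
        using lam t assms by (intro mult_right_mono_neg mult_nonpos_nonneg) auto
      then have "lam * (- k + y1 * (t - x1)) \<le> - k * lam + y1 * (t - x1)" by (simp add: algebra_simps)
      finally have "norm (osc lam (Complex t y1) / (Complex t y1 - of_real b)) \<le> exp (- k * lam + y1 * (t - x1)) / - y1"
        using assms by (intro norm_kernel_le) auto
      then show "norm (1 * (osc lam (Complex t y1) / (Complex t y1 - of_real b))) \<le> ?K * exp (y1 * (t - x1)) / - y1"
        by (simp only: exp_add mult_1)
    qed (use X1 horizontal_line assms in \<open>auto intro!: derivative_eq_intros simp: field_simps power2_eq_square\<close>)
    also have "\<dots> \<le> 1 / y1\<^sup>2 * ?K" by simp
    finally have 1: "norm (F (Complex X y1) - F (Complex x1 y1)) \<le> 1 / y1\<^sup>2 * ?K" .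
    have "norm (F (Complex X y1) - F (Complex X (- pi / 2))) \<le> ?K / - y1 * y1 - ?K / - y1 * (- pi / 2)"
    proof (rule line_bound[where d = \<i> and f = "\<lambda>v. osc lam v / (v - of_real b)" and p = "Complex X" and a = "- pi / 2" and b = y1
        and \<phi> = "\<lambda>t. ?K / - y1 * t" and \<phi>' = "\<lambda>t. ?K / - y1"])
      fix t assume t: "t \<in> {- pi / 2..y1}"
      show "(F has_field_derivative osc lam (Complex X t) / (Complex X t - of_real b)) (at (Complex X t))"
        using F assms t by auto
      have "sin t \<le> - s" unfolding s_def using t assms by (subst minus_minus, intro sin_monotone_2pi_le) auto
      then have "exp X * sin t \<le> exp X * (- s)" by (intro mult_left_mono) auto
      moreover have "(pi / 2 + k) / s * s \<le> exp X * s"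
        using X s exp_ge_add_one_self[of X] by (intro mult_right_mono) (auto simp: X0_def simp del: exp_ge_add_one_self)
      then have "pi / 2 + k \<le> exp X * s" using s by simp
      ultimately have "exp X * sin t - t \<le> - k" using t by auto
      then have "lam * (exp X * sin t - t) \<le> lam * (- k)" using lam by (intro mult_left_mono) auto
      then show "norm (\<i> * (osc lam (Complex X t) / (Complex X t - of_real b))) \<le> ?K / - y1"
        unfolding norm_mult norm_ii mult_1 using t assms by (intro norm_kernel_le) (auto simp: mult_ac)
    qed (use assms vertical_line in \<open>auto intro!: derivative_eq_intros\<close>)
    also have "\<dots> \<le> pi / 2 / - y1 * ?K" using assms by (simp add: field_simps zero_le_mult_iff mult_le_0_iff)
    finally have "norm (F (Complex X (- pi / 2)) - F (Complex X y1)) \<le> pi / 2 / - y1 * ?K"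
      by (simp only: norm_minus_commute)
    with 1 have "norm (F (Complex X (- pi / 2)) - F (Complex x1 y1)) \<le> pi / 2 / - y1 * ?K + 1 / y1\<^sup>2 * ?K"
      by (metis norm_diff_triangle_le)
    then show ?thesis by (simp add: C_def algebra_simps)
  qed
  have C: "C \<ge> 0" using assms by (auto simp: C_def intro!: add_nonneg_nonneg divide_nonneg_neg simp del: divide_minus_right)
  show ?thesis
    by (rule exI[of _ C], intro conjI exI[of _ k] exI[of _ X0] allI impI C k, rule main, assumption+)
qed

section \<open>The Hankel integral as a difference of values of a primitive\<close>

definition hankel_const :: "real \<Rightarrow> real \<Rightarrow> complex" where
  "hankel_const a lam = \<i> * exp (- (of_real lam * \<i> * (1 + of_real (ln a)))) / of_real pi"

lemma norm_hankel_const [simp]: "norm (hankel_const a lam) = 1 / pi"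
  by (simp add: hankel_const_def norm_mult norm_divide)

text \<open>The substitution w = -i e^v: the denominator of f becomes pi w (-i) (v - ln a), and lam
  S splits into a constant and the exponent of \<open>osc\<close>. The remaining 1 / w is cancelled
  by dw = w dv.\<close>

lemma hankel_kernel_eq:
  "hankel_f a (- \<i> * exp v) (v - \<i> * of_real pi / 2) * exp (of_real lam * hankel_S a (- \<i> * exp v) (v - \<i> * of_real pi / 2))
     = hankel_const a lam / (- \<i> * exp v) * (osc lam v / (v - of_real (ln a)))"
proof -
  have "of_real pi / 2 - \<i> * (v - \<i> * of_real pi / 2 - of_real (ln a)) = - \<i> * (v - of_real (ln a))"
    by (simp add: algebra_simps)
  then have f: "hankel_f a (- \<i> * exp v) (v - \<i> * of_real pi / 2)
      = 1 / (of_real pi * (- \<i> * exp v) * (- \<i> * (v - of_real (ln a))))"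
    by (simp only: hankel_f_def)
  have "of_real lam * hankel_S a (- \<i> * exp v) (v - \<i> * of_real pi / 2)
      = - (of_real lam * \<i> * (1 + of_real (ln a))) + - \<i> * of_real lam * (exp v - 1 - v)"
    by (simp add: hankel_S_def algebra_simps)
  then have e: "exp (of_real lam * hankel_S a (- \<i> * exp v) (v - \<i> * of_real pi / 2))
      = exp (- (of_real lam * \<i> * (1 + of_real (ln a)))) * osc lam v"
    by (simp only: exp_add osc_def)
  show ?thesis unfolding f e hankel_const_def
    by (simp add: divide_simps) (simp add: algebra_simps)
qed

definition hankel_cut_integrand :: "real \<Rightarrow> real \<Rightarrow> real \<Rightarrow> complex \<Rightarrow> complex \<Rightarrow> complex" where
  "hankel_cut_integrand d a lam w l = (if cmod (w + \<i> * of_real a) > d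
     then hankel_f a w l * exp (of_real lam * hankel_S a w l) else 0)"

text \<open>In v the rays are the horizontal lines Im v = y with y = -pi / 2 and y = 3 pi / 2. The
  cut does not act there, as -r is at distance at least r > 1 >= d from -i a. The result is a limit
  since the value of \<open>F\<close> at infinity is not known.\<close>

lemma hankel_ray:
  assumes lam: "lam > 0" and y: "sin y = -1" "cos y = 0" "\<bar>y\<bar> \<ge> 1" and d: "d \<le> 1"
    and F: "\<And>v. Im v \<noteq> 0 \<Longrightarrow> (F has_field_derivative osc lam v / (v - of_real (ln a))) (at v)"
  shows "((\<lambda>R. - hankel_const a lam * (F (Complex (ln R) y) - F (Complex 0 y))) \<longlongrightarrow>
     (LINT r:{1<..}|lborel. hankel_cut_integrand d a lam (- of_real r) (of_real (ln r) + \<i> * of_real (y - pi / 2)))) at_top"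
proof -
  let ?b = "ln a"
  let ?f = "\<lambda>r. of_real (1 / r) * (osc lam (Complex (ln r) y) / (Complex (ln r) y - of_real ?b))"
  have der: "((\<lambda>r. F (Complex (ln r) y)) has_vector_derivative ?f r) (at r)" if "r \<ge> 1" for r
  proof -
    have "((\<lambda>r. Complex (ln r) y) has_vector_derivative of_real (1 / r)) (at r)"
    proof -
      have "((\<lambda>r. of_real (ln r) + \<i> * of_real y) has_vector_derivative of_real (1 / r)) (at r)"
        using that by (auto intro!: derivative_eq_intros has_vector_derivative_of_real simp: has_real_derivative_iff_has_vector_derivative[symmetric])
      moreover have "(\<lambda>r. of_real (ln r) + \<i> * of_real y) = (\<lambda>r. Complex (ln r) y)"
        by (simp add: fun_eq_iff complex_eq_iff)
      ultimately show ?thesis by simp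
    qed
    moreover have "(F has_field_derivative osc lam (Complex (ln r) y) / (Complex (ln r) y - of_real ?b)) (at (Complex (ln r) y))"
      using y by (intro F) auto
    ultimately have "((F \<circ> (\<lambda>r. Complex (ln r) y)) has_vector_derivative ?f r) (at r)"
      by (rule field_vector_diff_chain_at)
    then show ?thesis by (simp only: comp_def)
  qed
  have nz: "Complex x y - of_real ?b \<noteq> 0" for x using y(3) by (auto simp: complex_eq_iff)
  have lim: "((\<lambda>R. F (Complex (ln R) y) - F (Complex (ln 1) y)) \<longlongrightarrow> (LINT r:{1<..}|lborel. ?f r)) at_top"
  proof (rule ray_limit[OF lam])
    have "continuous_on {1..} (\<lambda>r. Complex (ln r) y)"
      unfolding Complex_eq by (intro continuous_intros) auto
    then show "continuous_on {1..} ?f"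
      unfolding osc_def by (intro continuous_intros) (use nz in auto)
    fix r :: real assume r: "r \<ge> 1"
    have "lam * (exp (ln r) * sin y - y) \<le> - (lam * y) + - lam * r"
      using r by (simp add: y algebra_simps)
    then have "norm (osc lam (Complex (ln r) y) / (Complex (ln r) y - of_real ?b)) \<le> exp (- (lam * y) + - lam * r) / 1"
      using y by (intro norm_kernel_le) auto
    moreover have "norm (?f r) \<le> 1 * norm (osc lam (Complex (ln r) y) / (Complex (ln r) y - of_real ?b))"
      unfolding norm_mult using r by (intro mult_right_mono) (auto simp: norm_divide)
    ultimately show "norm (?f r) \<le> exp (- (lam * y)) * exp (- lam * r)"
      by (simp only: exp_add)
  qed (rule der)
  have "(LINT r:{1<..}|lborel. hankel_cut_integrand d a lam (- of_real r) (of_real (ln r) + \<i> * of_real (y - pi / 2)))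
      = (LINT r:{1<..}|lborel. - hankel_const a lam * ?f r)"
  proof (rule set_lebesgue_integral_cong)
    show "\<forall>r. r \<in> {1<..} \<longrightarrow> hankel_cut_integrand d a lam (- of_real r) (of_real (ln r) + \<i> * of_real (y - pi / 2)) = - hankel_const a lam * ?f r"
    proof (intro allI impI)
      fix r :: real assume r: "r \<in> {1<..}"
      let ?v = "Complex (ln r) y"
      have w: "- of_real r = - \<i> * exp ?v"
        using r y by (simp add: complex_eq_iff Re_exp Im_exp)
      have l: "of_real (ln r) + \<i> * of_real (y - pi / 2) = ?v - \<i> * of_real pi / 2"
        by (simp add: complex_eq_iff)
      have "d < r" using r d by auto
      also have "r \<le> cmod (- of_real r + \<i> * of_real a)"
        using abs_Re_le_cmod[of "- of_real r + \<i> * of_real a"] r by auto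
      finally have "hankel_cut_integrand d a lam (- of_real r) (of_real (ln r) + \<i> * of_real (y - pi / 2))
         = hankel_f a (- of_real r) (of_real (ln r) + \<i> * of_real (y - pi / 2)) * exp (of_real lam * hankel_S a (- of_real r) (of_real (ln r) + \<i> * of_real (y - pi / 2)))"
        by (simp add: hankel_cut_integrand_def)
      also have "\<dots> = hankel_const a lam / (- \<i> * exp ?v) * (osc lam ?v / (?v - of_real (ln a)))"
        by (simp only: w l hankel_kernel_eq)
      also have "\<dots> = - hankel_const a lam * ?f r"
        unfolding w[symmetric] using r by simp
      finally show "hankel_cut_integrand d a lam (- of_real r) (of_real (ln r) + \<i> * of_real (y - pi / 2)) = - hankel_const a lam * ?f r" .
    qed
  qed simp
  also have "\<dots> = - hankel_const a lam * (LINT r:{1<..}|lborel. ?f r)"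
    by (rule set_integral_mult_right)
  finally have eq: "(LINT r:{1<..}|lborel. hankel_cut_integrand d a lam (- of_real r) (of_real (ln r) + \<i> * of_real (y - pi / 2))) = \<dots>" .
  show ?thesis
    unfolding eq using tendsto_mult_left[OF lim, of "- hankel_const a lam"] by simp
qed

lemma hankel_circle_integral:
  "contour_integral (part_circlepath 0 1 (- pi) pi) (\<lambda>w. hankel_cut_integrand d a lam w (Ln w))
    = integral {- pi..pi} (\<lambda>\<theta>. if cmod (cis \<theta> + \<i> * of_real a) > d
        then hankel_const a lam * (\<i> * (osc lam (Complex 0 (\<theta> + pi / 2)) / (Complex 0 (\<theta> + pi / 2) - of_real (ln a)))) else 0)"
proof -
  have "contour_integral (part_circlepath 0 1 (- pi) pi) (\<lambda>w. hankel_cut_integrand d a lam w (Ln w))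
    = integral {- pi..pi} (\<lambda>\<theta>. hankel_cut_integrand d a lam (0 + of_real 1 * cis \<theta>) (Ln (0 + of_real 1 * cis \<theta>)) * of_real 1 * \<i> * cis \<theta>)"
    using contour_integral_part_circlepath_eq[of "-pi" pi 0 1] by simp
  also have "\<dots> = integral {- pi..pi} (\<lambda>\<theta>. if cmod (cis \<theta> + \<i> * of_real a) > d
        then hankel_const a lam * (\<i> * (osc lam (Complex 0 (\<theta> + pi / 2)) / (Complex 0 (\<theta> + pi / 2) - of_real (ln a)))) else 0)"
  \<comment> \<open>At \<theta> = -pi the principal value of Ln (-1) is i pi, not the value -i pi of
    the lower edge; a single point does not change the integral.\<close>
  proof (rule integral_spike[of "{-pi}"])
    fix \<theta> assume t: "\<theta> \<in> {- pi..pi} - {- pi}"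
    let ?v = "Complex 0 (\<theta> + pi / 2)"
    have "exp (\<i> * of_real \<theta>) = cis \<theta>" by (simp add: cis_conv_exp)
    then have L: "Ln (cis \<theta>) = \<i> * of_real \<theta>"
      using t Ln_exp[of "\<i> * of_real \<theta>"] by simp
    have l: "\<i> * of_real \<theta> = ?v - \<i> * of_real pi / 2" by (simp add: complex_eq_iff)
    have w: "cis \<theta> = - \<i> * exp ?v" by (simp add: complex_eq_iff Re_exp Im_exp cos_add sin_add)
    have "hankel_f a (cis \<theta>) (\<i> * of_real \<theta>) * exp (of_real lam * hankel_S a (cis \<theta>) (\<i> * of_real \<theta>))
       = hankel_const a lam / cis \<theta> * (osc lam ?v / (?v - of_real (ln a)))"
      unfolding w l hankel_kernel_eq ..
    then show "(if cmod (cis \<theta> + \<i> * of_real a) > d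
        then hankel_const a lam * (\<i> * (osc lam (Complex 0 (\<theta> + pi / 2)) / (Complex 0 (\<theta> + pi / 2) - of_real (ln a)))) else 0)
      = hankel_cut_integrand d a lam (0 + of_real 1 * cis \<theta>) (Ln (0 + of_real 1 * cis \<theta>)) * of_real 1 * \<i> * cis \<theta>"
      by (simp add: hankel_cut_integrand_def L)
  qed simp
  finally show ?thesis .
qed

lemma arc_derivative:
  assumes F: "(F has_field_derivative f (Complex 0 (\<theta> + pi / 2))) (at (Complex 0 (\<theta> + pi / 2)))"
  shows "((\<lambda>\<theta>. F (Complex 0 (\<theta> + pi / 2))) has_vector_derivative \<i> * f (Complex 0 (\<theta> + pi / 2))) (at \<theta> within S)"
proof -
  have "((\<lambda>t. of_real (t + pi / 2) * \<i>) has_vector_derivative \<i>) (at \<theta>)"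
    by (auto intro!: derivative_eq_intros has_vector_derivative_real_field)
  moreover have "(\<lambda>t. of_real (t + pi / 2) * \<i>) = (\<lambda>t. Complex 0 (t + pi / 2))"
    by (simp add: fun_eq_iff complex_eq_iff)
  ultimately have "((\<lambda>t. Complex 0 (t + pi / 2)) has_vector_derivative \<i>) (at \<theta>)" by simp
  from field_vector_diff_chain_at[OF this F] show ?thesis
    by (simp add: comp_def has_vector_derivative_at_within)
qed

lemma hankel_circle:
  assumes "a > 0" "a \<noteq> 1"
    and F: "\<And>v. Im v \<noteq> 0 \<or> v = 0 \<Longrightarrow> (F has_field_derivative osc lam v / (v - of_real (ln a))) (at v)"
  shows "contour_integral (part_circlepath 0 1 (- pi) pi) (\<lambda>w. hankel_cut_integrand 0 a lam w (Ln w))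
    = hankel_const a lam * (F (Complex 0 (3 * pi / 2)) - F (Complex 0 (- pi / 2)))"
proof -
  have nz: "cmod (cis \<theta> + \<i> * of_real a) > 0" for \<theta>
  proof -
    have "cis \<theta> \<noteq> - (\<i> * of_real a)"
    proof
      assume "cis \<theta> = - (\<i> * of_real a)"
      then have "norm (cis \<theta>) = norm (- (\<i> * of_real a :: complex))" by (rule arg_cong)
      then show False using assms by (simp add: norm_mult)
    qed
    then show ?thesis by (simp add: add_eq_0_iff2)
  qed
  have "((\<lambda>\<theta>. \<i> * (osc lam (Complex 0 (\<theta> + pi / 2)) / (Complex 0 (\<theta> + pi / 2) - of_real (ln a))))
      has_integral (F (Complex 0 (pi + pi / 2)) - F (Complex 0 (- pi + pi / 2)))) {- pi..pi}"
  proof (rule fundamental_theorem_of_calculus)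
    fix \<theta> :: real
    have "Im (Complex 0 (\<theta> + pi / 2)) \<noteq> 0 \<or> Complex 0 (\<theta> + pi / 2) = 0" by (simp add: complex_eq_iff)
    then show "((\<lambda>\<theta>. F (Complex 0 (\<theta> + pi / 2))) has_vector_derivative
       \<i> * (osc lam (Complex 0 (\<theta> + pi / 2)) / (Complex 0 (\<theta> + pi / 2) - of_real (ln a)))) (at \<theta> within {- pi..pi})"
      by (intro arc_derivative F)
  qed simp
  from has_integral_mult_right[OF this, of "hankel_const a lam"] show ?thesis
    unfolding hankel_circle_integral using nz by (simp add: integral_unique)
qed

text \<open>For a = 1 the chord satisfies |cis \<theta> + i|^2 = 2 - 2 cos (\<theta> + pi / 2), so
  the cut removes exactly the arc of half angle \<delta> around -i; in v this is a symmetric segment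
  of the imaginary axis around 0. The values of \<open>F\<close> at its ends stay behind.\<close>

lemma hankel_circle_cut:
  assumes d: "0 < d" "d < 1"
    and F: "\<And>v. Im v \<noteq> 0 \<Longrightarrow> (F has_field_derivative osc lam v / v) (at v)"
  defines "\<delta> \<equiv> arccos (1 - d\<^sup>2 / 2)"
  shows "contour_integral (part_circlepath 0 1 (- pi) pi) (\<lambda>w. hankel_cut_integrand d 1 lam w (Ln w))
    = hankel_const 1 lam * (F (Complex 0 (3 * pi / 2)) - F (Complex 0 \<delta>) + (F (Complex 0 (- \<delta>)) - F (Complex 0 (- pi / 2))))"
proof -
  have d2: "d\<^sup>2 < 1" "d\<^sup>2 > 0" using d by (auto simp: power_less_one_iff)
  have cosd: "cos \<delta> = 1 - d\<^sup>2 / 2" using d2 by (simp add: \<delta>_def)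
  have dl: "0 \<le> \<delta>" "\<delta> \<le> pi" using d2 by (auto simp: \<delta>_def arccos_lbound arccos_ubound)
  have d0: "\<delta> > 0" using dl cosd d2 by (cases "\<delta> = 0") auto
  have dp: "\<delta> < pi / 2"
  proof (rule ccontr)
    assume "\<not> \<delta> < pi / 2"
    then have "cos \<delta> \<le> cos (pi / 2)" using dl by (intro cos_monotone_0_pi_le) auto
    then show False using cosd d2 by simp
  qed
  have norm_eq: "cmod (cis \<theta> + \<i> * of_real 1) > d \<longleftrightarrow> cos (\<theta> + pi / 2) < cos \<delta>" for \<theta>
  proof -
    have "(cmod (cis \<theta> + \<i>))\<^sup>2 = (cos \<theta>)\<^sup>2 + (sin \<theta> + 1)\<^sup>2"
      by (simp add: cmod_power2)
    also have "\<dots> = 2 - 2 * cos (\<theta> + pi / 2)"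
      using sin_cos_squared_add[of \<theta>] by (simp add: cos_add power2_eq_square algebra_simps)
    finally have "(cmod (cis \<theta> + \<i>))\<^sup>2 = 2 - 2 * cos (\<theta> + pi / 2)" .
    moreover have "cmod (cis \<theta> + \<i>) > d \<longleftrightarrow> (cmod (cis \<theta> + \<i>))\<^sup>2 > d\<^sup>2"
      using d by (metis abs_norm_cancel abs_of_pos power2_abs abs_le_square_iff not_le)
    ultimately show ?thesis by (simp add: cosd) linarith
  qed
  let ?f = "\<lambda>\<theta>. \<i> * (osc lam (Complex 0 (\<theta> + pi / 2)) / Complex 0 (\<theta> + pi / 2))"
  let ?g = "\<lambda>\<theta>. if cos (\<theta> + pi / 2) < cos \<delta> then ?f \<theta> else 0"
  let ?H = "\<lambda>\<theta>. F (Complex 0 (\<theta> + pi / 2))"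
  have Hd: "(?H has_vector_derivative ?f \<theta>) (at \<theta> within S)" if "\<theta> \<noteq> - pi / 2" for \<theta> S
    by (intro arc_derivative F) (use that in auto)
  have 1: "(?g has_integral (?H (- pi / 2 - \<delta>) - ?H (- pi))) {- pi..- pi / 2 - \<delta>}"
  proof (rule has_integral_spike_finite[of "{- pi / 2 - \<delta>}"])
    show "(?f has_integral (?H (- pi / 2 - \<delta>) - ?H (- pi))) {- pi..- pi / 2 - \<delta>}"
      by (rule fundamental_theorem_of_calculus[OF _ Hd]) (use dp d0 in auto)
    fix \<theta> assume t: "\<theta> \<in> {- pi..- pi / 2 - \<delta>} - {- pi / 2 - \<delta>}"
    have "cos (- (\<theta> + pi / 2)) < cos \<delta>" using t dl by (intro cos_monotone_0_pi) auto
    then show "?g \<theta> = ?f \<theta>" by (simp only: cos_minus if_True)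
  qed simp
  have 2: "(?g has_integral 0) {- pi / 2 - \<delta>..- pi / 2 + \<delta>}"
  proof (rule has_integral_is_0)
    fix \<theta> assume t: "\<theta> \<in> {- pi / 2 - \<delta>..- pi / 2 + \<delta>}"
    have "cos \<delta> \<le> cos \<bar>\<theta> + pi / 2\<bar>" using t dl by (intro cos_monotone_0_pi_le) auto
    then show "?g \<theta> = 0" by simp
  qed
  have 3: "(?g has_integral (?H pi - ?H (- pi / 2 + \<delta>))) {- pi / 2 + \<delta>..pi}"
  proof (rule has_integral_spike_finite[of "{- pi / 2 + \<delta>}"])
    show "(?f has_integral (?H pi - ?H (- pi / 2 + \<delta>))) {- pi / 2 + \<delta>..pi}"
      by (rule fundamental_theorem_of_calculus[OF _ Hd]) (use dp d0 in auto)
    fix \<theta> assume t: "\<theta> \<in> {- pi / 2 + \<delta>..pi} - {- pi / 2 + \<delta>}"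
    have "cos (\<theta> + pi / 2) < cos \<delta>"
    proof (cases "\<theta> + pi / 2 \<le> pi")
      case True
      then show ?thesis using t dl by (intro cos_monotone_0_pi) auto
    next
      case False
      have "cos (\<theta> + pi / 2) = - sin \<theta>" by (simp add: cos_add)
      also have "\<dots> \<le> 0" using t False by (auto intro: sin_ge_zero)
      also have "\<dots> < cos \<delta>" using cosd d2 by simp
      finally show ?thesis .
    qed
    then show "?g \<theta> = ?f \<theta>" by simp
  qed simp
  have 4: "(?g has_integral (?H (- pi / 2 - \<delta>) - ?H (- pi) + 0)) {- pi..- pi / 2 + \<delta>}"
    by (rule has_integral_combine[OF _ _ 1 2]) (use dp d0 in auto)
  have "(?g has_integral (?H (- pi / 2 - \<delta>) - ?H (- pi) + 0 + (?H pi - ?H (- pi / 2 + \<delta>)))) {- pi..pi}"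
    by (rule has_integral_combine[OF _ _ 4 3]) (use dp d0 in auto)
  from has_integral_mult_right[OF this, of "hankel_const 1 lam"]
  have "integral {- pi..pi} (\<lambda>\<theta>. hankel_const 1 lam * ?g \<theta>)
    = hankel_const 1 lam * (?H (- pi / 2 - \<delta>) - ?H (- pi) + 0 + (?H pi - ?H (- pi / 2 + \<delta>)))"
    by (rule integral_unique)
  moreover have "(\<lambda>\<theta>. hankel_const 1 lam * ?g \<theta>) = (\<lambda>\<theta>. if cmod (cis \<theta> + \<i> * of_real 1) > d
        then hankel_const 1 lam * (\<i> * (osc lam (Complex 0 (\<theta> + pi / 2)) / (Complex 0 (\<theta> + pi / 2) - of_real (ln 1)))) else 0)"
    unfolding norm_eq by (rule ext) simp
  moreover have "?H (- pi / 2 - \<delta>) = F (Complex 0 (- \<delta>))" "?H (- pi) = F (Complex 0 (- pi / 2))"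
     "?H pi = F (Complex 0 (3 * pi / 2))" "?H (- pi / 2 + \<delta>) = F (Complex 0 \<delta>)"
    by (simp_all add: field_simps)
  ultimately show ?thesis unfolding hankel_circle_integral by (simp add: algebra_simps)
qed

lemma arccos_small_tendsto: "((\<lambda>d::real. arccos (1 - d\<^sup>2 / 2)) \<longlongrightarrow> 0) (at_right 0)"
proof -
  have "continuous_on {0..1} (\<lambda>d::real. arccos (1 - d\<^sup>2 / 2))"
  proof (rule continuous_on_compose2[OF continuous_on_arccos'])
    show "(\<lambda>d::real. 1 - d\<^sup>2 / 2) ` {0..1} \<subseteq> {- 1..1}"
      using power_le_one[of _ 2] by (force simp: algebra_simps)
  qed (intro continuous_intros, simp)
  then have "((\<lambda>d::real. arccos (1 - d\<^sup>2 / 2)) \<longlongrightarrow> arccos (1 - 0\<^sup>2 / 2)) (at 0 within {0..1})"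
    unfolding continuous_on_def by (rule bspec) simp
  then have "((\<lambda>d::real. arccos (1 - d\<^sup>2 / 2)) \<longlongrightarrow> 0) (at 0 within {0..1})" by simp
  then show ?thesis
    by (simp add: at_within_Icc_at_right)
qed

lemma arccos_small_pos:
  assumes "0 < d" "d < 1"
  shows "arccos (1 - d\<^sup>2 / 2) > 0"
proof -
  have d2: "d\<^sup>2 < 1" "d\<^sup>2 > 0" using assms by (auto simp: power_less_one_iff)
  have "cos (arccos (1 - d\<^sup>2 / 2)) = 1 - d\<^sup>2 / 2" using d2 by simp
  moreover have "arccos (1 - d\<^sup>2 / 2) \<ge> 0" using d2 by (intro arccos_lbound) auto
  ultimately show ?thesis using d2 by (cases "arccos (1 - d\<^sup>2 / 2) = 0") auto
qed

text \<open>The values of \<open>F\<close> where the circle meets the rays cancel. \<open>J\<close>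
  stands for the increment of \<open>F\<close> over the removed arc: it is 0 for a other than 1 and
  F (i \<delta>) - F (-i \<delta>) for a = 1.\<close>

lemma hankel_cut_limit:
  assumes lam: "lam > 0" and d: "d \<le> 1"
    and F: "\<And>v. Im v \<noteq> 0 \<Longrightarrow> (F has_field_derivative osc lam v / (v - of_real (ln a))) (at v)"
    and circ: "contour_integral (part_circlepath 0 1 (- pi) pi) (\<lambda>w. hankel_cut_integrand d a lam w (Ln w))
       = hankel_const a lam * (F (Complex 0 (3 * pi / 2)) - F (Complex 0 (- pi / 2)) - J)"
  shows "((\<lambda>R. hankel_const a lam * (F (Complex (ln R) (3 * pi / 2)) - F (Complex (ln R) (- pi / 2)) - J))
      \<longlongrightarrow> hankel_L_cut d a lam) at_top"
proof -
  let ?c = "hankel_const a lam"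
  have sc: "sin (3 * pi / 2) = -1" "cos (3 * pi / 2) = 0" using sin_3over2_pi cos_3over2_pi by simp_all
  have lo: "((\<lambda>R. - ?c * (F (Complex (ln R) (- pi / 2)) - F (Complex 0 (- pi / 2)))) \<longlongrightarrow>
     (LINT r:{1<..}|lborel. hankel_cut_integrand d a lam (- of_real r) (of_real (ln r) + \<i> * of_real (- pi / 2 - pi / 2)))) at_top"
    by (rule hankel_ray[OF lam _ _ _ d F]) (use pi_gt3 in auto)
  have up: "((\<lambda>R. - ?c * (F (Complex (ln R) (3 * pi / 2)) - F (Complex 0 (3 * pi / 2)))) \<longlongrightarrow>
     (LINT r:{1<..}|lborel. hankel_cut_integrand d a lam (- of_real r) (of_real (ln r) + \<i> * of_real (3 * pi / 2 - pi / 2)))) at_top"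
    by (rule hankel_ray[OF lam sc _ d F]) (use pi_gt3 in auto)
  have "3 * pi / 2 - pi / 2 = pi" "- pi / 2 - pi / 2 = - pi" by simp_all
  note up = up[unfolded this] and lo = lo[unfolded this]
  have L: "hankel_L_cut d a lam = (LINT r:{1<..}|lborel. hankel_cut_integrand d a lam (- of_real r) (of_real (ln r) + \<i> * of_real (- pi)))
     + ?c * (F (Complex 0 (3 * pi / 2)) - F (Complex 0 (- pi / 2)) - J)
     - (LINT r:{1<..}|lborel. hankel_cut_integrand d a lam (- of_real r) (of_real (ln r) + \<i> * of_real pi))"
    unfolding hankel_L_cut_def hankel_integral_def circ[symmetric] hankel_cut_integrand_def
    by (simp only: of_real_minus mult_minus_right add_uminus_conv_diff)
  have "((\<lambda>R. - ?c * (F (Complex (ln R) (- pi / 2)) - F (Complex 0 (- pi / 2)))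
       + ?c * (F (Complex 0 (3 * pi / 2)) - F (Complex 0 (- pi / 2)) - J)
       - (- ?c * (F (Complex (ln R) (3 * pi / 2)) - F (Complex 0 (3 * pi / 2))))) \<longlongrightarrow> hankel_L_cut d a lam) at_top"
    unfolding L by (intro tendsto_diff tendsto_add tendsto_const lo up)
  then show ?thesis by (simp add: algebra_simps)
qed

lemma limit_norm_bound:
  fixes f :: "real \<Rightarrow> complex"
  assumes "(f \<longlongrightarrow> l) at_top" "eventually (\<lambda>x. norm (f x - y) \<le> B) at_top"
  shows "norm (l - y) \<le> B"
  by (rule tendsto_upperbound[OF tendsto_norm[OF tendsto_diff[OF assms(1) tendsto_const]] assms(2)]) simp

text \<open>On both rays the far values of \<open>F\<close> differ from those at the end points of
  the saddle arc by exponentially small amounts, with constants that depend neither on a nor on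
  \<open>F\<close>. For a = 1 the term i pi is the limit of the increment of \<open>Ln\<close> from
  -i \<delta> to i \<delta>.\<close>

lemma hankel_L_via_primitive:
  assumes up: "x0 < 0" "0 < y0" "y0 \<le> 3 * pi / 2"
    and lo: "0 < x1" "y1 < 0" "- pi / 2 < y1" "exp x1 * sin y1 - y1 < 0"
  shows "\<exists>C\<ge>0. \<exists>c>0. \<forall>lam\<ge>1. \<forall>a F.
     (0 < a \<and> a \<noteq> 1 \<and> (\<forall>v. Im v \<noteq> 0 \<or> v = 0 \<longrightarrow> (F has_field_derivative osc lam v / (v - of_real (ln a))) (at v)) \<longrightarrow>
        norm (hankel_L a lam - hankel_const a lam * (F (Complex x0 y0) - F (Complex x1 y1))) \<le> C * exp (- c * lam)) \<and>
     (\<forall>E. (\<forall>v. isCont E v) \<and> (\<forall>v. F v = E v + Ln v) \<and> (\<forall>v. Im v \<noteq> 0 \<longrightarrow> (F has_field_derivative osc lam v / v) (at v)) \<longrightarrow>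
        norm (hankel_L 1 lam - hankel_const 1 lam * (F (Complex x0 y0) - F (Complex x1 y1) - \<i> * of_real pi)) \<le> C * exp (- c * lam))"
proof -
  obtain C1 c1 where C1: "C1 \<ge> 0" "c1 > 0" and B1: "\<forall>lam\<ge>1. \<forall>b F. \<forall>X\<ge>x0.
    (\<forall>v. Im v \<noteq> 0 \<longrightarrow> (F has_field_derivative osc lam v / (v - of_real b)) (at v)) \<longrightarrow>
    norm (F (Complex X (3 * pi / 2)) - F (Complex x0 y0)) \<le> C1 * exp (- c1 * lam)"
    using upper_path_bound[OF up] by (elim exE conjE) (rule that)
  obtain C2 c2 X0 where C2: "C2 \<ge> 0" "c2 > 0" and B2: "\<forall>lam\<ge>1. \<forall>b F. \<forall>X\<ge>X0.
    (\<forall>v. Im v \<noteq> 0 \<longrightarrow> (F has_field_derivative osc lam v / (v - of_real b)) (at v)) \<longrightarrow>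
    norm (F (Complex X (- pi / 2)) - F (Complex x1 y1)) \<le> C2 * exp (- c2 * lam)"
    using lower_path_bound[OF lo] by (elim exE conjE) (rule that)
  define c where "c = min c1 c2"
  have main: "norm (l - hankel_const a lam * (F (Complex x0 y0) - F (Complex x1 y1) - J)) \<le> (C1 + C2) * exp (- c * lam)"
    if lam: "lam \<ge> 1" and F: "\<forall>v. Im v \<noteq> 0 \<longrightarrow> (F has_field_derivative osc lam v / (v - of_real (ln a))) (at v)"
      and l: "((\<lambda>R. hankel_const a lam * (F (Complex (ln R) (3 * pi / 2)) - F (Complex (ln R) (- pi / 2)) - J)) \<longlongrightarrow> l) at_top"
    for lam a F l J
  proof (rule limit_norm_bound[OF l])
    have "eventually (\<lambda>R. ln R \<ge> max x0 X0) at_top"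
      using filterlim_at_top[THEN iffD1, OF ln_at_top] by blast
    then show "eventually (\<lambda>R. norm (hankel_const a lam * (F (Complex (ln R) (3 * pi / 2)) - F (Complex (ln R) (- pi / 2)) - J)
       - hankel_const a lam * (F (Complex x0 y0) - F (Complex x1 y1) - J)) \<le> (C1 + C2) * exp (- c * lam)) at_top"
    proof eventually_elim
      case (elim R)
      have e: "exp (- c1 * lam) \<le> exp (- c * lam)" "exp (- c2 * lam) \<le> exp (- c * lam)"
        using lam by (auto simp: c_def)
      have 1: "norm (F (Complex (ln R) (3 * pi / 2)) - F (Complex x0 y0)) \<le> C1 * exp (- c * lam)"
        using B1[rule_format, of lam "ln R" F "ln a"] F lam elim mult_left_mono[OF e(1) C1(1)] by auto
      have 2: "norm (F (Complex (ln R) (- pi / 2)) - F (Complex x1 y1)) \<le> C2 * exp (- c * lam)"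
        using B2[rule_format, of lam "ln R" F "ln a"] F lam elim mult_left_mono[OF e(2) C2(1)] by auto
      let ?D = "(F (Complex (ln R) (3 * pi / 2)) - F (Complex x0 y0)) - (F (Complex (ln R) (- pi / 2)) - F (Complex x1 y1))"
      have "norm (hankel_const a lam * ?D) = 1 / pi * norm ?D" by (simp add: norm_mult)
      also have "\<dots> \<le> 1 * norm ?D" using pi_gt3 by (intro mult_right_mono) auto
      also have "\<dots> \<le> C1 * exp (- c * lam) + C2 * exp (- c * lam)"
        unfolding mult_1 by (rule order_trans[OF norm_triangle_ineq4 add_mono[OF 1 2]])
      finally have "norm (hankel_const a lam * ?D) \<le> (C1 + C2) * exp (- c * lam)" by (simp add: distrib_right)
      moreover have "hankel_const a lam * ?D = hankel_const a lam * (F (Complex (ln R) (3 * pi / 2)) - F (Complex (ln R) (- pi / 2)) - J)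
       - hankel_const a lam * (F (Complex x0 y0) - F (Complex x1 y1) - J)"
        by (simp add: algebra_simps)
      ultimately show ?case by (simp only:)
    qed
  qed
  have S1: "norm (hankel_L a lam - hankel_const a lam * (F (Complex x0 y0) - F (Complex x1 y1))) \<le> (C1 + C2) * exp (- c * lam)"
    if lam: "1 \<le> lam" and a: "0 < a" "a \<noteq> 1" and F: "\<forall>v. Im v \<noteq> 0 \<or> v = 0 \<longrightarrow> (F has_field_derivative osc lam v / (v - of_real (ln a))) (at v)"
    for lam a F
  proof -
    have "((\<lambda>R. hankel_const a lam * (F (Complex (ln R) (3 * pi / 2)) - F (Complex (ln R) (- pi / 2)) - 0))
      \<longlongrightarrow> hankel_L_cut 0 a lam) at_top"
      by (rule hankel_cut_limit) (use lam F hankel_circle[OF a, of F lam] in auto)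
    from main[OF lam _ this] F a
    show ?thesis by (simp add: hankel_L_def)
  qed
  have S2: "norm (hankel_L 1 lam - hankel_const 1 lam * (F (Complex x0 y0) - F (Complex x1 y1) - \<i> * of_real pi)) \<le> (C1 + C2) * exp (- c * lam)"
    if lam: "1 \<le> lam" and E: "\<forall>v. isCont E v" and FE: "\<forall>v. F v = E v + Ln v"
      and F: "\<forall>v. Im v \<noteq> 0 \<longrightarrow> (F has_field_derivative osc lam v / v) (at v)" for lam F E
  proof -
    define \<delta> where "\<delta> d = arccos (1 - d\<^sup>2 / 2)" for d :: real
    define J where "J d = F (Complex 0 (\<delta> d)) - F (Complex 0 (- \<delta> d))" for d
    let ?A = "hankel_const 1 lam * (F (Complex x0 y0) - F (Complex x1 y1) - \<i> * of_real pi)"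
    have lim1: "((\<lambda>R. hankel_const 1 lam * (F (Complex (ln R) (3 * pi / 2)) - F (Complex (ln R) (- pi / 2)) - J d))
      \<longlongrightarrow> hankel_L_cut d 1 lam) at_top" if "0 < d" "d < 1" for d
      by (rule hankel_cut_limit) (use lam F that hankel_circle_cut[OF that, of F lam] in \<open>auto simp: J_def \<delta>_def algebra_simps\<close>)
    \<comment> \<open>\<open>l\<close> is the limit along the rays without the term
      \<open>J\<close>. The cut integral depends on d only through \<open>J d\<close>, so
      \<open>l\<close> may be read off at any admissible d, here 1/2, and the limit d \<rightarrow>
      0 reduces to that of \<open>J\<close>.\<close>
    define l where "l = hankel_L_cut (1/2) 1 lam + hankel_const 1 lam * J (1/2)"
    have lcut: "hankel_L_cut d 1 lam = l - hankel_const 1 lam * J d" if "0 < d" "d < 1" for d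
    proof -
      have "((\<lambda>R. hankel_const 1 lam * (F (Complex (ln R) (3 * pi / 2)) - F (Complex (ln R) (- pi / 2)) - J (1/2))
         + (hankel_const 1 lam * J (1/2) - hankel_const 1 lam * J d)) \<longlongrightarrow> l - hankel_const 1 lam * J d) at_top"
        unfolding l_def add_diff_eq[symmetric] by (intro tendsto_add lim1 tendsto_const) simp_all
      then have "((\<lambda>R. hankel_const 1 lam * (F (Complex (ln R) (3 * pi / 2)) - F (Complex (ln R) (- pi / 2)) - J d)) \<longlongrightarrow> l - hankel_const 1 lam * J d) at_top"
        by (simp add: algebra_simps)
      from tendsto_unique[OF _ lim1[OF that] this] show ?thesis by simp
    qed
    have dl: "(\<delta> \<longlongrightarrow> 0) (at_right 0)" unfolding \<delta>_def[abs_def] by (rule arccos_small_tendsto)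
    have Jlim: "(J \<longlongrightarrow> \<i> * of_real pi) (at_right 0)"
    proof -
      have c0: "((\<lambda>d. Complex 0 (\<delta> d)) \<longlongrightarrow> 0) (at_right 0)" "((\<lambda>d. Complex 0 (- \<delta> d)) \<longlongrightarrow> 0) (at_right 0)"
        using tendsto_Complex[OF tendsto_const dl, of 0] tendsto_Complex[OF tendsto_const tendsto_minus[OF dl], of 0]
        by (simp_all add: zero_complex.code)
      have "((\<lambda>d. E (Complex 0 (\<delta> d)) - E (Complex 0 (- \<delta> d)) + \<i> * of_real pi) \<longlongrightarrow> E 0 - E 0 + \<i> * of_real pi) (at_right 0)"
        using E c0 by (intro tendsto_add tendsto_diff tendsto_const isCont_tendsto_compose[of 0 E]) auto
      moreover have "eventually (\<lambda>d. J d = E (Complex 0 (\<delta> d)) - E (Complex 0 (- \<delta> d)) + \<i> * of_real pi) (at_right 0)"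
        unfolding eventually_at_right_field
      proof (intro exI[of _ 1] conjI allI impI)
        fix d :: real assume d: "0 < d" "d < 1"
        have dp: "\<delta> d > 0" unfolding \<delta>_def by (rule arccos_small_pos[OF d])
        have "Ln (Complex 0 y) = of_real (ln y) + \<i> * of_real (pi / 2)"
          "Ln (Complex 0 (- y)) = of_real (ln y) - \<i> * of_real (pi / 2)" if "y > 0" for y
        proof -
          have e: "exp (of_real (ln y) + \<i> * of_real (pi / 2)) = Complex 0 y"
            "exp (of_real (ln y) - \<i> * of_real (pi / 2)) = Complex 0 (- y)"
            using that by (simp_all add: complex_eq_iff Re_exp Im_exp)
          show "Ln (Complex 0 y) = of_real (ln y) + \<i> * of_real (pi / 2)"
            "Ln (Complex 0 (- y)) = of_real (ln y) - \<i> * of_real (pi / 2)"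
            unfolding e[symmetric] by (intro Ln_exp; use pi_gt3 in simp)+
        qed
        from this[OF dp] show "J d = E (Complex 0 (\<delta> d)) - E (Complex 0 (- \<delta> d)) + \<i> * of_real pi"
          by (simp add: J_def FE)
      qed simp
      ultimately show ?thesis by (simp add: tendsto_cong)
    qed
    have "((\<lambda>d. l - hankel_const 1 lam * J d) \<longlongrightarrow> l - hankel_const 1 lam * (\<i> * of_real pi)) (at_right 0)"
      by (intro tendsto_diff tendsto_mult tendsto_const Jlim)
    then have "((\<lambda>d. hankel_L_cut d 1 lam) \<longlongrightarrow> l - hankel_const 1 lam * (\<i> * of_real pi)) (at_right 0)"
      by (rule Lim_transform_eventually) (auto simp: eventually_at_right_field lcut intro!: exI[of _ 1])
    then have "hankel_L 1 lam = l - hankel_const 1 lam * (\<i> * of_real pi)"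
      unfolding hankel_L_def by (simp add: tendsto_Lim)
    moreover have "((\<lambda>R. hankel_const 1 lam * (F (Complex (ln R) (3 * pi / 2)) - F (Complex (ln R) (- pi / 2)) - \<i> * of_real pi))
       \<longlongrightarrow> l - hankel_const 1 lam * (\<i> * of_real pi)) at_top"
    proof -
      have "((\<lambda>R. hankel_const 1 lam * (F (Complex (ln R) (3 * pi / 2)) - F (Complex (ln R) (- pi / 2)) - J (1/2))
         + (hankel_const 1 lam * J (1/2) - hankel_const 1 lam * (\<i> * of_real pi))) \<longlongrightarrow> l - hankel_const 1 lam * (\<i> * of_real pi)) at_top"
        unfolding l_def add_diff_eq[symmetric] by (intro tendsto_add lim1 tendsto_const) simp_all
      then show ?thesis by (simp add: algebra_simps)
    qed
    ultimately show ?thesis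
      using main[OF lam, of F 1 "\<i> * of_real pi"] F by simp
  qed
  have C: "C1 + C2 \<ge> 0" "c > 0" using C1 C2 by (auto simp: c_def)
  show ?thesis
    by (rule exI[of _ "C1 + C2"], rule conjI[OF C(1)], rule exI[of _ c], rule conjI[OF C(2)],
        intro allI impI conjI; elim conjE; (rule S1 | rule S2); assumption)
qed

section \<open>Distance of the saddle curve from the pole\<close>

text \<open>Write D = e^v - 1. The principal logarithm u of 1 + D differs from v by a multiple of 2
  pi i, and by the phase equation u - D is i times the distance of t from a multiple of 2 pi. Since
  Ln (1 + D) - D = O(D^2), this distance is quadratically small: the curve comes back to the saddle
  only near lattice values of t.\<close>

lemma phase_near_lattice:
  assumes eq: "exp v = 1 + v - \<i> * of_real t" and D: "norm (exp v - 1) < 1/2"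
  obtains k :: int where "\<bar>t - 2 * pi * of_int k\<bar> \<le> 2 * (norm (exp v - 1))\<^sup>2"
    "norm (v - 2 * pi * of_int k * \<i>) \<le> 2 * norm (exp v - 1)"
    "v - 2 * pi * of_int k * \<i> = Ln (exp v)"
proof -
  let ?D = "exp v - 1"
  define u where "u = Ln (1 + ?D)"
  have "exp u = exp v" by (simp add: u_def)
  then obtain k :: int where k: "u = v + (of_int (2 * k) * pi) * \<i>"
    by (auto simp: exp_eq)
  have n: "norm ?D < 1" using D by linarith
  have "norm (u - ?D) \<le> (norm ?D)\<^sup>2 / (1 - norm ?D)"
    using Ln_approx_linear[OF n] by (simp add: u_def)
  also have "\<dots> \<le> (norm ?D)\<^sup>2 / (1/2)" using D by (intro divide_left_mono) auto
  finally have "norm (u - ?D) \<le> 2 * (norm ?D)\<^sup>2" by simp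
  moreover have "u - ?D = \<i> * of_real (t - 2 * pi * of_int (- k))"
    unfolding k using eq by (simp add: algebra_simps)
  ultimately have "\<bar>t - 2 * pi * of_int (- k)\<bar> \<le> 2 * (norm ?D)\<^sup>2" by (simp only: norm_mult norm_ii norm_of_real mult_1)
  moreover have "v - 2 * pi * of_int (- k) * \<i> = u" unfolding k by simp
  moreover have "norm u \<le> 2 * norm ?D" unfolding u_def using D by (rule norm_Ln_le)
  ultimately show thesis using that[of "- k"] by (simp add: u_def)
qed

text \<open>Turned around, this is an explicit lower bound for |e^v - 1| that holds for every branch
  of the curve. If |e^v - 1| >= 1/2, the right side is at least 1 and the claim is trivial.\<close>

lemma sin_half_le:
  assumes eq: "exp v = 1 + v - \<i> * of_real t"
  shows "\<bar>sin (t / 2)\<bar> \<le> 4 * (norm (exp v - 1))\<^sup>2"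
proof (cases "norm (exp v - 1) < 1/2")
  case True
  obtain k :: int where k: "\<bar>t - 2 * pi * of_int k\<bar> \<le> 2 * (norm (exp v - 1))\<^sup>2"
    by (rule phase_near_lattice[OF eq True])
  have "\<bar>sin (t / 2)\<bar> = \<bar>sin (t / 2 - pi * of_int k)\<bar>"
  proof -
    have s0: "sin (pi * of_int k) = 0" using sin_times_pi_eq_0[of "of_int k"] by (simp add: mult.commute)
    then have "\<bar>cos (pi * of_int k)\<bar> = 1" using sin_cos_squared_add[of "pi * of_int k"] by (simp add: abs_square_eq_1)
    then show ?thesis by (simp add: sin_diff s0 abs_mult)
  qed
  also have "\<dots> \<le> \<bar>t / 2 - pi * of_int k\<bar>" by (rule abs_sin_x_le_abs_x)
  also have "\<dots> = \<bar>t - 2 * pi * of_int k\<bar> / 2" by (simp add: abs_if)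
  also have "\<dots> \<le> (2 * (norm (exp v - 1))\<^sup>2) / 2" by (rule divide_right_mono[OF k]) simp
  also have "\<dots> \<le> 4 * (norm (exp v - 1))\<^sup>2" by simp
  finally show ?thesis .
next
  case False
  then have "(1/2)\<^sup>2 \<le> (norm (exp v - 1))\<^sup>2" by (intro power_mono) auto
  then have "1 \<le> 4 * (norm (exp v - 1))\<^sup>2" by (simp add: power2_eq_square)
  then show ?thesis using abs_sin_le_one[of "t/2"] by linarith
qed

text \<open>With u = Ln (e^v) the phase equation makes e^u - 1 - u imaginary. As
  \<open>expq 0\<close> = 1 and \<open>expq2 0\<close> = 1/2, the difference (e^u - 1)^2 - 2 (e^u -
  1 - u) vanishes to third order at u = 0, and its real part is that of (e^u - 1)^2. The factor 8 is
  due to |u| <= 2 |e^v - 1|.\<close>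

lemma Re_square_small:
  "\<exists>C>0. \<forall>v t. exp v = 1 + v - \<i> * of_real t \<longrightarrow> norm (exp v - 1) < 1/2 \<longrightarrow>
     \<bar>Re ((exp v - 1)\<^sup>2)\<bar> \<le> C * norm (exp v - 1) ^ 3"
proof -
  define h where "h u = (expq u)\<^sup>2 - 2 * expq2 u" for u
  have hol: "h holomorphic_on UNIV" unfolding h_def[abs_def]
    by (intro holomorphic_intros expq_holomorphic expq2_holomorphic)
  have h0: "h 0 = 0" by (simp add: h_def expq_0 expq2_0)
  have "continuous_on (cball 0 1) (divdiff h)"
    by (rule continuous_on_subset[OF holomorphic_on_imp_continuous_on[OF divdiff_holomorphic[OF hol open_UNIV]]]) auto
  then have "bounded (divdiff h ` cball 0 1)"
    by (intro compact_imp_bounded compact_continuous_image) auto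
  then obtain B where B: "B > 0" "\<And>u. norm u \<le> 1 \<Longrightarrow> norm (divdiff h u) \<le> B"
    by (auto simp: bounded_pos)
  have "\<bar>Re ((exp v - 1)\<^sup>2)\<bar> \<le> 8 * B * norm (exp v - 1) ^ 3"
    if eq: "exp v = 1 + v - \<i> * of_real t" and D: "norm (exp v - 1) < 1/2" for v t
  proof -
    obtain k :: int where k: "norm (v - 2 * pi * of_int k * \<i>) \<le> 2 * norm (exp v - 1)"
       "v - 2 * pi * of_int k * \<i> = Ln (exp v)"
      by (rule phase_near_lattice[OF eq D])
    define u where "u = v - 2 * pi * of_int k * \<i>"
    have eu: "exp u = exp v" unfolding u_def k(2) by (simp add: exp_Ln)
    have "exp u - 1 - u = - \<i> * of_real (t - 2 * pi * of_int k)"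
      unfolding eu unfolding u_def using eq by (simp add: algebra_simps)
    then have re: "Re (exp u - 1 - u) = 0" by simp
    have "(exp u - 1)\<^sup>2 - 2 * (exp u - 1 - u) = u\<^sup>2 * h u"
      unfolding exp_expq2 using exp_expq[of u] by (simp add: h_def power_mult_distrib algebra_simps)
    also have "h u = u * divdiff h u" using divdiff_eq[of h u] h0 by simp
    finally have cube: "(exp u - 1)\<^sup>2 - 2 * (exp u - 1 - u) = u ^ 3 * divdiff h u"
      by (simp add: power2_eq_square power3_eq_cube mult_ac)
    have "Re ((exp u - 1)\<^sup>2) = Re ((exp u - 1)\<^sup>2 - 2 * (exp u - 1 - u)) + 2 * Re (exp u - 1 - u)" by simp
    then have "Re ((exp u - 1)\<^sup>2) = Re (u ^ 3 * divdiff h u)"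
      unfolding cube re by simp
    then have "\<bar>Re ((exp u - 1)\<^sup>2)\<bar> \<le> norm u ^ 3 * norm (divdiff h u)"
      using abs_Re_le_cmod[of "u ^ 3 * divdiff h u"] by (simp add: norm_mult norm_power)
    also have "\<dots> \<le> (2 * norm (exp v - 1)) ^ 3 * B"
      using k D B by (intro mult_mono power_mono B) (auto simp: u_def)
    finally show ?thesis unfolding eu by (simp add: power_mult_distrib mult_ac)
  qed
  then show ?thesis using B(1) by (intro exI[of _ "8 * B"] conjI allI impI) auto
qed

text \<open>The real part of the phase equation is 1 + x = e^x cos y, and for negative x the right
  side has modulus below 1. So e^v never comes near 0.\<close>

lemma phase_Re_ge:
  assumes eq: "exp v = 1 + v - \<i> * of_real t"
  shows "Re v \<ge> -2"
proof (rule ccontr)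
  assume "\<not> Re v \<ge> -2"
  then have x: "Re v < -2" by simp
  have "1 + Re v = exp (Re v) * cos (Im v)" using arg_cong[OF eq, of Re] by (simp add: Re_exp)
  moreover have "\<bar>exp (Re v) * cos (Im v)\<bar> \<le> exp (Re v) * 1" unfolding abs_mult by (intro mult_mono) auto
  moreover have "exp (Re v) < exp 0" using x by (subst exp_less_cancel_iff) simp
  ultimately show False using x unfolding exp_zero by linarith
qed

text \<open>Re (D^2) = |D|^2 - 2 (Im D)^2, so if Re (D^2) is at most |D|^2 / 2, a fixed share of D
  is imaginary. Applied to D = e^v - 1 it says that the curve leaves the real axis at a definite
  angle at every return, and the imaginary part does not see a real a.\<close>

lemma norm_le_Im_of_Re_square:
  fixes D :: complex
  assumes Re: "\<bar>Re (D\<^sup>2)\<bar> \<le> C * norm D ^ 3" and C: "C * d \<le> 1/2" "C > 0" and D: "norm D < d"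
  shows "norm D \<le> 2 * \<bar>Im D\<bar>"
proof -
  have "C * norm D \<le> C * d" using D C by (intro mult_left_mono) auto
  then have "C * norm D \<le> 1/2" using C(1) by (rule order_trans)
  then have le: "C * norm D * (norm D)\<^sup>2 \<le> 1/2 * (norm D)\<^sup>2" by (rule mult_right_mono) simp
  have "norm D ^ 3 = norm D * (norm D)\<^sup>2" by (simp add: power2_eq_square power3_eq_cube)
  then have "Re (D\<^sup>2) \<le> C * norm D * (norm D)\<^sup>2" using Re by (simp only: abs_le_iff mult.assoc)
  with le have "Re (D\<^sup>2) \<le> 1/2 * (norm D)\<^sup>2" by (rule order_trans[rotated])
  moreover have "Re (D\<^sup>2) = (norm D)\<^sup>2 - 2 * (Im D)\<^sup>2"
    unfolding cmod_power2 by (simp add: power2_eq_square)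
  ultimately have "(norm D)\<^sup>2 \<le> 4 * (Im D)\<^sup>2" by linarith
  also have "\<dots> = (2 * \<bar>Im D\<bar>)\<^sup>2" by (simp add: power_mult_distrib)
  finally show ?thesis by (rule power2_le_imp_le) simp
qed

lemma distance_to_ray_near:
  assumes Csq: "\<bar>Re ((exp v - 1)\<^sup>2)\<bar> \<le> C * norm (exp v - 1) ^ 3"
    and C: "C * d \<le> 1/2" "C > 0" and D: "norm (exp v - 1) < d"
  shows "norm (exp v - 1) / 2 \<le> norm (exp v - of_real a)"
proof -
  have "Im (exp v - 1) = Im (exp v - of_real a)" by simp
  then have "\<bar>Im (exp v - 1)\<bar> \<le> norm (exp v - of_real a)"
    using abs_Im_le_cmod[of "exp v - of_real a"] by (simp only:)
  with norm_le_Im_of_Re_square[OF assms] show ?thesis by linarith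
qed

text \<open>Re (e^v) = 1 + Re v is only logarithmic in p = |e^v|. Once it is at most p / 2, the
  angle with the positive axis is at least 60 degrees, and |e^v - a|^2 >= p^2 - a p + a^2 >= 3/4
  max(p, a)^2 by the law of cosines.\<close>

lemma distance_to_ray_far:
  assumes eq: "exp v = 1 + v - \<i> * of_real t" and n: "norm (exp v) > 10" and a: "a > 0"
  shows "max (norm (exp v)) a * (4/5) \<le> norm (exp v - of_real a)"
proof -
    define p where "p = norm (exp v)"
    have p: "p = exp (Re v)" by (simp add: p_def)
    have "Re (exp v) = 1 + Re v" using arg_cong[OF eq, of Re] by simp
    have "Re v = 2 * (Re v / 2)" by simp
    have rv: "Re v > 0"
    proof (rule ccontr)
      assume "\<not> Re v > 0"
      then have "exp (Re v) \<le> exp 0" by (subst exp_le_cancel_iff) simp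
      then show False using n p unfolding p_def exp_zero by linarith
    qed
    have "1 + Re v + (Re v)\<^sup>2 / 2 \<le> p" unfolding p by (rule exp_lower_Taylor_quadratic) (use rv in simp)
    moreover have "p > 10" using n by (simp add: p_def)
    \<comment> \<open>Here the bound 10 is used: for Re v < 4 the left side is below 10, and for Re
      v >= 4 the quadratic Taylor polynomial of exp suffices.\<close>
    ultimately have half: "2 * (1 + Re v) \<le> p"
    proof -
      have "Re v * (Re v - 4) \<ge> 0" if "Re v \<ge> 4" using that by (intro mult_nonneg_nonneg) auto
      then have sq: "4 * Re v \<le> (Re v)\<^sup>2" if "Re v \<ge> 4" using that by (simp add: power2_eq_square algebra_simps)
      show ?thesis
      proof (cases "Re v \<ge> 4")
        case True
        from sq[OF True] \<open>1 + Re v + (Re v)\<^sup>2 / 2 \<le> p\<close> True show ?thesis by simp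
      next
        case False
        with \<open>p > 10\<close> show ?thesis by simp
      qed
    qed
    have "(norm (exp v - of_real a))\<^sup>2 = p\<^sup>2 - 2 * a * Re (exp v) + a\<^sup>2"
      unfolding p_def cmod_power2 by (simp add: power2_eq_square algebra_simps)
    also have "\<dots> = p\<^sup>2 - a * (2 * (1 + Re v)) + a\<^sup>2"
      unfolding \<open>Re (exp v) = 1 + Re v\<close> by (simp add: algebra_simps)
    also have "\<dots> \<ge> p\<^sup>2 - a * p + a\<^sup>2" using mult_left_mono[OF half, of a] a by simp
    finally have n2: "(norm (exp v - of_real a))\<^sup>2 \<ge> p\<^sup>2 - a * p + a\<^sup>2" .
    have "(max p a)\<^sup>2 * (16/25) \<le> (norm (exp v - of_real a))\<^sup>2"
    proof -
      have "(p - 2 * a)\<^sup>2 \<ge> 0" "(a - 2 * p)\<^sup>2 \<ge> 0" by simp_all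
      then have "p\<^sup>2 - a * p + a\<^sup>2 \<ge> 3/4 * p\<^sup>2" "p\<^sup>2 - a * p + a\<^sup>2 \<ge> 3/4 * a\<^sup>2"
        by (simp_all add: power2_eq_square algebra_simps)
      then have "p\<^sup>2 - a * p + a\<^sup>2 \<ge> 3/4 * (max p a)\<^sup>2" by (auto simp: max_def)
      then show ?thesis using n2 zero_le_power2[of "max p a"] by linarith
    qed
    then have "(max p a * (4/5))\<^sup>2 \<le> (norm (exp v - of_real a))\<^sup>2"
      by (simp add: power_mult_distrib power2_eq_square)
    then show ?thesis unfolding p_def by (rule power2_le_imp_le) simp
qed

text \<open>Compactness. The parameter t enters only the imaginary part of the phase equation, so z
  = e^v lies in a set that knows neither t nor the branch: Re z = 1 + ln |z|. On the positive axis
  this reads x - 1 = ln x, hence x = 1, which |z - 1| >= d excludes. A compact set disjoint from the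
  closed ray has positive distance from it.\<close>

lemma distance_to_ray_mid:
  assumes d: "d > 0"
  shows "\<exists>m>0. \<forall>v t a. exp v = 1 + v - \<i> * of_real t \<longrightarrow> norm (exp v) \<le> 10 \<longrightarrow> d \<le> norm (exp v - 1) \<longrightarrow> a \<ge> 0 \<longrightarrow>
     m \<le> norm (exp v - of_real a)"
proof -
  define S :: "complex set" where "S = {z. exp (-2) \<le> norm z \<and> norm z \<le> 10 \<and> d \<le> norm (z - 1)}"
  define K where "K = S \<inter> (\<lambda>z. Re z - (1 + ln (norm z))) -` {0}"
  have "closed S"
    unfolding S_def by (intro closed_Collect_conj closed_Collect_le continuous_intros)
  moreover have "continuous_on S (\<lambda>z. Re z - (1 + ln (norm z)))"
  proof (intro continuous_intros ballI)
    fix z :: complex assume "z \<in> S"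
    then have "exp (-2) \<le> norm z" by (simp add: S_def)
    then show "norm z \<noteq> 0" using exp_gt_zero[of "-2::real"] by linarith
  qed
  ultimately have clK: "closed K"
    unfolding K_def by (intro continuous_closed_preimage closed_singleton)
  have K_iff: "z \<in> K \<longleftrightarrow> exp (-2) \<le> norm z \<and> norm z \<le> 10 \<and> d \<le> norm (z - 1) \<and> Re z = 1 + ln (norm z)" for z
    unfolding K_def S_def Int_iff vimage_eq mem_Collect_eq singleton_iff right_minus_eq conj_assoc ..
  have "bounded K" by (rule bounded_subset[OF bounded_cball[of 0 10]]) (auto simp: K_iff)
  with clK have K: "compact K" by (simp add: compact_eq_bounded_closed)
  let ?ray = "complex_of_real ` {0..}"
  have clr: "closed ?ray"
  proof -
    have "?ray = \<real>\<^sub>\<ge>\<^sub>0" by (auto simp: nonneg_Reals_def)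
    then show ?thesis by simp
  qed
  have "\<exists>m>0. \<forall>z\<in>K. m \<le> infdist z ?ray"
  proof (cases "K = {}")
    case False
    obtain z0 where z0: "z0 \<in> K" "\<forall>z\<in>K. infdist z0 ?ray \<le> infdist z ?ray"
      by (rule bexE[OF continuous_attains_inf[OF K False continuous_on_infdist[OF continuous_on_id, where A = ?ray]]]) (rule that)
    have "z0 \<notin> ?ray"
    proof
      assume "z0 \<in> ?ray"
      then obtain x where x: "x \<ge> 0" "z0 = of_real x" by auto
      have "exp (-2) \<le> x" using z0(1) x by (auto simp: K_iff)
      then have "x > 0" by (meson exp_gt_zero less_le_trans)
      moreover have "x - 1 = ln x" using z0(1) x by (auto simp: K_iff)
      ultimately have "x = 1" using ln_eq_minus_one[of x] by simp
      then show False using z0(1) x d by (auto simp: K_iff)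
    qed
    then have "infdist z0 ?ray \<noteq> 0" using in_closed_iff_infdist_zero[OF clr, of z0] by blast
    then have "infdist z0 ?ray > 0" using infdist_nonneg[of z0 ?ray] by linarith
    then show ?thesis using z0(2) by (intro exI[of _ "infdist z0 ?ray"] conjI)
  qed (simp add: exI[of _ 1])
  then obtain m where m: "m > 0" "\<forall>z\<in>K. m \<le> infdist z ?ray" by (elim exE conjE) (rule that)
  have "m \<le> norm (exp v - of_real a)"
    if eq: "exp v = 1 + v - \<i> * of_real t" and mid: "norm (exp v) \<le> 10" "d \<le> norm (exp v - 1)" "a \<ge> 0" for v t a
  proof -
    have "exp (-2) \<le> norm (exp v)" using phase_Re_ge[OF eq] by simp
    moreover have "Re (exp v) = 1 + ln (norm (exp v))" using arg_cong[OF eq, of Re] by simp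
    ultimately have "exp v \<in> K" using mid by (simp add: K_iff)
    then have "m \<le> infdist (exp v) ?ray" using m(2) by (rule bspec[rotated])
    also have "\<dots> \<le> dist (exp v) (of_real a)" using mid by (intro infdist_le) auto
    finally show ?thesis by (simp add: dist_norm)
  qed
  then show ?thesis using m(1) by (intro exI[of _ m] conjI allI impI)
qed

text \<open>The factor \<open>max 1 a\<close> keeps the estimate useful after division by a large a,
  and the minimum with 1 joins the neighbourhood of the saddle, where the distance from 1 counts, to
  the rest.\<close>

lemma distance_to_ray:
  "\<exists>c>0. \<forall>v t a. exp v = 1 + v - \<i> * of_real t \<longrightarrow> a > 0 \<longrightarrow>
     c * max 1 a * min (norm (exp v - 1)) 1 \<le> norm (exp v - of_real a)"
proof -
  obtain C where C: "C > 0" and Csq': "\<forall>v t. exp v = 1 + v - \<i> * of_real t \<longrightarrow> norm (exp v - 1) < 1/2 \<longrightarrow>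
     \<bar>Re ((exp v - 1)\<^sup>2)\<bar> \<le> C * norm (exp v - 1) ^ 3"
    using Re_square_small by (elim exE conjE) (rule that)
  note Csq = Csq'[rule_format]
  \<comment> \<open>Small enough for \<open>Re_square_small\<close> and for the condition C d <= 1/2
    of \<open>distance_to_ray_near\<close>.\<close>
  define d where "d = min (1/4) (1 / (2 * C))"
  have "C * d \<le> C * (1 / (2 * C))" using C unfolding d_def by (intro mult_left_mono min.cobounded2) simp
  then have d: "d > 0" "d < 1/2" "C * d \<le> 1/2" using C by (simp_all add: d_def)
  obtain m where m: "m > 0" and midr: "\<forall>v t a. exp v = 1 + v - \<i> * of_real t \<longrightarrow> norm (exp v) \<le> 10 \<longrightarrow> d \<le> norm (exp v - 1) \<longrightarrow> a \<ge> 0 \<longrightarrow>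
     m \<le> norm (exp v - of_real a)"
    using distance_to_ray_mid[OF d(1)] by (elim exE conjE) (rule that)
  \<comment> \<open>For a <= 20 the factor \<open>max 1 a\<close> is at most 20: c <= 1/40 gives the
    1/2 lost near the saddle, and 20 c <= m covers the compact range.\<close>
  define c where "c = min (m / 20) (min (1/40) (1/8))"
  have "c * max 1 a * min (norm (exp v - 1)) 1 \<le> norm (exp v - of_real a)"
    if eq: "exp v = 1 + v - \<i> * of_real t" and a: "a > 0" for v t a
  proof -
    have c: "c > 0" "c \<le> 1/40" "20 * c \<le> m" using m by (auto simp: c_def)
    let ?M = "min (norm (exp v - 1)) 1"
    have M: "0 \<le> ?M" "?M \<le> 1" "?M \<le> norm (exp v - 1)" by auto
    have le1: "c * max 1 a * ?M \<le> c * max 1 a * 1" using c by (intro mult_left_mono M) auto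
    consider (big) "norm (exp v) > 10" | (far) "norm (exp v) \<le> 10" "a > 20"
      | (sm) "norm (exp v) \<le> 10" "a \<le> 20" "norm (exp v - 1) < d"
      | (mid) "norm (exp v) \<le> 10" "a \<le> 20" "d \<le> norm (exp v - 1)" by linarith
    then show ?thesis
    proof cases
      case big
      have "c * max 1 a \<le> 1/40 * max 1 a" using c by (intro mult_right_mono) auto
      also have "\<dots> \<le> max (norm (exp v)) a * (4/5)" using big by (auto simp: max_def)
      also have "\<dots> \<le> norm (exp v - of_real a)" by (rule distance_to_ray_far[OF eq big a])
      finally show ?thesis using le1 by simp
    next
      case far
      have "c * max 1 a \<le> 1/40 * max 1 a" using c by (intro mult_right_mono) auto
      also have "\<dots> \<le> a - norm (exp v)" using far by (auto simp: max_def)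
      also have "\<dots> \<le> norm (exp v - of_real a)"
        using norm_triangle_ineq3[of "of_real a" "exp v"] a by (simp add: norm_minus_commute)
      finally show ?thesis using le1 by simp
    next
      case sm
      have "c * max 1 a \<le> 1/40 * 20" using c sm a by (intro mult_mono) auto
      then have "c * max 1 a * ?M \<le> 1/2 * norm (exp v - 1)" using M by (intro mult_mono) auto
      then show ?thesis using distance_to_ray_near[OF Csq[OF eq] d(3) C sm(3), of a] sm(3) d(2) by simp
    next
      case mid
      have "m \<le> norm (exp v - of_real a)"
        using midr[rule_format, OF eq mid(1) mid(3)] a by simp
      moreover have "c * max 1 a \<le> c * 20" using c mid a by (intro mult_left_mono) auto
      ultimately show ?thesis using le1 c by linarith
    qed
  qed
  then show ?thesis using m by (intro exI[of _ c] conjI allI impI) (auto simp: c_def)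
qed

section \<open>The tails of the saddle curve\<close>

lemma set_integrable_of_HK_nonneg:
  fixes f :: "real \<Rightarrow> real"
  assumes "f \<in> borel_measurable borel" "f integrable_on A" "A \<in> sets borel" "\<And>x. x \<in> A \<Longrightarrow> 0 \<le> f x"
  shows "set_integrable lborel A f"
proof -
  have "f absolutely_integrable_on A"
    by (rule nonnegative_absolutely_integrable_1[OF assms(2,4)])
  then show ?thesis
    using assms unfolding set_integrable_def by (subst (asm) integrable_completion) auto
qed

lemma set_integrable_norm_bound:
  fixes f :: "real \<Rightarrow> 'b::{banach, second_countable_topology}"
  assumes "set_integrable lborel A g" "f \<in> borel_measurable borel" "A \<in> sets borel" "countable N"
    "\<And>x. x \<in> A \<Longrightarrow> x \<notin> N \<Longrightarrow> norm (f x) \<le> g x"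
  shows "set_integrable lborel A f"
proof -
  have g: "integrable lborel (\<lambda>x. indicator A x *\<^sub>R g x)" using assms(1) by (simp add: set_integrable_def)
  have N: "AE x in lborel. x \<notin> N" by (intro AE_not_in countable_imp_null_set_lborel assms)
  show ?thesis unfolding set_integrable_def
  proof (rule Bochner_Integration.integrable_bound[OF g])
    show "AE x in lborel. norm (indicator A x *\<^sub>R f x) \<le> norm (indicator A x *\<^sub>R g x)"
      using N by eventually_elim (use assms(5) in \<open>auto simp: indicator_def intro!: order_trans[OF _ abs_ge_self]\<close>)
  qed (use assms(2,3) in measurable)
qed

lemma finite_sin_quarter_zeros: "finite {r \<in> {0..b::real}. sin (r\<^sup>2 / 4) = 0}"
proof -
  have "{r \<in> {0..b}. sin (r\<^sup>2 / 4) = 0} \<subseteq> (\<lambda>k::int. 2 * sqrt (of_int k * pi)) ` {0..\<lceil>b\<^sup>2\<rceil>}"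
  proof
    fix r assume "r \<in> {r \<in> {0..b}. sin (r\<^sup>2 / 4) = 0}"
    then have r: "0 \<le> r" "r \<le> b" "sin (r\<^sup>2 / 4) = 0" by auto
    then obtain k :: int where k: "r\<^sup>2 / 4 = of_int k * pi"
      by (auto simp: sin_zero_iff_int2)
    have "sqrt (r\<^sup>2) = sqrt (4 * (of_int k * pi))" using k by simp
    then have rk: "r = 2 * sqrt (of_int k * pi)" using r by (simp add: real_sqrt_mult)
    have "of_int k * pi \<ge> 0" using k by (metis zero_le_divide_iff zero_le_numeral zero_le_power2)
    then have k0: "k \<ge> 0" using pi_gt_zero by (simp add: zero_le_mult_iff)
    have "r\<^sup>2 \<le> b\<^sup>2" using r by (intro power_mono) auto
    then have "of_int k * pi \<le> b\<^sup>2 / 4" using k by simp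
    moreover have "of_int k * 1 \<le> of_int k * pi" using k0 pi_gt3 by (intro mult_left_mono) auto
    ultimately have "of_int k \<le> b\<^sup>2 / 4" by simp
    also have "\<dots> \<le> b\<^sup>2" by simp
    finally have "k \<le> \<lceil>b\<^sup>2\<rceil>" by (meson le_of_int_ceiling of_int_le_iff order_trans)
    then show "r \<in> (\<lambda>k::int. 2 * sqrt (of_int k * pi)) ` {0..\<lceil>b\<^sup>2\<rceil>}"
      using rk k0 by auto
  qed
  then show ?thesis by (rule finite_subset) simp
qed

text \<open>The common majorant of the tails: r^2 / 4 is a multiple of pi at each possible return to
  the saddle, and by \<open>sin_half_le\<close> the reciprocal of |e^v - 1| is at most a multiple of
  the reciprocal root.\<close>

definition damped_root :: "real \<Rightarrow> real" where
  "damped_root r = r * exp (- r\<^sup>2) / sqrt \<bar>sin (r\<^sup>2 / 4)\<bar>"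

text \<open>The function \<open>exp (- r\<^sup>2) * (4 * sqrt (sin (r\<^sup>2 / 4)) * cos (r\<^sup>2 / 4) - 6)\<close> increases through every
  zero of the sine (note that \<open>sqrt\<close> is odd), and its derivative dominates \<open>damped_root\<close>.\<close>

lemma damped_root_integrable: "set_integrable lborel {0..} damped_root"
proof -
  define s where "s r = sin (r\<^sup>2 / 4)" for r :: real
  define q where "q r = sqrt (s r) * cos (r\<^sup>2 / 4)" for r
  define \<Phi> where "\<Phi> r = exp (- r\<^sup>2) * (4 * q r - 6)" for r
  define M where "M r = r * exp (- r\<^sup>2) * (1 / sqrt \<bar>s r\<bar> - 3 * (\<bar>s r\<bar> * sqrt \<bar>s r\<bar>) - 8 * q r + 12)" for r
  have qd: "(q has_real_derivative (r / 2 * (1 / (2 * sqrt \<bar>s r\<bar>) - 3/2 * (\<bar>s r\<bar> * sqrt \<bar>s r\<bar>)))) (at r)" if "s r \<noteq> 0" for r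
  proof -
    have sd: "(s has_real_derivative (cos (r\<^sup>2 / 4) * (r / 2))) (at r)"
      unfolding s_def[abs_def] by (auto intro!: derivative_eq_intros)
    have "(sqrt has_real_derivative (1 / (2 * sqrt \<bar>s r\<bar>))) (at (s r))"
    proof (rule DERIV_real_sqrt_generic[OF that])
      show "0 < s r \<Longrightarrow> 1 / (2 * sqrt \<bar>s r\<bar>) = inverse (sqrt (s r)) / 2" by (simp add: divide_simps)
      show "s r < 0 \<Longrightarrow> 1 / (2 * sqrt \<bar>s r\<bar>) = - inverse (sqrt (s r)) / 2" by (simp add: divide_simps real_sqrt_minus)
    qed
    from DERIV_chain2[OF this sd]
    have rd: "((\<lambda>r. sqrt (s r)) has_real_derivative (1 / (2 * sqrt \<bar>s r\<bar>) * (cos (r\<^sup>2 / 4) * (r / 2)))) (at r)" .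
    have "((\<lambda>r. cos (r\<^sup>2 / 4)) has_real_derivative (- s r * (r / 2))) (at r)"
      unfolding s_def by (auto intro!: derivative_eq_intros)
    from DERIV_mult[OF rd this]
    have "(q has_real_derivative (1 / (2 * sqrt \<bar>s r\<bar>) * (cos (r\<^sup>2 / 4) * (r / 2)) * cos (r\<^sup>2 / 4) + - s r * (r / 2) * sqrt (s r))) (at r)"
      unfolding q_def[abs_def] .
    moreover have "1 / (2 * sqrt \<bar>s r\<bar>) * (cos (r\<^sup>2 / 4) * (r / 2)) * cos (r\<^sup>2 / 4) + - s r * (r / 2) * sqrt (s r)
       = r / 2 * (1 / (2 * sqrt \<bar>s r\<bar>) - 3/2 * (\<bar>s r\<bar> * sqrt \<bar>s r\<bar>))"
    proof -
      define w where "w = sqrt \<bar>s r\<bar>"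
      have w: "w > 0" "w * w = \<bar>s r\<bar>" using that by (auto simp: w_def)
      have sw: "s r * sqrt (s r) = w * w * w"
        using w by (cases "s r > 0") (auto simp: w_def real_sqrt_minus)
      have c2: "cos (r\<^sup>2 / 4) * cos (r\<^sup>2 / 4) = 1 - w * w * (w * w)"
        using sin_cos_squared_add[of "r\<^sup>2 / 4"] unfolding w(2) by (simp add: s_def power2_eq_square abs_mult_self_eq)
      have "1 / (2 * w) * (cos (r\<^sup>2 / 4) * (r / 2)) * cos (r\<^sup>2 / 4) + - s r * (r / 2) * sqrt (s r)
         = r / 2 * (1 / (2 * w) * (cos (r\<^sup>2 / 4) * cos (r\<^sup>2 / 4)) - s r * sqrt (s r))"
        by (simp add: algebra_simps)
      also have "\<dots> = r / 2 * (1 / (2 * w) - 3/2 * (w * w * w))"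
        unfolding c2 sw using w(1) by (simp add: field_simps)
      also have "w * w * w = \<bar>s r\<bar> * w" by (simp only: w(2))
      finally show ?thesis by (simp only: w_def)
    qed
    ultimately show ?thesis by (simp only:)
  qed
  have \<Phi>d: "(\<Phi> has_real_derivative M r) (at r)" if "s r \<noteq> 0" for r
  proof -
    have "(\<Phi> has_real_derivative (exp (- r\<^sup>2) * (4 * (r / 2 * (1 / (2 * sqrt \<bar>s r\<bar>) - 3/2 * (\<bar>s r\<bar> * sqrt \<bar>s r\<bar>)))) + exp (- r\<^sup>2) * (- 2 * r) * (4 * q r - 6))) (at r)"
      unfolding \<Phi>_def[abs_def] by (rule derivative_eq_intros qd that refl)+ (simp add: algebra_simps)
    moreover have "exp (- r\<^sup>2) * (4 * (r / 2 * (1 / (2 * z) - 3/2 * y))) + exp (- r\<^sup>2) * (- 2 * r) * (4 * q r - 6)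
       = r * exp (- r\<^sup>2) * (1 / z - 3 * y - 8 * q r + 12)" for y z
      by (simp add: algebra_simps)
    ultimately show ?thesis unfolding M_def by (simp only:)
  qed
  have q1: "\<bar>q r\<bar> \<le> 1" for r
  proof -
    have "\<bar>sqrt (s r)\<bar> \<le> 1" unfolding s_def by (simp add: real_sqrt_abs2 flip: real_sqrt_abs') 
    then show ?thesis unfolding q_def abs_mult using mult_mono[of "\<bar>sqrt (s r)\<bar>" 1 "\<bar>cos (r\<^sup>2 / 4)\<bar>" 1] by simp
  qed
  have cont: "continuous_on A \<Phi>" for A
    unfolding \<Phi>_def[abs_def] q_def[abs_def] s_def[abs_def] by (intro continuous_intros) auto
  have sw1: "\<bar>s r\<bar> * sqrt \<bar>s r\<bar> \<le> 1" for r
    using mult_mono[of "\<bar>s r\<bar>" 1 "sqrt \<bar>s r\<bar>" 1] by (simp add: s_def)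
  have Mge: "damped_root r \<le> M r" "0 \<le> damped_root r" if "r \<ge> 0" for r
  proof -
    \<comment> \<open>The 12, which stems from the -6 in \<Phi>, outweighs the two terms of size at
      most 3 and 8.\<close>
    have "1 / sqrt \<bar>s r\<bar> \<le> 1 / sqrt \<bar>s r\<bar> - 3 * (\<bar>s r\<bar> * sqrt \<bar>s r\<bar>) - 8 * q r + 12"
      using q1[of r] sw1[of r] by (simp add: abs_le_iff)
    then have "r * exp (- r\<^sup>2) * (1 / sqrt \<bar>s r\<bar>) \<le> M r" unfolding M_def using that by (intro mult_left_mono) auto
    then show "damped_root r \<le> M r" by (simp add: damped_root_def s_def)
    show "0 \<le> damped_root r" using that by (simp add: damped_root_def)
  qed
  have int: "(M has_integral (\<Phi> y - \<Phi> 0)) {0..y}" if "y \<ge> 0" for y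
  proof (rule fundamental_theorem_of_calculus_strong[OF finite_sin_quarter_zeros[of y] that])
    fix x assume "x \<in> {0..y} - {r \<in> {0..y}. sin (r\<^sup>2 / 4) = 0}"
    then have "s x \<noteq> 0" by (auto simp: s_def)
    then show "(\<Phi> has_vector_derivative M x) (at x)"
      using \<Phi>d by (simp add: has_real_derivative_iff_has_vector_derivative)
  qed (rule cont)
  have "(M has_integral (0 - \<Phi> 0)) {0..}"
  proof (rule has_integral_to_inf)
    show "M integrable_on {0..y}" for y
      using int[of y] by (cases "y \<ge> 0") (auto simp: integrable_on_def)
    have "(\<Phi> \<longlongrightarrow> 0) at_top"
    proof (rule Lim_null_comparison)
      have "norm (\<Phi> r) \<le> 10 * exp (- r)" if "r \<ge> 1" for r
      proof -
        have "norm (\<Phi> r) = exp (- r\<^sup>2) * \<bar>4 * q r - 6\<bar>" by (simp add: \<Phi>_def abs_mult)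
        also have "\<dots> \<le> exp (- r) * 10"
          using q1[of r] that power_increasing[of 1 2 r] by (intro mult_mono) (auto simp: abs_le_iff)
        finally show ?thesis by simp
      qed
      then show "eventually (\<lambda>r. norm (\<Phi> r) \<le> 10 * exp (- r)) at_top"
        using eventually_ge_at_top[of 1] by (rule eventually_mono[rotated])
      have "((\<lambda>r::real. exp (- r)) \<longlongrightarrow> 0) at_top"
        by (intro filterlim_compose[OF exp_at_bot] filterlim_uminus_at_bot_at_top)
      then show "((\<lambda>r::real. 10 * exp (- r)) \<longlongrightarrow> 0) at_top" by (rule tendsto_mult_right_zero)
    qed
    then have "((\<lambda>y. \<Phi> y - \<Phi> 0) \<longlongrightarrow> 0 - \<Phi> 0) at_top" by (intro tendsto_intros)
    moreover have "eventually (\<lambda>y. integral {0..y} M = \<Phi> y - \<Phi> 0) at_top"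
      using eventually_ge_at_top[of 0] by eventually_elim (rule integral_unique[OF int])
    ultimately show "((\<lambda>y. integral {0..y} M) \<longlongrightarrow> 0 - \<Phi> 0) at_top" by (simp add: tendsto_cong)
    show "0 \<le> M y" if "0 \<le> y" for y using Mge[OF that] by linarith
  qed
  then have "M integrable_on {0..}" by (rule has_integral_integrable)
  moreover have "M \<in> borel_measurable borel"
    unfolding M_def[abs_def] q_def[abs_def] s_def[abs_def] by measurable
  ultimately have M: "set_integrable lborel {0..} M"
    using Mge by (intro set_integrable_of_HK_nonneg) (auto intro: order_trans)
  show ?thesis
  proof (rule set_integrable_norm_bound[OF M, where N = "{}"])
    show "damped_root \<in> borel_measurable borel" unfolding damped_root_def[abs_def] by measurable
    show "norm (damped_root x) \<le> M x" if "x \<in> {0..}" for x using Mge[of x] that by simp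
  qed simp_all
qed

definition sine_zeros :: "real set" where
  "sine_zeros = {r. 0 \<le> r \<and> sin (r\<^sup>2 / 4) = 0}"

lemma countable_sine_zeros: "countable sine_zeros"
proof -
  have "sine_zeros \<subseteq> (\<Union>n::nat. {r \<in> {0..real n}. sin (r\<^sup>2 / 4) = 0})"
  proof
    fix r assume r: "r \<in> sine_zeros"
    have "r \<le> real (nat \<lceil>r\<rceil>)" by (rule real_nat_ceiling_ge)
    then show "r \<in> (\<Union>n::nat. {r \<in> {0..real n}. sin (r\<^sup>2 / 4) = 0})"
      using r by (intro UN_I[of "nat \<lceil>r\<rceil>"]) (simp_all add: sine_zeros_def)
  qed
  moreover have "countable (\<Union>n::nat. {r \<in> {0..real n}. sin (r\<^sup>2 / 4) = 0})"
    by (rule countable_UN[OF countableI_type], rule countable_finite, rule finite_sin_quarter_zeros)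
  ultimately show ?thesis by (rule countable_subset)
qed

text \<open>Half of the Gaussian exponent yields the factor e^(-lam t0 / 2), the other half pays for
  the growth e^(r^2 / 2) and leaves the majorant \<open>damped_root\<close>. The factor
  \<open>lam\<close> in front is the price of the integrations by parts that follow, absorbed by
  half of the exponential decay.\<close>

lemma gaussian_tail_bound:
  assumes "0 < \<rho>"
  shows "\<exists>C\<ge>0. \<exists>c>0. \<forall>lam\<ge>6. \<forall>B\<ge>0. \<forall>f :: real \<Rightarrow> complex.
     f \<in> borel_measurable borel \<longrightarrow>
     (\<forall>r\<ge>\<rho>. r \<notin> sine_zeros \<longrightarrow> norm (f r) \<le> B * (exp (r\<^sup>2 / 2) / sqrt \<bar>sin (r\<^sup>2 / 4)\<bar>)) \<longrightarrow>
     set_integrable lborel {\<rho>..} (\<lambda>r. (r * exp (- (lam / 2) * r\<^sup>2)) *\<^sub>R f r) \<and>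
     lam * norm (LINT r:{\<rho>..}|lborel. (r * exp (- (lam / 2) * r\<^sup>2)) *\<^sub>R f r) \<le> C * B * exp (- c * lam)"
proof -
  define I where "I = (LINT r:{\<rho>..}|lborel. damped_root r)"
  have dint: "set_integrable lborel {\<rho>..} damped_root"
    by (rule set_integrable_subset[OF damped_root_integrable]) (use assms in auto)
  have dpos: "damped_root r \<ge> 0" if "r \<ge> 0" for r using that by (simp add: damped_root_def)
  have I: "I \<ge> 0" unfolding I_def set_lebesgue_integral_def
    by (rule Bochner_Integration.integral_nonneg) (use dpos assms in \<open>auto simp: indicator_def\<close>)
  define t0 where "t0 = \<rho>\<^sup>2 / 2"
  have t0: "t0 > 0" using assms by (simp add: t0_def)
  have main: "set_integrable lborel {\<rho>..} (\<lambda>r. (r * exp (- (lam / 2) * r\<^sup>2)) *\<^sub>R f r) \<and>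
     lam * norm (LINT r:{\<rho>..}|lborel. (r * exp (- (lam / 2) * r\<^sup>2)) *\<^sub>R f r) \<le> (4 / t0 * I) * B * exp (- (t0 / 4) * lam)"
    if lam: "lam \<ge> 6" and B: "B \<ge> 0" and fm: "f \<in> borel_measurable borel"
      and fb: "\<forall>r\<ge>\<rho>. r \<notin> sine_zeros \<longrightarrow> norm (f r) \<le> B * (exp (r\<^sup>2 / 2) / sqrt \<bar>sin (r\<^sup>2 / 4)\<bar>)"
    for lam B and f :: "real \<Rightarrow> complex"
  proof -
    let ?h = "\<lambda>r. (r * exp (- (lam / 2) * r\<^sup>2)) *\<^sub>R f r"
    let ?k = "B * exp (- (lam / 2) * t0)"
    have hb: "norm (?h r) \<le> ?k * damped_root r" if r: "r \<ge> \<rho>" "r \<notin> sine_zeros" for r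
    proof -
      have r0: "r \<ge> 0" using r assms by simp
      have "norm (?h r) = r * exp (- (lam / 2) * r\<^sup>2) * norm (f r)" using r0 by simp
      also have "\<dots> \<le> r * exp (- (lam / 2) * r\<^sup>2) * (B * (exp (r\<^sup>2 / 2) / sqrt \<bar>sin (r\<^sup>2 / 4)\<bar>))"
        using fb r r0 by (intro mult_left_mono) auto
      also have "\<dots> = (exp (- (lam / 2) * r\<^sup>2) * exp (r\<^sup>2 / 2)) * (B * r / sqrt \<bar>sin (r\<^sup>2 / 4)\<bar>)"
        by (simp only: times_divide_eq_right times_divide_eq_left mult_ac)
      also have "\<dots> \<le> (exp (- (lam / 2) * t0) * exp (- r\<^sup>2)) * (B * r / sqrt \<bar>sin (r\<^sup>2 / 4)\<bar>)"
      proof (rule mult_right_mono)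
        have "t0 \<le> r\<^sup>2 / 2" unfolding t0_def using r assms by (intro divide_right_mono power_mono) auto
        then have "lam / 2 * t0 \<le> lam / 2 * (r\<^sup>2 / 2)" using lam by (intro mult_left_mono) auto
        \<comment> \<open>The condition lam >= 6 comes from here: 6/4 = 1/2 + 1, the growth of the
          weight plus the exponent kept for \<open>damped_root\<close>.\<close>
        moreover have "6 * (r\<^sup>2 / 4) \<le> lam * (r\<^sup>2 / 4)" using lam by (intro mult_right_mono) auto
        ultimately have "- (lam / 2) * r\<^sup>2 + r\<^sup>2 / 2 \<le> - (lam / 2) * t0 + - r\<^sup>2" by (simp add: algebra_simps)
        then show "exp (- (lam / 2) * r\<^sup>2) * exp (r\<^sup>2 / 2) \<le> exp (- (lam / 2) * t0) * exp (- r\<^sup>2)"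
          by (simp only: exp_add[symmetric] exp_le_cancel_iff)
        show "0 \<le> B * r / sqrt \<bar>sin (r\<^sup>2 / 4)\<bar>" using B r0 by simp
      qed
      also have "\<dots> = ?k * damped_root r" by (simp add: damped_root_def)
      finally show ?thesis .
    qed
    have hm: "?h \<in> borel_measurable borel" using fm by measurable
    have kint: "set_integrable lborel {\<rho>..} (\<lambda>r. ?k * damped_root r)"
      using dint by (rule set_integrable_mult_right)
    have hint: "set_integrable lborel {\<rho>..} ?h"
      by (rule set_integrable_norm_bound[OF kint hm _ countable_sine_zeros]) (use hb in auto)
    have N: "AE x in lborel. x \<notin> sine_zeros" by (intro AE_not_in countable_imp_null_set_lborel countable_sine_zeros)
    have "norm (LINT r:{\<rho>..}|lborel. ?h r) \<le> (LINT r:{\<rho>..}|lborel. norm (?h r))"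
      unfolding set_lebesgue_integral_def by (rule order_trans[OF integral_norm_bound]) (simp add: abs_mult mult.assoc)
    also have "\<dots> \<le> (LINT r:{\<rho>..}|lborel. ?k * damped_root r)"
    proof (rule set_integral_mono_AE[OF set_integrable_norm[OF hint] kint])
      show "AE x\<in>{\<rho>..} in lborel. norm (?h x) \<le> ?k * damped_root x"
        using N by eventually_elim (use hb in auto)
    qed
    also have "\<dots> = ?k * I" unfolding I_def by (rule set_integral_mult_right)
    finally have "lam * norm (LINT r:{\<rho>..}|lborel. ?h r) \<le> lam * (?k * I)"
      using lam by (intro mult_left_mono) auto
    also have "\<dots> = (4 / t0 * (lam * t0 / 4)) * (B * I) * exp (- (lam / 2) * t0)"
      using t0 by simp
    also have "\<dots> \<le> (4 / t0 * exp (lam * t0 / 4)) * (B * I) * exp (- (lam / 2) * t0)"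
    proof (intro mult_right_mono mult_left_mono)
      show "lam * t0 / 4 \<le> exp (lam * t0 / 4)" using exp_ge_add_one_self[of "lam * t0 / 4"] by linarith
    qed (use t0 B I in auto)
    also have "\<dots> = (4 / t0 * I) * B * (exp (lam * t0 / 4) * exp (- (lam / 2) * t0))" by simp
    also have "exp (lam * t0 / 4) * exp (- (lam / 2) * t0) = exp (- (t0 / 4) * lam)"
      by (simp add: exp_add[symmetric] field_simps)
    finally show ?thesis using hint by simp
  qed
  show ?thesis
    by (rule exI[of _ "4 / t0 * I"], rule conjI, use t0 I in simp, rule exI[of _ "t0 / 4"], rule conjI, use t0 in simp,
        intro allI impI, rule main, assumption+)
qed

text \<open>Integration by parts against the Gaussian. \<open>f\<close> starts at 0, so no term
  arises at \<rho>. At the other end \<open>f\<close> is controlled only away from the zeros of the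
  sine; as both integrals exist, it is enough to let the end point run through a sequence that
  avoids them.\<close>

lemma by_parts_tail:
  fixes f f' :: "real \<Rightarrow> complex"
  assumes \<rho>: "0 < \<rho>" and lam: "lam \<ge> 6" and B: "B \<ge> 0"
    and cont: "continuous_on {\<rho>..} f" and f0: "f \<rho> = 0"
    and fin: "\<And>b. finite (S \<inter> {\<rho>..b})"
    and der: "\<And>r. r \<ge> \<rho> \<Longrightarrow> r \<notin> S \<Longrightarrow> (f has_vector_derivative f' r) (at r)"
    and fb: "\<forall>r\<ge>\<rho>. r \<notin> sine_zeros \<longrightarrow> norm (f r) \<le> B * (exp (r\<^sup>2 / 2) / sqrt \<bar>sin (r\<^sup>2 / 4)\<bar>)"
    and int1: "set_integrable lborel {\<rho>..} (\<lambda>r. exp (- (lam / 2) * r\<^sup>2) *\<^sub>R f' r)"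
    and int2: "set_integrable lborel {\<rho>..} (\<lambda>r. (r * exp (- (lam / 2) * r\<^sup>2)) *\<^sub>R f r)"
  shows "(LINT r:{\<rho>..}|lborel. exp (- (lam / 2) * r\<^sup>2) *\<^sub>R f' r)
      = lam *\<^sub>R (LINT r:{\<rho>..}|lborel. (r * exp (- (lam / 2) * r\<^sup>2)) *\<^sub>R f r)"
proof -
  let ?e = "\<lambda>r. exp (- (lam / 2) * r\<^sup>2)"
  let ?h = "\<lambda>r. ?e r *\<^sub>R f' r - lam *\<^sub>R ((r * ?e r) *\<^sub>R f r)"
  have hint: "set_integrable lborel {\<rho>..} ?h"
    by (intro set_integral_diff int1 set_integrable_scaleR_right int2)
  have lim: "((\<lambda>b. LINT r:{\<rho>..b}|lborel. ?h r) \<longlongrightarrow> (LINT r:{\<rho>..}|lborel. ?h r)) at_top"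
    by (rule tendsto_set_lebesgue_integral_at_top[OF _ hint]) simp
  \<comment> \<open>At these points r^2 / 4 is an odd multiple of pi / 2, so that |sin (r^2 / 4)| =
    1 and the weight is harmless.\<close>
  define X where "X n = 2 * sqrt (pi / 2 + real n * pi)" for n :: nat
  have X2: "(X n)\<^sup>2 / 4 = pi / 2 + real n * pi" for n
    by (simp add: X_def power_mult_distrib add_nonneg_nonneg)
  have Xs: "\<bar>sin ((X n)\<^sup>2 / 4)\<bar> = 1" for n
    unfolding X2 by (simp add: sin_add cos_npi power_abs mult.commute[of "real n" pi])
  have Xtop: "filterlim X at_top sequentially"
  proof -
    have "filterlim (\<lambda>n. pi / 2 + real n * pi) at_top sequentially"
      by (intro filterlim_tendsto_add_at_top[OF tendsto_const] filterlim_at_top_mult_tendsto_pos[OF tendsto_const _ filterlim_real_sequentially]) simp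
    then have "filterlim (\<lambda>n. sqrt (pi / 2 + real n * pi)) at_top sequentially"
      by (rule filterlim_compose[OF sqrt_at_top])
    then show ?thesis unfolding X_def
      by (intro filterlim_tendsto_pos_mult_at_top[OF tendsto_const]) simp
  qed
  have seg: "(LINT r:{\<rho>..b}|lborel. ?h r) = ?e b *\<^sub>R f b" if b: "b \<ge> \<rho>" for b
  proof -
    have "(?h has_integral (?e b *\<^sub>R f b - ?e \<rho> *\<^sub>R f \<rho>)) {\<rho>..b}"
    proof (rule fundamental_theorem_of_calculus_strong[OF fin[of b] b])
      show "continuous_on {\<rho>..b} (\<lambda>r. ?e r *\<^sub>R f r)"
        by (intro continuous_intros continuous_on_subset[OF cont]) auto
      fix r assume r: "r \<in> {\<rho>..b} - S \<inter> {\<rho>..b}"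
      have fd: "(f has_vector_derivative f' r) (at r)" using r by (intro der) auto
      have ed: "(?e has_real_derivative - (lam * r * ?e r)) (at r)"
        by (auto intro!: derivative_eq_intros)
      have "((\<lambda>r. ?e r *\<^sub>R f r) has_vector_derivative ?e r *\<^sub>R f' r + (- (lam * r * ?e r)) *\<^sub>R f r) (at r)"
        by (rule has_vector_derivative_scaleR[OF ed fd])
      then show "((\<lambda>r. ?e r *\<^sub>R f r) has_vector_derivative ?h r) (at r)"
        by (simp add: mult.assoc)
    qed
    then have "integral {\<rho>..b} ?h = ?e b *\<^sub>R f b" by (simp add: f0 integral_unique)
    moreover have "set_integrable lborel {\<rho>..b} ?h"
      by (rule set_integrable_subset[OF hint]) auto
    ultimately show ?thesis by (simp add: set_borel_integral_eq_integral(2))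
  qed
  have "((\<lambda>n. LINT r:{\<rho>..X n}|lborel. ?h r) \<longlonglongrightarrow> 0)"
  proof (rule Lim_null_comparison)
    have "eventually (\<lambda>n. X n \<ge> max \<rho> 1) sequentially"
      using Xtop filterlim_at_top by blast
    then show "eventually (\<lambda>n. norm (LINT r:{\<rho>..X n}|lborel. ?h r) \<le> B * exp (- X n)) sequentially"
    proof eventually_elim
      case (elim n)
      have nz: "X n \<notin> sine_zeros" using Xs[of n] by (auto simp: sine_zeros_def)
      have "norm (LINT r:{\<rho>..X n}|lborel. ?h r) = ?e (X n) * norm (f (X n))"
        using seg[of "X n"] elim by simp
      also have "\<dots> \<le> ?e (X n) * (B * (exp ((X n)\<^sup>2 / 2) / sqrt \<bar>sin ((X n)\<^sup>2 / 4)\<bar>))"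
        using fb nz elim by (intro mult_left_mono) auto
      also have "\<dots> = B * (?e (X n) * exp ((X n)\<^sup>2 / 2))" unfolding Xs by simp
      also have "?e (X n) * exp ((X n)\<^sup>2 / 2) \<le> exp (- X n)"
      proof -
        have "X n \<le> (X n)\<^sup>2" using elim by (simp add: power2_eq_square mult_le_cancel_left1)
        moreover have "3 * (X n)\<^sup>2 \<le> lam / 2 * (X n)\<^sup>2" using lam by (intro mult_right_mono) auto
        moreover have "0 \<le> (X n)\<^sup>2" by simp
        ultimately have "- (lam / 2) * (X n)\<^sup>2 + (X n)\<^sup>2 / 2 \<le> - X n" unfolding mult_minus_left by linarith
        then show ?thesis by (simp only: exp_add[symmetric] exp_le_cancel_iff)
      qed
      finally show ?case using B by (simp add: mult_left_mono)
    qed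
    have "((\<lambda>r::real. exp (- r)) \<longlongrightarrow> 0) at_top"
      by (intro filterlim_compose[OF exp_at_bot] filterlim_uminus_at_bot_at_top)
    then show "(\<lambda>n. B * exp (- X n)) \<longlonglongrightarrow> 0"
      by (intro tendsto_mult_right_zero filterlim_compose[OF _ Xtop])
  qed
  moreover have "((\<lambda>n. LINT r:{\<rho>..X n}|lborel. ?h r) \<longlonglongrightarrow> (LINT r:{\<rho>..}|lborel. ?h r))"
    by (rule filterlim_compose[OF lim Xtop])
  ultimately have "(LINT r:{\<rho>..}|lborel. ?h r) = 0" by (rule LIMSEQ_unique[symmetric])
  moreover have "(LINT r:{\<rho>..}|lborel. ?h r) = (LINT r:{\<rho>..}|lborel. ?e r *\<^sub>R f' r) - (LINT r:{\<rho>..}|lborel. lam *\<^sub>R ((r * ?e r) *\<^sub>R f r))"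
    by (intro set_integral_diff int1 set_integrable_scaleR_right int2)
  ultimately have "(LINT r:{\<rho>..}|lborel. ?e r *\<^sub>R f' r) - lam *\<^sub>R (LINT r:{\<rho>..}|lborel. (r * ?e r) *\<^sub>R f r) = 0"
    by (simp only: set_integral_scaleR_right)
  then show ?thesis by (rule eq_iff_diff_eq_0[THEN iffD2])
qed

text \<open>Continuity and the phase equation are all that is assumed: no derivative, and no choice
  of branch at later saddle points. Whatever is proved here holds for every admissible
  curve.\<close>

locale phase_curve =
  fixes v :: "real \<Rightarrow> complex"
  assumes cont_v: "continuous_on UNIV v" and v_0 [simp]: "v 0 = 0"
    and phase: "exp (v r) - 1 - v r = - \<i> * (of_real r)\<^sup>2 / 2"
begin

lemma phase_eq: "exp (v r) = 1 + v r - \<i> * of_real (r\<^sup>2 / 2)"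
  using phase[of r] by (simp add: algebra_simps)

text \<open>Differentiability out of continuity alone. In Caratheodory's form of the derivative of
  e^z - 1 - z the increment of the phase factors through v s - v r, with a continuous cofactor that
  is nonzero at r; division by it gives the difference quotient of v.\<close>

lemma v_deriv:
  assumes "exp (v r) \<noteq> 1"
  shows "(v has_vector_derivative (- \<i> * of_real r / (exp (v r) - 1))) (at r)"
proof -
  have "((\<lambda>z. exp z - 1 - z) has_field_derivative (exp (v r) - 1)) (at (v r))"
    by (auto intro!: derivative_eq_intros)
  then obtain g where g: "\<And>z. (exp z - 1 - z) - (exp (v r) - 1 - v r) = g z * (z - v r)"
      "isCont g (v r)" "g (v r) = exp (v r) - 1"
    unfolding CARAT_DERIV by auto
  define h where "h s = - \<i> * of_real (s + r) / 2 / g (v s)" for s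
  have vc: "isCont v x" for x using cont_v by (simp add: continuous_on_eq_continuous_at)
  have gc: "isCont (\<lambda>s. g (v s)) r" by (rule isCont_o2[OF vc g(2)])
  have gnz: "g (v r) \<noteq> 0" using assms g(3) by simp
  have "eventually (\<lambda>s. g (v s) \<noteq> 0) (at r)"
    using gc gnz unfolding isCont_def by (rule tendsto_imp_eventually_ne)
  then obtain d where d: "d > 0" "\<And>s. s \<noteq> r \<Longrightarrow> dist s r < d \<Longrightarrow> g (v s) \<noteq> 0"
    unfolding eventually_at by auto
  have eq: "v s - v r = of_real (s - r) * h s" if "dist s r < d" for s
  proof (cases "s = r")
    case False
    have "(exp (v s) - 1 - v s) - (exp (v r) - 1 - v r) = of_real (s - r) * (- \<i> * of_real (s + r) / 2)"
      unfolding phase by (simp add: power2_eq_square algebra_simps diff_divide_distrib)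
    then have "g (v s) * (v s - v r) = of_real (s - r) * (- \<i> * of_real (s + r) / 2)"
      using g(1)[of "v s"] by simp
    then show ?thesis using d(2)[OF False that] by (simp add: h_def field_simps)
  qed simp
  have hr: "h r = - \<i> * of_real r / (exp (v r) - 1)" by (simp add: h_def g(3))
  have "isCont h r" unfolding h_def by (intro continuous_intros gc gnz) simp
  then have hlim: "(h \<longlongrightarrow> h r) (at r)" by (simp add: isCont_def)
  show ?thesis
    unfolding has_vector_derivative_def has_derivative_at_alt
  proof (intro conjI allI impI)
    fix e :: real assume "e > 0"
    then have "eventually (\<lambda>s. dist (h s) (h r) < e) (at r)" by (rule tendstoD[OF hlim])
    then obtain d' where d': "d' > 0" "\<And>s. s \<noteq> r \<Longrightarrow> dist s r < d' \<Longrightarrow> dist (h s) (h r) < e"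
      unfolding eventually_at by auto
    show "\<exists>d>0. \<forall>y. norm (y - r) < d \<longrightarrow> norm (v y - v r - (y - r) *\<^sub>R (- \<i> * of_real r / (exp (v r) - 1))) \<le> e * norm (y - r)"
    proof (intro exI[of _ "min d d'"] conjI allI impI)
      fix y assume y: "norm (y - r) < min d d'"
      have "v y - v r - (y - r) *\<^sub>R h r = of_real (y - r) * (h y - h r)"
        using eq[of y] y by (simp add: dist_norm scaleR_conv_of_real right_diff_distrib)
      then have "norm (v y - v r - (y - r) *\<^sub>R h r) = dist (h y) (h r) * norm (y - r)"
        by (simp only: norm_mult norm_of_real real_norm_def dist_norm mult.commute)
      also have "\<dots> \<le> e * norm (y - r)"
        using d'(2)[of y] y \<open>e > 0\<close> by (cases "y = r") (auto intro!: mult_right_mono simp: dist_norm)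
      finally show "norm (v y - v r - (y - r) *\<^sub>R (- \<i> * of_real r / (exp (v r) - 1))) \<le> e * norm (y - r)"
        unfolding hr .
    qed (use d d' in simp)
  qed (rule bounded_linear_scaleR_left)
qed

lemma sin_quarter_le: "\<bar>sin (r\<^sup>2 / 4)\<bar> \<le> 4 * (norm (exp (v r) - 1))\<^sup>2"
  using sin_half_le[OF phase_eq[of r]] by simp

lemma exp_eq_1_sin: "r \<ge> 0 \<Longrightarrow> exp (v r) = 1 \<Longrightarrow> r \<in> sine_zeros"
  using sin_quarter_le[of r] by (simp add: sine_zeros_def)

lemma inverse_D_le:
  assumes "r \<ge> 0" "r \<notin> sine_zeros"
  shows "1 / norm (exp (v r) - 1) \<le> 2 / sqrt \<bar>sin (r\<^sup>2 / 4)\<bar>"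
proof -
  have s: "sqrt \<bar>sin (r\<^sup>2 / 4)\<bar> > 0" using assms by (simp add: sine_zeros_def)
  have "\<bar>sin (r\<^sup>2 / 4)\<bar> \<le> (2 * norm (exp (v r) - 1))\<^sup>2"
    using sin_quarter_le[of r] by (simp add: power_mult_distrib)
  then have "sqrt \<bar>sin (r\<^sup>2 / 4)\<bar> \<le> sqrt ((2 * norm (exp (v r) - 1))\<^sup>2)" by (rule real_sqrt_le_mono)
  also have "\<dots> = 2 * norm (exp (v r) - 1)" by (simp only: real_sqrt_abs) simp
  finally have le: "sqrt \<bar>sin (r\<^sup>2 / 4)\<bar> \<le> 2 * norm (exp (v r) - 1)" .
  then have "0 < 2 * norm (exp (v r) - 1)" using s by linarith
  with le have "2 / (2 * norm (exp (v r) - 1)) \<le> 2 / sqrt \<bar>sin (r\<^sup>2 / 4)\<bar>"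
    using s by (intro divide_left_mono mult_pos_pos) auto
  then show ?thesis by simp
qed

lemma one_le_inverse_root:
  assumes "r \<ge> 0" "r \<notin> sine_zeros"
  shows "1 \<le> 1 / sqrt \<bar>sin (r\<^sup>2 / 4)\<bar>"
proof -
  have "sqrt \<bar>sin (r\<^sup>2 / 4)\<bar> > 0" using assms by (simp add: sine_zeros_def)
  moreover have "sqrt \<bar>sin (r\<^sup>2 / 4)\<bar> \<le> 1" by simp
  ultimately show ?thesis by (simp add: field_simps)
qed

text \<open>After the last point with \<open>norm (exp (v r) - 1) \<le> 1/4\<close>, which is close to a multiple of \<open>2 * pi * \<i>\<close>,
  the speed is at most \<open>4 * r\<close>.\<close>

lemma norm_v_le:
  assumes "r \<ge> 0"
  shows "norm (v r) \<le> 2 + 2 * r\<^sup>2"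
proof -
  define A where "A = {s \<in> {0..r}. norm (exp (v s) - 1) \<le> 1/4}"
  have "compact A"
  proof -
    have "closed ({0..r} \<inter> (\<lambda>s. norm (exp (v s) - 1)) -` {..1/4})"
      by (intro continuous_closed_preimage continuous_intros continuous_on_subset[OF cont_v]) auto
    also have "{0..r} \<inter> (\<lambda>s. norm (exp (v s) - 1)) -` {..1/4} = A" by (auto simp: A_def)
    finally have "closed A" .
    moreover have "bounded A" by (rule bounded_subset[of "{0..r}"]) (auto simp: A_def)
    ultimately show ?thesis by (simp add: compact_eq_bounded_closed)
  qed
  moreover have "0 \<in> A" using assms by (simp add: A_def)
  ultimately obtain r0 where r0: "r0 \<in> A" "\<forall>s\<in>A. s \<le> r0"
    using compact_attains_sup[of A] by auto
  have r0': "0 \<le> r0" "r0 \<le> r" "norm (exp (v r0) - 1) < 1/2" "norm (exp (v r0) - 1) \<le> 1/4" using r0 by (auto simp: A_def)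
  have v0: "norm (v r0) \<le> r0\<^sup>2 / 2 + 1"
  proof -
    obtain k :: int where k: "\<bar>r0\<^sup>2 / 2 - 2 * pi * of_int k\<bar> \<le> 2 * (norm (exp (v r0) - 1))\<^sup>2"
      "norm (v r0 - 2 * pi * of_int k * \<i>) \<le> 2 * norm (exp (v r0) - 1)"
      by (rule phase_near_lattice[OF phase_eq r0'(3)])
    have "(norm (exp (v r0) - 1))\<^sup>2 \<le> (1/4)\<^sup>2" using r0'(4) by (intro power_mono) auto
    then have "\<bar>r0\<^sup>2 / 2 - 2 * pi * of_int k\<bar> \<le> 1/8" using k(1) by (simp add: power2_eq_square)
    moreover have "norm (v r0) \<le> norm (v r0 - 2 * pi * of_int k * \<i>) + norm (2 * pi * of_int k * \<i>)"
      using norm_triangle_ineq[of "v r0 - 2 * pi * of_int k * \<i>" "2 * pi * of_int k * \<i>"] by simp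
    moreover have "norm (2 * pi * of_int k * \<i>) = \<bar>2 * pi * of_int k\<bar>" by (simp add: norm_mult abs_mult)
    moreover have "r0\<^sup>2 \<ge> 0" by simp
    ultimately show ?thesis using k(2) r0'(4) by linarith
  qed
  have "norm (v r - v r0) \<le> 2 * r\<^sup>2 - 2 * r0\<^sup>2"
  proof (cases "r0 = r")
    case False
    show ?thesis
    proof (rule differentiable_bound_general[where f' = "\<lambda>s. - \<i> * of_real s / (exp (v s) - 1)" and \<phi> = "\<lambda>s. 2 * s\<^sup>2" and \<phi>' = "\<lambda>s. 4 * s"])
      show "r0 < r" using False r0' by simp
      show "continuous_on {r0..r} v" by (rule continuous_on_subset[OF cont_v]) simp
      fix s assume s: "r0 < s" "s < r"
      have far: "norm (exp (v s) - 1) > 1/4"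
      proof (rule ccontr)
        assume "\<not> ?thesis"
        then have "s \<in> A" using s r0' by (simp add: A_def)
        then show False using r0(2) s by auto
      qed
      then have "exp (v s) \<noteq> 1" by auto
      then show "(v has_vector_derivative - \<i> * of_real s / (exp (v s) - 1)) (at s)" by (rule v_deriv)
      show "((\<lambda>s. 2 * s\<^sup>2) has_vector_derivative 4 * s) (at s)"
        unfolding has_real_derivative_iff_has_vector_derivative[symmetric] by (auto intro!: derivative_eq_intros)
      have "norm (- \<i> * of_real s / (exp (v s) - 1)) = s / norm (exp (v s) - 1)"
        using s r0' by (simp add: norm_divide norm_mult)
      also have "\<dots> \<le> s / (1/4)" using far s r0' by (intro divide_left_mono) auto
      finally show "norm (- \<i> * of_real s / (exp (v s) - 1)) \<le> 4 * s" by simp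
    qed (intro continuous_intros)
  qed simp
  then have "norm (v r) \<le> norm (v r0) + (2 * r\<^sup>2 - 2 * r0\<^sup>2)" using norm_triangle_sub[of "v r" "v r0"] by linarith
  moreover have "0 \<le> r0\<^sup>2" by simp
  ultimately show ?thesis using v0 by linarith
qed

lemma norm_exp_v_le:
  assumes "r \<ge> 0"
  shows "norm (exp (v r)) \<le> 3 + 3 * r\<^sup>2"
proof -
  have "norm (exp (v r)) \<le> norm (1 + v r) + norm (\<i> * of_real (r\<^sup>2 / 2))"
    unfolding phase_eq by (rule norm_triangle_ineq4)
  also have "norm (1 + v r) \<le> 1 + norm (v r)" using norm_triangle_ineq[of 1 "v r"] by simp
  also have "norm (\<i> * of_real (r\<^sup>2 / 2)) = r\<^sup>2 / 2" by (simp only: norm_mult norm_ii norm_of_real) simp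
  finally show ?thesis using norm_v_le[OF assms] zero_le_power2[of r] by linarith
qed

text \<open>At a point of the positive axis the distance in \<open>distance_to_ray\<close> is 0 for
  a = e^v, which forces e^v = 1. So for a other than 1 the pole -i a is never on the curve.\<close>

lemma exp_v_real:
  assumes "exp (v r) = of_real a" "a > 0"
  shows "a = 1"
proof -
  obtain c where c: "c > 0" and ray: "\<forall>v t a. exp v = 1 + v - \<i> * of_real t \<longrightarrow> a > 0 \<longrightarrow>
     c * max 1 a * min (norm (exp v - 1)) 1 \<le> norm (exp v - of_real a)"
    using distance_to_ray by (elim exE conjE) (rule that)
  have "c * max 1 a * min (norm (exp (v r) - 1)) 1 \<le> 0"
    using ray[rule_format, OF phase_eq[of r] assms(2)] unfolding assms(1) by simp
  moreover have "c * max 1 a > 0" using c by simp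
  ultimately have "min (norm (exp (v r) - 1)) 1 \<le> 0" by (metis mult_pos_pos not_le)
  then have "norm (exp (v r) - 1) = 0" using norm_ge_zero[of "exp (v r) - 1"] by linarith
  then have "of_real a = (1::complex)" unfolding assms(1)[symmetric] by simp
  then show ?thesis by simp
qed

text \<open>Up to constants a logarithm of e^v - a, in the form that stays off the principal cut:
  e^v meets the positive axis only in 1, where 1 - e^v / a is positive for a > 1 but negative for a
  < 1; in the latter case 1 - a / e^v is used, and v makes up for the factor e^v.\<close>

definition log_primitive :: "real \<Rightarrow> real \<Rightarrow> complex" where
  "log_primitive a r = (if a > 1 then Ln (1 - exp (v r) / of_real a) else v r + Ln (1 - of_real a / exp (v r)))"

lemma log_arg:
  assumes "a > 0" "a \<noteq> 1"
  shows "a > 1 \<Longrightarrow> 1 - exp (v r) / of_real a \<notin> \<real>\<^sub>\<le>\<^sub>0" "a < 1 \<Longrightarrow> 1 - of_real a / exp (v r) \<notin> \<real>\<^sub>\<le>\<^sub>0"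
proof -
  show "1 - exp (v r) / of_real a \<notin> \<real>\<^sub>\<le>\<^sub>0" if "a > 1"
  proof
    assume "1 - exp (v r) / of_real a \<in> \<real>\<^sub>\<le>\<^sub>0"
    then obtain x where x: "x \<le> 0" "1 - exp (v r) / of_real a = of_real x" by (auto simp: nonpos_Reals_def)
    then have "exp (v r) = of_real (a * (1 - x))" using that by (simp add: field_simps)
    moreover have ge: "a * 1 \<le> a * (1 - x)" using x that by (intro mult_left_mono) auto
    ultimately have "a * (1 - x) = 1" using that by (intro exp_v_real[of r]) linarith+
    then show False using ge that by linarith
  qed
  show "1 - of_real a / exp (v r) \<notin> \<real>\<^sub>\<le>\<^sub>0" if "a < 1"
  proof
    assume "1 - of_real a / exp (v r) \<in> \<real>\<^sub>\<le>\<^sub>0"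
    then obtain x where x: "x \<le> 0" "1 - of_real a / exp (v r) = of_real x" by (auto simp: nonpos_Reals_def)
    then have x1: "1 - x > 0" by simp
    have "of_real a / exp (v r) = of_real (1 - x)" using x(2) by (simp add: algebra_simps)
    then have "of_real a = of_real (1 - x) * exp (v r)" by (simp add: divide_eq_eq)
    then have "exp (v r) = of_real (a / (1 - x))" using x1 by (simp add: field_simps del: of_real_diff)
    moreover have "a / (1 - x) < 1" using that x by (simp add: field_simps)
    ultimately show False using exp_v_real[of r "a / (1 - x)"] assms x1 by simp
  qed
qed

lemma continuous_log_primitive:
  assumes "a > 0" "a \<noteq> 1"
  shows "continuous_on S (log_primitive a)"
proof (cases "a > 1")
  case True
  show ?thesis unfolding log_primitive_def[abs_def] using True assms log_arg(1)[OF assms True]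
    by (auto intro!: continuous_intros continuous_on_subset[OF cont_v])
next
  case False
  then have "a < 1" using assms by simp
  then show ?thesis unfolding log_primitive_def[abs_def] using assms log_arg(2)[OF assms]
    by (auto intro!: continuous_intros continuous_on_subset[OF cont_v])
qed

lemma log_primitive_deriv:
  assumes a: "a > 0" "a \<noteq> 1" and r: "exp (v r) \<noteq> 1"
  shows "(log_primitive a has_vector_derivative - (\<i> * exp (v r) * of_real r / ((exp (v r) - 1) * (exp (v r) - of_real a)))) (at r)"
proof -
  have ne: "exp (v r) \<noteq> of_real a" using exp_v_real[of r a] a by auto
  define G where "G z = (if a > 1 then Ln (1 - exp z / of_real a) else z + Ln (1 - of_real a / exp z))" for z
  have "(G has_field_derivative exp (v r) / (exp (v r) - of_real a)) (at (v r))"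
  proof (cases "a > 1")
    case True
    have "((\<lambda>z. Ln (1 - exp z / of_real a)) has_field_derivative (0 - exp (v r) / of_real a) / (1 - exp (v r) / of_real a)) (at (v r))"
      using log_arg(1)[OF a True, of r] by (auto intro!: derivative_eq_intros simp: divide_simps)
    moreover have "(0 - exp (v r) / of_real a) / (1 - exp (v r) / of_real a) = exp (v r) / (exp (v r) - of_real a)"
      using ne a by (simp add: divide_simps) (auto simp: algebra_simps)
    ultimately show ?thesis using True by (simp add: G_def[abs_def])
  next
    case False
    then have a1: "a < 1" using a by simp
    have "((\<lambda>z. z + Ln (1 - of_real a / exp z)) has_field_derivative 1 + (of_real a / exp (v r)) / (1 - of_real a / exp (v r))) (at (v r))"
      using log_arg(2)[OF a a1, of r] by (auto intro!: derivative_eq_intros simp: divide_simps)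
    moreover have "1 + (of_real a / exp (v r)) / (1 - of_real a / exp (v r)) = exp (v r) / (exp (v r) - of_real a)"
      using ne a by (simp add: divide_simps) 
    ultimately show ?thesis using False by (simp add: G_def[abs_def])
  qed
  from field_vector_diff_chain_at[OF v_deriv[OF r] this]
  have "((\<lambda>r. G (v r)) has_vector_derivative - \<i> * of_real r / (exp (v r) - 1) * (exp (v r) / (exp (v r) - of_real a))) (at r)"
    by (simp only: comp_def)
  moreover have "(\<lambda>r. G (v r)) = log_primitive a" by (simp add: fun_eq_iff G_def log_primitive_def)
  moreover have "- \<i> * of_real r / (exp (v r) - 1) * (exp (v r) / (exp (v r) - of_real a))
     = - (\<i> * exp (v r) * of_real r / ((exp (v r) - 1) * (exp (v r) - of_real a)))"
    by (simp add: mult_ac)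
  ultimately show ?thesis by (simp only:)
qed

end

text \<open>Crude on purpose: a single reciprocal 1 / |z| amounts to |sin (r^2 / 4)|^(-1/2) later
  on, which is still integrable.\<close>

lemma norm_Ln_le_abs_ln:
  assumes "z \<noteq> 0"
  shows "norm (Ln z) \<le> norm z + 1 / norm z + pi"
proof -
  have z: "norm z > 0" using assms by simp
  have "norm (Ln z) \<le> \<bar>Re (Ln z)\<bar> + \<bar>Im (Ln z)\<bar>" by (rule cmod_le)
  moreover have "\<bar>Im (Ln z)\<bar> \<le> pi" using mpi_less_Im_Ln[OF assms] Im_Ln_le_pi[OF assms] by linarith
  moreover have "\<bar>ln (norm z)\<bar> \<le> norm z + 1 / norm z"
  proof -
    have 1: "ln (norm z) \<le> norm z" using ln_le_minus_one[OF z] by linarith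
    have 2: "- ln (norm z) \<le> 1 / norm z" using ln_le_minus_one[of "1 / norm z"] z by (simp add: ln_div)
    have "0 \<le> 1 / norm z" using z by simp
    with 1 2 z show ?thesis by linarith
  qed
  ultimately show ?thesis
    unfolding Re_Ln[OF assms] by linarith
qed

text \<open>The exponential leaves room for the polynomial growth of v and e^v in r; the Gaussian
  takes it back.\<close>

definition root_weight :: "real \<Rightarrow> real" where
  "root_weight r = exp (r\<^sup>2 / 2) / sqrt \<bar>sin (r\<^sup>2 / 4)\<bar>"

section \<open>Tails for a other than 1\<close>

context phase_curve
begin

text \<open>The integrand of K without the Gaussian, w r / ((w + i a) (w + i)) with w = -i e^v. Away
  from the saddle points it equals -v' e^v / (e^v - a).\<close>

definition saddle_kernel :: "real \<Rightarrow> real \<Rightarrow> complex" where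
  "saddle_kernel a r = \<i> * exp (v r) * of_real r / ((exp (v r) - 1) * (exp (v r) - of_real a))"

lemma borel_v [measurable]: "v \<in> borel_measurable borel"
  by (rule borel_measurable_continuous_onI[OF cont_v])

text \<open>The one interface to the tail bound: constants, quadratic growth and one reciprocal of
  |e^v - 1| all fit under \<open>root_weight\<close>, because 1 + r^2 <= 2 e^(r^2 / 2) and 1 / |e^v
  - 1| <= 2 / sqrt |sin (r^2 / 4)|.\<close>

lemma weight_bounds:
  assumes "r \<ge> 0" "r \<notin> sine_zeros" "A \<ge> 0" "B \<ge> 0" "C \<ge> 0"
  shows "A + B * (1 + r\<^sup>2) + C * ((1 + r\<^sup>2) / norm (exp (v r) - 1)) \<le> 2 * (A + B + 2 * C) * root_weight r"
proof -
  define T S U where "T = 1 + r\<^sup>2" and "S = 1 / sqrt \<bar>sin (r\<^sup>2 / 4)\<bar>" and "U = 1 / norm (exp (v r) - 1)"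
  have S: "S \<ge> 1" unfolding S_def by (rule one_le_inverse_root[OF assms(1,2)])
  have T: "T \<ge> 1" by (simp add: T_def)
  have "U \<le> 2 * S" using inverse_D_le[OF assms(1,2)] by (simp add: U_def S_def)
  then have "C * (T * U) \<le> C * (T * (2 * S))" using assms T by (intro mult_left_mono) auto
  moreover have "1 * 1 \<le> T * S" by (intro mult_mono T S) (use T in auto)
  then have "A * 1 \<le> A * (T * S)" using assms by (intro mult_left_mono) auto
  moreover have "T * 1 \<le> T * S" using T S by (intro mult_left_mono) auto
  then have "B * T \<le> B * (T * S)" using assms by (intro mult_left_mono) auto
  ultimately have "A + B * T + C * (T * U) \<le> (A + B + 2 * C) * (T * S)"
    by (simp add: algebra_simps)
  also have "T \<le> 2 * exp (r\<^sup>2 / 2)" unfolding T_def using exp_ge_add_one_self[of "r\<^sup>2 / 2"] by linarith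
  then have "(A + B + 2 * C) * (T * S) \<le> (A + B + 2 * C) * ((2 * exp (r\<^sup>2 / 2)) * S)"
    using assms S by (intro mult_left_mono mult_right_mono) auto
  also have "\<dots> = 2 * (A + B + 2 * C) * root_weight r" by (simp add: root_weight_def S_def)
  finally show ?thesis by (simp add: T_def U_def)
qed

lemma distance_lower:
  "\<exists>c>0. \<forall>a>0. \<forall>r. exp (v r) \<noteq> 1 \<longrightarrow> max 1 a / norm (exp (v r) - of_real a) \<le> c * (1 + 1 / norm (exp (v r) - 1))"
proof -
  obtain c where c: "c > 0" and ray: "\<forall>v t a. exp v = 1 + v - \<i> * of_real t \<longrightarrow> a > 0 \<longrightarrow>
     c * max 1 a * min (norm (exp v - 1)) 1 \<le> norm (exp v - of_real a)"
    using distance_to_ray by (elim exE conjE) (rule that)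
  have "max 1 a / norm (exp (v r) - of_real a) \<le> 1 / c * (1 + 1 / norm (exp (v r) - 1))"
    if a: "a > 0" and r: "exp (v r) \<noteq> 1" for a r
  proof -
    let ?D = "norm (exp (v r) - 1)"
    have D: "?D > 0" using r by simp
    have m: "min ?D 1 > 0" using D by simp
    have "max 1 a / norm (exp (v r) - of_real a) \<le> max 1 a / (c * max 1 a * min ?D 1)"
    proof (intro divide_left_mono mult_pos_pos)
      have "exp (v r) \<noteq> of_real a" using exp_v_real[of r a] a r by auto
      then show "0 < norm (exp (v r) - of_real a)" by simp
    qed (use ray[rule_format, OF phase_eq[of r] a] c m in auto)
    also have "\<dots> = 1 / c * (1 / min ?D 1)" using c by (simp add: divide_simps)
    also have "\<dots> \<le> 1 / c * (1 + 1 / ?D)"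
      using c D by (intro mult_left_mono) (auto simp: min_def field_simps)
    finally show ?thesis .
  qed
  then show ?thesis using c by (intro exI[of _ "1 / c"] conjI allI impI) simp_all
qed

text \<open>Uniform in a because the argument z of the logarithm has modulus |e^v - a| / a for a > 1
  and |e^v - a| / |e^v| for a < 1. The factor \<open>max 1 a\<close> of
  \<open>distance_lower\<close> absorbs the division by a in the first case, the growth bound for
  e^v serves in the second, and |e^v| >= e^(-2) bounds z from above there.\<close>

lemma log_primitive_bound:
  "\<exists>K\<ge>0. \<forall>a>0. a \<noteq> 1 \<longrightarrow> (\<forall>r\<ge>0. r \<notin> sine_zeros \<longrightarrow> norm (log_primitive a r) \<le> K * root_weight r)"
proof -
  obtain c where c: "c > 0" and low: "\<forall>a>0. \<forall>r. exp (v r) \<noteq> 1 \<longrightarrow> max 1 a / norm (exp (v r) - of_real a) \<le> c * (1 + 1 / norm (exp (v r) - 1))"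
    using distance_lower by (elim exE conjE) (rule that)
  let ?K = "2 * (5 + exp 2 + (6 + 3 * c) + 2 * (3 * c))"
  have "norm (log_primitive a r) \<le> ?K * root_weight r" if a: "a > 0" "a \<noteq> 1" and r: "r \<ge> 0" "r \<notin> sine_zeros" for a r
  proof -
    let ?e = "exp (v r)"
    let ?D = "norm (?e - 1)"
    define T where "T = 1 + r\<^sup>2"
    have ne1: "?e \<noteq> 1" using exp_eq_1_sin r by blast
    have ne: "?e \<noteq> of_real a" using exp_v_real[of r a] a by auto
    have l: "max 1 a / norm (?e - of_real a) \<le> c * (1 + 1 / ?D)" using low a(1) ne1 by blast
    have T1: "T \<ge> 1" by (simp add: T_def)
    have eT: "norm ?e \<le> 3 * T" using norm_exp_v_le[OF r(1)] by (simp add: T_def)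
    have e2: "exp (-2) \<le> norm ?e" using phase_Re_ge[OF phase_eq[of r]] by simp
    have DT: "0 \<le> 1 / ?D" "1 / ?D \<le> T / ?D" using T1 by (auto intro: divide_right_mono)
    have cD: "c * (1 + 1 / ?D) \<le> c * T + c * (T / ?D)"
      using c DT T1 unfolding distrib_left[symmetric] by (intro mult_left_mono add_mono) auto
    have "norm (log_primitive a r) \<le> (5 + exp 2) + (6 + 3 * c) * T + 3 * c * (T / ?D)"
    proof (cases "a > 1")
      case True
      let ?z = "1 - ?e / of_real a"
      have z: "?z \<noteq> 0" using ne a by (auto simp: field_simps)
      have "norm ?z \<le> 1 + norm ?e / a" using norm_triangle_ineq4[of 1 "?e / of_real a"] a by (simp add: norm_divide)
      also have "norm ?e / a \<le> norm ?e / 1" using True by (intro divide_left_mono) auto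
      finally have n1: "norm ?z \<le> 1 + 3 * T" using eT by simp
      have "?z = (of_real a - ?e) / of_real a" using a by (simp add: field_simps)
      then have "norm ?z = norm (?e - of_real a) / a" using a by (simp add: norm_divide norm_minus_commute)
      then have n2: "1 / norm ?z \<le> c * (1 + 1 / ?D)" using l True by (simp add: max_def)
      have "norm (log_primitive a r) \<le> (1 + 3 * T) + (c * T + c * (T / ?D)) + 4"
        using norm_Ln_le_abs_ln[OF z] n1 n2 cD pi_less_4 True unfolding log_primitive_def if_P[OF True] by linarith
      moreover have "0 \<le> c * T" "0 \<le> c * (T / ?D)" "(0::real) < exp 2" using c DT T1 by auto
      moreover have "x \<le> 5 + e + (6 * t + 3 * p) + 3 * q"
        if "x \<le> (1 + 3 * t) + (p + q) + 4" "0 \<le> p" "0 \<le> q" "0 < e" "1 \<le> t" for x t p q e :: real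
        using that by linarith
      ultimately show ?thesis using T1 unfolding distrib_right mult.assoc by blast
    next
      case False
      then have a1: "a < 1" using a by simp
      let ?z = "1 - of_real a / ?e"
      have z: "?z \<noteq> 0" using ne by (auto simp: field_simps)
      have "norm ?z \<le> 1 + a / norm ?e" using norm_triangle_ineq4[of 1 "of_real a / ?e"] a by (simp add: norm_divide)
      also have "a / norm ?e \<le> 1 / exp (-2)" using e2 a1 a by (intro frac_le) auto
      also have "1 / exp (-2) = (exp 2 :: real)" by (simp add: exp_minus field_simps)
      finally have n1: "norm ?z \<le> 1 + exp 2" by simp
      have "?z = (?e - of_real a) / ?e" by (simp add: field_simps)
      then have "norm ?z = norm (?e - of_real a) / norm ?e" by (simp add: norm_divide)
      then have "1 / norm ?z = norm ?e * (1 / norm (?e - of_real a))" by simp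
      also have "\<dots> \<le> norm ?e * (c * (1 + 1 / ?D))" using l a1 by (intro mult_left_mono) auto
      also have "\<dots> \<le> (3 * T) * (c * (1 + 1 / ?D))" using eT c by (intro mult_right_mono) auto
      also have "\<dots> = 3 * c * T + 3 * c * (T / ?D)" by (simp add: algebra_simps)
      finally have n2: "1 / norm ?z \<le> 3 * c * T + 3 * c * (T / ?D)" .
      have vT: "norm (v r) \<le> 2 * T" using norm_v_le[OF r(1)] by (simp add: T_def)
      have "norm (log_primitive a r) \<le> norm (v r) + norm (Ln ?z)"
        unfolding log_primitive_def if_not_P[OF False] by (rule norm_triangle_ineq)
      then have "norm (log_primitive a r) \<le> 2 * T + ((1 + exp 2) + (3 * c * T + 3 * c * (T / ?D)) + 4)"
        using norm_Ln_le_abs_ln[OF z] n1 n2 pi_less_4 vT by linarith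
      then show ?thesis using T1 unfolding distrib_right mult.assoc using c DT by linarith
    qed
    also have "\<dots> \<le> ?K * root_weight r"
      using weight_bounds[OF r, of "5 + exp 2" "6 + 3 * c" "3 * c"] c by (simp add: T_def add_nonneg_nonneg)
    finally show ?thesis .
  qed
  moreover have "?K \<ge> 0" using c by (simp add: add_nonneg_nonneg)
  ultimately show ?thesis by (intro exI[of _ ?K] conjI allI impI)
qed

lemma root_weight_ge_1:
  assumes "r \<ge> 0" "r \<notin> sine_zeros"
  shows "1 \<le> root_weight r"
proof -
  have "1 * 1 \<le> exp (r\<^sup>2 / 2) * (1 / sqrt \<bar>sin (r\<^sup>2 / 4)\<bar>)"
    using one_le_inverse_root[OF assms] by (intro mult_mono) auto
  then show ?thesis by (simp add: root_weight_def)
qed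

lemma finite_sine_zeros: "finite (sine_zeros \<inter> {\<rho>..b})"
  by (rule finite_subset[OF _ finite_sin_quarter_zeros[of b]]) (auto simp: sine_zeros_def)

text \<open>Two different estimates: for each fixed a the kernel is integrable, by a bound that
  blows up as a tends to 1, and once the integral exists, integration by parts against
  \<open>log_primitive\<close> replaces it by one with a bound uniform in a.\<close>

lemma tail_regular:
  assumes \<rho>: "\<rho> > 0" "\<rho> \<notin> sine_zeros"
  shows "\<exists>C\<ge>0. \<exists>c>0. \<forall>lam\<ge>6. \<forall>a>0. a \<noteq> 1 \<longrightarrow>
     set_integrable lborel {\<rho>..} (\<lambda>r. exp (- (lam / 2) * r\<^sup>2) *\<^sub>R saddle_kernel a r) \<and>
     norm (LINT r:{\<rho>..}|lborel. exp (- (lam / 2) * r\<^sup>2) *\<^sub>R saddle_kernel a r) \<le> C * exp (- c * lam)"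
proof -
  obtain K where K: "K \<ge> 0" and Kb: "\<forall>a>0. a \<noteq> 1 \<longrightarrow> (\<forall>r\<ge>0. r \<notin> sine_zeros \<longrightarrow> norm (log_primitive a r) \<le> K * root_weight r)"
    using log_primitive_bound by (elim exE conjE) (rule that)
  obtain C c where C: "C \<ge> 0" "c > 0" and tail: "\<forall>lam\<ge>6. \<forall>B\<ge>0. \<forall>f :: real \<Rightarrow> complex.
     f \<in> borel_measurable borel \<longrightarrow>
     (\<forall>r\<ge>\<rho>. r \<notin> sine_zeros \<longrightarrow> norm (f r) \<le> B * (exp (r\<^sup>2 / 2) / sqrt \<bar>sin (r\<^sup>2 / 4)\<bar>)) \<longrightarrow>
     set_integrable lborel {\<rho>..} (\<lambda>r. (r * exp (- (lam / 2) * r\<^sup>2)) *\<^sub>R f r) \<and>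
     lam * norm (LINT r:{\<rho>..}|lborel. (r * exp (- (lam / 2) * r\<^sup>2)) *\<^sub>R f r) \<le> C * B * exp (- c * lam)"
    using gaussian_tail_bound[OF \<rho>(1)] by (elim exE conjE) (rule that)
  note tail = tail[folded root_weight_def]
  define B where "B = K + K * root_weight \<rho>"
  have w\<rho>: "root_weight \<rho> \<ge> 1" using root_weight_ge_1[of \<rho>] \<rho> by simp
  have B: "B \<ge> 0" using K w\<rho> by (simp add: B_def)
  have "set_integrable lborel {\<rho>..} (\<lambda>r. exp (- (lam / 2) * r\<^sup>2) *\<^sub>R saddle_kernel a r) \<and>
     norm (LINT r:{\<rho>..}|lborel. exp (- (lam / 2) * r\<^sup>2) *\<^sub>R saddle_kernel a r) \<le> (C * B) * exp (- c * lam)"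
    if lam: "lam \<ge> 6" and a: "a > 0" "a \<noteq> 1" for lam a
  proof -
    define f where "f r = log_primitive a r - log_primitive a \<rho>" for r
    have fb: "\<forall>r\<ge>\<rho>. r \<notin> sine_zeros \<longrightarrow> norm (f r) \<le> B * root_weight r"
    proof (intro allI impI)
      fix r assume r: "\<rho> \<le> r" "r \<notin> sine_zeros"
      have "norm (f r) \<le> norm (log_primitive a r) + norm (log_primitive a \<rho>)" unfolding f_def by (rule norm_triangle_ineq4)
      also have "\<dots> \<le> K * root_weight r + K * root_weight \<rho> * 1"
        using Kb a r \<rho> by (intro add_mono) auto
      also have "\<dots> \<le> K * root_weight r + K * root_weight \<rho> * root_weight r"
        using root_weight_ge_1[of r] r \<rho> K w\<rho> by (intro add_mono mult_left_mono order_refl) auto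
      finally show "norm (f r) \<le> B * root_weight r" by (simp add: B_def distrib_right)
    qed
    have fc: "continuous_on S f" for S unfolding f_def[abs_def] by (intro continuous_intros continuous_log_primitive a)
    have fm: "f \<in> borel_measurable borel" by (rule borel_measurable_continuous_onI[OF fc])
    have i2: "set_integrable lborel {\<rho>..} (\<lambda>r. (r * exp (- (lam / 2) * r\<^sup>2)) *\<^sub>R f r)"
      and b2: "lam * norm (LINT r:{\<rho>..}|lborel. (r * exp (- (lam / 2) * r\<^sup>2)) *\<^sub>R f r) \<le> C * B * exp (- c * lam)"
      using tail[rule_format, OF lam B fm fb[rule_format]] by simp_all
    have der: "(f has_vector_derivative - saddle_kernel a r) (at r)" if r: "r \<ge> \<rho>" "r \<notin> sine_zeros" for r
    proof -
      have "exp (v r) \<noteq> 1" using exp_eq_1_sin[of r] r \<rho> by auto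
      from has_vector_derivative_diff[OF log_primitive_deriv[OF a this] has_vector_derivative_const]
      show ?thesis by (simp add: f_def[abs_def] saddle_kernel_def)
    qed
    \<comment> \<open>Only for integrability at this a: where e^v is within \<delta> / 2 of 1 it is
      at least \<delta> / 2 away from a, and elsewhere \<open>distance_lower\<close> bounds the
      reciprocal. The resulting \<open>m\<close> is not uniform and does not enter the final
      constant.\<close>
    define \<delta> where "\<delta> = norm (of_real a - (1::complex))"
    have \<delta>: "\<delta> > 0" using a by (simp add: \<delta>_def)
    obtain c1 where c1: "c1 > 0" and low: "\<forall>a>0. \<forall>r. exp (v r) \<noteq> 1 \<longrightarrow> max 1 a / norm (exp (v r) - of_real a) \<le> c1 * (1 + 1 / norm (exp (v r) - 1))"
      using distance_lower by (elim exE conjE) (rule that)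
    define m where "m = 2 / \<delta> + c1 * (1 + 2 / \<delta>)"
    have m: "m \<ge> 0" using \<delta> c1 by (simp add: m_def)
    have ub: "1 / norm (exp (v r) - of_real a) \<le> m" if ne1: "exp (v r) \<noteq> 1" for r
    proof (cases "norm (exp (v r) - 1) \<le> \<delta> / 2")
      case True
      have "\<delta> \<le> norm (exp (v r) - of_real a) + norm (exp (v r) - 1)"
        unfolding \<delta>_def using norm_triangle_ineq4[of "exp (v r) - 1" "exp (v r) - of_real a"] by simp
      then have "\<delta> / 2 \<le> norm (exp (v r) - of_real a)" using True by linarith
      then have "1 / norm (exp (v r) - of_real a) \<le> 1 / (\<delta> / 2)" using \<delta> by (intro divide_left_mono mult_pos_pos) auto
      also have "\<dots> \<le> m" using \<delta> c1 by (simp add: m_def)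
      finally show ?thesis .
    next
      case False
      have "1 / norm (exp (v r) - of_real a) \<le> max 1 a / norm (exp (v r) - of_real a)" by (intro divide_right_mono) auto
      also have "\<dots> \<le> c1 * (1 + 1 / norm (exp (v r) - 1))" using low a(1) ne1 by blast
      also have "\<dots> \<le> c1 * (1 + 1 / (\<delta> / 2))"
        using False \<delta> c1 by (intro mult_left_mono add_left_mono divide_left_mono mult_pos_pos) auto
      also have "\<dots> \<le> m" using \<delta> c1 by (simp add: m_def)
      finally show ?thesis .
    qed
    define g where "g r = \<i> * exp (v r) / ((exp (v r) - 1) * (exp (v r) - of_real a))" for r
    have gm: "g \<in> borel_measurable borel" unfolding g_def by measurable
    have gb: "norm (g r) \<le> 12 * m * root_weight r" if r: "r \<ge> \<rho>" "r \<notin> sine_zeros" for r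
    proof -
      have ne1: "exp (v r) \<noteq> 1" using exp_eq_1_sin[of r] r \<rho> by auto
      have "norm (g r) = norm (exp (v r)) * (1 / norm (exp (v r) - of_real a)) * (1 / norm (exp (v r) - 1))"
        by (simp add: g_def norm_divide norm_mult)
      also have "\<dots> \<le> (3 * (1 + r\<^sup>2)) * m * (1 / norm (exp (v r) - 1))"
        using norm_exp_v_le[of r] r \<rho> ub[OF ne1] by (intro mult_mono) (auto intro!: mult_nonneg_nonneg m)
      also have "\<dots> = 0 + 0 * (1 + r\<^sup>2) + 3 * m * ((1 + r\<^sup>2) / norm (exp (v r) - 1))" by simp
      also have "\<dots> \<le> 2 * (0 + 0 + 2 * (3 * m)) * root_weight r"
        using r \<rho> m by (intro weight_bounds) auto
      finally show ?thesis by simp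
    qed
    have "set_integrable lborel {\<rho>..} (\<lambda>r. (r * exp (- (lam / 2) * r\<^sup>2)) *\<^sub>R g r)"
      using tail[rule_format, OF lam _ gm gb] m by simp
    moreover have "(r * exp (- (lam / 2) * r\<^sup>2)) *\<^sub>R g r = exp (- (lam / 2) * r\<^sup>2) *\<^sub>R saddle_kernel a r" for r
      by (simp add: g_def saddle_kernel_def scaleR_conv_of_real)
    ultimately have i1: "set_integrable lborel {\<rho>..} (\<lambda>r. exp (- (lam / 2) * r\<^sup>2) *\<^sub>R saddle_kernel a r)"
      by (simp only:)
    then have i1': "set_integrable lborel {\<rho>..} (\<lambda>r. exp (- (lam / 2) * r\<^sup>2) *\<^sub>R (- saddle_kernel a r))"
      using set_integrable_scaleR_right[of "-1" lborel "{\<rho>..}"] by (simp add: set_integrable_def)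
    have "(LINT r:{\<rho>..}|lborel. exp (- (lam / 2) * r\<^sup>2) *\<^sub>R (- saddle_kernel a r))
       = lam *\<^sub>R (LINT r:{\<rho>..}|lborel. (r * exp (- (lam / 2) * r\<^sup>2)) *\<^sub>R f r)"
      by (rule by_parts_tail[OF \<rho>(1) lam B fc _ finite_sine_zeros der fb[unfolded root_weight_def] i1' i2]) (simp add: f_def)
    moreover have "(LINT r:{\<rho>..}|lborel. exp (- (lam / 2) * r\<^sup>2) *\<^sub>R (- saddle_kernel a r))
       = - (LINT r:{\<rho>..}|lborel. exp (- (lam / 2) * r\<^sup>2) *\<^sub>R saddle_kernel a r)"
      unfolding set_lebesgue_integral_def by simp
    ultimately have "- (LINT r:{\<rho>..}|lborel. exp (- (lam / 2) * r\<^sup>2) *\<^sub>R saddle_kernel a r)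
       = lam *\<^sub>R (LINT r:{\<rho>..}|lborel. (r * exp (- (lam / 2) * r\<^sup>2)) *\<^sub>R f r)" by (simp only:)
    from arg_cong[OF this, of norm]
    have "norm (LINT r:{\<rho>..}|lborel. exp (- (lam / 2) * r\<^sup>2) *\<^sub>R saddle_kernel a r)
       = lam * norm (LINT r:{\<rho>..}|lborel. (r * exp (- (lam / 2) * r\<^sup>2)) *\<^sub>R f r)"
      using lam by (simp add: norm_minus_cancel)
    then show ?thesis using i1 b2 by simp
  qed
  note main = this
  have "C * B \<ge> 0" using C B by simp
  with main show ?thesis using C(2) by (intro exI[of _ "C * B"] exI[of _ c] conjI allI impI) simp_all
qed

end

section \<open>Tails for a = 1, as principal values\<close>

context phase_curve
begin

text \<open>With D = e^v - 1 one has e^v / D^2 = 1 / D^2 + 1 / D, and Re (1 / D^2) = Re (D^2) /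
  |D|^4 is O(1 / |D|) by \<open>Re_square_small\<close>. So the double singularity sits in the
  imaginary part alone.\<close>

lemma Re_kernel_bound:
  "\<exists>C\<ge>1. \<forall>r. exp (v r) \<noteq> 1 \<longrightarrow> \<bar>Re (exp (v r) / (exp (v r) - 1)\<^sup>2)\<bar> \<le> C / norm (exp (v r) - 1)"
proof -
  obtain C where C: "C > 0" and Csq: "\<forall>v t. exp v = 1 + v - \<i> * of_real t \<longrightarrow> norm (exp v - 1) < 1/2 \<longrightarrow>
     \<bar>Re ((exp v - 1)\<^sup>2)\<bar> \<le> C * norm (exp v - 1) ^ 3"
    using Re_square_small by (elim exE conjE) (rule that)
  have main: "\<bar>Re (exp (v r) / (exp (v r) - 1)\<^sup>2)\<bar> \<le> (C + 3) / norm (exp (v r) - 1)" if ne: "exp (v r) \<noteq> 1" for r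
  proof -
    define D where "D = exp (v r) - 1"
    have D: "norm D > 0" using ne by (simp add: D_def)
    have "exp (v r) / D\<^sup>2 = 1 / D\<^sup>2 + 1 / D"
      using D by (simp add: D_def divide_simps power2_eq_square)
    then have "Re (exp (v r) / D\<^sup>2) = Re (1 / D\<^sup>2) + Re (1 / D)" by simp
    moreover have "\<bar>Re (1 / D)\<bar> \<le> 1 / norm D" using abs_Re_le_cmod[of "1 / D"] by (simp add: norm_divide)
    moreover have "\<bar>Re (1 / D\<^sup>2)\<bar> \<le> (C + 2) / norm D"
    proof (cases "norm D < 1/2")
      case True
      have "Re (1 / D\<^sup>2) = Re (D\<^sup>2) / (norm D ^ 4)"
        by (simp add: Re_divide cmod_power2[symmetric] norm_power power_mult[symmetric])
      then have "\<bar>Re (1 / D\<^sup>2)\<bar> = \<bar>Re (D\<^sup>2)\<bar> / (norm D ^ 4)" by simp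
      also have "\<dots> \<le> (C * norm D ^ 3) / (norm D ^ 4)"
        using Csq[rule_format, OF phase_eq[of r]] True by (intro divide_right_mono) (auto simp: D_def)
      also have "\<dots> = C / norm D" using D by (simp add: eval_nat_numeral)
      also have "\<dots> \<le> (C + 2) / norm D" using D by (intro divide_right_mono) auto
      finally show ?thesis .
    next
      case False
      have "\<bar>Re (1 / D\<^sup>2)\<bar> \<le> norm (1 / D\<^sup>2)" by (rule abs_Re_le_cmod)
      also have "\<dots> = 1 / norm D * (1 / norm D)" by (simp add: norm_divide norm_mult power2_eq_square)
      also have "\<dots> \<le> 1 / norm D * 2" using False D by (intro mult_left_mono) (auto simp: field_simps)
      also have "\<dots> \<le> (C + 2) / norm D" using C D by (simp add: field_simps)
      finally show ?thesis .
    qed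
    ultimately have "\<bar>Re (exp (v r) / D\<^sup>2)\<bar> \<le> (C + 2) / norm D + 1 / norm D" by linarith
    then show ?thesis unfolding D_def by (simp add: add_divide_distrib)
  qed
  then show ?thesis using C by (intro exI[of _ "C + 3"] conjI allI impI) simp_all
qed

lemma saddle_kernel_1: "saddle_kernel 1 r = of_real r * (\<i> * (exp (v r) / (exp (v r) - 1)\<^sup>2))"
  by (simp add: saddle_kernel_def power2_eq_square)

text \<open>For a = 1 the kernel is minus the logarithmic derivative of e^v - 1, and its real part
  belongs to the modulus. The modulus needs no branch, and it is the very quantity by which the
  principal value is cut.\<close>

lemma ln_norm_deriv:
  assumes "exp (v r) \<noteq> 1"
  shows "((\<lambda>r. norm (exp (v r) - 1)) has_real_derivative - norm (exp (v r) - 1) * Re (saddle_kernel 1 r)) (at r)"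
    and "((\<lambda>r. ln (norm (exp (v r) - 1))) has_real_derivative - Re (saddle_kernel 1 r)) (at r)"
proof -
  let ?D = "exp (v r) - 1"
  have D: "?D \<noteq> 0" "norm ?D > 0" using assms by simp_all
  have "((\<lambda>z. exp z - 1) has_field_derivative exp (v r)) (at (v r))" by (auto intro!: derivative_eq_intros)
  from field_vector_diff_chain_at[OF v_deriv[OF assms] this]
  have "((\<lambda>r. exp (v r) - 1) has_vector_derivative (- \<i> * of_real r / ?D * exp (v r))) (at r)" by (simp only: comp_def)
  also have "- \<i> * of_real r / ?D * exp (v r) = - (?D * saddle_kernel 1 r)"
    using D by (simp add: saddle_kernel_def)
  finally have d: "((\<lambda>r. exp (v r) - 1) has_derivative (\<lambda>h. h *\<^sub>R - (?D * saddle_kernel 1 r))) (at r)"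
    by (simp only: has_vector_derivative_def)
  have "((\<lambda>r. norm (exp (v r) - 1)) has_derivative (\<lambda>h. (h *\<^sub>R - (?D * saddle_kernel 1 r)) \<bullet> sgn ?D)) (at r)"
    by (rule has_derivative_compose[OF d has_derivative_norm[OF D(1)]])
  also have "(\<lambda>h. (h *\<^sub>R - (?D * saddle_kernel 1 r)) \<bullet> sgn ?D) = (*) (- norm ?D * Re (saddle_kernel 1 r))"
  proof (rule ext)
    fix h :: real
    have "(?D * k) \<bullet> sgn ?D = norm ?D * Re k" for k
    proof -
      have "(?D * k) \<bullet> ?D = (norm ?D)\<^sup>2 * Re k"
        unfolding inner_complex_def cmod_power2 by (simp add: power2_eq_square algebra_simps)
      then show ?thesis using D by (simp add: sgn_div_norm power2_eq_square)
    qed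
    from this[of "saddle_kernel 1 r"]
    show "(h *\<^sub>R - (?D * saddle_kernel 1 r)) \<bullet> sgn ?D = - norm ?D * Re (saddle_kernel 1 r) * h"
      by (simp only: inner_scaleR_left inner_minus_left) simp
  qed
  finally show N: "((\<lambda>r. norm (exp (v r) - 1)) has_real_derivative - norm ?D * Re (saddle_kernel 1 r)) (at r)"
    unfolding has_field_derivative_def .
  from DERIV_chain2[OF DERIV_ln_divide[OF D(2)] N]
  show "((\<lambda>r. ln (norm (exp (v r) - 1))) has_real_derivative - Re (saddle_kernel 1 r)) (at r)"
    using D by simp
qed

text \<open>Integration by parts over the cut domain tolerates finitely many corners. At an
  accumulation point of a level set the modulus |e^v - 1| would have derivative 0, so e^v / D^2
  would be real and, by \<open>Re_kernel_bound\<close>, at most C / d; but its modulus is at least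
  (1 - d) / d^2. This is a contradiction for d < 1 / (1 + C).\<close>

lemma finite_level_set:
  "\<exists>d0>0. \<forall>d b \<rho>. 0 < d \<longrightarrow> d < d0 \<longrightarrow> 0 < \<rho> \<longrightarrow> finite {r \<in> {\<rho>..b}. norm (exp (v r) - 1) = d}"
proof -
  obtain C where C: "C \<ge> 1" and Re: "\<forall>r. exp (v r) \<noteq> 1 \<longrightarrow> \<bar>Re (exp (v r) / (exp (v r) - 1)\<^sup>2)\<bar> \<le> C / norm (exp (v r) - 1)"
    using Re_kernel_bound by (elim exE conjE) (rule that)
  have main: "finite {r \<in> {\<rho>..b}. norm (exp (v r) - 1) = d}" if d: "0 < d" "d < 1 / (1 + C)" and \<rho>: "0 < \<rho>" for d b \<rho>
  proof (rule ccontr)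
    let ?A = "{r \<in> {\<rho>..b}. norm (exp (v r) - 1) = d}"
    assume inf: "infinite ?A"
    have "closed ({\<rho>..b} \<inter> (\<lambda>s. norm (exp (v s) - 1)) -` {d})"
      by (intro continuous_closed_preimage continuous_intros continuous_on_subset[OF cont_v]) auto
    also have "{\<rho>..b} \<inter> (\<lambda>s. norm (exp (v s) - 1)) -` {d} = ?A" by auto
    finally have "closed ?A" .
    moreover have "bounded ?A" by (rule bounded_subset[of "{\<rho>..b}"]) auto
    ultimately have "compact ?A" by (simp add: compact_eq_bounded_closed)
    then obtain x where x: "x \<in> ?A" "x islimpt ?A"
      using Heine_Borel_imp_Bolzano_Weierstrass[OF _ inf, of ?A] by auto
    define D where "D = exp (v x) - 1"
    have nD: "norm D = d" and x0: "x > 0" using x \<rho> by (auto simp: D_def)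
    have ne: "exp (v x) \<noteq> 1" using nD d by (auto simp: D_def)
    have "Re (saddle_kernel 1 x) \<noteq> 0"
    proof
      assume "Re (saddle_kernel 1 x) = 0"
      moreover have "Re (of_real x * (\<i> * z)) = - x * Im z" for z by simp
      from this[of "exp (v x) / D\<^sup>2"] have "Re (saddle_kernel 1 x) = - x * Im (exp (v x) / D\<^sup>2)"
        unfolding saddle_kernel_1 D_def[symmetric] .
      ultimately have "Im (exp (v x) / D\<^sup>2) = 0" using x0 by simp
      then have "norm (exp (v x) / D\<^sup>2) = \<bar>Re (exp (v x) / D\<^sup>2)\<bar>" by (simp add: cmod_eq_Re)
      also have "\<dots> \<le> C / d" using Re ne nD unfolding D_def by blast
      finally have "norm (exp (v x)) / d\<^sup>2 \<le> C / d" by (simp add: norm_divide norm_power nD)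
      then have "norm (exp (v x)) \<le> C * d" using d by (simp add: field_simps power2_eq_square)
      moreover have "1 - d \<le> norm (exp (v x))"
        using norm_triangle_ineq4[of "exp (v x)" D] nD by (simp add: D_def)
      ultimately have "1 \<le> (1 + C) * d" by (simp add: algebra_simps)
      then show False using d C by (simp add: field_simps)
    qed
    then have nz: "- norm D * Re (saddle_kernel 1 x) \<noteq> 0" using nD d by simp
    have "((\<lambda>r. (norm (exp (v r) - 1) - norm D) / (r - x)) \<longlongrightarrow> - norm D * Re (saddle_kernel 1 x)) (at x)"
      using ln_norm_deriv(1)[OF ne] unfolding has_field_derivative_iff D_def .
    then have "eventually (\<lambda>r. (norm (exp (v r) - 1) - norm D) / (r - x) \<noteq> 0) (at x)"
      using nz by (rule tendsto_imp_eventually_ne)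
    then have "eventually (\<lambda>r. r \<notin> ?A) (at x)"
      by (rule eventually_mono) (auto simp: nD)
    then show False using x(2) by (simp add: islimpt_iff_eventually)
  qed
  show ?thesis
    by (rule exI[of _ "1 / (1 + C)"], rule conjI) (use C main in simp_all)
qed

lemma tail_dominated_convergence:
  fixes f :: "real \<Rightarrow> real \<Rightarrow> complex"
  assumes \<rho>: "\<rho> > 0" and lam: "lam \<ge> 6" and B: "B \<ge> 0"
    and fm: "\<And>d. f d \<in> borel_measurable borel" "g \<in> borel_measurable borel"
    and fb: "\<And>d r. 0 < d \<Longrightarrow> d < 1 \<Longrightarrow> r \<ge> \<rho> \<Longrightarrow> r \<notin> sine_zeros \<Longrightarrow> norm (f d r) \<le> B * root_weight r"
    and lim: "\<And>r. r \<ge> \<rho> \<Longrightarrow> r \<notin> sine_zeros \<Longrightarrow> ((\<lambda>d. f d r) \<longlongrightarrow> g r) (at_right 0)"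
  shows "((\<lambda>d. LINT r:{\<rho>..}|lborel. (r * exp (- (lam / 2) * r\<^sup>2)) *\<^sub>R f d r) \<longlongrightarrow>
      (LINT r:{\<rho>..}|lborel. (r * exp (- (lam / 2) * r\<^sup>2)) *\<^sub>R g r)) (at_right 0)"
proof -
  let ?w = "\<lambda>r. r * exp (- (lam / 2) * r\<^sup>2)"
  have rwm: "root_weight \<in> borel_measurable borel" unfolding root_weight_def[abs_def] by measurable
  have rw0: "root_weight r \<ge> 0" for r by (simp add: root_weight_def)
  obtain C c where "\<forall>lam\<ge>6. \<forall>B\<ge>0. \<forall>f :: real \<Rightarrow> complex.
     f \<in> borel_measurable borel \<longrightarrow>
     (\<forall>r\<ge>\<rho>. r \<notin> sine_zeros \<longrightarrow> norm (f r) \<le> B * (exp (r\<^sup>2 / 2) / sqrt \<bar>sin (r\<^sup>2 / 4)\<bar>)) \<longrightarrow>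
     set_integrable lborel {\<rho>..} (\<lambda>r. (r * exp (- (lam / 2) * r\<^sup>2)) *\<^sub>R f r) \<and>
     lam * norm (LINT r:{\<rho>..}|lborel. (r * exp (- (lam / 2) * r\<^sup>2)) *\<^sub>R f r) \<le> C * B * exp (- c * lam)"
    using gaussian_tail_bound[OF \<rho>] by (elim exE conjE) (rule that)
  \<comment> \<open>The tail bound applied to its own majorant yields the integrable dominating
    function.\<close>
  then have "set_integrable lborel {\<rho>..} (\<lambda>r. ?w r *\<^sub>R complex_of_real (B * root_weight r))"
    using lam B rwm rw0 unfolding root_weight_def[symmetric]
    by (auto simp: norm_mult)
  then have "integrable lborel (\<lambda>r. norm (indicator {\<rho>..} r *\<^sub>R (?w r *\<^sub>R complex_of_real (B * root_weight r))))"
    unfolding set_integrable_def by (rule integrable_norm)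
  then have wint: "integrable lborel (\<lambda>r. indicator {\<rho>..} r * (\<bar>?w r\<bar> * (B * root_weight r)))"
    using B rw0 by (simp add: abs_mult mult.assoc norm_mult)
  have N: "AE x in lborel. x \<notin> sine_zeros" by (intro AE_not_in countable_imp_null_set_lborel countable_sine_zeros)
  show ?thesis
    unfolding tendsto_at_iff_sequentially
  proof (intro allI impI)
    fix X :: "nat \<Rightarrow> real" assume X: "\<forall>i. X i \<in> {0<..} - {0}" "X \<longlonglongrightarrow> 0"
    have "eventually (\<lambda>i. X i < 1) sequentially" using X(2) by (rule order_tendstoD) simp
    then obtain n0 where n0: "\<And>i. i \<ge> n0 \<Longrightarrow> X i < 1" by (auto simp: eventually_sequentially)
    have "(\<lambda>i. \<integral>r. indicator {\<rho>..} r *\<^sub>R (?w r *\<^sub>R f (X (i + n0)) r) \<partial>lborel) \<longlonglongrightarrow> (\<integral>r. indicator {\<rho>..} r *\<^sub>R (?w r *\<^sub>R g r) \<partial>lborel)"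
    proof (rule integral_dominated_convergence[OF _ _ wint])
      show "(\<lambda>r. indicator {\<rho>..} r *\<^sub>R (?w r *\<^sub>R g r)) \<in> borel_measurable lborel" using fm(2) by measurable
      show "(\<lambda>r. indicator {\<rho>..} r *\<^sub>R (?w r *\<^sub>R f (X (i + n0)) r)) \<in> borel_measurable lborel" for i using fm(1) by measurable
      show "AE r in lborel. (\<lambda>i. indicator {\<rho>..} r *\<^sub>R (?w r *\<^sub>R f (X (i + n0)) r)) \<longlonglongrightarrow> indicator {\<rho>..} r *\<^sub>R (?w r *\<^sub>R g r)"
        using N
      proof eventually_elim
        case (elim r)
        show ?case
        proof (cases "r \<ge> \<rho>")
          case True
          have "(\<lambda>i. f (X i) r) \<longlonglongrightarrow> g r"
            using lim[OF True elim, unfolded tendsto_at_iff_sequentially, rule_format, of X] X by (simp add: comp_def)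
          then have "(\<lambda>i. f (X (i + n0)) r) \<longlonglongrightarrow> g r" by (rule LIMSEQ_ignore_initial_segment)
          then show ?thesis by (intro tendsto_intros)
        qed simp
      qed
      show "AE r in lborel. norm (indicator {\<rho>..} r *\<^sub>R (?w r *\<^sub>R f (X (i + n0)) r)) \<le> indicator {\<rho>..} r * (\<bar>?w r\<bar> * (B * root_weight r))" for i
        using N
      proof eventually_elim
        case (elim r)
        have "X (i + n0) > 0" "X (i + n0) < 1" using X(1) n0[of "i + n0"] by auto
        then show ?case using fb[of "X (i + n0)" r] elim by (cases "r \<ge> \<rho>") (auto intro!: mult_left_mono)
      qed
    qed
    then have "(\<lambda>i. LINT r:{\<rho>..}|lborel. ?w r *\<^sub>R f (X (i + n0)) r) \<longlonglongrightarrow> (LINT r:{\<rho>..}|lborel. ?w r *\<^sub>R g r)"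
      by (simp only: set_lebesgue_integral_def)
    then show "((\<lambda>d. LINT r:{\<rho>..}|lborel. ?w r *\<^sub>R f d r) \<circ> X) \<longlonglongrightarrow> (LINT r:{\<rho>..}|lborel. ?w r *\<^sub>R g r)"
      unfolding comp_def by (rule LIMSEQ_offset)
  qed
qed

text \<open>The bound does not depend on d, so it dominates the passage d \<rightarrow> 0.\<close>

lemma ln_max_bound:
  assumes "0 < d" "d < 1" "r \<ge> 0" "r \<notin> sine_zeros"
  shows "\<bar>ln (max (norm (exp (v r) - 1)) d)\<bar> \<le> 16 * root_weight r"
proof -
  let ?D = "norm (exp (v r) - 1)"
  define m where "m = max ?D d"
  have D: "?D > 0" using exp_eq_1_sin[of r] assms by auto
  have m: "m > 0" using assms by (simp add: m_def)
  have "?D \<le> norm (exp (v r)) + 1" using norm_triangle_ineq4[of "exp (v r)" 1] by simp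
  then have "?D \<le> 4 * (1 + r\<^sup>2)"
    using norm_exp_v_le[OF assms(3)] zero_le_power2[of r] unfolding distrib_left by linarith
  moreover have "d \<le> 4 * (1 + r\<^sup>2)" using assms(2) zero_le_power2[of r] unfolding distrib_left by linarith
  ultimately have mu: "m \<le> 4 * (1 + r\<^sup>2)" by (simp add: m_def)
  have "1 / m \<le> 1 / ?D" using D using m by (intro divide_left_mono mult_pos_pos) (auto simp: m_def)
  also have "\<dots> \<le> (1 + r\<^sup>2) / ?D" by (intro divide_right_mono) auto
  finally have mi: "1 / m \<le> (1 + r\<^sup>2) / ?D" .
  have "ln m \<le> m" using ln_le_minus_one[OF m] by linarith
  moreover have "- ln m \<le> 1 / m" using ln_le_minus_one[of "1 / m"] m by (simp add: ln_div)
  moreover have "0 < 1 / m" using m by simp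
  ultimately have "\<bar>ln m\<bar> \<le> 0 + 4 * (1 + r\<^sup>2) + 1 * ((1 + r\<^sup>2) / ?D)"
    using mu mi m by linarith
  also have "\<dots> \<le> 2 * (0 + 4 + 2 * 1) * root_weight r" using assms by (intro weight_bounds) auto
  also have "\<dots> \<le> 16 * root_weight r" by (intro mult_right_mono) (auto simp: root_weight_def)
  finally show ?thesis by (simp add: m_def)
qed

definition cut_kernel :: "real \<Rightarrow> real \<Rightarrow> complex" where
  "cut_kernel d r = (if norm (exp (v r) - 1) > d then saddle_kernel 1 r else 0)"

text \<open>The imaginary part of the kernel is r \<open>k\<close> r with \<open>k\<close> = O(1 /
  |e^v - 1|), absolutely integrable, so its cut version converges by domination. The real part is
  integrated by parts against the logarithm of the modulus; the result contains only a logarithmic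
  singularity and again converges by domination.\<close>

lemma tail_principal_value:
  assumes \<rho>: "\<rho> > 0" "\<rho> \<notin> sine_zeros"
  shows "\<exists>C\<ge>0. \<exists>c>0. \<exists>d1>0. \<forall>lam\<ge>6. \<exists>l. norm l \<le> C * exp (- c * lam) \<and>
     ((\<lambda>d. LINT r:{\<rho>..}|lborel. exp (- (lam / 2) * r\<^sup>2) *\<^sub>R cut_kernel d r) \<longlongrightarrow> l) (at_right 0) \<and>
     (\<forall>d. 0 < d \<longrightarrow> d < d1 \<longrightarrow> set_integrable lborel {\<rho>..} (\<lambda>r. exp (- (lam / 2) * r\<^sup>2) *\<^sub>R cut_kernel d r))"
proof -
  obtain C c where C: "C \<ge> 0" "c > 0" and tail: "\<forall>lam\<ge>6. \<forall>B\<ge>0. \<forall>f :: real \<Rightarrow> complex.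
     f \<in> borel_measurable borel \<longrightarrow>
     (\<forall>r\<ge>\<rho>. r \<notin> sine_zeros \<longrightarrow> norm (f r) \<le> B * (exp (r\<^sup>2 / 2) / sqrt \<bar>sin (r\<^sup>2 / 4)\<bar>)) \<longrightarrow>
     set_integrable lborel {\<rho>..} (\<lambda>r. (r * exp (- (lam / 2) * r\<^sup>2)) *\<^sub>R f r) \<and>
     lam * norm (LINT r:{\<rho>..}|lborel. (r * exp (- (lam / 2) * r\<^sup>2)) *\<^sub>R f r) \<le> C * B * exp (- c * lam)"
    using gaussian_tail_bound[OF \<rho>(1)] by (elim exE conjE) (rule that)
  note tail = tail[folded root_weight_def]
  obtain C1 where C1: "C1 \<ge> 1" and Re: "\<forall>r. exp (v r) \<noteq> 1 \<longrightarrow> \<bar>Re (exp (v r) / (exp (v r) - 1)\<^sup>2)\<bar> \<le> C1 / norm (exp (v r) - 1)"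
    using Re_kernel_bound by (elim exE conjE) (rule that)
  obtain d0 where d0: "d0 > 0" and lev: "\<forall>d b \<rho>. 0 < d \<longrightarrow> d < d0 \<longrightarrow> 0 < \<rho> \<longrightarrow> finite {r \<in> {\<rho>..b}. norm (exp (v r) - 1) = d}"
    using finite_level_set by (elim exE conjE) (rule that)
  let ?D = "\<lambda>r. norm (exp (v r) - 1)"
  have D\<rho>: "?D \<rho> > 0" using exp_eq_1_sin[of \<rho>] \<rho> by auto
  have Dpos: "?D r > 0" if "r \<ge> \<rho>" "r \<notin> sine_zeros" for r using exp_eq_1_sin[of r] that \<rho> by auto
  \<comment> \<open>Below |e^(v \<rho>) - 1| the cut does not reach the point \<rho>, hence
    \<open>F d \<rho>\<close> = 0; the other two bounds are for \<open>finite_level_set\<close> and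
    \<open>ln_max_bound\<close>.\<close>
  define d1 where "d1 = min (min d0 1) (?D \<rho>)"
  have d1: "d1 > 0" "d1 \<le> d0" "d1 \<le> 1" "d1 \<le> ?D \<rho>" using d0 D\<rho> by (auto simp: d1_def)
  define k where "k r = Re (exp (v r) / (exp (v r) - 1)\<^sup>2)" for r
  define gI where "gI d r = complex_of_real (if ?D r > d then k r else 0)" for d r
  \<comment> \<open>The maximum freezes the logarithm where the cut acts. \<open>F d\<close> is
    therefore continuous and has derivative minus the real part of the cut kernel, so cutting
    produces no boundary terms.\<close>
  define F where "F d r = complex_of_real (ln (max (?D r) d) - ln (?D \<rho>))" for d r
  define B where "B = 16 + \<bar>ln (?D \<rho>)\<bar> + 4 * C1"
  have B: "B \<ge> 0" using C1 by (simp add: B_def)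
  have km [measurable]: "k \<in> borel_measurable borel" unfolding k_def by measurable
  have gIm: "gI d \<in> borel_measurable borel" for d unfolding gI_def by measurable
  have Fm: "F d \<in> borel_measurable borel" for d unfolding F_def by measurable
  have kb: "norm (complex_of_real (k r)) \<le> B * root_weight r" if r: "r \<ge> \<rho>" "r \<notin> sine_zeros" for r
  proof -
    have "norm (complex_of_real (k r)) \<le> C1 / ?D r" using Re Dpos[OF r] unfolding k_def by auto
    also have "\<dots> \<le> C1 * ((1 + r\<^sup>2) / ?D r)"
      using C1 Dpos[OF r] by (simp add: divide_right_mono mult_le_cancel_left1)
    also have "\<dots> = 0 + 0 * (1 + r\<^sup>2) + C1 * ((1 + r\<^sup>2) / ?D r)" by simp
    also have "\<dots> \<le> 2 * (0 + 0 + 2 * C1) * root_weight r" using r \<rho> C1 by (intro weight_bounds) auto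
    also have "\<dots> \<le> B * root_weight r" unfolding B_def by (intro mult_right_mono) (auto simp: root_weight_def)
    finally show ?thesis .
  qed
  have gIb: "norm (gI d r) \<le> B * root_weight r" if "r \<ge> \<rho>" "r \<notin> sine_zeros" for d r
    using kb[OF that] B root_weight_ge_1[of r] that \<rho> by (auto simp: gI_def)
  have Fb: "norm (F d r) \<le> B * root_weight r" if "0 < d" "d < 1" "r \<ge> \<rho>" "r \<notin> sine_zeros" for d r
  proof -
    have "norm (F d r) \<le> \<bar>ln (max (?D r) d)\<bar> + \<bar>ln (?D \<rho>)\<bar> * 1" unfolding F_def norm_of_real by simp
    also have "\<dots> \<le> 16 * root_weight r + \<bar>ln (?D \<rho>)\<bar> * root_weight r"
      using that \<rho> root_weight_ge_1[of r] by (intro add_mono ln_max_bound mult_left_mono) auto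
    also have "\<dots> \<le> B * root_weight r"
      using C1 unfolding B_def distrib_right by (simp add: root_weight_def)
    finally show ?thesis .
  qed
  have limI: "((\<lambda>d. gI d r) \<longlongrightarrow> complex_of_real (k r)) (at_right 0)" if "r \<ge> \<rho>" "r \<notin> sine_zeros" for r
  proof (rule tendsto_eventually)
    show "eventually (\<lambda>d. gI d r = complex_of_real (k r)) (at_right 0)"
      unfolding eventually_at_right_field using Dpos[OF that] by (intro exI[of _ "?D r"]) (auto simp: gI_def)
  qed
  have limF: "((\<lambda>d. F d r) \<longlongrightarrow> F 0 r) (at_right 0)" if "r \<ge> \<rho>" "r \<notin> sine_zeros" for r
  proof (rule tendsto_eventually)
    show "eventually (\<lambda>d. F d r = F 0 r) (at_right 0)"
      unfolding eventually_at_right_field using Dpos[OF that] by (intro exI[of _ "?D r"]) (auto simp: F_def max_def)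
  qed
  have F0b: "norm (F 0 r) \<le> B * root_weight r" if "r \<ge> \<rho>" "r \<notin> sine_zeros" for r
  proof (rule tendsto_upperbound[OF tendsto_norm[OF limF[OF that]]])
    show "eventually (\<lambda>d. norm (F d r) \<le> B * root_weight r) (at_right 0)"
      unfolding eventually_at_right_field using Fb that by (intro exI[of _ 1]) auto
  qed simp
  have main: "\<exists>l. norm l \<le> (2 * C * B) * exp (- c * lam) \<and>
     ((\<lambda>d. LINT r:{\<rho>..}|lborel. exp (- (lam / 2) * r\<^sup>2) *\<^sub>R cut_kernel d r) \<longlongrightarrow> l) (at_right 0) \<and>
     (\<forall>d. 0 < d \<longrightarrow> d < d1 \<longrightarrow> set_integrable lborel {\<rho>..} (\<lambda>r. exp (- (lam / 2) * r\<^sup>2) *\<^sub>R cut_kernel d r))"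
    if lam: "lam \<ge> 6" for lam
  proof -
    let ?e = "\<lambda>r. exp (- (lam / 2) * r\<^sup>2)"
    let ?I = "\<lambda>f. LINT r:{\<rho>..}|lborel. (r * ?e r) *\<^sub>R f r"
    have kcm: "(\<lambda>r. complex_of_real (k r)) \<in> borel_measurable borel" by measurable
    define G where "G d r = complex_of_real (if ?D r > d then Re (saddle_kernel 1 r) else 0)" for d r
    have split: "?e r *\<^sub>R cut_kernel d r = ?e r *\<^sub>R G d r + \<i> * ((r * ?e r) *\<^sub>R gI d r)" for d r
    proof -
      have "cut_kernel d r = G d r + \<i> * (of_real r * gI d r)"
      proof -
        have "of_real r * (\<i> * z) = of_real (Re (of_real r * (\<i> * z))) + \<i> * (of_real r * of_real (Re z))" for z
          by (simp add: complex_eq_iff)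
        then show ?thesis
          unfolding cut_kernel_def G_def gI_def k_def saddle_kernel_1 by (cases "?D r > d") (simp_all only: if_True if_False, simp)
      qed
      then show ?thesis by (simp add: scaleR_conv_of_real algebra_simps)
    qed
    have iI: "set_integrable lborel {\<rho>..} (\<lambda>r. (r * ?e r) *\<^sub>R gI d r)" for d
      using tail[rule_format, OF lam B gIm gIb] by simp
    have iG: "set_integrable lborel {\<rho>..} (\<lambda>r. ?e r *\<^sub>R G d r)" and
      eqG: "(LINT r:{\<rho>..}|lborel. ?e r *\<^sub>R G d r) = - (lam *\<^sub>R ?I (F d))" if d: "0 < d" "d < d1" for d
    proof -
      \<comment> \<open>For fixed d > 0 the surviving kernel is bounded by 1 / d^2 + 1 / d apart
        from the factor r; this gives integrability only and plays no part in the limit.\<close>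
      define h where "h r = complex_of_real (if ?D r > d then Re (\<i> * (exp (v r) / (exp (v r) - 1)\<^sup>2)) else 0)" for r
      have hm: "h \<in> borel_measurable borel" unfolding h_def by measurable
      have hb: "norm (h r) \<le> (1 / d\<^sup>2 + 1 / d) * root_weight r" if r: "r \<ge> \<rho>" "r \<notin> sine_zeros" for r
      proof (cases "?D r > d")
        case True
        let ?DD = "exp (v r) - 1"
        have "norm (h r) \<le> norm (exp (v r) / ?DD\<^sup>2)"
          using True abs_Re_le_cmod[of "\<i> * (exp (v r) / ?DD\<^sup>2)"] unfolding h_def norm_of_real norm_mult norm_ii mult_1 by simp
        also have "exp (v r) / ?DD\<^sup>2 = 1 / ?DD\<^sup>2 + 1 / ?DD"
          using True d by (auto simp: divide_simps power2_eq_square)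
        also have "norm \<dots> \<le> 1 / (?D r)\<^sup>2 + 1 / ?D r"
          by (rule order_trans[OF norm_triangle_ineq]) (simp add: norm_divide norm_power)
        also have "\<dots> \<le> 1 / d\<^sup>2 + 1 / d"
          using True d by (intro add_mono divide_left_mono power_mono mult_pos_pos) auto
        also have "\<dots> \<le> (1 / d\<^sup>2 + 1 / d) * root_weight r"
          using mult_left_mono[of 1 "root_weight r" "1 / d\<^sup>2 + 1 / d"] d root_weight_ge_1[of r] r \<rho> by simp
        finally show ?thesis .
      next
        case False
        then show ?thesis using d by (simp add: h_def root_weight_def)
      qed
      have "set_integrable lborel {\<rho>..} (\<lambda>r. (r * ?e r) *\<^sub>R h r)"
        using tail[rule_format, OF lam _ hm hb] d by simp
      moreover have "(r * ?e r) *\<^sub>R h r = ?e r *\<^sub>R G d r" for r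
      proof -
        have "(r * ?e r) *\<^sub>R complex_of_real (Re y) = ?e r *\<^sub>R complex_of_real (Re (of_real r * y))" for y
          by (simp add: scaleR_conv_of_real)
        then show ?thesis
          unfolding h_def G_def saddle_kernel_1 by (cases "?D r > d") (simp_all only: if_True if_False, simp)
      qed
      ultimately show iG: "set_integrable lborel {\<rho>..} (\<lambda>r. ?e r *\<^sub>R G d r)" by (simp only:)
      then have iG': "set_integrable lborel {\<rho>..} (\<lambda>r. ?e r *\<^sub>R (- G d r))"
        using set_integrable_scaleR_right[of "-1" lborel "{\<rho>..}"] by (simp add: set_integrable_def)
      have d': "d < 1" "d < d0" "d < ?D \<rho>" using d d1 by auto
      have fb: "\<forall>r\<ge>\<rho>. r \<notin> sine_zeros \<longrightarrow> norm (F d r) \<le> B * root_weight r" using Fb d d' by simp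
      have fin: "finite ((sine_zeros \<union> {r. ?D r = d}) \<inter> {\<rho>..b})" for b
      proof -
        have "(sine_zeros \<union> {r. ?D r = d}) \<inter> {\<rho>..b} = (sine_zeros \<inter> {\<rho>..b}) \<union> {r \<in> {\<rho>..b}. ?D r = d}" by auto
        then show ?thesis using lev d d' \<rho> finite_sine_zeros by simp
      qed
      have cD: "continuous_on A ?D" for A by (intro continuous_intros continuous_on_subset[OF cont_v]) simp
      have "(LINT r:{\<rho>..}|lborel. ?e r *\<^sub>R (- G d r)) = lam *\<^sub>R ?I (F d)"
      proof (rule by_parts_tail[OF \<rho>(1) lam B _ _ fin _ fb[unfolded root_weight_def] iG'])
        show "continuous_on {\<rho>..} (F d)"
          unfolding F_def by (intro continuous_intros cD) (use d in \<open>auto simp: max_def\<close>)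
        show "F d \<rho> = 0" using d' by (simp add: F_def max_def)
        show "set_integrable lborel {\<rho>..} (\<lambda>r. (r * ?e r) *\<^sub>R F d r)"
          using tail[rule_format, OF lam B Fm fb[rule_format]] by simp
        fix r assume r: "\<rho> \<le> r" "r \<notin> sine_zeros \<union> {r. ?D r = d}"
        have oc: "open (?D -` U)" if "open U" for U
          using cD[of UNIV] that by (simp add: continuous_on_open_vimage)
        show "(F d has_vector_derivative - G d r) (at r)"
        proof (cases "?D r > d")
          case True
          then have "exp (v r) \<noteq> 1" using d by auto
          from DERIV_diff[OF ln_norm_deriv(2)[OF this] DERIV_const, of "ln (?D \<rho>)"]
          have "((\<lambda>r. complex_of_real (ln (?D r) - ln (?D \<rho>))) has_vector_derivative complex_of_real (- Re (saddle_kernel 1 r) - 0)) (at r)"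
            by (rule has_vector_derivative_of_real)
          then have "(F d has_vector_derivative complex_of_real (- Re (saddle_kernel 1 r) - 0)) (at r)"
            by (rule has_vector_derivative_transform_within_open[where S = "?D -` {d<..}"])
               (use True oc in \<open>auto simp: F_def max_def\<close>)
          then show ?thesis using True by (simp add: G_def)
        next
          case False
          then have lt: "?D r < d" using r by auto
          have "((\<lambda>r. complex_of_real (ln d - ln (?D \<rho>))) has_vector_derivative 0) (at r)"
            by (rule has_vector_derivative_const)
          then have "(F d has_vector_derivative 0) (at r)"
            by (rule has_vector_derivative_transform_within_open[where S = "?D -` {..<d}"])
               (use lt oc in \<open>auto simp: F_def max_def\<close>)
          then show ?thesis using False by (simp add: G_def)
        qed
      qed
      moreover have "(LINT r:{\<rho>..}|lborel. ?e r *\<^sub>R (- G d r)) = - (LINT r:{\<rho>..}|lborel. ?e r *\<^sub>R G d r)"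
        unfolding set_lebesgue_integral_def by simp
      ultimately show "(LINT r:{\<rho>..}|lborel. ?e r *\<^sub>R G d r) = - (lam *\<^sub>R ?I (F d))"
        by (simp only: minus_equation_iff[of "LINT r:{\<rho>..}|lborel. ?e r *\<^sub>R G d r"])
    qed
    define l where "l = - (lam *\<^sub>R ?I (F 0)) + \<i> * ?I (\<lambda>r. complex_of_real (k r))"
    have eq: "(LINT r:{\<rho>..}|lborel. ?e r *\<^sub>R cut_kernel d r) = - (lam *\<^sub>R ?I (F d)) + \<i> * ?I (gI d)"
      and int: "set_integrable lborel {\<rho>..} (\<lambda>r. ?e r *\<^sub>R cut_kernel d r)" if d: "0 < d" "d < d1" for d
    proof -
      have i2: "set_integrable lborel {\<rho>..} (\<lambda>r. \<i> * ((r * ?e r) *\<^sub>R gI d r))"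
        by (rule set_integrable_mult_right[OF iI])
      show "set_integrable lborel {\<rho>..} (\<lambda>r. ?e r *\<^sub>R cut_kernel d r)"
        unfolding split by (rule set_integral_add(1)[OF iG[OF d] i2])
      show "(LINT r:{\<rho>..}|lborel. ?e r *\<^sub>R cut_kernel d r) = - (lam *\<^sub>R ?I (F d)) + \<i> * ?I (gI d)"
        unfolding split set_integral_add(2)[OF iG[OF d] i2] eqG[OF d] by (simp only: set_integral_mult_right)
    qed
    have "((\<lambda>d. - (lam *\<^sub>R ?I (F d)) + \<i> * ?I (gI d)) \<longlongrightarrow> l) (at_right 0)"
      unfolding l_def
      by (intro tendsto_add tendsto_minus tendsto_scaleR tendsto_mult tendsto_const
           tail_dominated_convergence[OF \<rho>(1) lam B Fm Fm Fb limF] tail_dominated_convergence[OF \<rho>(1) lam B gIm kcm gIb limI])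
    then have lim: "((\<lambda>d. LINT r:{\<rho>..}|lborel. ?e r *\<^sub>R cut_kernel d r) \<longlongrightarrow> l) (at_right 0)"
      by (rule Lim_transform_eventually)
         (use d1(1) eq in \<open>auto simp: eventually_at_right_field intro!: exI[of _ d1]\<close>)
    have "lam * norm (?I (F 0)) \<le> C * B * exp (- c * lam)"
      using tail[rule_format, OF lam B Fm F0b] by simp
    moreover have "1 * norm (?I (\<lambda>r. complex_of_real (k r))) \<le> lam * norm (?I (\<lambda>r. complex_of_real (k r)))"
      using lam by (intro mult_right_mono) auto
    moreover have "lam * norm (?I (\<lambda>r. complex_of_real (k r))) \<le> C * B * exp (- c * lam)"
      using tail[rule_format, OF lam B kcm kb] by simp
    moreover have "norm l \<le> lam * norm (?I (F 0)) + norm (?I (\<lambda>r. complex_of_real (k r)))"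
      unfolding l_def using lam by (intro order_trans[OF norm_triangle_ineq]) (simp add: norm_mult)
    ultimately have "norm l \<le> (2 * C * B) * exp (- c * lam)" by linarith
    then show ?thesis using lim int by (intro exI[of _ l]) simp
  qed
  have "2 * C * B \<ge> 0" using C B by simp
  then show ?thesis using C(2) d1(1) main by (intro exI[of _ "2 * C * B"] exI[of _ c] exI[of _ d1] conjI allI impI)
qed

end

section \<open>The saddle curve near the saddle point\<close>

locale saddle_setup = local_saddle V R + phase_curve v
  for V :: "complex \<Rightarrow> complex" and R :: real and v :: "real \<Rightarrow> complex" +
  assumes agree: "\<bar>r\<bar> < R \<Longrightarrow> v r = V (of_real r)"
begin

text \<open>Half of R leaves a larger disc for the Cauchy estimates, and the arc is so short that
  sin (r^2 / 4) vanishes on it at r = 0 only.\<close>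

definition \<rho> :: real where "\<rho> = R / 2"

lemma rho: "0 < \<rho>" "\<rho> < R" "\<rho> \<le> 1/4"
  using R_pos R_le by (auto simp: \<rho>_def)

lemma rho_not_zero: "r \<noteq> 0 \<Longrightarrow> \<bar>r\<bar> \<le> \<rho> \<Longrightarrow> r \<notin> sine_zeros"
proof -
  assume r: "r \<noteq> 0" "\<bar>r\<bar> \<le> \<rho>"
  have "r\<^sup>2 \<le> 1\<^sup>2" using r rho by (intro power2_le_iff_abs_le[THEN iffD2]) auto
  then have "sin (r\<^sup>2 / 4) > 0" using r pi_gt3 by (intro sin_gt_zero) auto
  then show ?thesis by (simp add: sine_zeros_def)
qed

lemma in_ball: "\<bar>r\<bar> \<le> \<rho> \<Longrightarrow> complex_of_real r \<in> ball 0 R"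
  using rho by simp

lemma exp_V_ne_1: "r \<noteq> 0 \<Longrightarrow> \<bar>r\<bar> < R \<Longrightarrow> exp (V (of_real r)) \<noteq> 1"
  using V_ode[of "of_real r"] by auto

lemma V_ne_real: "r \<noteq> 0 \<Longrightarrow> \<bar>r\<bar> < R \<Longrightarrow> Im (V (of_real r)) \<noteq> 0"
  using V_real(1)[of r] by auto

text \<open>Steepest descent: along V the phase is purely real, and the oscillating factor becomes a
  Gaussian.\<close>

lemma osc_V: "\<bar>r\<bar> < R \<Longrightarrow> osc lam (V (of_real r)) = of_real (exp (- (lam / 2) * r\<^sup>2))"
proof -
  assume r: "\<bar>r\<bar> < R"
  have "- \<i> * of_real lam * (- \<i> * (of_real r)\<^sup>2 / 2) = complex_of_real (- (lam / 2) * r\<^sup>2)"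
    by (simp add: complex_eq_iff power2_eq_square)
  then show ?thesis using V_phase[of "of_real r"] r unfolding osc_def exp_of_real[symmetric] by simp
qed

lemma V_real_deriv: "\<bar>r\<bar> < R \<Longrightarrow> ((\<lambda>r. V (of_real r)) has_vector_derivative deriv V (of_real r)) (at r within S)"
  by (rule has_vector_derivative_at_within, rule has_vector_derivative_real_field, rule V_has_deriv) simp

lemma continuous_V_real: "continuous_on {-\<rho>..\<rho>} (\<lambda>r. V (of_real r))"
  and continuous_dV_real: "continuous_on {-\<rho>..\<rho>} (\<lambda>r. deriv V (of_real r))"
proof -
  have "continuous_on {-\<rho>..\<rho>} (\<lambda>r. f (of_real r))" if "f holomorphic_on ball 0 R" for f :: "complex \<Rightarrow> complex"
    by (rule continuous_on_compose2[OF holomorphic_on_imp_continuous_on[OF that]])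
       (use rho in \<open>auto intro: continuous_intros\<close>)
  from this[OF V_hol] this[OF deriv_V_hol]
  show "continuous_on {-\<rho>..\<rho>} (\<lambda>r. V (of_real r))" "continuous_on {-\<rho>..\<rho>} (\<lambda>r. deriv V (of_real r))" .
qed

definition local_integral :: "real \<Rightarrow> (real \<Rightarrow> complex) \<Rightarrow> complex" where
  "local_integral lam g = (LINT r:{-\<rho>..\<rho>}|lborel. exp (- (lam / 2) * r\<^sup>2) *\<^sub>R g r)"

lemma primitive_along_V:
  assumes "(F has_field_derivative osc lam (V (of_real r)) / (V (of_real r) - b)) (at (V (of_real r)))" "\<bar>r\<bar> < R"
  shows "((\<lambda>r. F (V (of_real r))) has_vector_derivative
      exp (- (lam / 2) * r\<^sup>2) *\<^sub>R (deriv V (of_real r) / (V (of_real r) - b))) (at r within S)"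
proof -
  from field_vector_diff_chain_at[OF V_real_deriv[OF assms(2)] assms(1)]
  have "((\<lambda>r. F (V (of_real r))) has_vector_derivative
      deriv V (of_real r) * (osc lam (V (of_real r)) / (V (of_real r) - b))) (at r)"
    by (simp only: comp_def)
  moreover have "x * (y / z) = y * (x / z)" for x y z :: complex by simp
  from this[of "deriv V (of_real r)"] have "deriv V (of_real r) * (osc lam (V (of_real r)) / (V (of_real r) - b))
     = exp (- (lam / 2) * r\<^sup>2) *\<^sub>R (deriv V (of_real r) / (V (of_real r) - b))"
    unfolding osc_V[OF assms(2)] scaleR_conv_of_real .
  ultimately show ?thesis by (simp only: has_vector_derivative_at_within)
qed

lemma local_integral_primitive:
  fixes b :: real
  assumes b: "b \<noteq> 0"
    and F: "\<forall>v. Im v \<noteq> 0 \<or> v = 0 \<longrightarrow> (F has_field_derivative osc lam v / (v - of_real b)) (at v)"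
  shows "local_integral lam (\<lambda>r. deriv V (of_real r) / (V (of_real r) - of_real b)) = F (V (of_real \<rho>)) - F (V (of_real (- \<rho>)))"
  unfolding local_integral_def set_lebesgue_integral_def
proof (rule integral_FTC_Icc)
  show "- \<rho> \<le> \<rho>" using rho by simp
  have ok: "Im (V (of_real r)) \<noteq> 0 \<or> V (of_real r) = 0" if "\<bar>r\<bar> \<le> \<rho>" for r
    using V_ne_real[of r] that rho by (cases "r = 0") auto
  show "((\<lambda>r. F (V (of_real r))) has_vector_derivative
      exp (- (lam / 2) * r\<^sup>2) *\<^sub>R (deriv V (of_real r) / (V (of_real r) - of_real b))) (at r within {-\<rho>..\<rho>})"
    if "- \<rho> \<le> r" "r \<le> \<rho>" for r
    using F ok[of r] that rho by (intro primitive_along_V) auto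
  have "V (of_real r) - of_real b \<noteq> 0" if "\<bar>r\<bar> \<le> \<rho>" for r
    using ok[OF that] b by auto
  then show "continuous_on {-\<rho>..\<rho>} (\<lambda>r. exp (- (lam / 2) * r\<^sup>2) *\<^sub>R (deriv V (of_real r) / (V (of_real r) - of_real b)))"
    by (intro continuous_intros continuous_V_real continuous_dV_real) auto
qed

text \<open>\<open>reg_kernel_eq\<close> at u = V - ln a, where e^u = e^V / a, multiplied by V'. It
  writes the integrand of K as that of L, with its pole at ln a, minus a holomorphic
  function.\<close>

lemma kernel_split:
  assumes "a > 0" "r \<noteq> 0" "\<bar>r\<bar> < R"
  shows "- saddle_kernel a r = deriv V (of_real r) / (V (of_real r) - of_real (ln a))
      - deriv V (of_real r) * reg_kernel (V (of_real r) - of_real (ln a))"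
proof -
  let ?V = "V (of_real r)"
  define u where "u = ?V - of_real (ln a)"
  have e1: "exp ?V - 1 \<noteq> 0" using exp_V_ne_1[OF assms(2,3)] by simp
  have ode: "deriv V (of_real r) = - \<i> * of_real r / (exp ?V - 1)"
    using V_ode[of "of_real r"] assms e1 by (simp add: field_simps)
  have un: "u \<noteq> 0" using V_ne_real[OF assms(2,3)] by (auto simp: u_def)
  have "\<bar>Im u\<bar> \<le> norm ?V" unfolding u_def using abs_Im_le_cmod[of ?V] by simp
  then have Iu: "\<bar>Im u\<bar> < 2 * pi" using V_less_1[of "of_real r"] assms pi_gt3 by auto
  have "exp ?V = exp u * of_real a" using assms(1) by (simp add: u_def exp_diff exp_of_real)
  then have "exp ?V / (exp ?V - of_real a) = exp u / (exp u - 1)"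
    using assms(1) by (simp add: divide_simps) (simp add: algebra_simps)
  then have rk: "reg_kernel u = 1 / u - exp ?V / (exp ?V - of_real a)"
    using reg_kernel_eq[OF Iu un] by simp
  show ?thesis
    unfolding u_def[symmetric] rk saddle_kernel_def agree[OF assms(3)] ode
    by (simp add: algebra_simps)
qed

lemma reg_kernel_along_V_continuous:
  "continuous_on {-\<rho>..\<rho>} (\<lambda>r. reg_kernel (V (of_real r) - of_real b))"
proof (rule continuous_on_compose2[OF holomorphic_on_imp_continuous_on[OF reg_kernel_holomorphic]])
  show "continuous_on {-\<rho>..\<rho>} (\<lambda>r. V (of_real r) - of_real b)" by (intro continuous_intros continuous_V_real)
  show "(\<lambda>r. V (of_real r) - of_real b) ` {-\<rho>..\<rho>} \<subseteq> {u. \<bar>Im u\<bar> < 2 * pi}"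
  proof clarsimp
    fix r assume r: "- \<rho> \<le> r" "r \<le> \<rho>"
    have "\<bar>Im (V (of_real r))\<bar> < 1"
      by (rule le_less_trans[OF abs_Im_le_cmod V_less_1[OF in_ball]]) (use r in auto)
    then show "\<bar>Im (V (of_real r))\<bar> < 2 * pi" using pi_gt3 by linarith
  qed
qed

lemma local_kernel_integral:
  assumes a: "a > 0" "a \<noteq> 1"
  shows "set_integrable lborel {-\<rho>..\<rho>} (\<lambda>r. exp (- (lam / 2) * r\<^sup>2) *\<^sub>R saddle_kernel a r)"
    and "- local_integral lam (saddle_kernel a) = local_integral lam (\<lambda>r. deriv V (of_real r) / (V (of_real r) - of_real (ln a)))
      - local_integral lam (\<lambda>r. deriv V (of_real r) * reg_kernel (V (of_real r) - of_real (ln a)))"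
proof -
  let ?e = "\<lambda>r. exp (- (lam / 2) * r\<^sup>2)" and ?b = "ln a"
  let ?f = "\<lambda>r. deriv V (of_real r) / (V (of_real r) - of_real ?b)" and ?g = "\<lambda>r. deriv V (of_real r) * reg_kernel (V (of_real r) - of_real ?b)"
  have b: "?b \<noteq> 0" using a by simp
  have "V (of_real r) - of_real ?b \<noteq> 0" if "\<bar>r\<bar> \<le> \<rho>" for r
    using V_ne_real[of r] that rho b by (cases "r = 0") auto
  then have fi: "set_integrable lborel {-\<rho>..\<rho>} (\<lambda>r. ?e r *\<^sub>R ?f r)"
    by (intro borel_integrable_atLeastAtMost' continuous_intros continuous_V_real continuous_dV_real) auto
  have gi: "set_integrable lborel {-\<rho>..\<rho>} (\<lambda>r. ?e r *\<^sub>R ?g r)"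
    by (intro borel_integrable_atLeastAtMost' continuous_intros continuous_dV_real reg_kernel_along_V_continuous)
  have fgi: "set_integrable lborel {-\<rho>..\<rho>} (\<lambda>r. ?e r *\<^sub>R ?g r - ?e r *\<^sub>R ?f r)"
    by (rule set_integral_diff(1)[OF gi fi])
  have eq: "?e r *\<^sub>R saddle_kernel a r = ?e r *\<^sub>R ?g r - ?e r *\<^sub>R ?f r" if "r \<noteq> 0" "r \<in> {-\<rho>..\<rho>}" for r
  proof -
    have "\<bar>r\<bar> < R" using that rho by auto
    then have "- saddle_kernel a r = ?f r - ?g r" by (rule kernel_split[OF a(1) that(1)])
    then have "saddle_kernel a r = ?g r - ?f r" by (metis minus_diff_eq minus_minus)
    then show ?thesis by (simp only: scaleR_diff_right)
  qed
  \<comment> \<open>At r = 0 \<open>saddle_kernel\<close> is 0 / 0, that is 0, and the splitting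
    fails; the point is negligible.\<close>
  have N: "AE r in lborel. r \<noteq> (0::real)" by (rule AE_lborel_singleton)
  show i: "set_integrable lborel {-\<rho>..\<rho>} (\<lambda>r. ?e r *\<^sub>R saddle_kernel a r)"
    unfolding set_integrable_def
  proof (rule integrable_cong_AE_imp[OF fgi[unfolded set_integrable_def]])
    show "(\<lambda>r. indicator {-\<rho>..\<rho>} r *\<^sub>R (?e r *\<^sub>R saddle_kernel a r)) \<in> borel_measurable lborel"
      unfolding saddle_kernel_def by measurable
    show "AE r in lborel. indicator {-\<rho>..\<rho>} r *\<^sub>R (?e r *\<^sub>R ?g r - ?e r *\<^sub>R ?f r) = indicator {-\<rho>..\<rho>} r *\<^sub>R (?e r *\<^sub>R saddle_kernel a r)"
      using N by eventually_elim (use eq in \<open>auto simp: indicator_def\<close>)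
  qed
  have "local_integral lam (saddle_kernel a) = (LINT r:{-\<rho>..\<rho>}|lborel. ?e r *\<^sub>R ?g r - ?e r *\<^sub>R ?f r)"
    unfolding local_integral_def set_lebesgue_integral_def
  proof (rule integral_cong_AE)
    show "(\<lambda>r. indicator {-\<rho>..\<rho>} r *\<^sub>R (?e r *\<^sub>R saddle_kernel a r)) \<in> borel_measurable lborel"
      unfolding saddle_kernel_def by measurable
    show "(\<lambda>r. indicator {-\<rho>..\<rho>} r *\<^sub>R (?e r *\<^sub>R ?g r - ?e r *\<^sub>R ?f r)) \<in> borel_measurable lborel"
      using fgi by (simp add: set_integrable_def)
    show "AE r in lborel. indicator {-\<rho>..\<rho>} r *\<^sub>R (?e r *\<^sub>R saddle_kernel a r) = indicator {-\<rho>..\<rho>} r *\<^sub>R (?e r *\<^sub>R ?g r - ?e r *\<^sub>R ?f r)"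
      using N by eventually_elim (use eq in \<open>auto simp: indicator_def\<close>)
  qed
  also have "\<dots> = local_integral lam ?g - local_integral lam ?f"
    unfolding local_integral_def by (rule set_integral_diff(2)[OF gi fi])
  finally show "- local_integral lam (saddle_kernel a) = local_integral lam ?f - local_integral lam ?g" by simp
qed

text \<open>The cut \<open>norm (exp (v r) - 1) > d\<close> differs from the symmetric cut \<open>\<bar>r\<bar> > d\<close> only on a set of measure
  \<open>O(d\<^sup>2)\<close>, where the integrand is \<open>O(1/d)\<close>.\<close>

lemma D_near_abs:
  "\<exists>M>0. \<forall>r. \<bar>r\<bar> \<le> \<rho> \<longrightarrow> \<bar>norm (exp (v r) - 1) - \<bar>r\<bar>\<bar> \<le> M * r\<^sup>2"
proof -
  let ?G = "\<lambda>z. exp (V z) - 1"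
  obtain B where B0: "B \<ge> 0" and B: "\<And>G M r. G holomorphic_on ball (0::complex) R \<Longrightarrow>
     (\<And>z. z \<in> ball 0 R \<Longrightarrow> norm (G z) \<le> M) \<Longrightarrow>
     norm (indicator {-\<rho>..\<rho>} r *\<^sub>R G (of_real r) - (\<Sum>k\<le>1. (deriv ^^ k) G 0 / fact k * of_real r ^ k))
        \<le> B * M * \<bar>r\<bar> ^ (1 + 1)"
    by (fact taylor_remainder_bound[OF rho(1,2)])
  have hol: "?G holomorphic_on ball 0 R" by (intro holomorphic_intros V_hol)
  have bd: "norm (?G z) \<le> 4" if "z \<in> ball 0 R" for z
  proof -
    have "norm (exp (V z)) \<le> exp 1"
      using V_less_1[OF that] complex_Re_le_cmod[of "V z"] by simp
    also have "\<dots> \<le> 3" by (rule exp_le)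
    finally show ?thesis using norm_triangle_ineq4[of "exp (V z)" 1] by simp
  qed
  have "(?G has_field_derivative exp (V 0) * deriv V 0) (at 0)"
    using DERIV_diff[OF DERIV_chain2[OF DERIV_exp V_has_deriv] DERIV_const, of 0 1] R_pos by simp
  then have d: "deriv ?G 0 = sdir" by (simp add: V_deriv_0 DERIV_imp_deriv)
  have "\<bar>norm (exp (v r) - 1) - \<bar>r\<bar>\<bar> \<le> (4 * B + 1) * r\<^sup>2" if r: "\<bar>r\<bar> \<le> \<rho>" for r
  proof -
    have "r \<in> {-\<rho>..\<rho>}" using r by auto
    then have "norm (exp (v r) - 1 - sdir * of_real r) \<le> B * 4 * r\<^sup>2"
      using B[OF hol bd, of r] r rho d by (simp add: agree power2_eq_square)
    moreover have "\<bar>norm (exp (v r) - 1) - norm (sdir * of_real r)\<bar> \<le> norm (exp (v r) - 1 - sdir * of_real r)"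
      by (rule norm_triangle_ineq3)
    moreover have "norm (sdir * of_real r) = \<bar>r\<bar>" by (simp add: norm_mult)
    moreover have "0 \<le> r\<^sup>2" by simp
    moreover have "(4 * B + 1) * r\<^sup>2 = B * 4 * r\<^sup>2 + r\<^sup>2" by (simp add: algebra_simps)
    ultimately show ?thesis by linarith
  qed
  then show ?thesis using B0 by (intro exI[of _ "4 * B + 1"] conjI allI impI) simp_all
qed

text \<open>|e^V - 1 - V| <= 2/5 |V| for |V| <= 11/40, so |e^V - 1| >= 3/5 |V| >= 3/5 * 9/10 |r|,
  and 27/50 > 1/2.\<close>

lemma D_lower:
  assumes "\<bar>r\<bar> \<le> \<rho>"
  shows "\<bar>r\<bar> / 2 \<le> norm (exp (v r) - 1)"
proof -
  let ?V = "V (of_real r)"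
  have r: "of_real r \<in> ball (0::complex) R" by (rule in_ball[OF assms])
  have n: "norm ?V \<le> 11/40" using V_upper[OF r] assms rho by simp
  have "norm (exp ?V - (\<Sum>k\<le>1. ?V ^ k / fact k)) \<le> exp \<bar>Re ?V\<bar> * norm ?V ^ Suc 1 / fact 1"
    by (rule Taylor_exp)
  also have "\<dots> = exp \<bar>Re ?V\<bar> * norm ?V * norm ?V" by simp
  also have "\<dots> \<le> (1 + 11/40 + (11/40)\<^sup>2) * (11/40) * norm ?V"
  proof (intro mult_right_mono mult_mono)
    have "\<bar>Re ?V\<bar> \<le> 11/40" using abs_Re_le_cmod[of ?V] n by linarith
    then have "exp \<bar>Re ?V\<bar> \<le> exp (11/40)" by simp
    also have "\<dots> \<le> 1 + 11/40 + (11/40)\<^sup>2" by (rule exp_bound) auto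
    finally show "exp \<bar>Re ?V\<bar> \<le> 1 + 11/40 + (11/40)\<^sup>2" .
  qed (use n in auto)
  also have "\<dots> \<le> 2/5 * norm ?V" by (intro mult_right_mono) (auto simp: power2_eq_square)
  finally have "norm (exp ?V - 1 - ?V) \<le> 2/5 * norm ?V" by (simp add: algebra_simps)
  then have "3/5 * norm ?V \<le> norm (exp ?V - 1)"
    using norm_triangle_ineq3[of "exp ?V - 1" ?V] by (simp add: abs_le_iff)
  moreover have "9/10 * \<bar>r\<bar> \<le> norm ?V" using V_lower[OF r] by simp
  ultimately show ?thesis using agree[of r] assms rho by simp
qed

text \<open>Where the two cuts disagree, |r| equals d up to O(d^2). The factor 4 on one side appears
  because there |r| is known only to be at most 2 d.\<close>

lemma cut_region:
  assumes M: "M > 0" "\<forall>r. \<bar>r\<bar> \<le> \<rho> \<longrightarrow> \<bar>norm (exp (v r) - 1) - \<bar>r\<bar>\<bar> \<le> M * r\<^sup>2"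
    and r: "\<bar>r\<bar> \<le> \<rho>" and d: "d > 0"
    and diff: "(norm (exp (v r) - 1) > d) \<noteq> (\<bar>r\<bar> > d)"
  shows "d - M * d\<^sup>2 \<le> \<bar>r\<bar>" "\<bar>r\<bar> \<le> d + 4 * M * d\<^sup>2"
proof -
  let ?D = "norm (exp (v r) - 1)"
  have near: "\<bar>?D - \<bar>r\<bar>\<bar> \<le> M * r\<^sup>2" using M r by blast
  have "d - M * d\<^sup>2 \<le> \<bar>r\<bar> \<and> \<bar>r\<bar> \<le> d + 4 * M * d\<^sup>2"
  proof (cases "\<bar>r\<bar> > d")
    case True
    then have "?D \<le> d" using diff by auto
    then have "\<bar>r\<bar> \<le> 2 * d" using D_lower[OF r] by linarith
    then have "\<bar>r\<bar>\<^sup>2 \<le> (2 * d)\<^sup>2" by (intro power_mono) auto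
    then have "M * r\<^sup>2 \<le> M * (4 * d\<^sup>2)" using M by (intro mult_left_mono) (auto simp: power_mult_distrib)
    moreover have "0 \<le> M * d\<^sup>2" using M by simp
    ultimately show ?thesis using near \<open>?D \<le> d\<close> True by linarith
  next
    case False
    then have "?D > d" using diff by auto
    have "\<bar>r\<bar>\<^sup>2 \<le> d\<^sup>2" using False by (intro power_mono) auto
    then have "M * r\<^sup>2 \<le> M * d\<^sup>2" using M by (intro mult_left_mono) auto
    moreover have "0 \<le> M * d\<^sup>2" using M by simp
    ultimately show ?thesis using near \<open>?D > d\<close> False by linarith
  qed
  then show "d - M * d\<^sup>2 \<le> \<bar>r\<bar>" "\<bar>r\<bar> \<le> d + 4 * M * d\<^sup>2" by simp_all
qed

definition pole_kernel :: "real \<Rightarrow> complex" where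
  "pole_kernel r = deriv V (of_real r) / V (of_real r)"

lemma pole_kernel_bound: "\<exists>B>0. \<forall>r. \<bar>r\<bar> \<le> \<rho> \<longrightarrow> r \<noteq> 0 \<longrightarrow> norm (pole_kernel r) \<le> B / \<bar>r\<bar>"
proof -
  obtain B where B: "B > 0" "\<forall>z\<in>cball 0 \<rho>. norm (deriv V z) \<le> B"
    using deriv_V_bounded[OF rho(2)] by (elim exE conjE) (rule that)
  have "norm (pole_kernel r) \<le> 2 * B / \<bar>r\<bar>" if r: "\<bar>r\<bar> \<le> \<rho>" "r \<noteq> 0" for r
  proof -
    have "\<bar>r\<bar> / 2 \<le> norm (V (of_real r))" using V_lower[OF in_ball[OF r(1)]] by simp
    then have "norm (pole_kernel r) \<le> B / (\<bar>r\<bar> / 2)"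
      unfolding pole_kernel_def norm_divide using B r by (intro frac_le) auto
    then show ?thesis by (simp add: mult.commute)
  qed
  then show ?thesis using B(1) by (intro exI[of _ "2 * B"] conjI allI impI) simp_all
qed

lemma pole_kernel_measurable: "(\<lambda>r. indicator {-\<rho>..\<rho>} r *\<^sub>R pole_kernel r) \<in> borel_measurable borel"
proof -
  have "(\<lambda>r. (indicator {-\<rho>..\<rho>} r *\<^sub>R deriv V (of_real r)) / (indicator {-\<rho>..\<rho>} r *\<^sub>R V (of_real r))) \<in> borel_measurable borel"
    by (intro borel_measurable_divide borel_measurable_continuous_on_indicator continuous_V_real continuous_dV_real) simp_all
  also have "(\<lambda>r. (indicator {-\<rho>..\<rho>} r *\<^sub>R deriv V (of_real r)) / (indicator {-\<rho>..\<rho>} r *\<^sub>R V (of_real r)))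
     = (\<lambda>r. indicator {-\<rho>..\<rho>} r *\<^sub>R pole_kernel r)"
    by (auto simp: indicator_def pole_kernel_def fun_eq_iff)
  finally show ?thesis .
qed

lemma symmetric_cut_integral:
  assumes F: "\<forall>v. Im v \<noteq> 0 \<longrightarrow> (F has_field_derivative osc lam v / v) (at v)" and d: "0 < d" "d < \<rho>"
  shows "set_integrable lborel {-\<rho>..\<rho>} (\<lambda>r. exp (- (lam / 2) * r\<^sup>2) *\<^sub>R (if \<bar>r\<bar> > d then pole_kernel r else 0))"
    and "local_integral lam (\<lambda>r. if \<bar>r\<bar> > d then pole_kernel r else 0)
      = F (V (of_real \<rho>)) - F (V (of_real d)) + (F (V (of_real (- d))) - F (V (of_real (- \<rho>))))"
proof -
  let ?e = "\<lambda>r. exp (- (lam / 2) * r\<^sup>2)"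
  let ?h = "\<lambda>r. ?e r *\<^sub>R pole_kernel r"
  have seg: "has_bochner_integral lborel (\<lambda>r. indicator {p..q} r *\<^sub>R ?h r) (F (V (of_real q)) - F (V (of_real p)))"
    if pq: "p \<le> q" "{p..q} \<subseteq> {-\<rho>..\<rho>}" "0 \<notin> {p..q}" for p q
  proof (rule has_bochner_integral_FTC_Icc[OF pq(1)])
    fix r assume r: "p \<le> r" "r \<le> q"
    then have r': "\<bar>r\<bar> < R" "r \<noteq> 0" "\<bar>r\<bar> \<le> \<rho>" using pq rho by auto
    have "(F has_field_derivative osc lam (V (of_real r)) / (V (of_real r) - 0)) (at (V (of_real r)))"
      using F V_ne_real[OF r'(2,1)] by simp
    from primitive_along_V[OF this r'(1)]
    show "((\<lambda>r. F (V (of_real r))) has_vector_derivative ?h r) (at r within {p..q})"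
      by (simp add: pole_kernel_def)
  next
    have "V (of_real r) \<noteq> 0" if "r \<in> {p..q}" for r
      using V_ne_real[of r] pq that rho by force
    then show "continuous_on {p..q} ?h"
      unfolding pole_kernel_def
      by (intro continuous_intros continuous_on_subset[OF continuous_V_real pq(2)] continuous_on_subset[OF continuous_dV_real pq(2)]) auto
  qed
  have "has_bochner_integral lborel (\<lambda>r. indicator {d..\<rho>} r *\<^sub>R ?h r + indicator {-\<rho>..-d} r *\<^sub>R ?h r)
     (F (V (of_real \<rho>)) - F (V (of_real d)) + (F (V (of_real (- d))) - F (V (of_real (- \<rho>)))))"
    by (intro has_bochner_integral_add seg) (use d in auto)
  moreover have "indicator {d..\<rho>} r *\<^sub>R ?h r + indicator {-\<rho>..-d} r *\<^sub>R ?h r = indicator {-\<rho>..\<rho>} r *\<^sub>R (?e r *\<^sub>R (if \<bar>r\<bar> > d then pole_kernel r else 0))"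
    if "r \<notin> {d, -d}" for r
    using that d by (auto simp: indicator_def abs_if split: if_splits)
  ultimately have "has_bochner_integral lborel (\<lambda>r. indicator {-\<rho>..\<rho>} r *\<^sub>R (?e r *\<^sub>R (if \<bar>r\<bar> > d then pole_kernel r else 0)))
     (F (V (of_real \<rho>)) - F (V (of_real d)) + (F (V (of_real (- d))) - F (V (of_real (- \<rho>)))))"
    by (subst has_bochner_integral_discrete_difference[where X = "{d, -d}" and g = "\<lambda>r. indicator {d..\<rho>} r *\<^sub>R ?h r + indicator {-\<rho>..-d} r *\<^sub>R ?h r"]) auto
  then show "set_integrable lborel {-\<rho>..\<rho>} (\<lambda>r. ?e r *\<^sub>R (if \<bar>r\<bar> > d then pole_kernel r else 0))"
    "local_integral lam (\<lambda>r. if \<bar>r\<bar> > d then pole_kernel r else 0)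
      = F (V (of_real \<rho>)) - F (V (of_real d)) + (F (V (of_real (- d))) - F (V (of_real (- \<rho>))))"
    by (simp_all add: has_bochner_integral_iff set_integrable_def local_integral_def set_lebesgue_integral_def)
qed

text \<open>Division by d > 0 does not change the difference of the logarithms, and V(d) / d and
  V(-d) / d tend to \<open>sdir\<close> and -\<open>sdir\<close>, with principal arguments 3 pi / 4
  and -pi / 4. Along the Hankel circle they are pi / 2 and -pi / 2: another direction through 0, but
  the same jump.\<close>

lemma Ln_V_jump: "((\<lambda>d. Ln (V (of_real d)) - Ln (V (of_real (- d)))) \<longlongrightarrow> \<i> * of_real pi) (at_right 0)"
proof -
  have q: "((\<lambda>z. V z / z) \<longlongrightarrow> sdir) (at 0)"
    using V_has_deriv[of 0] R_pos by (simp add: has_field_derivative_iff V_deriv_0)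
  have f1: "filterlim complex_of_real (at 0) (at_right 0)"
    unfolding filterlim_at by (auto intro!: tendsto_eq_intros simp: eventually_at_filter)
  have f2: "filterlim (\<lambda>d. complex_of_real (- d)) (at 0) (at_right 0)"
    unfolding filterlim_at by (auto intro!: tendsto_eq_intros simp: eventually_at_filter)
  have L: "Ln sdir = \<i> * of_real (3 * pi / 4)" "Ln (- sdir) = - (\<i> * of_real (pi / 4))"
  proof -
    have "sdir = exp (\<i> * of_real (3 * pi / 4))" by (simp add: sdir_def cis_conv_exp)
    then show "Ln sdir = \<i> * of_real (3 * pi / 4)"
      by (rule ssubst) (rule Ln_exp, use pi_gt3 in simp_all)
    have "- sdir = exp (- (\<i> * of_real (pi / 4)))"
    proof -
      have "exp (- (\<i> * of_real (pi / 4))) = cis (3 * pi / 4 - pi)"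
        unfolding cis_conv_exp by (rule arg_cong[of _ _ exp]) (simp add: complex_eq_iff)
      also have "cis (x - pi) = - cis x" for x by (simp add: complex_eq_iff cos_diff sin_diff)
      finally show ?thesis by (simp add: sdir_def)
    qed
    then show "Ln (- sdir) = - (\<i> * of_real (pi / 4))"
      by (rule ssubst) (rule Ln_exp, use pi_gt3 in simp_all)
  qed
  have s1: "sdir \<notin> \<real>\<^sub>\<le>\<^sub>0" "- sdir \<notin> \<real>\<^sub>\<le>\<^sub>0"
    by (auto simp: complex_nonpos_Reals_iff sdir_Re_Im)
  have "((\<lambda>d. Ln (V (of_real d) / of_real d)) \<longlongrightarrow> Ln sdir) (at_right 0)"
    by (intro tendsto_Ln filterlim_compose[OF q f1] s1)
  moreover have "((\<lambda>d. Ln (- (V (of_real (- d)) / of_real (- d)))) \<longlongrightarrow> Ln (- sdir)) (at_right 0)"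
    by (intro tendsto_Ln tendsto_minus filterlim_compose[OF q f2] s1)
  ultimately have "((\<lambda>d. Ln (V (of_real d) / of_real d) - Ln (- (V (of_real (- d)) / of_real (- d)))) \<longlongrightarrow> Ln sdir - Ln (- sdir)) (at_right 0)"
    by (rule tendsto_diff)
  moreover have "Ln sdir - Ln (- sdir) = \<i> * of_real pi" unfolding L by (simp add: complex_eq_iff)
  moreover have "eventually (\<lambda>d. Ln (V (of_real d) / of_real d) - Ln (- (V (of_real (- d)) / of_real (- d))) = Ln (V (of_real d)) - Ln (V (of_real (- d)))) (at_right 0)"
    unfolding eventually_at_right_field
  proof (intro exI[of _ R] conjI allI impI)
    fix d :: real assume d: "0 < d" "d < R"
    have nz: "V (of_real d) / of_real d \<noteq> 0" "V (of_real (- d)) / of_real d \<noteq> 0"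
      using V_ne_real[of d] V_ne_real[of "-d"] d by auto
    have "Ln (of_real d * z) = Ln (of_real d) + Ln z" if "z \<noteq> 0" for z
      using Ln_times_of_real[OF d(1) that] by simp
    from this[OF nz(1)] this[OF nz(2)]
    show "Ln (V (of_real d) / of_real d) - Ln (- (V (of_real (- d)) / of_real (- d))) = Ln (V (of_real d)) - Ln (V (of_real (- d)))"
      using d by simp
  qed (rule R_pos)
  ultimately show ?thesis by (simp add: tendsto_cong)
qed

text \<open>The cut kernel is \<open>q1\<close> minus \<open>s1\<close> minus \<open>df\<close>: a
  bounded part that converges by domination, the pole with a cut symmetric in r, evaluated by the
  primitive, and the discrepancy of the two cuts, whose integral is O(d).\<close>

lemma local_principal_value:
  assumes lam: "lam \<ge> 0" and E: "\<forall>v. isCont E v" and FE: "\<forall>v. F v = E v + Ln v"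
    and F: "\<forall>v. Im v \<noteq> 0 \<longrightarrow> (F has_field_derivative osc lam v / v) (at v)"
  shows "((\<lambda>d. local_integral lam (cut_kernel d)) \<longlongrightarrow>
      local_integral lam (\<lambda>r. deriv V (of_real r) * reg_kernel (V (of_real r)))
      - (F (V (of_real \<rho>)) - F (V (of_real (- \<rho>))) - \<i> * of_real pi)) (at_right 0)"
    and "\<exists>d1>0. \<forall>d. 0 < d \<longrightarrow> d < d1 \<longrightarrow>
      set_integrable lborel {-\<rho>..\<rho>} (\<lambda>r. exp (- (lam / 2) * r\<^sup>2) *\<^sub>R cut_kernel d r)"
proof -
  let ?e = "\<lambda>r. exp (- (lam / 2) * r\<^sup>2)" and ?D = "\<lambda>r. norm (exp (v r) - 1)"
  define q where "q r = deriv V (of_real r) * reg_kernel (V (of_real r))" for r :: real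
  define s1 where "s1 d r = (if \<bar>r\<bar> > d then pole_kernel r else 0)" for d r
  define df where "df d r = (if ?D r > d then pole_kernel r else 0) - s1 d r" for d r
  define q1 where "q1 d r = (if ?D r > d then q r else 0)" for d r
  obtain M where M: "M > 0" "\<forall>r. \<bar>r\<bar> \<le> \<rho> \<longrightarrow> \<bar>?D r - \<bar>r\<bar>\<bar> \<le> M * r\<^sup>2"
    using D_near_abs by (elim exE conjE) (rule that)
  obtain B where B: "B > 0" "\<forall>r. \<bar>r\<bar> \<le> \<rho> \<longrightarrow> r \<noteq> 0 \<longrightarrow> norm (pole_kernel r) \<le> B / \<bar>r\<bar>"
    using pole_kernel_bound by (elim exE conjE) (rule that)
  \<comment> \<open>For M d <= 1/2 the region of disagreement stays outside |r| < d / 2, where the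
    pole is O(1 / d).\<close>
  define d1 where "d1 = min \<rho> (1 / (2 * M))"
  have d1: "d1 > 0" "d1 \<le> \<rho>" "d1 \<le> 1 / (2 * M)" using rho M by (auto simp: d1_def)
  have N: "AE r in lborel. r \<noteq> (0::real)" by (rule AE_lborel_singleton)
  have qc: "continuous_on {-\<rho>..\<rho>} q"
    unfolding q_def using reg_kernel_along_V_continuous[of 0] by (intro continuous_intros continuous_dV_real) simp
  have qi: "set_integrable lborel {-\<rho>..\<rho>} (\<lambda>r. ?e r *\<^sub>R q r)"
    by (intro borel_integrable_atLeastAtMost' continuous_intros qc)
  have qm: "(\<lambda>r. indicator {-\<rho>..\<rho>} r *\<^sub>R q r) \<in> borel_measurable borel"
    by (intro borel_measurable_continuous_on_indicator qc) simp
  have q1m: "(\<lambda>r. indicator {-\<rho>..\<rho>} r *\<^sub>R (?e r *\<^sub>R q1 d r)) \<in> borel_measurable borel" for d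
  proof -
    have "(\<lambda>r. ?e r *\<^sub>R (if ?D r > d then indicator {-\<rho>..\<rho>} r *\<^sub>R q r else 0)) \<in> borel_measurable borel"
      using qm by measurable
    also have "(\<lambda>r. ?e r *\<^sub>R (if ?D r > d then indicator {-\<rho>..\<rho>} r *\<^sub>R q r else 0)) = (\<lambda>r. indicator {-\<rho>..\<rho>} r *\<^sub>R (?e r *\<^sub>R q1 d r))"
      by (auto simp: q1_def fun_eq_iff indicator_def)
    finally show ?thesis .
  qed
  have q1i: "set_integrable lborel {-\<rho>..\<rho>} (\<lambda>r. ?e r *\<^sub>R q1 d r)" for d
    unfolding set_integrable_def
    by (rule Bochner_Integration.integrable_bound[OF qi[unfolded set_integrable_def]])
       (use q1m in \<open>auto simp: q1_def\<close>)
  have lim_q: "((\<lambda>d. local_integral lam (q1 d)) \<longlongrightarrow> local_integral lam q) (at_right 0)"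
    unfolding tendsto_at_iff_sequentially
  proof (intro allI impI)
    fix X :: "nat \<Rightarrow> real" assume X: "\<forall>i. X i \<in> {0<..} - {0}" "X \<longlonglongrightarrow> 0"
    have "(\<lambda>i. \<integral>r. indicator {-\<rho>..\<rho>} r *\<^sub>R (?e r *\<^sub>R q1 (X i) r) \<partial>lborel) \<longlonglongrightarrow> (\<integral>r. indicator {-\<rho>..\<rho>} r *\<^sub>R (?e r *\<^sub>R q r) \<partial>lborel)"
    proof (rule integral_dominated_convergence[OF _ _ integrable_norm[OF qi[unfolded set_integrable_def]]])
      show "(\<lambda>r. indicator {-\<rho>..\<rho>} r *\<^sub>R (?e r *\<^sub>R q r)) \<in> borel_measurable lborel" using qi by (simp add: set_integrable_def)
      show "(\<lambda>r. indicator {-\<rho>..\<rho>} r *\<^sub>R (?e r *\<^sub>R q1 (X i) r)) \<in> borel_measurable lborel" for i using q1m by simp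
      show "AE r in lborel. norm (indicator {-\<rho>..\<rho>} r *\<^sub>R (?e r *\<^sub>R q1 (X i) r)) \<le> norm (indicator {-\<rho>..\<rho>} r *\<^sub>R (?e r *\<^sub>R q r))" for i
        by (intro AE_I2) (simp add: q1_def)
      show "AE r in lborel. (\<lambda>i. indicator {-\<rho>..\<rho>} r *\<^sub>R (?e r *\<^sub>R q1 (X i) r)) \<longlonglongrightarrow> indicator {-\<rho>..\<rho>} r *\<^sub>R (?e r *\<^sub>R q r)"
        using N
      proof eventually_elim
        case (elim r)
        show ?case
        proof (cases "\<bar>r\<bar> \<le> \<rho>")
          case True
          then have "?D r > 0" using D_lower[of r] elim by auto
          then have "eventually (\<lambda>i. X i < ?D r) sequentially" using X(2) by (intro order_tendstoD(2))
          then have "eventually (\<lambda>i. q1 (X i) r = q r) sequentially" by eventually_elim (simp add: q1_def)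
          then have "(\<lambda>i. q1 (X i) r) \<longlonglongrightarrow> q r" by (rule tendsto_eventually)
          then show ?thesis by (intro tendsto_intros)
        next
          case False
          then have "r \<notin> {-\<rho>..\<rho>}" by auto
          then show ?thesis by simp
        qed
      qed
    qed
    then show "((\<lambda>d. local_integral lam (q1 d)) \<circ> X) \<longlonglongrightarrow> local_integral lam q"
      by (simp add: comp_def local_integral_def set_lebesgue_integral_def)
  qed
  have dfm: "(\<lambda>r. indicator {-\<rho>..\<rho>} r *\<^sub>R (?e r *\<^sub>R df d r)) \<in> borel_measurable borel" for d
  proof -
    have "(\<lambda>r. ?e r *\<^sub>R ((if ?D r > d then indicator {-\<rho>..\<rho>} r *\<^sub>R pole_kernel r else 0) - (if \<bar>r\<bar> > d then indicator {-\<rho>..\<rho>} r *\<^sub>R pole_kernel r else 0))) \<in> borel_measurable borel"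
      using pole_kernel_measurable by measurable
    also have "(\<lambda>r. ?e r *\<^sub>R ((if ?D r > d then indicator {-\<rho>..\<rho>} r *\<^sub>R pole_kernel r else 0) - (if \<bar>r\<bar> > d then indicator {-\<rho>..\<rho>} r *\<^sub>R pole_kernel r else 0)))
        = (\<lambda>r. indicator {-\<rho>..\<rho>} r *\<^sub>R (?e r *\<^sub>R df d r))"
      by (auto simp: df_def s1_def fun_eq_iff indicator_def)
    finally show ?thesis .
  qed
  have dfi: "set_integrable lborel {-\<rho>..\<rho>} (\<lambda>r. ?e r *\<^sub>R df d r)"
    and dfb: "norm (local_integral lam (df d)) \<le> 20 * B * M * d" if d: "0 < d" "d < d1" for d
  proof -
    let ?p = "d - M * d\<^sup>2" and ?q = "d + 4 * M * d\<^sup>2"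
    have "M * d \<le> M * (1 / (2 * M))" using d d1 M by (intro mult_left_mono) auto
    then have "M * d \<le> 1/2" using M by simp
    then have "M * d * d \<le> 1/2 * d" using d by (intro mult_right_mono) auto
    then have p: "d / 2 \<le> ?p" by (simp add: power2_eq_square)
    have Md: "0 \<le> M * d\<^sup>2" using M by simp
    have bd: "norm (indicator {-\<rho>..\<rho>} r *\<^sub>R (?e r *\<^sub>R df d r)) \<le> 2 * B / d * (indicator {?p..?q} r + indicator {-?q..-?p} r)" for r
    proof (cases "\<bar>r\<bar> \<le> \<rho> \<and> (?D r > d) \<noteq> (\<bar>r\<bar> > d)")
      case True
      then have r: "\<bar>r\<bar> \<le> \<rho>" and df: "(?D r > d) \<noteq> (\<bar>r\<bar> > d)" by auto
      have reg: "?p \<le> \<bar>r\<bar>" "\<bar>r\<bar> \<le> ?q" using cut_region[OF M r d(1) df] by auto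
      have r2: "d / 2 \<le> \<bar>r\<bar>" using p reg by linarith
      have "norm (df d r) = norm (pole_kernel r)" using df by (auto simp: df_def s1_def)
      also have "\<dots> \<le> B / \<bar>r\<bar>" using B r r2 d by auto
      also have "\<dots> \<le> B / (d / 2)" using r2 d B by (intro divide_left_mono) auto
      finally have 1: "norm (df d r) \<le> 2 * B / d" by (simp add: mult.commute)
      have "?e r \<le> 1" using lam by simp
      then have "?e r * norm (df d r) \<le> 1 * (2 * B / d)" using 1 B d by (intro mult_mono) auto
      moreover have "(1::real) \<le> indicator {?p..?q} r + indicator {-?q..-?p} r"
        using reg by (auto simp: indicator_def abs_if split: if_splits)
      then have "2 * B / d * 1 \<le> 2 * B / d * (indicator {?p..?q} r + indicator {-?q..-?p} r)" using B d by (intro mult_left_mono) auto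
      moreover have "norm (indicator {-\<rho>..\<rho>} r *\<^sub>R (?e r *\<^sub>R df d r)) \<le> ?e r * norm (df d r)" by (simp add: indicator_def)
      ultimately show ?thesis by linarith
    next
      case False
      then have "indicator {-\<rho>..\<rho>} r *\<^sub>R (?e r *\<^sub>R df d r) = 0"
        by (auto simp: df_def s1_def indicator_def abs_le_iff)
      then show ?thesis using B d by (simp add: indicator_def)
    qed
    have hb: "has_bochner_integral lborel (\<lambda>r. 2 * B / d * (indicator {?p..?q} r + indicator {-?q..-?p} r)) (2 * B / d * ((?q - ?p) + (- ?p - - ?q)))"
    proof (intro has_bochner_integral_mult_right has_bochner_integral_add)
      show "has_bochner_integral lborel (indicator {?p..?q}) (?q - ?p)" "has_bochner_integral lborel (indicator {-?q..-?p}) (- ?p - - ?q)"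
        using has_bochner_integral_real_indicator[of "{?p..?q}" lborel] has_bochner_integral_real_indicator[of "{-?q..-?p}" lborel] Md by simp_all
    qed
    \<comment> \<open>Two intervals of length 5 M d^2 each, with an integrand of size 2 B /
      d.\<close>
    have val: "2 * B / d * ((?q - ?p) + (- ?p - - ?q)) = 20 * B * M * d"
      using d by (simp add: field_simps power2_eq_square)
    have hi: "integrable lborel (\<lambda>r. 2 * B / d * (indicator {?p..?q} r + indicator {-?q..-?p} r :: real))"
      using hb by (simp add: has_bochner_integral_iff)
    show i: "set_integrable lborel {-\<rho>..\<rho>} (\<lambda>r. ?e r *\<^sub>R df d r)"
      unfolding set_integrable_def
    proof (rule Bochner_Integration.integrable_bound[OF hi])
      show "AE r in lborel. norm (indicator {-\<rho>..\<rho>} r *\<^sub>R (?e r *\<^sub>R df d r)) \<le> norm (2 * B / d * (indicator {?p..?q} r + indicator {-?q..-?p} r))"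
        by (intro AE_I2 order_trans[OF bd]) (simp only: real_norm_def abs_ge_self)
    qed (use dfm in simp)
    have "norm (local_integral lam (df d)) \<le> (LINT r|lborel. 2 * B / d * (indicator {?p..?q} r + indicator {-?q..-?p} r))"
      unfolding local_integral_def set_lebesgue_integral_def
      by (rule Bochner_Integration.integral_norm_bound_integral[OF i[unfolded set_integrable_def] hi bd])
    also have "\<dots> = 20 * B * M * d" unfolding val[symmetric] by (rule has_bochner_integral_integral_eq[OF hb])
    finally show "norm (local_integral lam (df d)) \<le> 20 * B * M * d" .
  qed
  have ceq: "?e r *\<^sub>R cut_kernel d r = ?e r *\<^sub>R q1 d r - (?e r *\<^sub>R s1 d r + ?e r *\<^sub>R df d r)" if "r \<noteq> 0" "r \<in> {-\<rho>..\<rho>}" for r d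
  proof -
    have "\<bar>r\<bar> < R" using that rho by auto
    from kernel_split[OF zero_less_one that(1) this]
    have "- saddle_kernel 1 r = pole_kernel r - q r" by (simp add: pole_kernel_def q_def)
    then have "saddle_kernel 1 r = q r - pole_kernel r" by (metis minus_diff_eq minus_minus)
    then have "cut_kernel d r = q1 d r - (s1 d r + df d r)" by (simp add: cut_kernel_def q1_def df_def)
    then show ?thesis by (simp only: scaleR_diff_right scaleR_add_right)
  qed
  have cut: "set_integrable lborel {-\<rho>..\<rho>} (\<lambda>r. ?e r *\<^sub>R cut_kernel d r) \<and>
    local_integral lam (cut_kernel d) = local_integral lam (q1 d) - (local_integral lam (s1 d) + local_integral lam (df d))"
    if d: "0 < d" "d < d1" for d
  proof -
    have s1i: "set_integrable lborel {-\<rho>..\<rho>} (\<lambda>r. ?e r *\<^sub>R s1 d r)"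
      unfolding s1_def using symmetric_cut_integral(1)[OF F d(1)] d d1 by simp
    note sd = set_integral_add[OF s1i dfi[OF d]]
    note all = set_integral_diff[OF q1i[of d] sd(1)]
    have cm: "(\<lambda>r. indicator {-\<rho>..\<rho>} r *\<^sub>R (?e r *\<^sub>R cut_kernel d r)) \<in> borel_measurable lborel"
      unfolding cut_kernel_def saddle_kernel_def by measurable
    have ae: "AE r in lborel. indicator {-\<rho>..\<rho>} r *\<^sub>R (?e r *\<^sub>R q1 d r - (?e r *\<^sub>R s1 d r + ?e r *\<^sub>R df d r)) = indicator {-\<rho>..\<rho>} r *\<^sub>R (?e r *\<^sub>R cut_kernel d r)"
      using N by eventually_elim (use ceq in \<open>auto simp: indicator_def\<close>)
    have "set_integrable lborel {-\<rho>..\<rho>} (\<lambda>r. ?e r *\<^sub>R cut_kernel d r)"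
      unfolding set_integrable_def by (rule integrable_cong_AE_imp[OF all(1)[unfolded set_integrable_def] cm ae])
    moreover have "local_integral lam (cut_kernel d) = (LINT r:{-\<rho>..\<rho>}|lborel. ?e r *\<^sub>R q1 d r - (?e r *\<^sub>R s1 d r + ?e r *\<^sub>R df d r))"
      unfolding local_integral_def set_lebesgue_integral_def
    proof (rule integral_cong_AE[OF cm])
      show "(\<lambda>r. indicator {-\<rho>..\<rho>} r *\<^sub>R (?e r *\<^sub>R q1 d r - (?e r *\<^sub>R s1 d r + ?e r *\<^sub>R df d r))) \<in> borel_measurable lborel"
        using all(1) by (simp add: set_integrable_def)
      show "AE r in lborel. indicator {-\<rho>..\<rho>} r *\<^sub>R (?e r *\<^sub>R cut_kernel d r) = indicator {-\<rho>..\<rho>} r *\<^sub>R (?e r *\<^sub>R q1 d r - (?e r *\<^sub>R s1 d r + ?e r *\<^sub>R df d r))"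
        using ae by eventually_elim simp
    qed
    ultimately show ?thesis unfolding all(2) sd(2) local_integral_def by simp
  qed
  then show "\<exists>d1>0. \<forall>d. 0 < d \<longrightarrow> d < d1 \<longrightarrow> set_integrable lborel {-\<rho>..\<rho>} (\<lambda>r. ?e r *\<^sub>R cut_kernel d r)"
    using d1(1) by (intro exI[of _ d1] conjI allI impI) simp_all
  have lim_df: "((\<lambda>d. local_integral lam (df d)) \<longlongrightarrow> 0) (at_right 0)"
  proof (rule Lim_null_comparison)
    show "eventually (\<lambda>d. norm (local_integral lam (df d)) \<le> 20 * B * M * d) (at_right 0)"
      unfolding eventually_at_right_field using dfb d1(1) by (intro exI[of _ d1]) simp
    show "((\<lambda>d. 20 * B * M * d) \<longlongrightarrow> 0) (at_right 0)" by (auto intro!: tendsto_eq_intros)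
  qed
  let ?FV = "\<lambda>d. F (V (of_real d))"
  have lim_s: "((\<lambda>d. local_integral lam (s1 d)) \<longlongrightarrow> ?FV \<rho> - ?FV (- \<rho>) - \<i> * of_real pi) (at_right 0)"
  proof -
    have Vc: "((\<lambda>d. V (of_real d)) \<longlongrightarrow> 0) (at_right 0)" "((\<lambda>d. V (of_real (- d))) \<longlongrightarrow> 0) (at_right 0)"
    proof -
      have "isCont V 0" using V_has_deriv[of 0] R_pos DERIV_isCont by (metis centre_in_ball)
      then have Vl: "isCont V (complex_of_real 0)" by simp
      have "((\<lambda>d. complex_of_real d) \<longlongrightarrow> complex_of_real 0) (at_right 0)" "((\<lambda>d. complex_of_real (- d)) \<longlongrightarrow> complex_of_real 0) (at_right 0)"
        by (auto intro!: tendsto_eq_intros)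
      from isCont_tendsto_compose[OF Vl this(1)] isCont_tendsto_compose[OF Vl this(2)]
      show "((\<lambda>d. V (of_real d)) \<longlongrightarrow> 0) (at_right 0)" "((\<lambda>d. V (of_real (- d))) \<longlongrightarrow> 0) (at_right 0)" by simp_all
    qed
    have E0: "isCont E 0" using E by simp
    have "((\<lambda>d. ?FV \<rho> - ?FV (- \<rho>) - ((E (V (of_real d)) - E (V (of_real (- d)))) + (Ln (V (of_real d)) - Ln (V (of_real (- d))))))
        \<longlongrightarrow> ?FV \<rho> - ?FV (- \<rho>) - ((E 0 - E 0) + \<i> * of_real pi)) (at_right 0)"
      by (intro tendsto_diff tendsto_add tendsto_const Ln_V_jump isCont_tendsto_compose[OF E0] Vc)
    then have l: "((\<lambda>d. ?FV \<rho> - ?FV (- \<rho>) - ((E (V (of_real d)) - E (V (of_real (- d)))) + (Ln (V (of_real d)) - Ln (V (of_real (- d))))))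
        \<longlongrightarrow> ?FV \<rho> - ?FV (- \<rho>) - \<i> * of_real pi) (at_right 0)" by simp
    show ?thesis
    proof (rule Lim_transform_eventually[OF l])
      show "eventually (\<lambda>d. ?FV \<rho> - ?FV (- \<rho>) - ((E (V (of_real d)) - E (V (of_real (- d)))) + (Ln (V (of_real d)) - Ln (V (of_real (- d)))))
          = local_integral lam (s1 d)) (at_right 0)"
        unfolding eventually_at_right_field
      proof (intro exI[of _ \<rho>] conjI allI impI)
        fix d assume d: "0 < d" "d < \<rho>"
        have "local_integral lam (s1 d) = ?FV \<rho> - ?FV d + (?FV (- d) - ?FV (- \<rho>))"
          unfolding s1_def by (rule symmetric_cut_integral(2)[OF F d])
        moreover have "?FV d = E (V (of_real d)) + Ln (V (of_real d))" "?FV (- d) = E (V (of_real (- d))) + Ln (V (of_real (- d)))"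
          using FE by simp_all
        ultimately show "?FV \<rho> - ?FV (- \<rho>) - ((E (V (of_real d)) - E (V (of_real (- d)))) + (Ln (V (of_real d)) - Ln (V (of_real (- d)))))
          = local_integral lam (s1 d)" by (simp only:) simp
      qed (rule rho(1))
    qed
  qed
  have "((\<lambda>d. local_integral lam (q1 d) - (local_integral lam (s1 d) + local_integral lam (df d))) \<longlongrightarrow>
     local_integral lam q - ((?FV \<rho> - ?FV (- \<rho>) - \<i> * of_real pi) + 0)) (at_right 0)"
    by (intro tendsto_diff tendsto_add lim_q lim_s lim_df)
  then have "((\<lambda>d. local_integral lam (cut_kernel d)) \<longlongrightarrow>
     local_integral lam q - ((?FV \<rho> - ?FV (- \<rho>) - \<i> * of_real pi) + 0)) (at_right 0)"
    by (rule Lim_transform_eventually)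
       (unfold eventually_at_right_field, use d1(1) cut in \<open>auto intro!: exI[of _ d1]\<close>)
  then show "((\<lambda>d. local_integral lam (cut_kernel d)) \<longlongrightarrow>
      local_integral lam (\<lambda>r. deriv V (of_real r) * reg_kernel (V (of_real r)))
      - (?FV \<rho> - ?FV (- \<rho>) - \<i> * of_real pi)) (at_right 0)"
    by (simp add: q_def[abs_def])
qed

end

lemma integral_three_pieces:
  fixes f :: "real \<Rightarrow> complex"
  assumes \<rho>: "\<rho> > 0" and r: "set_integrable lborel {\<rho>..} f" and l: "set_integrable lborel {\<rho>..} (\<lambda>r. f (- r))"
    and m: "set_integrable lborel {-\<rho>..\<rho>} f"
  shows "(LINT r|lborel. f r) = (LINT r:{\<rho>..}|lborel. f r) + (LINT r:{\<rho>..}|lborel. f (- r)) + (LINT r:{-\<rho>..\<rho>}|lborel. f r)"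
proof -
  let ?h = "\<lambda>r. indicator {\<rho>..} r *\<^sub>R f r + indicator {\<rho>..} (- r) *\<^sub>R f r + indicator {-\<rho>..\<rho>} r *\<^sub>R f r"
  have "has_bochner_integral lborel (\<lambda>r. indicator {\<rho>..} r *\<^sub>R f (- r)) (LINT r:{\<rho>..}|lborel. f (- r))"
    using l by (simp add: has_bochner_integral_iff set_integrable_def set_lebesgue_integral_def)
  from this[THEN lborel_has_bochner_integral_real_affine_iff[where c = "-1" and t = 0, THEN iffD1, rotated]]
  have hl: "has_bochner_integral lborel (\<lambda>r. indicator {\<rho>..} (- r) *\<^sub>R f r) (LINT r:{\<rho>..}|lborel. f (- r))"
    by simp
  have "has_bochner_integral lborel ?h ((LINT r:{\<rho>..}|lborel. f r) + (LINT r:{\<rho>..}|lborel. f (- r)) + (LINT r:{-\<rho>..\<rho>}|lborel. f r))"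
    by (intro has_bochner_integral_add hl)
       (use r m in \<open>simp_all add: has_bochner_integral_iff set_integrable_def set_lebesgue_integral_def\<close>)
  moreover have "?h r = f r" if "r \<notin> {\<rho>, - \<rho>}" for r
  proof -
    have "r \<noteq> \<rho>" "r \<noteq> - \<rho>" using that by auto
    then have "r < - \<rho> \<or> (- \<rho> < r \<and> r < \<rho>) \<or> \<rho> < r" by linarith
    then show ?thesis using \<rho> by (elim disjE conjE) (simp_all add: indicator_def)
  qed
  ultimately have "has_bochner_integral lborel f ((LINT r:{\<rho>..}|lborel. f r) + (LINT r:{\<rho>..}|lborel. f (- r)) + (LINT r:{-\<rho>..\<rho>}|lborel. f r))"
    by (subst has_bochner_integral_discrete_difference[where X = "{\<rho>, - \<rho>}" and g = ?h]) auto
  then show ?thesis by (rule has_bochner_integral_integral_eq)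
qed

section \<open>Comparison of L and K\<close>

context saddle_setup
begin

definition saddle_w :: "real \<Rightarrow> complex" where
  "saddle_w r = - \<i> * exp (v r)"

lemma saddle_integrand:
  "exp (- (of_real lam / 2) * (of_real r)\<^sup>2) / (saddle_w r + \<i> * of_real a) * (saddle_w r * of_real r / (saddle_w r + \<i>))
    = exp (- (lam / 2) * r\<^sup>2) *\<^sub>R saddle_kernel a r"
proof -
  have e: "exp (- (of_real lam / 2) * (of_real r)\<^sup>2) = complex_of_real (exp (- (lam / 2) * r\<^sup>2))"
    unfolding exp_of_real[symmetric] by simp
  have w: "saddle_w r + \<i> * of_real a = - \<i> * (exp (v r) - of_real a)" "saddle_w r + \<i> = - \<i> * (exp (v r) - 1)"
    by (simp_all add: saddle_w_def algebra_simps)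
  have "E / (- \<i> * A) * (- \<i> * x * y / (- \<i> * D)) = E * (\<i> * x * y / (D * A))" for E A x y D :: complex
    by (simp add: divide_simps)
  then show ?thesis
    unfolding e w saddle_kernel_def scaleR_conv_of_real by (simp only: saddle_w_def)
qed

lemma hankel_K_cut_eq:
  "hankel_K_cut saddle_w d a lam = - hankel_const a lam *
     (LINT r|lborel. (if norm (exp (v r) - of_real a) > d then exp (- (lam / 2) * r\<^sup>2) *\<^sub>R saddle_kernel a r else 0))"
proof -
  have "saddle_w r + \<i> * of_real a = - \<i> * (exp (v r) - of_real a)" for r
    by (simp add: saddle_w_def algebra_simps)
  then have "norm (saddle_w r + \<i> * of_real a) = norm (exp (v r) - of_real a)" for r
    by (simp only: norm_mult norm_minus_cancel norm_ii mult_1)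
  then show ?thesis
    unfolding hankel_K_cut_def saddle_integrand hankel_const_def by simp
qed

text \<open>The phase depends on r^2 only. The tail over r <= -\<rho> is thereby a tail of another
  curve of the same kind.\<close>

lemma reversed_curve: "phase_curve (\<lambda>r. v (- r))"
proof
  show "continuous_on UNIV (\<lambda>r. v (- r))"
    by (rule continuous_on_compose2[OF cont_v]) (auto intro: continuous_intros)
  show "exp (v (- r)) - 1 - v (- r) = - \<i> * (complex_of_real r)\<^sup>2 / 2" for r
    using phase[of "- r"] by simp
qed simp

text \<open>The ends of the arc satisfy what the two path bounds require. The last condition is the
  imaginary part of the phase equation, which equals -\<rho>^2 / 2.\<close>

lemma V_end_points:
  "Re (V (of_real \<rho>)) < 0" "0 < Im (V (of_real \<rho>))" "Im (V (of_real \<rho>)) \<le> 3 * pi / 2"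
  "0 < Re (V (of_real (- \<rho>)))" "Im (V (of_real (- \<rho>))) < 0" "- pi / 2 < Im (V (of_real (- \<rho>)))"
  "exp (Re (V (of_real (- \<rho>)))) * sin (Im (V (of_real (- \<rho>)))) - Im (V (of_real (- \<rho>))) < 0"
proof -
  have b: "of_real \<rho> \<in> ball (0::complex) R" "of_real (- \<rho>) \<in> ball (0::complex) R" using rho by simp_all
  have n: "\<bar>Im (V (of_real \<rho>))\<bar> < 1" "\<bar>Im (V (of_real (- \<rho>)))\<bar> < 1"
    using abs_Im_le_cmod V_less_1[OF b(1)] V_less_1[OF b(2)] by (meson le_less_trans)+
  show "Re (V (of_real \<rho>)) < 0" "0 < Im (V (of_real \<rho>))"
    using V_real(2,3)[of \<rho>] rho by auto
  show "0 < Re (V (of_real (- \<rho>)))" "Im (V (of_real (- \<rho>))) < 0"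
    using V_real(4,5)[of "- \<rho>"] rho by auto
  show "Im (V (of_real \<rho>)) \<le> 3 * pi / 2" "- pi / 2 < Im (V (of_real (- \<rho>)))" using n pi_gt3 by linarith+
  have "exp (Re (V (of_real (- \<rho>)))) * sin (Im (V (of_real (- \<rho>)))) - Im (V (of_real (- \<rho>)))
      = Im (exp (V (of_real (- \<rho>))) - 1 - V (of_real (- \<rho>)))" by (simp add: Im_exp)
  also have "\<dots> = - \<rho>\<^sup>2 / 2" unfolding V_phase[OF b(2)] by (simp add: power2_eq_square)
  also have "\<dots> < 0" using rho by simp
  finally show "exp (Re (V (of_real (- \<rho>)))) * sin (Im (V (of_real (- \<rho>)))) - Im (V (of_real (- \<rho>))) < 0" .
qed

definition reg_integrand :: "real \<Rightarrow> real \<Rightarrow> complex" where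
  "reg_integrand a r = deriv V (of_real r) * reg_kernel (V (of_real r) - of_real (ln a))"

definition pole_integrand :: "real \<Rightarrow> real \<Rightarrow> complex" where
  "pole_integrand a r = deriv V (of_real r) / (V (of_real r) - of_real (ln a))"

lemma hankel_L_local:
  "\<exists>C\<ge>0. \<exists>c>0. \<forall>lam\<ge>1. \<forall>a>0.
     (a \<noteq> 1 \<longrightarrow> norm (hankel_L a lam - hankel_const a lam * local_integral lam (pole_integrand a)) \<le> C * exp (- c * lam)) \<and>
     (\<forall>E F. (\<forall>v. isCont E v) \<and> (\<forall>v. F v = E v + Ln v) \<and> (\<forall>v. Im v \<noteq> 0 \<longrightarrow> (F has_field_derivative osc lam v / v) (at v)) \<longrightarrow>
        norm (hankel_L 1 lam - hankel_const 1 lam * (F (V (of_real \<rho>)) - F (V (of_real (- \<rho>))) - \<i> * of_real pi)) \<le> C * exp (- c * lam))"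
proof -
  obtain C c where C: "C \<ge> 0" "c > 0" and main: "\<forall>lam\<ge>1. \<forall>a F.
     (0 < a \<and> a \<noteq> 1 \<and> (\<forall>v. Im v \<noteq> 0 \<or> v = 0 \<longrightarrow> (F has_field_derivative osc lam v / (v - of_real (ln a))) (at v)) \<longrightarrow>
        norm (hankel_L a lam - hankel_const a lam * (F (V (of_real \<rho>)) - F (V (of_real (- \<rho>))))) \<le> C * exp (- c * lam)) \<and>
     (\<forall>E. (\<forall>v. isCont E v) \<and> (\<forall>v. F v = E v + Ln v) \<and> (\<forall>v. Im v \<noteq> 0 \<longrightarrow> (F has_field_derivative osc lam v / v) (at v)) \<longrightarrow>
        norm (hankel_L 1 lam - hankel_const 1 lam * (F (V (of_real \<rho>)) - F (V (of_real (- \<rho>))) - \<i> * of_real pi)) \<le> C * exp (- c * lam))"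
    using hankel_L_via_primitive[OF V_end_points] unfolding complex.collapse by (elim exE conjE) (rule that)
  have 1: "norm (hankel_L a lam - hankel_const a lam * local_integral lam (pole_integrand a)) \<le> C * exp (- c * lam)"
    if lam: "lam \<ge> 1" and a: "a > 0" "a \<noteq> 1" for lam a
  proof -
    have b: "ln a \<noteq> 0" using a by simp
    obtain F where F: "\<forall>v. Im v \<noteq> 0 \<or> v = 0 \<longrightarrow> (F has_field_derivative osc lam v / (v - of_real (ln a))) (at v)"
      using osc_primitive[OF b, of lam] by (elim exE) (rule that)
    have "norm (hankel_L a lam - hankel_const a lam * (F (V (of_real \<rho>)) - F (V (of_real (- \<rho>))))) \<le> C * exp (- c * lam)"
      by (rule main[rule_format, OF lam, THEN conjunct1, rule_format]) (intro conjI a F)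
    then show ?thesis unfolding pole_integrand_def[abs_def] local_integral_primitive[OF b F] .
  qed
  have 2: "norm (hankel_L 1 lam - hankel_const 1 lam * (F (V (of_real \<rho>)) - F (V (of_real (- \<rho>))) - \<i> * of_real pi)) \<le> C * exp (- c * lam)"
    if lam: "lam \<ge> 1" and EF: "(\<forall>v. isCont E v) \<and> (\<forall>v. F v = E v + Ln v) \<and> (\<forall>v. Im v \<noteq> 0 \<longrightarrow> (F has_field_derivative osc lam v / v) (at v))" for lam E F
    by (rule main[rule_format, OF lam, THEN conjunct2, rule_format, OF EF])
  show ?thesis
    by (rule exI[of _ C], rule conjI[OF C(1)], rule exI[of _ c], rule conjI[OF C(2)], intro allI impI conjI, rule 1, assumption+, rule 2, assumption+)
qed

text \<open>K is -\<open>hankel_const\<close> times tails plus arc; the tails are exponentially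
  small, and on the arc the kernel is the regular part minus the pole part. The pole part is L up to
  an exponentially small error, so L - K retains the regular part. For a = 1 both L and K contribute
  the increment of \<open>F\<close> along the arc less i pi.\<close>

lemma hankel_L_minus_K:
  "\<exists>C\<ge>0. \<exists>c>0. \<forall>lam\<ge>6. \<forall>a>0.
     norm (hankel_L a lam - hankel_K saddle_w a lam - hankel_const a lam * local_integral lam (reg_integrand a)) \<le> C * exp (- c * lam)"
proof -
  interpret m: phase_curve "\<lambda>r. v (- r)" by (rule reversed_curve)
  have \<rho>: "\<rho> > 0" "\<rho> \<notin> sine_zeros" using rho rho_not_zero[of \<rho>] by auto
  obtain C0 c0 where C0: "C0 \<ge> 0" "c0 > 0" and L: "\<forall>lam\<ge>1. \<forall>a>0.
     (a \<noteq> 1 \<longrightarrow> norm (hankel_L a lam - hankel_const a lam * local_integral lam (pole_integrand a)) \<le> C0 * exp (- c0 * lam)) \<and>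
     (\<forall>E F. (\<forall>v. isCont E v) \<and> (\<forall>v. F v = E v + Ln v) \<and> (\<forall>v. Im v \<noteq> 0 \<longrightarrow> (F has_field_derivative osc lam v / v) (at v)) \<longrightarrow>
        norm (hankel_L 1 lam - hankel_const 1 lam * (F (V (of_real \<rho>)) - F (V (of_real (- \<rho>))) - \<i> * of_real pi)) \<le> C0 * exp (- c0 * lam))"
    using hankel_L_local by (elim exE conjE) (rule that)
  obtain C1 c1 where C1: "C1 \<ge> 0" "c1 > 0" and R1: "\<forall>lam\<ge>6. \<forall>a>0. a \<noteq> 1 \<longrightarrow>
     set_integrable lborel {\<rho>..} (\<lambda>r. exp (- (lam / 2) * r\<^sup>2) *\<^sub>R saddle_kernel a r) \<and>
     norm (LINT r:{\<rho>..}|lborel. exp (- (lam / 2) * r\<^sup>2) *\<^sub>R saddle_kernel a r) \<le> C1 * exp (- c1 * lam)"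
    using tail_regular[OF \<rho>] by (elim exE conjE) (rule that)
  obtain C2 c2 where C2: "C2 \<ge> 0" "c2 > 0" and R2: "\<forall>lam\<ge>6. \<forall>a>0. a \<noteq> 1 \<longrightarrow>
     set_integrable lborel {\<rho>..} (\<lambda>r. exp (- (lam / 2) * r\<^sup>2) *\<^sub>R m.saddle_kernel a r) \<and>
     norm (LINT r:{\<rho>..}|lborel. exp (- (lam / 2) * r\<^sup>2) *\<^sub>R m.saddle_kernel a r) \<le> C2 * exp (- c2 * lam)"
    using m.tail_regular[OF \<rho>] by (elim exE conjE) (rule that)
  obtain C3 c3 d3 where C3: "C3 \<ge> 0" "c3 > 0" "d3 > 0" and R3: "\<forall>lam\<ge>6. \<exists>l. norm l \<le> C3 * exp (- c3 * lam) \<and>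
     ((\<lambda>d. LINT r:{\<rho>..}|lborel. exp (- (lam / 2) * r\<^sup>2) *\<^sub>R cut_kernel d r) \<longlongrightarrow> l) (at_right 0) \<and>
     (\<forall>d. 0 < d \<longrightarrow> d < d3 \<longrightarrow> set_integrable lborel {\<rho>..} (\<lambda>r. exp (- (lam / 2) * r\<^sup>2) *\<^sub>R cut_kernel d r))"
    using tail_principal_value[OF \<rho>] by (elim exE conjE) (rule that)
  obtain C4 c4 d4 where C4: "C4 \<ge> 0" "c4 > 0" "d4 > 0" and R4: "\<forall>lam\<ge>6. \<exists>l. norm l \<le> C4 * exp (- c4 * lam) \<and>
     ((\<lambda>d. LINT r:{\<rho>..}|lborel. exp (- (lam / 2) * r\<^sup>2) *\<^sub>R m.cut_kernel d r) \<longlongrightarrow> l) (at_right 0) \<and>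
     (\<forall>d. 0 < d \<longrightarrow> d < d4 \<longrightarrow> set_integrable lborel {\<rho>..} (\<lambda>r. exp (- (lam / 2) * r\<^sup>2) *\<^sub>R m.cut_kernel d r))"
    using m.tail_principal_value[OF \<rho>] by (elim exE conjE) (rule that)
  define C where "C = C0 + C1 + C2 + C3 + C4"
  define c where "c = min c0 (min (min c1 c2) (min c3 c4))"
  have Cc: "C \<ge> 0" "c > 0" using C0 C1 C2 C3 C4 by (auto simp: C_def c_def)
  have refl: "saddle_kernel a (- r) = - m.saddle_kernel a r" for a r
    by (simp add: saddle_kernel_def m.saddle_kernel_def)
  have hc: "norm (hankel_const a lam * z) \<le> norm z" for a lam z
  proof -
    have "norm (hankel_const a lam * z) = 1 / pi * norm z" by (simp add: norm_mult)
    also have "\<dots> \<le> 1 * norm z" using pi_gt3 by (intro mult_right_mono) auto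
    finally show ?thesis by simp
  qed
  have main: "norm (hankel_L a lam - hankel_K saddle_w a lam - hankel_const a lam * local_integral lam (reg_integrand a)) \<le> C * exp (- c * lam)"
    if lam: "lam \<ge> 6" and a: "a > 0" for lam a
  proof -
    have ex: "x * exp (- c' * lam) \<le> x * exp (- c * lam)" if "c \<le> c'" "x \<ge> 0" for c' x
      using that lam by (intro mult_left_mono) auto
    have cs: "c \<le> c0" "c \<le> c1" "c \<le> c2" "c \<le> c3" "c \<le> c4" by (auto simp: c_def)
    note ex0 = ex[OF cs(1) C0(1)] and ex1 = ex[OF cs(2) C1(1)] and ex2 = ex[OF cs(3) C2(1)] and ex3 = ex[OF cs(4) C3(1)] and ex4 = ex[OF cs(5) C4(1)]
    have pos: "0 \<le> x * exp (- c * lam)" if "x \<ge> 0" for x using that by simp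
    note p = pos[OF C1(1)] pos[OF C2(1)] pos[OF C3(1)] pos[OF C4(1)]
    have Cd: "C * exp (- c * lam) = C0 * exp (- c * lam) + C1 * exp (- c * lam) + C2 * exp (- c * lam) + C3 * exp (- c * lam) + C4 * exp (- c * lam)"
      by (simp add: C_def algebra_simps)
    let ?e = "\<lambda>r. exp (- (lam / 2) * r\<^sup>2)"
    have lam1: "lam \<ge> 1" using lam by simp
    show ?thesis
    proof (cases "a = 1")
      case False
      let ?T = "LINT r:{\<rho>..}|lborel. ?e r *\<^sub>R saddle_kernel a r" and ?T' = "LINT r:{\<rho>..}|lborel. ?e r *\<^sub>R m.saddle_kernel a r"
      have i1: "set_integrable lborel {\<rho>..} (\<lambda>r. ?e r *\<^sub>R saddle_kernel a r)" and b1: "norm ?T \<le> C1 * exp (- c1 * lam)"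
        using R1[rule_format, OF lam a False] by simp_all
      have i2: "set_integrable lborel {\<rho>..} (\<lambda>r. ?e r *\<^sub>R m.saddle_kernel a r)" and b2: "norm ?T' \<le> C2 * exp (- c2 * lam)"
        using R2[rule_format, OF lam a False] by simp_all
      have ne: "norm (exp (v r) - of_real a) > 0" for r using exp_v_real[of r a] a False by auto
      have "(LINT r|lborel. ?e r *\<^sub>R saddle_kernel a r) = ?T + (LINT r:{\<rho>..}|lborel. ?e (- r) *\<^sub>R saddle_kernel a (- r)) + (LINT r:{-\<rho>..\<rho>}|lborel. ?e r *\<^sub>R saddle_kernel a r)"
      proof (rule integral_three_pieces[OF \<rho>(1) i1 _ local_kernel_integral(1)[OF a False]])
        show "set_integrable lborel {\<rho>..} (\<lambda>r. ?e (- r) *\<^sub>R saddle_kernel a (- r))"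
          using i2 unfolding refl by (simp add: set_integrable_def)
      qed
      also have "(LINT r:{\<rho>..}|lborel. ?e (- r) *\<^sub>R saddle_kernel a (- r)) = - ?T'"
        unfolding refl by (simp add: set_lebesgue_integral_def)
      finally have "hankel_K saddle_w a lam = - hankel_const a lam * (?T + - ?T' + local_integral lam (saddle_kernel a))"
        using ne False by (simp add: hankel_K_def hankel_K_cut_eq local_integral_def)
      moreover have "local_integral lam (saddle_kernel a) = local_integral lam (reg_integrand a) - local_integral lam (pole_integrand a)"
        using local_kernel_integral(2)[OF a False, of lam] unfolding reg_integrand_def[abs_def] pole_integrand_def[abs_def]
        by (metis minus_diff_eq minus_minus)
      ultimately have "hankel_L a lam - hankel_K saddle_w a lam - hankel_const a lam * local_integral lam (reg_integrand a)
        = (hankel_L a lam - hankel_const a lam * local_integral lam (pole_integrand a)) + hankel_const a lam * (?T - ?T')"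
        by (simp add: algebra_simps)
      then have "norm (hankel_L a lam - hankel_K saddle_w a lam - hankel_const a lam * local_integral lam (reg_integrand a))
        \<le> norm (hankel_L a lam - hankel_const a lam * local_integral lam (pole_integrand a)) + norm (hankel_const a lam * (?T - ?T'))"
        by (simp only: norm_triangle_ineq)
      moreover have "norm (hankel_const a lam * (?T - ?T')) \<le> norm ?T + norm ?T'"
        by (rule order_trans[OF hc norm_triangle_ineq4])
      moreover have "norm (hankel_L a lam - hankel_const a lam * local_integral lam (pole_integrand a)) \<le> C0 * exp (- c0 * lam)"
        using L[rule_format, OF lam1 a, THEN conjunct1] False by simp
      ultimately show ?thesis unfolding Cd using ex0 ex1 ex2 b1 b2 p by linarith
    next
      case True
      \<comment> \<open>One primitive for L and for K, so that its values at the ends of the arc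
        cancel along with the jump.\<close>
      obtain F E where E: "\<forall>v. isCont E v" and FE: "\<forall>v. F v = E v + Ln v"
        and F: "\<forall>v. Im v \<noteq> 0 \<longrightarrow> (F has_field_derivative osc lam v / v) (at v)"
        using osc_primitive_0[of lam] by (elim exE conjE) (rule that)
      let ?F = "F (V (of_real \<rho>)) - F (V (of_real (- \<rho>))) - \<i> * of_real pi"
      obtain l where l: "norm l \<le> C3 * exp (- c3 * lam)"
         "((\<lambda>d. LINT r:{\<rho>..}|lborel. ?e r *\<^sub>R cut_kernel d r) \<longlongrightarrow> l) (at_right 0)"
         "\<forall>d. 0 < d \<longrightarrow> d < d3 \<longrightarrow> set_integrable lborel {\<rho>..} (\<lambda>r. ?e r *\<^sub>R cut_kernel d r)"
        using R3[rule_format, OF lam] by (elim exE conjE) (rule that)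
      obtain l' where l': "norm l' \<le> C4 * exp (- c4 * lam)"
         "((\<lambda>d. LINT r:{\<rho>..}|lborel. ?e r *\<^sub>R m.cut_kernel d r) \<longlongrightarrow> l') (at_right 0)"
         "\<forall>d. 0 < d \<longrightarrow> d < d4 \<longrightarrow> set_integrable lborel {\<rho>..} (\<lambda>r. ?e r *\<^sub>R m.cut_kernel d r)"
        using R4[rule_format, OF lam] by (elim exE conjE) (rule that)
      have lam0: "lam \<ge> 0" using lam by simp
      note lp = local_principal_value[OF lam0 E FE F]
      obtain d5 where d5: "d5 > 0" "\<forall>d. 0 < d \<longrightarrow> d < d5 \<longrightarrow> set_integrable lborel {-\<rho>..\<rho>} (\<lambda>r. ?e r *\<^sub>R cut_kernel d r)"
        using lp(2) by (elim exE conjE) (rule that)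
      have reg1: "reg_integrand 1 = (\<lambda>r. deriv V (of_real r) * reg_kernel (V (of_real r)))"
        by (simp add: reg_integrand_def fun_eq_iff)
      let ?I = "\<lambda>d. LINT r:{\<rho>..}|lborel. ?e r *\<^sub>R cut_kernel d r" and ?I' = "\<lambda>d. LINT r:{\<rho>..}|lborel. ?e r *\<^sub>R m.cut_kernel d r"
      have Kc: "hankel_K_cut saddle_w d 1 lam = - hankel_const 1 lam * (?I d - ?I' d + local_integral lam (cut_kernel d))"
        if d: "0 < d" "d < d3" "d < d4" "d < d5" for d
      proof -
        have refl': "cut_kernel d (- r) = - m.cut_kernel d r" for r
          by (simp add: cut_kernel_def m.cut_kernel_def refl)
        have i1: "set_integrable lborel {\<rho>..} (\<lambda>r. ?e r *\<^sub>R cut_kernel d r)" using l(3) d by simp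
        have i2: "set_integrable lborel {\<rho>..} (\<lambda>r. ?e r *\<^sub>R m.cut_kernel d r)" using l'(3) d by simp
        have i3: "set_integrable lborel {-\<rho>..\<rho>} (\<lambda>r. ?e r *\<^sub>R cut_kernel d r)" using d5(2) d by simp
        have "(LINT r|lborel. ?e r *\<^sub>R cut_kernel d r) = ?I d + (LINT r:{\<rho>..}|lborel. ?e (- r) *\<^sub>R cut_kernel d (- r)) + (LINT r:{-\<rho>..\<rho>}|lborel. ?e r *\<^sub>R cut_kernel d r)"
        proof (rule integral_three_pieces[OF \<rho>(1) i1 _ i3])
          show "set_integrable lborel {\<rho>..} (\<lambda>r. ?e (- r) *\<^sub>R cut_kernel d (- r))"
            using i2 unfolding refl' by (simp add: set_integrable_def)
        qed
        also have "(LINT r:{\<rho>..}|lborel. ?e (- r) *\<^sub>R cut_kernel d (- r)) = - ?I' d"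
          unfolding refl' by (simp add: set_lebesgue_integral_def)
        finally have "(LINT r|lborel. ?e r *\<^sub>R cut_kernel d r) = ?I d - ?I' d + local_integral lam (cut_kernel d)"
          by (simp add: local_integral_def)
        moreover have "(if norm (exp (v r) - of_real 1) > d then ?e r *\<^sub>R saddle_kernel 1 r else 0) = ?e r *\<^sub>R cut_kernel d r" for r
          by (simp add: cut_kernel_def)
        ultimately show ?thesis unfolding hankel_K_cut_eq by (simp only:)
      qed
      have "((\<lambda>d. - hankel_const 1 lam * (?I d - ?I' d + local_integral lam (cut_kernel d))) \<longlongrightarrow>
         - hankel_const 1 lam * (l - l' + (local_integral lam (reg_integrand 1) - ?F))) (at_right 0)"
        unfolding reg1 by (intro tendsto_mult tendsto_add tendsto_diff tendsto_const l(2) l'(2) lp(1))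
      then have "((\<lambda>d. hankel_K_cut saddle_w d 1 lam) \<longlongrightarrow>
         - hankel_const 1 lam * (l - l' + (local_integral lam (reg_integrand 1) - ?F))) (at_right 0)"
      proof (rule Lim_transform_eventually)
        show "eventually (\<lambda>d. - hankel_const 1 lam * (?I d - ?I' d + local_integral lam (cut_kernel d)) = hankel_K_cut saddle_w d 1 lam) (at_right 0)"
          unfolding eventually_at_right_field using C3(3) C4(3) d5(1) Kc by (intro exI[of _ "min d3 (min d4 d5)"]) simp
      qed
      then have "hankel_K saddle_w 1 lam = - hankel_const 1 lam * (l - l' + (local_integral lam (reg_integrand 1) - ?F))"
        unfolding hankel_K_def by (simp add: tendsto_Lim)
      then have "hankel_L 1 lam - hankel_K saddle_w 1 lam - hankel_const 1 lam * local_integral lam (reg_integrand 1)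
        = (hankel_L 1 lam - hankel_const 1 lam * ?F) + hankel_const 1 lam * (l - l')"
        by (simp add: algebra_simps)
      then have "norm (hankel_L 1 lam - hankel_K saddle_w 1 lam - hankel_const 1 lam * local_integral lam (reg_integrand 1))
        \<le> norm (hankel_L 1 lam - hankel_const 1 lam * ?F) + norm (hankel_const 1 lam * (l - l'))"
        by (simp only: norm_triangle_ineq)
      moreover have "norm (hankel_const 1 lam * (l - l')) \<le> norm l + norm l'"
        by (rule order_trans[OF hc norm_triangle_ineq4])
      moreover have "norm (hankel_L 1 lam - hankel_const 1 lam * ?F) \<le> C0 * exp (- c0 * lam)"
      proof -
        have EF: "(\<forall>v. isCont E v) \<and> (\<forall>v. F v = E v + Ln v) \<and> (\<forall>v. Im v \<noteq> 0 \<longrightarrow> (F has_field_derivative osc lam v / v) (at v))"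
          by (intro conjI E FE F)
        show ?thesis by (rule L[THEN spec, THEN mp, OF lam1, THEN spec, THEN mp, OF zero_less_one, THEN conjunct2, THEN spec, THEN spec, THEN mp, OF EF])
      qed
      ultimately show ?thesis unfolding Cd True using ex0 ex3 ex4 l(1) l'(1) p by linarith
    qed
  qed
  show ?thesis
    by (rule exI[of _ C], rule conjI[OF Cc(1)], rule exI[of _ c], rule conjI[OF Cc(2)], intro allI impI, rule main, assumption+)
qed

end

text \<open>v is the continued logarithm of w shifted by i pi / 2, which makes it vanish at r = 0.
  In the difference of the two values of S the parameter a drops out, and the phase equation
  results. The radius is shrunk to where the uniqueness part of \<open>saddle_inverse\<close>
  identifies v with V.\<close>

lemma saddle_curve_setup:
  assumes "saddle_curve w"
  shows "\<exists>V R v. saddle_setup V R v \<and> w = (\<lambda>r. - \<i> * exp (v r))"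
proof -
  obtain l where l: "continuous_on UNIV l" "l 0 = Ln (- \<i>)" and el: "\<forall>r. exp (l r) = w r"
    and S: "\<forall>a>0. \<forall>r. hankel_S a (w r) (l r) - hankel_S a (- \<i>) (Ln (- \<i>)) = - (of_real r)\<^sup>2 / 2"
    using assms unfolding saddle_curve_def by (elim conjE exE) (rule that)
  have dw: "(w has_vector_derivative exp (\<i> * of_real pi / 4)) (at 0)"
    using assms by (simp add: saddle_curve_def)
  define v where "v r = l r + \<i> * of_real (pi / 2)" for r
  have Lni: "Ln (- \<i>) = - (\<i> * of_real (pi / 2))" by (simp add: Ln_minus_ii)
  have v0: "v 0 = 0" by (simp add: v_def l Lni)
  have ev: "exp (v r) = \<i> * w r" for r
    unfolding v_def exp_add cis_conv_exp[symmetric] using el by (simp add: mult.commute)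
  have w: "w = (\<lambda>r. - \<i> * exp (v r))" by (simp add: ev fun_eq_iff)
  have ph: "exp (v r) - 1 - v r = - \<i> * (of_real r)\<^sup>2 / 2" for r
  proof -
    have "w r + \<i> * l r + \<i> - \<i> * Ln (- \<i>) = - (of_real r)\<^sup>2 / 2"
      using S[rule_format, OF zero_less_one, of r] by (simp add: hankel_S_def algebra_simps)
    then have "w r + \<i> * v r - \<i> * (\<i> * of_real (pi / 2)) + \<i> + \<i> * (\<i> * of_real (pi / 2)) = - (of_real r)\<^sup>2 / 2"
      by (simp add: v_def Lni algebra_simps)
    then have eq: "w r + \<i> * v r + \<i> = - (of_real r)\<^sup>2 / 2" by (simp add: add_ac)
    have "\<i> * (w r + \<i> * v r + \<i>) = \<i> * (- (of_real r)\<^sup>2 / 2)" by (simp only: eq)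
    then show ?thesis unfolding ev by (simp add: algebra_simps)
  qed
  have cv: "continuous_on UNIV v" unfolding v_def[abs_def] by (intro continuous_intros l)
  have dv: "(v has_vector_derivative sdir) (at 0)"
  proof -
    have sd: "\<i> * exp (\<i> * of_real pi / 4) = sdir"
    proof -
      have "\<i> * exp (\<i> * of_real pi / 4) = cis (pi / 2) * cis (pi / 4)" unfolding cis_pi_half by (simp add: cis_conv_exp)
      also have "\<dots> = sdir" unfolding cis_mult sdir_def by (simp add: field_simps)
      finally show ?thesis .
    qed
    have d1: "((\<lambda>r. exp (v r)) has_vector_derivative sdir) (at 0)"
      unfolding ev sd[symmetric] by (intro has_vector_derivative_mult_right dw)
    have "(Ln has_field_derivative 1) (at (exp (v 0)))"
      by (rule derivative_eq_intros refl | simp add: v0)+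
    from field_vector_diff_chain_at[OF d1 this]
    have d2: "((\<lambda>r. Ln (exp (v r))) has_vector_derivative sdir) (at 0)" by (simp add: comp_def)
    \<comment> \<open>Only w is assumed to be differentiable at 0. As long as |Im v| < pi, v is the
      principal logarithm of e^v, and so inherits the derivative.\<close>
    have "open {r. \<bar>Im (v r)\<bar> < pi}"
      by (intro open_Collect_less continuous_intros cv)
    from has_vector_derivative_transform_within_open[OF d2 this]
    show ?thesis using v0 by (simp add: abs_less_iff)
  qed
  show ?thesis
  proof (rule saddle_inverse)
    fix V R assume R: "0 < R" "R \<le> 1/2" and V: "V holomorphic_on ball 0 R" "deriv V 0 = sdir"
        "\<And>z. z \<in> ball 0 R \<Longrightarrow> exp (V z) - 1 - V z = - \<i> * z\<^sup>2 / 2"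
        "\<And>z. z \<in> ball 0 R \<Longrightarrow> norm (V z - sdir * z) \<le> norm z / 10"
      and U: "\<And>v :: real \<Rightarrow> complex. \<lbrakk>v 0 = 0; (v has_vector_derivative sdir) (at 0);
          \<And>r. exp (v r) - 1 - v r = - \<i> * (of_real r)\<^sup>2 / 2\<rbrakk>
          \<Longrightarrow> \<exists>\<delta>>0. \<forall>r. \<bar>r\<bar> < \<delta> \<longrightarrow> v r = V (of_real r)"
    obtain \<delta> where \<delta>: "\<delta> > 0" "\<forall>r. \<bar>r\<bar> < \<delta> \<longrightarrow> v r = V (of_real r)"
      using U[OF v0 dv ph] by (elim exE conjE) (rule that)
    have sub: "ball 0 (min R \<delta>) \<subseteq> ball (0::complex) R" by auto
    have "saddle_setup V (min R \<delta>) v"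
    proof
      show "V holomorphic_on ball 0 (min R \<delta>)" by (rule holomorphic_on_subset[OF V(1) sub])
      show "exp (V z) - 1 - V z = - \<i> * z\<^sup>2 / 2" "norm (V z - sdir * z) \<le> norm z / 10" if "z \<in> ball 0 (min R \<delta>)" for z
        using V(3,4)[of z] that by simp_all
    qed (use R \<delta> V(2) cv v0 ph in auto)
    then show ?thesis using w by (intro exI conjI)
  qed
qed

section \<open>Expansions at the saddle point\<close>

lemma remove_sing_holomorphic:
  assumes "open S" "0 \<in> S" "G holomorphic_on S"
    and h: "\<And>r. r \<noteq> 0 \<Longrightarrow> of_real r \<in> S \<Longrightarrow> h r = G (of_real r)" and r: "of_real r \<in> S"
  shows "remove_sing_at 0 h r = G (of_real r)"
proof (cases "r = 0")
  case True
  have "isCont G (of_real 0)"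
    using continuous_on_interior[OF holomorphic_on_imp_continuous_on[OF assms(3)], of 0] assms(1,2)
    by (simp add: interior_open)
  then have "isCont (\<lambda>r. G (of_real r)) 0"
    by (rule isCont_o2[rotated]) (intro continuous_intros)
  then have "((\<lambda>r. G (of_real r)) \<longlongrightarrow> G (of_real 0)) (at 0)" by (rule isContD)
  moreover have "eventually (\<lambda>r. G (of_real r) = h r) (at 0)"
  proof -
    have "open (complex_of_real -` S)" by (intro open_vimage assms continuous_intros)
    then have "eventually (\<lambda>r. r \<in> complex_of_real -` S) (nhds 0)"
      using assms(2) by (intro eventually_nhds_in_open) auto
    then have "eventually (\<lambda>r. r \<in> complex_of_real -` S) (at 0)"
      by (rule filter_leD[OF at_within_le_nhds])
    moreover have "eventually (\<lambda>r::real. r \<noteq> 0) (at 0)" by (simp add: eventually_at_filter)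
    ultimately show ?thesis by eventually_elim (use h in auto)
  qed
  ultimately have "(h \<longlongrightarrow> G (of_real 0)) (at 0)" by (rule Lim_transform_eventually)
  then show ?thesis using True by (simp add: remove_sing_at_def tendsto_Lim)
qed (use assms in \<open>simp add: remove_sing_at_def\<close>)

definition gauss_sum :: "(complex \<Rightarrow> complex) \<Rightarrow> nat \<Rightarrow> real \<Rightarrow> complex" where
  "gauss_sum G N lam = (\<Sum>j=0..N div 2. (deriv ^^ (2 * j)) G 0 / fact (2 * j)
        * of_real (Gamma (real j + 1/2) * (2 / lam) powr (real j + 1/2)))"

lemma hankel_sum_remove_sing:
  assumes S: "open S" "0 \<in> S" "G holomorphic_on S"
    and h: "\<And>r. r \<noteq> 0 \<Longrightarrow> of_real r \<in> S \<Longrightarrow> h r = c * G (of_real r)"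
  shows "hankel_sum (remove_sing_at 0 h) N lam = c * gauss_sum G N lam"
proof -
  have cG: "(\<lambda>z. c * G z) holomorphic_on S" by (intro holomorphic_intros S)
  have "nth_deriv n (remove_sing_at 0 h) 0 = c * (deriv ^^ n) G 0" for n
  proof -
    have "nth_deriv n (remove_sing_at 0 h) 0 = (deriv ^^ n) (\<lambda>z. c * G z) (of_real 0)"
    proof (rule nth_deriv_of_real[OF S(1) cG])
      show "remove_sing_at 0 h r = c * G (of_real r)" if "of_real r \<in> S" for r
        using remove_sing_holomorphic[OF S(1,2) cG, of h r] h that by simp
    qed (use S in simp)
    also have "\<dots> = c * (deriv ^^ n) G 0"
      using higher_deriv_cmult[OF S(3) _ S(1), of 0 n c] S(2) by simp
    finally show ?thesis .
  qed
  then show ?thesis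
    by (simp add: hankel_sum_def gauss_sum_def sum_distrib_left mult.assoc)
qed

text \<open>One factor e^(i pi / 4) comes from the prefactor of the expansion and one from g; their
  product is the i in \<open>hankel_const\<close>.\<close>

lemma prefactor_hankel_const:
  "hankel_prefactor a lam * (exp (of_real pi * \<i> / 4) / of_real pi * s) = hankel_const a lam * s"
proof -
  have "exp (of_real pi * \<i> / 4) * exp (of_real pi * \<i> / 4) = cis (pi / 4) * cis (pi / 4)"
    by (simp add: cis_conv_exp mult.commute)
  also have "\<dots> = \<i>" unfolding cis_mult by (simp add: cis_pi_half)
  finally have e: "exp (of_real pi * \<i> / 4) * exp (of_real pi * \<i> / 4) = \<i>" .
  have "x * y * (x / z * s) = (x * x) * y / z * s" for x y z s :: complex
    by (simp add: divide_inverse mult_ac)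
  from this[of "exp (of_real pi * \<i> / 4)"] show ?thesis
    unfolding hankel_prefactor_def hankel_const_def e .
qed

lemma exp_le_powr:
  fixes c p :: real
  assumes "c > 0"
  shows "\<exists>K\<ge>0. \<forall>lam\<ge>1. exp (- c * lam) \<le> K * lam powr (- p)"
proof -
  define n where "n = Suc (nat \<lceil>\<bar>p\<bar>\<rceil>)"
  have n: "n > 0" "p \<le> real n" unfolding n_def by linarith+
  define K where "K = (real n / c) ^ n"
  have "exp (- c * lam) \<le> K * lam powr (- p)" if lam: "lam \<ge> 1" for lam
  proof -
    have x: "0 < c * lam" using assms lam by simp
    have "(c * lam / real n) ^ n \<le> (1 + c * lam / real n) ^ n"
      using x n by (intro power_mono) auto
    also have "\<dots> \<le> exp (c * lam)"
      using x n by (intro exp_ge_one_plus_x_over_n_power_n) auto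
    finally have "inverse (exp (c * lam)) \<le> inverse ((c * lam / real n) ^ n)"
      using x n by (intro le_imp_inverse_le) auto
    also have "\<dots> = K * inverse (lam ^ n)" using assms lam n by (simp add: K_def field_simps)
    also have "inverse (lam ^ n) = lam powr (- real n)" using lam by (simp add: powr_minus powr_realpow)
    also have "K * lam powr (- real n) \<le> K * lam powr (- p)"
      using lam n assms by (intro mult_left_mono powr_mono) (auto simp: K_def)
    finally show ?thesis by (simp add: exp_minus)
  qed
  moreover have "K \<ge> 0" using assms by (simp add: K_def)
  ultimately show ?thesis by (intro exI[of _ K]) simp
qed

text \<open>Cauchy's inequality on a circle of radius s bounds the derivative by a multiple of s^(N
  + 1 - k), which tends to 0 with s. It shows that a remainder of order N + 1 does not touch the
  coefficients.\<close>

lemma derivs_zero_of_small: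
  assumes r: "0 < r" and f: "f holomorphic_on ball (0::complex) r" and K: "\<And>z. z \<in> ball 0 r \<Longrightarrow> norm (f z) \<le> K * norm z ^ Suc N" "K \<ge> 0"
    and k: "k \<le> N"
  shows "(deriv ^^ k) f 0 = 0"
proof -
  have bd: "norm ((deriv ^^ k) f 0) \<le> fact k * K * s" if s: "0 < s" "s < min r 1" for s
  proof -
    have sub: "cball 0 s \<subseteq> ball (0::complex) r" using s by auto
    have "norm ((deriv ^^ k) f 0) \<le> fact k * (K * s ^ Suc N) / s ^ k"
    proof (rule Cauchy_inequality)
      show "f holomorphic_on ball 0 s" by (rule holomorphic_on_subset[OF f]) (use s in auto)
      show "continuous_on (cball 0 s) f" by (rule continuous_on_subset[OF holomorphic_on_imp_continuous_on[OF f] sub])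
      show "norm (f x) \<le> K * s ^ Suc N" if "norm (0 - x) = s" for x using K(1)[of x] that s by simp
    qed (use s in auto)
    also have "s ^ Suc N = s ^ Suc (N - k) * s ^ k" unfolding power_add[symmetric] using k by simp
    also have "fact k * (K * (s ^ Suc (N - k) * s ^ k)) / s ^ k = fact k * K * s ^ Suc (N - k)" using s by simp
    also have "\<dots> \<le> fact k * K * s"
    proof (rule mult_left_mono)
      have "s ^ (N - k) \<le> 1" using s by (intro power_le_one) auto
      then show "s ^ Suc (N - k) \<le> s" using s by (simp add: mult_left_le)
    qed (use K in simp)
    finally show ?thesis .
  qed
  have "((\<lambda>s. fact k * K * s) \<longlongrightarrow> fact k * K * 0) (at_right 0)" by (intro tendsto_intros)
  moreover have "eventually (\<lambda>s. norm ((deriv ^^ k) f 0) \<le> fact k * K * s) (at_right 0)"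
    unfolding eventually_at_right_field using bd r by (intro exI[of _ "min r 1"]) simp
  ultimately have "norm ((deriv ^^ k) f 0) \<le> fact k * K * 0" by (rule tendsto_lowerbound) simp
  then show ?thesis by simp
qed

section \<open>The functions g and g_reg as holomorphic germs\<close>

context saddle_setup
begin

definition reg_germ :: "real \<Rightarrow> complex \<Rightarrow> complex" where
  "reg_germ a z = deriv V z * reg_kernel (V z - of_real (ln a))"

definition pole_germ :: "real \<Rightarrow> complex \<Rightarrow> complex" where
  "pole_germ a z = deriv V z * (1 / (V z - of_real (ln a)))"

definition pole_free :: "real \<Rightarrow> complex set" where
  "pole_free a = {z \<in> ball 0 R. V z \<noteq> of_real (ln a)}"

lemma Im_V_less: "z \<in> ball 0 R \<Longrightarrow> \<bar>Im (V z)\<bar> < 1"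
  using abs_Im_le_cmod[of "V z"] V_less_1[of z] by simp

lemma reg_germ_holomorphic: "reg_germ a holomorphic_on ball 0 R"
  unfolding reg_germ_def[abs_def]
  by (rule kernel_deriv2(1)[OF reg_kernel_holomorphic open_strip]) (use Im_V_less pi_gt3 in fastforce)

lemma pole_free_open: "open (pole_free a)"
proof -
  have "open (ball 0 R \<inter> V -` (- {of_real (ln a)}))"
    by (rule continuous_open_preimage[OF holomorphic_on_imp_continuous_on[OF V_hol]]) auto
  moreover have "pole_free a = ball 0 R \<inter> V -` (- {of_real (ln a)})" by (auto simp: pole_free_def)
  ultimately show ?thesis by simp
qed

lemma pole_germ_holomorphic: "pole_germ a holomorphic_on pole_free a"
  unfolding pole_germ_def[abs_def]
  by (intro holomorphic_intros holomorphic_on_subset[OF V_hol] holomorphic_on_subset[OF deriv_V_hol]) (auto simp: pole_free_def)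

text \<open>Near r = 0 the imaginary part of V - ln a - i pi / 2 lies within (-pi, pi) because |Im
  V| < 1, so the principal logarithm in g and g_reg is the continued one. The other values follow
  from w = -i e^V and \<open>V_ode\<close>.\<close>

lemma saddle_w_values:
  assumes a: "a > 0" and r: "r \<noteq> 0" "\<bar>r\<bar> < R"
  shows "of_real pi / 2 - \<i> * Ln (saddle_w r / of_real a) = - \<i> * (V (of_real r) - of_real (ln a))"
    and "1 - \<i> * saddle_w r = 1 - exp (V (of_real r))"
    and "saddle_w r + \<i> * of_real a = - \<i> * (exp (V (of_real r)) - of_real a)"
    and "saddle_w r = - \<i> * exp (V (of_real r))"
    and "deriv V (of_real r) = \<i> * of_real r / (1 - exp (V (of_real r)))"
    and "1 - exp (V (of_real r)) \<noteq> 0"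
proof -
  have b: "of_real r \<in> ball (0::complex) R" using r by simp
  let ?u = "V (of_real r) - of_real (ln a) - \<i> * of_real (pi / 2)"
  have "exp ?u = saddle_w r / of_real a"
    using a by (simp add: saddle_w_def agree[OF r(2)] exp_diff exp_of_real cis_conv_exp[symmetric] flip: of_real_divide)
  then have L: "Ln (saddle_w r / of_real a) = ?u"
    by (rule Ln_unique) (use Im_V_less[OF b] pi_gt3 in auto)
  show "of_real pi / 2 - \<i> * Ln (saddle_w r / of_real a) = - \<i> * (V (of_real r) - of_real (ln a))"
    unfolding L by (simp add: algebra_simps)
  show "1 - \<i> * saddle_w r = 1 - exp (V (of_real r))" "saddle_w r = - \<i> * exp (V (of_real r))"
    "saddle_w r + \<i> * of_real a = - \<i> * (exp (V (of_real r)) - of_real a)"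
    by (simp_all add: saddle_w_def agree[OF r(2)] algebra_simps)
  show n: "1 - exp (V (of_real r)) \<noteq> 0" using exp_V_ne_1[OF r] by auto
  show "deriv V (of_real r) = \<i> * of_real r / (1 - exp (V (of_real r)))"
    using V_ode[OF b] n by (simp add: field_simps)
qed

lemma hankel_sum_g_fun:
  assumes a: "a > 0" "a \<noteq> 1"
  shows "hankel_prefactor a lam * hankel_sum (g_fun saddle_w a) N lam = hankel_const a lam * gauss_sum (pole_germ a) N lam"
proof -
  have "hankel_sum (g_fun saddle_w a) N lam = exp (of_real pi * \<i> / 4) / of_real pi * gauss_sum (pole_germ a) N lam"
    unfolding g_fun_def
  proof (rule hankel_sum_remove_sing[OF pole_free_open _ pole_germ_holomorphic])
    show "0 \<in> pole_free a" using a R_pos by (simp add: pole_free_def)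
    fix r assume r: "r \<noteq> 0" "complex_of_real r \<in> pole_free a"
    have r': "\<bar>r\<bar> < R" and u: "V (of_real r) - of_real (ln a) \<noteq> 0" using r by (simp_all add: pole_free_def)
    note v = saddle_w_values[OF a(1) r(1) r']
    have "e * x / (p * (- \<i> * u) * d) = e / p * (\<i> * x / d * (1 / u))" if "u \<noteq> 0" "d \<noteq> 0" for e x p u d :: complex
      using that by (simp add: divide_simps)
    then show "exp (of_real pi * \<i> / 4) * of_real r / (of_real pi * (of_real pi / 2 - \<i> * Ln (saddle_w r / of_real a)) * (1 - \<i> * saddle_w r))
      = exp (of_real pi * \<i> / 4) / of_real pi * pole_germ a (of_real r)"
      unfolding pole_germ_def v(1,2,5) using u v(6) by simp
  qed
  then show ?thesis by (simp only: prefactor_hankel_const)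
qed

lemma hankel_sum_g_reg:
  assumes a: "a > 0"
  shows "hankel_prefactor a lam * hankel_sum (g_reg saddle_w a) N lam = hankel_const a lam * gauss_sum (reg_germ a) N lam"
proof -
  have "hankel_sum (g_reg saddle_w a) N lam = exp (of_real pi * \<i> / 4) / of_real pi * gauss_sum (reg_germ a) N lam"
    unfolding g_reg_def
  proof (rule hankel_sum_remove_sing[OF open_ball _ reg_germ_holomorphic])
    show "0 \<in> ball (0::complex) R" using R_pos by simp
    fix r assume r: "r \<noteq> 0" "complex_of_real r \<in> ball 0 R"
    have r': "\<bar>r\<bar> < R" using r by simp
    note v = saddle_w_values[OF a(1) r(1) r']
    have iv: "Im (V (of_real r)) \<noteq> 0" by (rule V_ne_real[OF r(1) r'])
    have u: "V (of_real r) - of_real (ln a) \<noteq> 0" using iv by auto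
    have ea: "exp (V (of_real r)) - of_real a \<noteq> 0" 
      using exp_v_real[of r a] exp_V_ne_1[OF r(1) r'] a unfolding agree[OF r'] by auto
    have g: "reg_germ a (of_real r) = deriv V (of_real r) * (1 / (V (of_real r) - of_real (ln a)) - exp (V (of_real r)) / (exp (V (of_real r)) - of_real a))"
    proof -
      have "saddle_kernel a r = - deriv V (of_real r) * (exp (V (of_real r)) / (exp (V (of_real r)) - of_real a))"
      proof -
        have "\<i> * E * x / ((E - 1) * A) = - (\<i> * x / (1 - E)) * (E / A)" if "1 - E \<noteq> 0" "A \<noteq> 0" for E x A :: complex
          using that by (simp add: divide_simps) (simp add: algebra_simps)
        then show ?thesis unfolding saddle_kernel_def agree[OF r'] v(5) using v(6) ea by simp
      qed
      then show ?thesis using kernel_split[OF a r(1) r'] unfolding reg_germ_def by (simp add: algebra_simps)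
    qed
    have "- \<i> * E * e * x / (p * d) * (1 / (- \<i> * E * (- \<i> * u)) - \<i> / (- \<i> * A)) = e / p * (\<i> * x / d * (1 / u - E / A))"
      if "u \<noteq> 0" "d \<noteq> 0" "A \<noteq> 0" "E \<noteq> 0" for E e x p u d A :: complex
      using that by (simp add: divide_simps) (simp add: algebra_simps)
    then show "saddle_w r * exp (of_real pi * \<i> / 4) * of_real r / (of_real pi * (1 - \<i> * saddle_w r))
       * (1 / (saddle_w r * (of_real pi / 2 - \<i> * Ln (saddle_w r / of_real a))) - \<i> / (saddle_w r + \<i> * of_real a))
      = exp (of_real pi * \<i> / 4) / of_real pi * reg_germ a (of_real r)"
      unfolding g v(1,2,3,5) unfolding v(4) using u v(6) ea by simp
  qed
  then show ?thesis by (simp only: prefactor_hankel_const)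
qed

end

lemma gauss_sum_cong:
  assumes "\<And>k. k \<le> N \<Longrightarrow> (deriv ^^ k) G 0 = (deriv ^^ k) H 0"
  shows "gauss_sum G N lam = gauss_sum H N lam"
  unfolding gauss_sum_def by (intro sum.cong refl arg_cong2[where f = "(*)"] arg_cong2[where f = "(/)"] assms) auto

text \<open>The geometric series with exact remainder. It does not require |x| < |b|, which is
  essential because b = ln a may be far smaller than V on most of the arc.\<close>

lemma inverse_diff_expansion:
  fixes x b :: complex
  assumes "b \<noteq> 0" "x \<noteq> b"
  shows "1 / (x - b) = - (\<Sum>k\<le>N. x ^ k / b ^ Suc k) + (x / b) ^ Suc N * (1 / (x - b))"
proof (induction N)
  case (Suc N)
  have "(x / b) ^ Suc N * (1 / (x - b)) = (x / b) ^ Suc (Suc N) * (1 / (x - b)) - x ^ Suc N / b ^ Suc (Suc N)"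
  proof -
    have "p * (1 / (x - b)) = x / b * p * (1 / (x - b)) - p / b" for p
      using assms by (simp add: divide_simps) (simp add: algebra_simps)
    from this[of "(x / b) ^ Suc N"] show ?thesis by (simp only: power_Suc[of _ "Suc N"] power_divide divide_divide_eq_left mult.commute)
  qed
  note Suc[unfolded this]
  then show ?case unfolding sum.atMost_Suc minus_add_distrib by (simp only: diff_conv_add_uminus add_ac)
qed (use assms in \<open>simp add: field_simps\<close>)

text \<open>Both cases are ln x <= x - 1: used for 1 / a if a > 1 and for a itself if a < 1. The
  summand 1 on the right takes care of a far from 1.\<close>

lemma inverse_ln_bound:
  fixes a :: real
  assumes "a > 0" "a \<noteq> 1"
  shows "(1 + 1 / \<bar>ln a\<bar>) ^ n \<le> 4 ^ n * (1 / \<bar>a - 1\<bar> ^ n + 1)"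
proof -
  define x where "x = 1 / \<bar>a - 1\<bar>"
  have x: "x > 0" using assms by (simp add: x_def)
  have "1 / \<bar>ln a\<bar> \<le> 1 + x"
  proof (cases "a > 1")
    case True
    have "ln (1 / a) \<le> 1 / a - 1" using assms by (intro ln_le_minus_one) auto
    then have "(a - 1) / a \<le> ln a" using True by (simp add: ln_div diff_divide_distrib)
    then have "1 / ln a \<le> 1 / ((a - 1) / a)" using True by (intro divide_left_mono) auto
    also have "\<dots> = 1 + x" using True by (simp add: x_def field_simps)
    finally show ?thesis using True by simp
  next
    case False
    have l: "1 - a \<le> - ln a" using ln_le_minus_one[of a] assms by simp
    have "1 / (- ln a) \<le> 1 / (1 - a)" using l False assms by (intro divide_left_mono mult_pos_pos) auto
    also have "\<dots> \<le> 1 + x" using False assms by (simp add: x_def)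
    finally show ?thesis using False assms l by simp
  qed
  then have "1 + 1 / \<bar>ln a\<bar> \<le> 4 * max 1 x" by simp
  then have "(1 + 1 / \<bar>ln a\<bar>) ^ n \<le> (4 * max 1 x) ^ n" by (rule power_mono) simp
  also have "\<dots> = 4 ^ n * max 1 x ^ n" by (rule power_mult_distrib)
  also have "\<dots> \<le> 4 ^ n * (x ^ n + 1)"
    using x by (intro mult_left_mono) (auto simp: max_def)
  also have "x ^ n = 1 / \<bar>a - 1\<bar> ^ n" by (simp add: x_def power_divide)
  finally show ?thesis .
qed

section \<open>Uniform asymptotics of the integrals over the arc\<close>

context saddle_setup
begin

lemma local_integrable:
  fixes g :: "real \<Rightarrow> complex"
  assumes "continuous_on {-\<rho>..\<rho>} g"
  shows "set_integrable lborel {-\<rho>..\<rho>} (\<lambda>r. exp (- (lam / 2) * r\<^sup>2) *\<^sub>R g r)"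
  by (intro borel_integrable_atLeastAtMost' continuous_intros assms) 

lemma local_integral_moment_bound:
  obtains m where "m \<ge> 0" "\<And>g K lam. continuous_on {-\<rho>..\<rho>} g \<Longrightarrow> lam > 0 \<Longrightarrow>
    (\<And>r. \<bar>r\<bar> \<le> \<rho> \<Longrightarrow> norm (g r) \<le> K * \<bar>r\<bar> ^ n) \<Longrightarrow> 0 \<le> K \<Longrightarrow>
    norm (local_integral lam g) \<le> K * m * lam powr (- (real n + 1) / 2)"
proof -
  obtain m where m: "m \<ge> 0" "\<And>lam. lam > 0 \<Longrightarrow>
     has_bochner_integral lborel (\<lambda>r::real. exp (- (lam / 2) * r\<^sup>2) * \<bar>r\<bar> ^ n) (m * lam powr (- (real n + 1) / 2))"
    by (fact gauss_moment_abs)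
  have "norm (local_integral lam g) \<le> K * m * lam powr (- (real n + 1) / 2)"
    if g: "continuous_on {-\<rho>..\<rho>} g" and lam: "lam > 0" and K: "\<And>r. \<bar>r\<bar> \<le> \<rho> \<Longrightarrow> norm (g r) \<le> K * \<bar>r\<bar> ^ n" "0 \<le> K" for g K lam
  proof -
    have i: "has_bochner_integral lborel (\<lambda>r. K * (exp (- (lam / 2) * r\<^sup>2) * \<bar>r\<bar> ^ n)) (K * (m * lam powr (- (real n + 1) / 2)))"
      by (intro has_bochner_integral_mult_right m lam)
    have "norm (local_integral lam g) \<le> (LINT r|lborel. K * (exp (- (lam / 2) * r\<^sup>2) * \<bar>r\<bar> ^ n))"
      unfolding local_integral_def set_lebesgue_integral_def
    proof (rule Bochner_Integration.integral_norm_bound_integral)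
      show "integrable lborel (\<lambda>r. indicator {-\<rho>..\<rho>} r *\<^sub>R exp (- (lam / 2) * r\<^sup>2) *\<^sub>R g r)"
        using local_integrable[OF g] by (simp add: set_integrable_def)
      show "integrable lborel (\<lambda>r. K * (exp (- (lam / 2) * r\<^sup>2) * \<bar>r\<bar> ^ n))" using i by (simp add: has_bochner_integral_iff)
      show "norm (indicator {-\<rho>..\<rho>} r *\<^sub>R exp (- (lam / 2) * r\<^sup>2) *\<^sub>R g r) \<le> K * (exp (- (lam / 2) * r\<^sup>2) * \<bar>r\<bar> ^ n)" for r
      proof (cases "\<bar>r\<bar> \<le> \<rho>")
        case True
        have "exp (- (lam / 2) * r\<^sup>2) * norm (g r) \<le> exp (- (lam / 2) * r\<^sup>2) * (K * \<bar>r\<bar> ^ n)"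
          using K(1)[OF True] by (rule mult_left_mono) simp
        then show ?thesis using True by (simp add: indicator_def mult_ac abs_le_iff)
      next
        case False
        then have "r \<notin> {-\<rho>..\<rho>}" by auto
        then show ?thesis using K(2) by simp
      qed
    qed
    also have "\<dots> = K * m * lam powr (- (real n + 1) / 2)" using i by (simp add: has_bochner_integral_iff mult.assoc)
    finally show ?thesis .
  qed
  with m(1) show thesis by (rule that)
qed

text \<open>ln a is real, so V - ln a remains in the strip |Im u| <= 1 for every a, and the bound
  for \<open>reg_kernel\<close> there is all that Watson's lemma has to know. A disc smaller than
  that of radius R is used since V' is bounded on compact subdiscs only.\<close>

lemma reg_asymptotics:
  "\<exists>C\<ge>0. \<forall>lam>0. \<forall>a. norm (local_integral lam (reg_integrand a) - gauss_sum (reg_germ a) N lam) \<le> C * lam powr (- (real N + 2) / 2)"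
proof -
  define R' where "R' = 3 * R / 4"
  have R': "\<rho> < R'" "R' < R" using R_pos by (auto simp: R'_def \<rho>_def)
  obtain B1 where B1: "B1 > 0" "\<forall>z\<in>cball 0 R'. norm (deriv V z) \<le> B1"
    using deriv_V_bounded[OF R'(2)] by (elim exE conjE) (rule that)
  obtain B2 where B2: "B2 > 0" "\<forall>u. \<bar>Im u\<bar> \<le> 1 \<longrightarrow> norm (reg_kernel u) \<le> B2"
    using reg_kernel_bounded by (elim exE conjE) (rule that)
  obtain C where C: "C \<ge> 0" "\<And>G M lam. G holomorphic_on ball (0::complex) R' \<Longrightarrow>
     (\<And>z. z \<in> ball 0 R' \<Longrightarrow> norm (G z) \<le> M) \<Longrightarrow> lam > 0 \<Longrightarrow>
     norm ((LINT r:{-\<rho>..\<rho>}|lborel. exp (- (lam / 2) * r\<^sup>2) *\<^sub>R G (of_real r))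
        - (\<Sum>j=0..N div 2. (deriv ^^ (2 * j)) G 0 / fact (2 * j)
             * of_real (Gamma (real j + 1/2) * (2 / lam) powr (real j + 1/2))))
       \<le> C * M * lam powr (- (real N + 2) / 2)"
    by (fact watson_holomorphic[OF rho(1) R'(1)])
  have "norm (local_integral lam (reg_integrand a) - gauss_sum (reg_germ a) N lam) \<le> C * (B1 * B2) * lam powr (- (real N + 2) / 2)"
    if lam: "lam > 0" for lam a
    unfolding local_integral_def gauss_sum_def reg_integrand_def[folded reg_germ_def]
  proof (rule C(2)[OF _ _ lam])
    show "reg_germ a holomorphic_on ball 0 R'" by (rule holomorphic_on_subset[OF reg_germ_holomorphic]) (use R' in auto)
    show "norm (reg_germ a z) \<le> B1 * B2" if z: "z \<in> ball 0 R'" for z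
    proof -
      have "\<bar>Im (V z - of_real (ln a))\<bar> \<le> 1" using Im_V_less[of z] z R' by simp
      then show ?thesis unfolding reg_germ_def norm_mult using B1 B2 z by (intro mult_mono) auto
    qed
  qed
  then show ?thesis using C(1) B1(1) B2(1) by (intro exI[of _ "C * (B1 * B2)"]) simp
qed

text \<open>Watson's lemma cannot be applied to V' / (V - b) itself, as the disc without pole
  shrinks with b. The partial sum \<open>T\<close> is a polynomial in V and holomorphic on the whole
  disc, with a bound in powers of 1 / |b|. The remainder \<open>Q\<close> is estimated on the real
  arc only, where V keeps a distance |b| / 5 from b, and there it is O(|r|^(N+1) / |b|^(N+2)). It
  vanishes to order N + 1 at 0, hence leaves the coefficients alone.\<close>

lemma pole_asymptotics:
  "\<exists>C\<ge>0. \<forall>lam>0. \<forall>a>0. a \<noteq> 1 \<longrightarrow> norm (local_integral lam (pole_integrand a) - gauss_sum (pole_germ a) N lam)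
     \<le> C * (1 + 1 / \<bar>ln a\<bar>) ^ (N + 2) * lam powr (- (real N + 2) / 2)"
proof -
  define R' where "R' = 3 * R / 4"
  have R': "\<rho> < R'" "R' < R" "0 < R'" using R_pos by (auto simp: R'_def \<rho>_def)
  obtain B where B: "B > 0" "\<forall>z\<in>cball 0 R'. norm (deriv V z) \<le> B"
    using deriv_V_bounded[OF R'(2)] by (elim exE conjE) (rule that)
  obtain C where C: "C \<ge> 0" "\<And>G M lam. G holomorphic_on ball (0::complex) R' \<Longrightarrow>
     (\<And>z. z \<in> ball 0 R' \<Longrightarrow> norm (G z) \<le> M) \<Longrightarrow> lam > 0 \<Longrightarrow>
     norm ((LINT r:{-\<rho>..\<rho>}|lborel. exp (- (lam / 2) * r\<^sup>2) *\<^sub>R G (of_real r))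
        - (\<Sum>j=0..N div 2. (deriv ^^ (2 * j)) G 0 / fact (2 * j)
             * of_real (Gamma (real j + 1/2) * (2 / lam) powr (real j + 1/2))))
       \<le> C * M * lam powr (- (real N + 2) / 2)"
    by (fact watson_holomorphic[OF rho(1) R'(1)])
  obtain m where m: "m \<ge> 0" "\<And>g K lam. continuous_on {-\<rho>..\<rho>} g \<Longrightarrow> lam > 0 \<Longrightarrow>
    (\<And>r. \<bar>r\<bar> \<le> \<rho> \<Longrightarrow> norm (g r) \<le> K * \<bar>r\<bar> ^ Suc N) \<Longrightarrow> 0 \<le> K \<Longrightarrow>
    norm (local_integral lam g) \<le> K * m * lam powr (- (real (Suc N) + 1) / 2)"
    by (fact local_integral_moment_bound)
  define K where "K = C * (B * (real N + 1)) + B * ((11/10) ^ Suc N * 5) * m"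
  have K: "K \<ge> 0" unfolding K_def using C(1) m(1) B(1) by simp
  have "norm (local_integral lam (pole_integrand a) - gauss_sum (pole_germ a) N lam)
     \<le> K * (1 + 1 / \<bar>ln a\<bar>) ^ (N + 2) * lam powr (- (real N + 2) / 2)"
    if lam: "lam > 0" and a: "a > 0" "a \<noteq> 1" for lam a
  proof -
    define b where "b = complex_of_real (ln a)"
    have b: "b \<noteq> 0" "norm b = \<bar>ln a\<bar>" using a by (simp_all add: b_def)
    define y where "y = 1 / norm b"
    have y: "y > 0" using b(1) by (simp add: y_def)
    define T where "T z = - (\<Sum>k\<le>N. V z ^ k / b ^ Suc k)" for z
    define Q where "Q z = (V z / b) ^ Suc N * (1 / (V z - b))" for z
    have split: "pole_germ a z = deriv V z * T z + deriv V z * Q z" if "V z \<noteq> b" for z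
      unfolding pole_germ_def b_def[symmetric] T_def Q_def distrib_left[symmetric]
      by (rule arg_cong[OF inverse_diff_expansion[OF b(1) that]])
    have T_hol: "(\<lambda>z. deriv V z * T z) holomorphic_on S" if "S \<subseteq> ball 0 R" for S
      unfolding T_def[abs_def]
      by (intro holomorphic_intros holomorphic_on_subset[OF V_hol that] holomorphic_on_subset[OF deriv_V_hol that]) (use b in auto)
    have T_bound: "norm (deriv V z * T z) \<le> B * ((real N + 1) * (1 + y) ^ (N + 2))" if z: "z \<in> ball 0 R'" for z
      unfolding norm_mult
    proof (rule mult_mono)
      have "norm (T z) \<le> (\<Sum>k\<le>N. norm (V z ^ k / b ^ Suc k))" unfolding T_def norm_minus_cancel by (rule norm_sum)
      also have "\<dots> \<le> (\<Sum>k\<le>N. (1 + y) ^ (N + 2))"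
      proof (rule sum_mono)
        fix k assume k: "k \<in> {..N}"
        have "norm (V z ^ k / b ^ Suc k) = norm (V z) ^ k * y ^ Suc k"
          by (simp add: norm_divide norm_mult norm_power y_def power_divide)
        also have "\<dots> \<le> 1 * (1 + y) ^ Suc k"
          using V_less_1[of z] z R' y by (intro mult_mono power_mono power_le_one) auto
        also have "\<dots> \<le> 1 * (1 + y) ^ (N + 2)" using y k by (intro mult_left_mono power_increasing) auto
        finally show "norm (V z ^ k / b ^ Suc k) \<le> (1 + y) ^ (N + 2)" by simp
      qed
      also have "\<dots> = (real N + 1) * (1 + y) ^ (N + 2)" by simp
      finally show "norm (T z) \<le> (real N + 1) * (1 + y) ^ (N + 2)" .
    qed (use B z in auto)
    have Q_bound: "norm (Q z) \<le> (11/10) ^ Suc N * c * y ^ (N + 2) * norm z ^ Suc N"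
      if z: "z \<in> ball 0 R" and c: "norm b / c \<le> norm (V z - b)" "c > 0" for z c
    proof -
      have "norm (Q z) = (norm (V z) * y) ^ Suc N * (1 / norm (V z - b))"
        by (simp add: Q_def norm_mult norm_divide norm_power y_def)
      also have "\<dots> \<le> ((11/10 * norm z) * y) ^ Suc N * (c * y)"
      proof (rule mult_mono)
        show "(norm (V z) * y) ^ Suc N \<le> ((11/10 * norm z) * y) ^ Suc N"
          using V_upper[OF z] y by (intro power_mono mult_right_mono) auto
        have p: "0 < norm b / c" using b(1) c(2) by simp
        have "1 / norm (V z - b) \<le> 1 / (norm b / c)"
          by (rule divide_left_mono[OF c(1)]) (use p less_le_trans[OF p c(1)] in \<open>simp_all only: mult_pos_pos zero_le_one\<close>)
        then show "1 / norm (V z - b) \<le> c * y" by (simp add: y_def)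
      qed (use y in auto)
      also have "\<dots> = (11/10) ^ Suc N * c * y ^ (N + 2) * norm z ^ Suc N"
        unfolding power_mult_distrib by (simp add: mult_ac)
      finally show ?thesis .
    qed
    have derivs: "(deriv ^^ k) (pole_germ a) 0 = (deriv ^^ k) (\<lambda>z. deriv V z * T z) 0" if k: "k \<le> N" for k
    proof -
      \<comment> \<open>On this disc |V| <= 11/10 * |b| / 3 < |b| / 2, so the pole is outside. It
        shrinks with b, but only derivatives at 0 are read off from it.\<close>
      define s where "s = min R' (norm b / 3)"
      have s: "0 < s" "s \<le> R'" "s \<le> norm b / 3" using R' b(1) by (auto simp: s_def)
      have far: "norm b / 2 \<le> norm (V z - b)" if z: "z \<in> ball 0 s" for z
      proof -
        have "norm (V z) \<le> 11/10 * norm z" using z s R' by (intro V_upper) auto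
        moreover have "norm z < norm b / 3" using z s by simp
        ultimately have "norm (V z) \<le> norm b / 2" using norm_ge_zero[of b] by linarith
        then show ?thesis using norm_triangle_ineq2[of b "V z"] by (simp add: norm_minus_commute)
      qed
      have sub: "ball 0 s \<subseteq> ball 0 R" using s R' by auto
      have ne: "V z \<noteq> b" if "z \<in> ball 0 s" for z using far[OF that] b(1) by auto
      have p_hol: "pole_germ a holomorphic_on ball 0 s"
        by (rule holomorphic_on_subset[OF pole_germ_holomorphic]) (use sub ne in \<open>auto simp: pole_free_def b_def\<close>)
      let ?D = "\<lambda>z. pole_germ a z - deriv V z * T z"
      have "(deriv ^^ k) ?D 0 = 0"
      proof (rule derivs_zero_of_small[OF s(1) _ _ _ k])
        show "?D holomorphic_on ball 0 s" by (intro holomorphic_on_diff p_hol T_hol sub)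
        show "norm (?D z) \<le> (B * ((11/10) ^ Suc N * 2 * y ^ (N + 2))) * norm z ^ Suc N" if z: "z \<in> ball 0 s" for z
        proof -
          have "?D z = deriv V z * Q z" using split[OF ne[OF z]] by simp
          moreover have "norm (deriv V z * Q z) \<le> B * ((11/10) ^ Suc N * 2 * y ^ (N + 2) * norm z ^ Suc N)"
            unfolding norm_mult using B s z far[OF z] by (intro mult_mono Q_bound subsetD[OF sub z]) auto
          ultimately show ?thesis by (simp add: mult.assoc)
        qed
        show "0 \<le> B * ((11/10) ^ Suc N * 2 * y ^ (N + 2))" using B y by simp
      qed
      moreover have "(deriv ^^ k) ?D 0 = (deriv ^^ k) (pole_germ a) 0 - (deriv ^^ k) (\<lambda>z. deriv V z * T z) 0"
        by (rule higher_deriv_diff[OF p_hol T_hol[OF sub] open_ball]) (use s in simp)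
      ultimately show ?thesis by simp
    qed
    let ?t = "\<lambda>r::real. deriv V (of_real r) * T (of_real r)" and ?q = "\<lambda>r::real. deriv V (of_real r) * Q (of_real r)"
    \<comment> \<open>Off the real arc no such bound holds uniformly in b; it rests on the angle
      between the curve and the real axis.\<close>
    have off: "norm b / 5 \<le> norm (V (of_real r) - b)" if "\<bar>r\<bar> \<le> \<rho>" for r
      using V_minus_real(2)[of r "ln a"] that rho unfolding b_def by simp
    then have ne: "V (of_real r) \<noteq> b" if "\<bar>r\<bar> \<le> \<rho>" for r using off[OF that] b(1) by auto
    have ne': "V (of_real r) - b \<noteq> 0" if "- \<rho> \<le> r" "r \<le> \<rho>" for r using ne[of r] that by (simp add: abs_le_iff)
    have t_cont: "continuous_on {-\<rho>..\<rho>} ?t"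
      unfolding T_def by (intro continuous_intros continuous_V_real continuous_dV_real) (use b in auto)
    have q_cont: "continuous_on {-\<rho>..\<rho>} ?q"
      unfolding Q_def by (intro continuous_intros continuous_V_real continuous_dV_real) (use b ne' in simp_all)
    have "local_integral lam (pole_integrand a) = (LINT r:{-\<rho>..\<rho>}|lborel. exp (- (lam / 2) * r\<^sup>2) *\<^sub>R ?t r + exp (- (lam / 2) * r\<^sup>2) *\<^sub>R ?q r)"
      unfolding local_integral_def
    proof (rule set_lebesgue_integral_cong)
      show "\<forall>r. r \<in> {-\<rho>..\<rho>} \<longrightarrow> exp (- (lam / 2) * r\<^sup>2) *\<^sub>R pole_integrand a r
         = exp (- (lam / 2) * r\<^sup>2) *\<^sub>R ?t r + exp (- (lam / 2) * r\<^sup>2) *\<^sub>R ?q r"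
      proof (intro allI impI)
        fix r assume "r \<in> {-\<rho>..\<rho>}"
        then have "\<bar>r\<bar> \<le> \<rho>" by auto
        then have "pole_integrand a r = ?t r + ?q r"
          using split[OF ne] by (simp add: pole_germ_def pole_integrand_def)
        then show "exp (- (lam / 2) * r\<^sup>2) *\<^sub>R pole_integrand a r
         = exp (- (lam / 2) * r\<^sup>2) *\<^sub>R ?t r + exp (- (lam / 2) * r\<^sup>2) *\<^sub>R ?q r" by (simp only: scaleR_add_right)
      qed
    qed simp
    also have "\<dots> = local_integral lam ?t + local_integral lam ?q"
      unfolding local_integral_def by (intro set_integral_add local_integrable t_cont q_cont)
    finally have eq: "local_integral lam (pole_integrand a) - gauss_sum (pole_germ a) N lam
       = (local_integral lam ?t - gauss_sum (\<lambda>z. deriv V z * T z) N lam) + local_integral lam ?q"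
      using gauss_sum_cong[OF derivs, of N lam] by simp
    have e1: "norm (local_integral lam ?t - gauss_sum (\<lambda>z. deriv V z * T z) N lam)
       \<le> C * (B * ((real N + 1) * (1 + y) ^ (N + 2))) * lam powr (- (real N + 2) / 2)"
      unfolding local_integral_def gauss_sum_def
      by (rule C(2)[OF T_hol T_bound lam]) (use R' in auto)
    have e2: "norm (local_integral lam ?q) \<le> (B * ((11/10) ^ Suc N * 5 * y ^ (N + 2))) * m * lam powr (- (real (Suc N) + 1) / 2)"
    proof (rule m(2)[OF q_cont lam])
      fix r assume r: "\<bar>r\<bar> \<le> \<rho>"
      have "norm (?q r) \<le> B * ((11/10) ^ Suc N * 5 * y ^ (N + 2) * norm (complex_of_real r) ^ Suc N)"
        unfolding norm_mult using B R' r off[OF r] in_ball[OF r] by (intro mult_mono Q_bound) auto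
      then show "norm (?q r) \<le> B * ((11/10) ^ Suc N * 5 * y ^ (N + 2)) * \<bar>r\<bar> ^ Suc N" by (simp add: mult.assoc)
    qed (use B y in simp)
    also have "- (real (Suc N) + 1) / 2 = - (real N + 2) / 2" by simp
    also have "(B * ((11/10) ^ Suc N * 5 * y ^ (N + 2))) * m * lam powr (- (real N + 2) / 2)
      \<le> (B * ((11/10) ^ Suc N * 5 * (1 + y) ^ (N + 2))) * m * lam powr (- (real N + 2) / 2)"
      using y B m(1) by (intro mult_right_mono mult_left_mono power_mono) auto
    finally have e2: "norm (local_integral lam ?q) \<le> (B * ((11/10) ^ Suc N * 5 * (1 + y) ^ (N + 2))) * m * lam powr (- (real N + 2) / 2)" .
    have "norm (local_integral lam (pole_integrand a) - gauss_sum (pole_germ a) N lam)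
      \<le> C * (B * ((real N + 1) * (1 + y) ^ (N + 2))) * lam powr (- (real N + 2) / 2)
        + (B * ((11/10) ^ Suc N * 5 * (1 + y) ^ (N + 2))) * m * lam powr (- (real N + 2) / 2)"
      unfolding eq by (rule norm_triangle_le[OF add_mono[OF e1 e2]])
    also have "\<dots> = K * (1 + y) ^ (N + 2) * lam powr (- (real N + 2) / 2)"
    proof -
      have "C * (B * (n * Y)) * p + (B * (e * 5 * Y)) * m * p = (C * (B * n) + B * (e * 5) * m) * Y * p" for n e Y p :: real
        by (simp add: algebra_simps)
      then show ?thesis unfolding K_def .
    qed
    finally show ?thesis unfolding y_def b(2) .
  qed
  with K show ?thesis by (intro exI[of _ K]) simp
qed

end

section \<open>The explicit coefficients for N = 3\<close>

lemma reg_kernel_derivs: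
  assumes "\<bar>Im u\<bar> < 2 * pi" "u \<noteq> 0"
  shows "deriv reg_kernel u = - 1 / u\<^sup>2 + exp u / (exp u - 1)\<^sup>2"
    and "deriv (deriv reg_kernel) u = 2 / u ^ 3 - exp u * (exp u + 1) / (exp u - 1) ^ 3"
proof -
  define S where "S = {u. \<bar>Im u\<bar> < 2 * pi} - {0}"
  have S: "open S" unfolding S_def by (intro open_Diff open_strip) simp
  have ne: "u \<noteq> 0" "exp u - 1 \<noteq> 0" if "u \<in> S" for u
    using that exp_eq_1_strip[of u] by (auto simp: S_def)
  have d1: "deriv reg_kernel u = - 1 / u\<^sup>2 + exp u / (exp u - 1)\<^sup>2" if u: "u \<in> S" for u
  proof (rule DERIV_imp_deriv)
    have "((\<lambda>u. 1 / u - exp u / (exp u - 1)) has_field_derivative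
       (0 * u - 1 * 1) / (u * u) - (exp u * (exp u - 1) - exp u * (exp u - 0)) / ((exp u - 1) * (exp u - 1))) (at u)"
      using ne[OF u] by (intro DERIV_diff DERIV_divide DERIV_const DERIV_ident DERIV_exp) auto
    then have "(reg_kernel has_field_derivative
       (0 * u - 1 * 1) / (u * u) - (exp u * (exp u - 1) - exp u * (exp u - 0)) / ((exp u - 1) * (exp u - 1))) (at u)"
      by (rule has_field_derivative_transform_within_open[OF _ S u]) (simp add: reg_kernel_eq S_def)
    moreover have "(0 * u - 1 * 1) / (u * u) - (E * (E - 1) - E * (E - 0)) / ((E - 1) * (E - 1)) = - 1 / u\<^sup>2 + E / (E - 1)\<^sup>2" for E
      by (simp add: power2_eq_square algebra_simps)
    ultimately show "(reg_kernel has_field_derivative - 1 / u\<^sup>2 + exp u / (exp u - 1)\<^sup>2) (at u)" by (simp only:)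
  qed
  have u: "u \<in> S" using assms by (simp add: S_def)
  show "deriv reg_kernel u = - 1 / u\<^sup>2 + exp u / (exp u - 1)\<^sup>2" by (rule d1[OF u])
  show "deriv (deriv reg_kernel) u = 2 / u ^ 3 - exp u * (exp u + 1) / (exp u - 1) ^ 3"
  proof (rule DERIV_imp_deriv)
    have "((\<lambda>u. - 1 / u\<^sup>2 + exp u / (exp u - 1)\<^sup>2) has_field_derivative
       2 / u ^ 3 - exp u * (exp u + 1) / (exp u - 1) ^ 3) (at u)"
    proof -
      have n1: "u\<^sup>2 \<noteq> 0" and n2: "(exp u - 1)\<^sup>2 \<noteq> 0" using ne[OF u] by auto
      have e1: "(0 * u\<^sup>2 - (- 1) * (2 * u)) / (u\<^sup>2 * u\<^sup>2) = 2 / u ^ 3"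
        using ne(1)[OF u] by (simp add: field_simps eval_nat_numeral)
      have e2: "(E * D\<^sup>2 - E * (2 * D * E)) / (D\<^sup>2 * D\<^sup>2) = - (E * (E + 1) / D ^ 3)" if "D = E - 1" "D \<noteq> 0" for E D :: complex
        using that(2) unfolding that(1) by (simp add: divide_simps) (simp add: algebra_simps eval_nat_numeral)
      have p1: "((\<lambda>u::complex. u\<^sup>2) has_field_derivative 2 * u) (at u)" by (auto intro!: derivative_eq_intros)
      have p2: "((\<lambda>u::complex. (exp u - 1)\<^sup>2) has_field_derivative 2 * (exp u - 1) * exp u) (at u)" by (auto intro!: derivative_eq_intros)
      have "((\<lambda>u. - 1 / u\<^sup>2 + exp u / (exp u - 1)\<^sup>2) has_field_derivative
         (0 * u\<^sup>2 - (- 1) * (2 * u)) / (u\<^sup>2 * u\<^sup>2)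
         + (exp u * (exp u - 1)\<^sup>2 - exp u * (2 * (exp u - 1) * exp u)) / ((exp u - 1)\<^sup>2 * (exp u - 1)\<^sup>2)) (at u)"
        by (intro DERIV_add DERIV_divide DERIV_const DERIV_exp p1 p2 n1 n2)
      then show ?thesis unfolding e1 e2[OF refl ne(2)[OF u]] by simp
    qed
    then show "(deriv reg_kernel has_field_derivative 2 / u ^ 3 - exp u * (exp u + 1) / (exp u - 1) ^ 3) (at u)"
      by (rule has_field_derivative_transform_within_open[OF _ S u]) (simp add: d1)
  qed
qed

text \<open>The coefficients of (2 / lam)^(1/2) and (2 / lam)^(3/2) that a germ V' h (V - ln a)
  produces behind the prefactor, at u = -ln a; \<open>h\<close> is 1/u or
  \<open>reg_kernel\<close>.\<close>

definition kernel_coeff0 :: "(complex \<Rightarrow> complex) \<Rightarrow> complex \<Rightarrow> complex" where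
  "kernel_coeff0 h u = - h u / of_real (sqrt pi)"

definition kernel_coeff1 :: "(complex \<Rightarrow> complex) \<Rightarrow> complex \<Rightarrow> complex" where
  "kernel_coeff1 h u = \<i> * (h u - 6 * deriv h u + 6 * deriv (deriv h) u) / of_real (24 * sqrt pi)"

lemma remove_sing_at_isCont:
  assumes f: "isCont f x" and h: "eventually (\<lambda>y. y \<noteq> x \<longrightarrow> h y = f y) (nhds x)"
  shows "remove_sing_at x h x = f x"
proof -
  have "(f \<longlongrightarrow> f x) (at x)" using f by (rule isContD)
  moreover have "eventually (\<lambda>y. f y = h y) (at x)"
    unfolding eventually_at_filter using h by eventually_elim simp
  ultimately have "(h \<longlongrightarrow> f x) (at x)" by (rule Lim_transform_eventually)
  then show ?thesis by (simp add: remove_sing_at_def tendsto_Lim)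
qed

text \<open>For a other than 1 this is algebra with e^u = 1 / a at u = -ln a. The right sides are
  continuous at a = 1, since \<open>reg_kernel\<close> is holomorphic at 0; so they also supply the
  limits by which the singularities of the explicit formulas are removed.\<close>

lemma reg_coeff_eq:
  assumes a: "a > 0"
  shows "reg_coeff0 a = kernel_coeff0 reg_kernel (- of_real (ln a))"
    and "reg_coeff1 a = kernel_coeff1 reg_kernel (- of_real (ln a))"
proof -
  let ?S = "{u. \<bar>Im u\<bar> < 2 * pi}"
  let ?f0 = "\<lambda>a. kernel_coeff0 reg_kernel (- of_real (ln a))" and ?f1 = "\<lambda>a. kernel_coeff1 reg_kernel (- of_real (ln a))"
  have ev: "exp (- complex_of_real (ln a)) = of_real (1 / a)" if "a > 0" for a
  proof -
    have "exp (- complex_of_real (ln a)) = of_real (exp (- ln a))" by (simp flip: exp_of_real)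
    also have "exp (- ln a) = 1 / a" using that by (simp add: exp_minus inverse_eq_divide)
    finally show ?thesis .
  qed
  have v0: "complex_of_real ((a - 1 - ln a) / (sqrt pi * (a - 1) * ln a)) = ?f0 a" if a: "a > 0" "a \<noteq> 1" for a
  proof -
    have l: "ln a \<noteq> 0" "a - 1 \<noteq> 0" using a by simp_all
    have "reg_kernel (- of_real (ln a)) = 1 / (- of_real (ln a)) - of_real (1 / a) / (of_real (1 / a) - 1)"
      unfolding ev[OF a(1), symmetric] by (rule reg_kernel_eq) (use l pi_gt_zero in simp_all)
    also have "\<dots> = of_real (1 / (- ln a) - (1 / a) / (1 / a - 1))" by simp
    also have "1 / (- ln a) - (1 / a) / (1 / a - 1) = - (a - 1 - ln a) / ((a - 1) * ln a)"
    proof -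
      have "(1 / a) / (1 / a - 1) = - 1 / (a - 1)" using a l by (simp add: divide_simps)
      then show ?thesis using l by (simp add: field_simps)
    qed
    finally have k: "reg_kernel (- of_real (ln a)) = of_real (- (a - 1 - ln a) / ((a - 1) * ln a))" .
    have "x / (s * p * l) = - (- x / (p * l)) / s" for x s p l :: real by (simp add: mult_ac)
    then show ?thesis unfolding kernel_coeff0_def k by (simp only: of_real_minus of_real_divide)
  qed
  have v1: "\<i> * of_real (((1 + 10 * a + a\<^sup>2) / (a - 1) ^ 3
                    - (12 - 6 * ln a + (ln a)\<^sup>2) / (ln a) ^ 3) / (24 * sqrt pi)) = ?f1 a" if a: "a > 0" "a \<noteq> 1" for a
  proof -
    define b where "b = ln a"
    have l: "b \<noteq> 0" "a - 1 \<noteq> 0" "1 - a \<noteq> 0" using a by (simp_all add: b_def)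
    let ?u = "- complex_of_real b"
    have u: "\<bar>Im ?u\<bar> < 2 * pi" "?u \<noteq> 0" using l by simp_all
    note e = ev[OF a(1), folded b_def]
    have "reg_kernel ?u - 6 * deriv reg_kernel ?u + 6 * deriv (deriv reg_kernel) ?u
      = of_real ((1 / (- b) - (1 / a) / (1 / a - 1)) - 6 * (- 1 / (- b)\<^sup>2 + (1 / a) / (1 / a - 1)\<^sup>2)
          + 6 * (2 / (- b) ^ 3 - (1 / a) * (1 / a + 1) / (1 / a - 1) ^ 3))"
      unfolding reg_kernel_eq[OF u] reg_kernel_derivs[OF u] e by simp
    also have "(1 / (- b) - (1 / a) / (1 / a - 1)) - 6 * (- 1 / (- b)\<^sup>2 + (1 / a) / (1 / a - 1)\<^sup>2)
          + 6 * (2 / (- b) ^ 3 - (1 / a) * (1 / a + 1) / (1 / a - 1) ^ 3)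
        = (1 + 10 * a + a\<^sup>2) / (a - 1) ^ 3 - (12 - 6 * b + b\<^sup>2) / b ^ 3"
    proof -
      have "1 / a - 1 = (1 - a) / a" "1 / a + 1 = (1 + a) / a" using a by (simp_all add: field_simps)
      note q = this
      have k0: "(1 / a) / (1 / a - 1) = 1 / (1 - a)" unfolding q using a by simp
      have k1: "(1 / a) / (1 / a - 1)\<^sup>2 = a / (1 - a)\<^sup>2" unfolding q using a by (simp add: power2_eq_square)
      have k2: "(1 / a) * (1 / a + 1) / (1 / a - 1) ^ 3 = a * (1 + a) / (1 - a) ^ 3"
        unfolding q using a by (simp add: power3_eq_cube)
      have "1 / d + 6 * (a / d\<^sup>2) + 6 * (a * (1 + a) / d ^ 3) = (1 + 10 * a + a\<^sup>2) / d ^ 3" if "d = 1 - a" "d \<noteq> 0" for d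
      proof -
        have "1 / d + 6 * (a / d\<^sup>2) + 6 * (a * (1 + a) / d ^ 3) = (d\<^sup>2 + 6 * a * d + 6 * (a * (1 + a))) / d ^ 3"
          using that(2) by (simp add: divide_simps) (simp add: power2_eq_square power3_eq_cube algebra_simps)
        also have "d\<^sup>2 + 6 * a * d + 6 * (a * (1 + a)) = 1 + 10 * a + a\<^sup>2"
          unfolding that(1) by (simp add: power2_eq_square algebra_simps)
        finally show ?thesis .
      qed
      note A = this[OF refl l(3)]
      have "(1 - a) ^ 3 = - ((a - 1) ^ 3)" by (simp add: power3_eq_cube algebra_simps)
      then have A': "(1 + 10 * a + a\<^sup>2) / (1 - a) ^ 3 = - ((1 + 10 * a + a\<^sup>2) / (a - 1) ^ 3)" by simp
      have Bq: "1 / (- b) - 6 * (- 1 / (- b)\<^sup>2) + 6 * (2 / (- b) ^ 3) = - ((12 - 6 * b + b\<^sup>2) / b ^ 3)"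
        using l(1) by (simp add: divide_simps) (simp add: power2_eq_square power3_eq_cube algebra_simps)
      show ?thesis unfolding k0 k1 k2 using A A' Bq by (simp add: algebra_simps)
    qed
    finally show ?thesis unfolding kernel_coeff1_def b_def by simp
  qed
  have h1: "deriv reg_kernel holomorphic_on ?S" by (rule holomorphic_deriv[OF reg_kernel_holomorphic open_strip])
  have h2: "deriv (deriv reg_kernel) holomorphic_on ?S" by (rule holomorphic_deriv[OF h1 open_strip])
  have ct: "isCont (\<lambda>a. h (- complex_of_real (ln a))) 1" if "h holomorphic_on ?S" for h
  proof (rule isCont_o2[where g = h])
    show "isCont (\<lambda>a. - complex_of_real (ln a)) 1" by (intro continuous_intros) simp
    show "isCont h (- complex_of_real (ln 1))"
      by (rule continuous_on_interior[OF holomorphic_on_imp_continuous_on[OF that]]) (simp add: interior_open[OF open_strip])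
  qed
  have near: "eventually (\<lambda>a::real. a > 0) (nhds 1)" using eventually_nhds_in_open[of "{0<..}" "1::real"] by simp
  show "reg_coeff0 a = ?f0 a"
  proof (cases "a = 1")
    case True
    have "isCont ?f0 1" unfolding kernel_coeff0_def by (intro continuous_intros ct[OF reg_kernel_holomorphic]) simp
    then show ?thesis unfolding reg_coeff0_def True
      by (rule remove_sing_at_isCont) (use near in eventually_elim, intro impI v0, assumption+)
  qed (use v0[OF a] in \<open>simp add: reg_coeff0_def remove_sing_at_def\<close>)
  show "reg_coeff1 a = ?f1 a"
  proof (cases "a = 1")
    case True
    have "isCont ?f1 1" unfolding kernel_coeff1_def
      by (intro continuous_intros ct[OF reg_kernel_holomorphic] ct[OF h1] ct[OF h2]) simp
    then show ?thesis unfolding reg_coeff1_def True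
      by (rule remove_sing_at_isCont) (use near in eventually_elim, intro impI v1, assumption+)
  qed (use v1[OF a] in \<open>simp add: reg_coeff1_def remove_sing_at_def\<close>)
qed

context saddle_setup
begin

text \<open>The powers of the direction combine with the prefactor: e^(i pi / 4) \<open>sdir\<close>
  = -1 and e^(i pi / 4) \<open>sdir\<close>^3 = i. The radius r may be smaller than R so that for h
  u = 1 / u the disc can avoid V = ln a.\<close>

lemma gauss_sum_three:
  assumes h: "h holomorphic_on S" "open S" "\<And>z. z \<in> ball 0 r \<Longrightarrow> V z - b \<in> S"
    and r: "0 < r" "r \<le> R"
  shows "hankel_const a lam * gauss_sum (\<lambda>z. deriv V z * h (V z - b)) 3 lam
    = hankel_prefactor a lam * (kernel_coeff0 h (- b) * of_real ((2 / lam) powr (1/2)) + kernel_coeff1 h (- b) * of_real ((2 / lam) powr (3/2)))"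
proof -
  have "local_saddle V r"
  proof
    show "V holomorphic_on ball 0 r" by (rule holomorphic_on_subset[OF V_hol]) (use r in auto)
  qed (use r R_le V_deriv_0 V_phase V_near in auto)
  then interpret small: local_saddle V r .
  let ?G = "\<lambda>z. deriv V z * h (V z - b)" and ?e = "exp (of_real pi * \<i> / 4)"
  let ?p = "complex_of_real ((2 / lam) powr (1/2))" and ?q = "complex_of_real ((2 / lam) powr (3/2))"
  have e: "?e = cis (pi / 4)" by (simp add: cis_conv_exp mult.commute)
  have e1: "?e * sdir = - 1" unfolding e sdir_def cis_mult by (simp add: field_simps)
  have e3: "?e * sdir ^ 3 = \<i>"
  proof -
    have "?e * sdir ^ 3 = (?e * sdir) * sdir\<^sup>2" by (simp add: power2_eq_square power3_eq_cube)
    then show ?thesis unfolding e1 sdir_sq by simp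
  qed
  have G2: "Gamma (3 / 2 :: real) = sqrt pi / 2"
  proof -
    have "(1 / 2 :: real) \<notin> \<int>\<^sub>\<le>\<^sub>0" using nonpos_Ints_nonpos[of "1/2 :: real"] by auto
    from Gamma_plus1[OF this] show ?thesis by (simp add: Gamma_one_half_real)
  qed
  have sp: "complex_of_real (sqrt pi) * of_real (sqrt pi) = of_real pi" by (simp flip: of_real_mult)
  have "gauss_sum ?G 3 lam = ?G 0 * (of_real (sqrt pi) * ?p) + (deriv ^^ 2) ?G 0 / 2 * (of_real (sqrt pi) / 2 * ?q)"
  proof -
    have "{0..3 div 2} = {0, 1::nat}" by auto
    then show ?thesis unfolding gauss_sum_def by (simp add: Gamma_one_half_real G2)
  qed
  also have "(deriv ^^ 2) ?G 0 = sdir ^ 3 * (h (- b) / 6 - deriv h (- b) + deriv (deriv h) (- b))"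
    by (rule small.kernel_deriv2(2)[OF h])
  also have "?G 0 = sdir * h (- b)" by (simp add: V_deriv_0)
  finally have g: "gauss_sum ?G 3 lam = sdir * h (- b) * (of_real (sqrt pi) * ?p)
      + sdir ^ 3 * (h (- b) / 6 - deriv h (- b) + deriv (deriv h) (- b)) / 2 * (of_real (sqrt pi) / 2 * ?q)" .
  have "E / (s * s) * (d * x * (s * p) + d ^ 3 * (x / 6 - y + z) / 2 * (s / 2 * q))
     = (E * d) * x / s * p + (E * d ^ 3) * (x - 6 * y + 6 * z) / (24 * s) * q" if "s \<noteq> 0" for E s d x y z p q :: complex
    using that by (simp add: divide_simps) (simp add: algebra_simps)
  from this[of "of_real (sqrt pi)" ?e sdir]
  have "?e / of_real pi * gauss_sum ?G 3 lam = kernel_coeff0 h (- b) * ?p + kernel_coeff1 h (- b) * ?q"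
    unfolding g sp e1 e3 kernel_coeff0_def kernel_coeff1_def by simp
  then show ?thesis using prefactor_hankel_const[of a lam "gauss_sum ?G 3 lam"] by simp
qed

lemma uniform_expansion_reg:
  "\<exists>C. \<exists>L0>0. \<forall>lam\<ge>L0. \<forall>a>0.
     cmod (hankel_L a lam - (hankel_const a lam * gauss_sum (reg_germ a) N lam + hankel_K saddle_w a lam))
       \<le> C * lam powr (- (real N + 2) / 2)"
proof -
  obtain C1 c where C1: "C1 \<ge> 0" "c > 0" and loc: "\<forall>lam\<ge>6. \<forall>a>0.
     norm (hankel_L a lam - hankel_K saddle_w a lam - hankel_const a lam * local_integral lam (reg_integrand a)) \<le> C1 * exp (- c * lam)"
    using hankel_L_minus_K by (elim exE conjE) (rule that)
  obtain C2 where C2: "C2 \<ge> 0" and asy: "\<forall>lam>0. \<forall>a. norm (local_integral lam (reg_integrand a) - gauss_sum (reg_germ a) N lam) \<le> C2 * lam powr (- (real N + 2) / 2)"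
    using reg_asymptotics[of N] by (elim exE conjE) (rule that)
  obtain K where K: "K \<ge> 0" "\<forall>lam\<ge>1. exp (- c * lam) \<le> K * lam powr (- (real N + 2) / 2)"
    using exp_le_powr[OF C1(2), of "(real N + 2) / 2", unfolded minus_divide_left] by (elim exE conjE) (rule that)
  have "cmod (hankel_L a lam - (hankel_const a lam * gauss_sum (reg_germ a) N lam + hankel_K saddle_w a lam))
       \<le> (C1 * K + C2) * lam powr (- (real N + 2) / 2)" if lam: "lam \<ge> 6" and a: "a > 0" for lam a
  proof -
    let ?P = "lam powr (- (real N + 2) / 2)" and ?I = "local_integral lam (reg_integrand a)" and ?S = "gauss_sum (reg_germ a) N lam"
    have "hankel_L a lam - (hankel_const a lam * ?S + hankel_K saddle_w a lam)
      = (hankel_L a lam - hankel_K saddle_w a lam - hankel_const a lam * ?I) + hankel_const a lam * (?I - ?S)"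
      by (simp add: algebra_simps)
    then have "norm (hankel_L a lam - (hankel_const a lam * ?S + hankel_K saddle_w a lam))
      \<le> norm (hankel_L a lam - hankel_K saddle_w a lam - hankel_const a lam * ?I) + norm (hankel_const a lam * (?I - ?S))"
      by (simp only: norm_triangle_ineq)
    moreover have "norm (hankel_const a lam * (?I - ?S)) \<le> 1 * norm (?I - ?S)"
      unfolding norm_mult norm_hankel_const using pi_gt3 by (intro mult_right_mono) auto
    moreover have "norm (?I - ?S) \<le> C2 * ?P" using asy[rule_format, of lam a] lam by simp
    moreover have "norm (hankel_L a lam - hankel_K saddle_w a lam - hankel_const a lam * ?I) \<le> C1 * exp (- c * lam)"
      by (rule loc[rule_format, OF lam a])
    moreover have "C1 * exp (- c * lam) \<le> C1 * (K * ?P)"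
      using K(2)[rule_format, of lam] lam C1(1) by (intro mult_left_mono) auto
    ultimately show ?thesis unfolding distrib_right mult.assoc by linarith
  qed
  then show ?thesis by (intro exI[of _ "C1 * K + C2"] exI[of _ 6]) simp
qed

lemma uniform_expansion_pole:
  "\<exists>C. \<exists>L0>0. \<forall>lam\<ge>L0. \<forall>a\<in>{0<..} - {1}.
     cmod (hankel_L a lam - hankel_const a lam * gauss_sum (pole_germ a) N lam)
       \<le> C * ((1 / \<bar>a - 1\<bar> ^ (N + 2) + 1) * lam powr (- (real N + 2) / 2))"
proof -
  obtain C1 c where C1: "C1 \<ge> 0" "c > 0" and L: "\<forall>lam\<ge>1. \<forall>a>0.
     (a \<noteq> 1 \<longrightarrow> norm (hankel_L a lam - hankel_const a lam * local_integral lam (pole_integrand a)) \<le> C1 * exp (- c * lam)) \<and>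
     (\<forall>E F. (\<forall>v. isCont E v) \<and> (\<forall>v. F v = E v + Ln v) \<and> (\<forall>v. Im v \<noteq> 0 \<longrightarrow> (F has_field_derivative osc lam v / v) (at v)) \<longrightarrow>
        norm (hankel_L 1 lam - hankel_const 1 lam * (F (V (of_real \<rho>)) - F (V (of_real (- \<rho>))) - \<i> * of_real pi)) \<le> C1 * exp (- c * lam))"
    using hankel_L_local by (elim exE conjE) (rule that)
  obtain C2 where C2: "C2 \<ge> 0" and asy: "\<forall>lam>0. \<forall>a>0. a \<noteq> 1 \<longrightarrow> norm (local_integral lam (pole_integrand a) - gauss_sum (pole_germ a) N lam)
     \<le> C2 * (1 + 1 / \<bar>ln a\<bar>) ^ (N + 2) * lam powr (- (real N + 2) / 2)"
    using pole_asymptotics[of N] by (elim exE conjE) (rule that)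
  obtain K where K: "K \<ge> 0" "\<forall>lam\<ge>1. exp (- c * lam) \<le> K * lam powr (- (real N + 2) / 2)"
    using exp_le_powr[OF C1(2), of "(real N + 2) / 2", unfolded minus_divide_left] by (elim exE conjE) (rule that)
  have "cmod (hankel_L a lam - hankel_const a lam * gauss_sum (pole_germ a) N lam)
       \<le> (C1 * K + C2 * 4 ^ (N + 2)) * ((1 / \<bar>a - 1\<bar> ^ (N + 2) + 1) * lam powr (- (real N + 2) / 2))"
    if lam: "lam \<ge> 1" and a: "a > 0" "a \<noteq> 1" for lam a
  proof -
    let ?P = "lam powr (- (real N + 2) / 2)" and ?I = "local_integral lam (pole_integrand a)" and ?S = "gauss_sum (pole_germ a) N lam"
    have alg: "(C1 * K + C2 * q) * (x * p) = C1 * (K * (x * p)) + C2 * (q * x) * p" for q x p :: real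
      by (simp add: algebra_simps)
    let ?X = "1 / \<bar>a - 1\<bar> ^ (N + 2) + 1"
    \<comment> \<open>The summand 1 absorbs the exponentially small error of the deformation, which
      carries no power of 1 / |a - 1|.\<close>
    have X: "?X \<ge> 1" by simp
    have "hankel_L a lam - hankel_const a lam * ?S
      = (hankel_L a lam - hankel_const a lam * ?I) + hankel_const a lam * (?I - ?S)"
      by (simp add: algebra_simps)
    then have "norm (hankel_L a lam - hankel_const a lam * ?S)
      \<le> norm (hankel_L a lam - hankel_const a lam * ?I) + norm (hankel_const a lam * (?I - ?S))"
      by (simp only: norm_triangle_ineq)
    moreover have "norm (hankel_const a lam * (?I - ?S)) \<le> 1 * norm (?I - ?S)"
      unfolding norm_mult norm_hankel_const using pi_gt3 by (intro mult_right_mono) auto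
    moreover have "norm (?I - ?S) \<le> C2 * (1 + 1 / \<bar>ln a\<bar>) ^ (N + 2) * ?P" using asy[rule_format, of lam a] lam a by simp
    moreover have "C2 * (1 + 1 / \<bar>ln a\<bar>) ^ (N + 2) * ?P \<le> C2 * (4 ^ (N + 2) * ?X) * ?P"
      by (intro mult_right_mono mult_left_mono inverse_ln_bound a C2) simp
    moreover have "norm (hankel_L a lam - hankel_const a lam * ?I) \<le> C1 * exp (- c * lam)"
      by (rule L[rule_format, OF lam a(1), THEN conjunct1, rule_format, OF a(2)])
    moreover have "C1 * exp (- c * lam) \<le> C1 * (K * (?X * ?P))"
    proof (rule mult_left_mono[OF _ C1(1)])
      have "exp (- c * lam) \<le> K * (1 * ?P)" using K(2)[rule_format, OF lam] by simp
      also have "\<dots> \<le> K * (?X * ?P)" using X K(1) by (intro mult_left_mono mult_right_mono) auto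
      finally show "exp (- c * lam) \<le> K * (?X * ?P)" .
    qed
    ultimately show ?thesis unfolding alg by linarith
  qed
  then show ?thesis by (intro exI[of _ "C1 * K + C2 * 4 ^ (N + 2)"] exI[of _ 1]) simp
qed

lemma gauss_sum_reg_three:
  assumes "a > 0"
  shows "hankel_const a lam * gauss_sum (reg_germ a) 3 lam
    = hankel_prefactor a lam * (reg_coeff0 a * of_real ((2 / lam) powr (1/2)) + reg_coeff1 a * of_real ((2 / lam) powr (3/2)))"
  unfolding reg_germ_def[abs_def] reg_coeff_eq[OF assms]
  by (rule gauss_sum_three[OF reg_kernel_holomorphic open_strip _ R_pos order_refl]) (use Im_V_less pi_gt3 in fastforce)

lemma gauss_sum_pole_three:
  assumes a: "a > 0" "a \<noteq> 1"
  shows "hankel_const a lam * gauss_sum (pole_germ a) 3 lam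
    = hankel_prefactor a lam * (of_real (1 / (sqrt pi * ln a)) * of_real ((2 / lam) powr (1/2))
        - \<i> * of_real ((12 - 6 * ln a + (ln a)\<^sup>2) / (24 * sqrt pi * (ln a) ^ 3)) * of_real ((2 / lam) powr (3/2)))"
proof -
  define b where "b = complex_of_real (ln a)"
  have b: "b \<noteq> 0" using a by (simp add: b_def)
  let ?h = "\<lambda>u::complex. 1 / u"
  define r where "r = min R (norm b / 2)"
  have r: "0 < r" "r \<le> R" "r \<le> norm b / 2" using b R_pos by (auto simp: r_def)
  have d1: "deriv ?h u = - 1 / u\<^sup>2" if "u \<noteq> 0" for u
    by (rule DERIV_imp_deriv) (use that in \<open>auto intro!: derivative_eq_intros simp: power2_eq_square\<close>)
  have d2: "deriv (deriv ?h) u = 2 / u ^ 3" if u: "u \<noteq> 0" for u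
  proof (rule DERIV_imp_deriv)
    have "((\<lambda>u. - 1 / u\<^sup>2) has_field_derivative 2 / u ^ 3) (at u)"
      using u by (auto intro!: derivative_eq_intros simp: field_simps eval_nat_numeral)
    then show "(deriv ?h has_field_derivative 2 / u ^ 3) (at u)"
      by (rule has_field_derivative_transform_within_open[of _ _ _ "- {0}"]) (use u d1 in auto)
  qed
  have "hankel_const a lam * gauss_sum (\<lambda>z. deriv V z * ?h (V z - b)) 3 lam
    = hankel_prefactor a lam * (kernel_coeff0 ?h (- b) * of_real ((2 / lam) powr (1/2)) + kernel_coeff1 ?h (- b) * of_real ((2 / lam) powr (3/2)))"
  proof (rule gauss_sum_three[OF _ _ _ r(1,2)])
    show "?h holomorphic_on - {0}" by (intro holomorphic_intros) auto
    show "open (- {0::complex})" by (intro open_Compl) simp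
    show "V z - b \<in> - {0}" if z: "z \<in> ball 0 r" for z
    proof -
      have "norm (V z) \<le> 11/10 * norm z" using z r by (intro V_upper) auto
      then have "norm (V z) < norm b" using z r by simp
      then show ?thesis by auto
    qed
  qed
  moreover have "kernel_coeff0 ?h (- b) = of_real (1 / (sqrt pi * ln a))"
    by (simp add: kernel_coeff0_def b_def)
  moreover have "kernel_coeff1 ?h (- b) = - (\<i> * of_real ((12 - 6 * ln a + (ln a)\<^sup>2) / (24 * sqrt pi * (ln a) ^ 3)))"
  proof -
    have "1 / (- b) - 6 * (- 1 / (- b)\<^sup>2) + 6 * (2 / (- b) ^ 3) = - ((12 - 6 * b + b\<^sup>2) / b ^ 3)"
      using b by (simp add: divide_simps) (simp add: power2_eq_square power3_eq_cube algebra_simps)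
    note eq = this
    have nb: "- b \<noteq> 0" using b by simp
    have "kernel_coeff1 ?h (- b) = \<i> * (- ((12 - 6 * b + b\<^sup>2) / b ^ 3)) / of_real (24 * sqrt pi)"
      unfolding kernel_coeff1_def d1[OF nb] d2[OF nb] eq ..
    also have "\<dots> = - (\<i> * ((12 - 6 * b + b\<^sup>2) / (of_real (24 * sqrt pi) * b ^ 3)))"
      by (simp add: mult.commute)
    finally show ?thesis unfolding b_def by simp
  qed
  ultimately show ?thesis unfolding pole_germ_def[abs_def] b_def[symmetric] by simp
qed

end

theorem theorem1p1:
  fixes w :: "real \<Rightarrow> complex"
  assumes "saddle_curve w"
  shows
    "(\<forall>N\<ge>1. \<exists>C. \<exists>L0>0. \<forall>lam\<ge>L0. \<forall>\<alpha>>0.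
        cmod (hankel_L \<alpha> lam
              - (hankel_prefactor \<alpha> lam * hankel_sum (g_reg w \<alpha>) N lam + hankel_K w \<alpha> lam))
          \<le> C * lam powr (- (real N + 2) / 2))
   \<and> (\<forall>N\<ge>1. \<exists>C. \<exists>L0>0. \<forall>lam\<ge>L0. \<forall>\<alpha>\<in>{0<..} - {1}.
        cmod (hankel_L \<alpha> lam - hankel_prefactor \<alpha> lam * hankel_sum (g_fun w \<alpha>) N lam)
          \<le> C * ((1 / \<bar>\<alpha> - 1\<bar> ^ (N + 2) + 1) * lam powr (- (real N + 2) / 2)))
   \<and> (\<exists>C. \<exists>L0>0. \<forall>lam\<ge>L0. \<forall>\<alpha>>0.
        cmod (hankel_L \<alpha> lam
              - (hankel_prefactor \<alpha> lam *
                   (reg_coeff0 \<alpha> * of_real ((2 / lam) powr (1/2))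
                    + reg_coeff1 \<alpha> * of_real ((2 / lam) powr (3/2)))
                 + hankel_K w \<alpha> lam))
          \<le> C * lam powr (- 5/2))
   \<and> (\<exists>C. \<exists>L0>0. \<forall>lam\<ge>L0. \<forall>\<alpha>\<in>{0<..} - {1}.
        cmod (hankel_L \<alpha> lam
              - hankel_prefactor \<alpha> lam *
                  (of_real (1 / (sqrt pi * ln \<alpha>)) * of_real ((2 / lam) powr (1/2))
                   - \<i> * of_real ((12 - 6 * ln \<alpha> + (ln \<alpha>)\<^sup>2) / (24 * sqrt pi * (ln \<alpha>) ^ 3))
                       * of_real ((2 / lam) powr (3/2))))
          \<le> C * ((1 / \<bar>\<alpha> - 1\<bar> ^ 5 + 1) * lam powr (- 5/2)))"
  proof -
  obtain V R v where S: "saddle_setup V R v" and w: "w = (\<lambda>r. - \<i> * exp (v r))"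
    using saddle_curve_setup[OF assms] by (elim exE conjE) (rule that)
  interpret saddle_setup V R v by (fact S)
  have w: "w = saddle_w" unfolding w saddle_w_def[abs_def] ..
  note reg = uniform_expansion_reg and pole = uniform_expansion_pole
  have three: "(- (real 3 + 2) / 2 :: real) = - 5 / 2" "3 + 2 = (5::nat)" by simp_all
  show ?thesis
    unfolding w
  proof (intro conjI allI impI)
    fix N :: nat assume "1 \<le> N"
    obtain C L0 where L0: "L0 > 0" and b: "\<forall>lam\<ge>L0. \<forall>a>0.
       cmod (hankel_L a lam - (hankel_const a lam * gauss_sum (reg_germ a) N lam + hankel_K saddle_w a lam))
         \<le> C * lam powr (- (real N + 2) / 2)"
      using reg[of N] by (elim exE conjE) (rule that)
    show "\<exists>C. \<exists>L0>0. \<forall>lam\<ge>L0. \<forall>\<alpha>>0.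
        cmod (hankel_L \<alpha> lam
              - (hankel_prefactor \<alpha> lam * hankel_sum (g_reg saddle_w \<alpha>) N lam + hankel_K saddle_w \<alpha> lam))
          \<le> C * lam powr (- (real N + 2) / 2)"
    proof (rule exI[of _ C], rule exI[of _ L0], rule conjI[OF L0], intro allI impI)
      fix lam \<alpha> :: real assume "L0 \<le> lam" "0 < \<alpha>"
      then show "cmod (hankel_L \<alpha> lam
              - (hankel_prefactor \<alpha> lam * hankel_sum (g_reg saddle_w \<alpha>) N lam + hankel_K saddle_w \<alpha> lam))
          \<le> C * lam powr (- (real N + 2) / 2)"
        unfolding hankel_sum_g_reg[OF \<open>0 < \<alpha>\<close>] by (rule b[rule_format])
    qed
    obtain C L0 where L0: "L0 > 0" and b: "\<forall>lam\<ge>L0. \<forall>a\<in>{0<..} - {1}.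
       cmod (hankel_L a lam - hankel_const a lam * gauss_sum (pole_germ a) N lam)
         \<le> C * ((1 / \<bar>a - 1\<bar> ^ (N + 2) + 1) * lam powr (- (real N + 2) / 2))"
      using pole[of N] by (elim exE conjE) (rule that)
    show "\<exists>C. \<exists>L0>0. \<forall>lam\<ge>L0. \<forall>\<alpha>\<in>{0<..} - {1}.
        cmod (hankel_L \<alpha> lam - hankel_prefactor \<alpha> lam * hankel_sum (g_fun saddle_w \<alpha>) N lam)
          \<le> C * ((1 / \<bar>\<alpha> - 1\<bar> ^ (N + 2) + 1) * lam powr (- (real N + 2) / 2))"
    proof (rule exI[of _ C], rule exI[of _ L0], rule conjI[OF L0], intro allI impI ballI)
      fix lam \<alpha> :: real assume *: "L0 \<le> lam" "\<alpha> \<in> {0<..} - {1}"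
      then have a: "0 < \<alpha>" "\<alpha> \<noteq> 1" by auto
      show "cmod (hankel_L \<alpha> lam - hankel_prefactor \<alpha> lam * hankel_sum (g_fun saddle_w \<alpha>) N lam)
          \<le> C * ((1 / \<bar>\<alpha> - 1\<bar> ^ (N + 2) + 1) * lam powr (- (real N + 2) / 2))"
        unfolding hankel_sum_g_fun[OF a] by (rule b[rule_format, OF *])
    qed
  next
    obtain C L0 where L0: "L0 > 0" and b: "\<forall>lam\<ge>L0. \<forall>a>0.
       cmod (hankel_L a lam - (hankel_const a lam * gauss_sum (reg_germ a) 3 lam + hankel_K saddle_w a lam))
         \<le> C * lam powr (- 5 / 2)"
      using reg[of 3, unfolded three] by (elim exE conjE) (rule that)
    show "\<exists>C. \<exists>L0>0. \<forall>lam\<ge>L0. \<forall>\<alpha>>0.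
        cmod (hankel_L \<alpha> lam
              - (hankel_prefactor \<alpha> lam *
                   (reg_coeff0 \<alpha> * of_real ((2 / lam) powr (1/2))
                    + reg_coeff1 \<alpha> * of_real ((2 / lam) powr (3/2)))
                 + hankel_K saddle_w \<alpha> lam))
          \<le> C * lam powr (- 5/2)"
    proof (rule exI[of _ C], rule exI[of _ L0], rule conjI[OF L0], intro allI impI)
      fix lam \<alpha> :: real assume "L0 \<le> lam" "0 < \<alpha>"
      then show "cmod (hankel_L \<alpha> lam
              - (hankel_prefactor \<alpha> lam *
                   (reg_coeff0 \<alpha> * of_real ((2 / lam) powr (1/2))
                    + reg_coeff1 \<alpha> * of_real ((2 / lam) powr (3/2)))
                 + hankel_K saddle_w \<alpha> lam))
          \<le> C * lam powr (- 5/2)"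
        unfolding gauss_sum_reg_three[OF \<open>0 < \<alpha>\<close>, symmetric] by (rule b[rule_format])
    qed
  next
    obtain C L0 where L0: "L0 > 0" and b: "\<forall>lam\<ge>L0. \<forall>a\<in>{0<..} - {1}.
       cmod (hankel_L a lam - hankel_const a lam * gauss_sum (pole_germ a) 3 lam)
         \<le> C * ((1 / \<bar>a - 1\<bar> ^ 5 + 1) * lam powr (- 5 / 2))"
      using pole[of 3, unfolded three] by (elim exE conjE) (rule that)
    show "\<exists>C. \<exists>L0>0. \<forall>lam\<ge>L0. \<forall>\<alpha>\<in>{0<..} - {1}.
        cmod (hankel_L \<alpha> lam
              - hankel_prefactor \<alpha> lam *
                  (of_real (1 / (sqrt pi * ln \<alpha>)) * of_real ((2 / lam) powr (1/2))
                   - \<i> * of_real ((12 - 6 * ln \<alpha> + (ln \<alpha>)\<^sup>2) / (24 * sqrt pi * (ln \<alpha>) ^ 3))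
                       * of_real ((2 / lam) powr (3/2))))
          \<le> C * ((1 / \<bar>\<alpha> - 1\<bar> ^ 5 + 1) * lam powr (- 5/2))"
    proof (rule exI[of _ C], rule exI[of _ L0], rule conjI[OF L0], intro allI impI ballI)
      fix lam \<alpha> :: real assume *: "L0 \<le> lam" "\<alpha> \<in> {0<..} - {1}"
      then have a: "0 < \<alpha>" "\<alpha> \<noteq> 1" by auto
      show "cmod (hankel_L \<alpha> lam
              - hankel_prefactor \<alpha> lam *
                  (of_real (1 / (sqrt pi * ln \<alpha>)) * of_real ((2 / lam) powr (1/2))
                   - \<i> * of_real ((12 - 6 * ln \<alpha> + (ln \<alpha>)\<^sup>2) / (24 * sqrt pi * (ln \<alpha>) ^ 3))
                       * of_real ((2 / lam) powr (3/2))))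
          \<le> C * ((1 / \<bar>\<alpha> - 1\<bar> ^ 5 + 1) * lam powr (- 5/2))"
        unfolding gauss_sum_pole_three[OF a, symmetric] by (rule b[rule_format, OF *])
    qed
  qed
qed


end
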